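(* Let $d\ge 1$ and let $(P_n)_{n\ge 1}$ be a sequence of multivariate real polynomials of degree at most $d$. Let $\vec X=(X_i)_{i\ge 1}$ be a sequence of independent and identically distributed real random variables with $\mathbf E[X_1]=0$, $\mathbf E[X_1^2]=1$ and $\mathbf E[|X_1|^p]<\infty$ for all $p\in\mathbb N$. Assume that $P_n(\vec X)$ converges in law, as $n\to\infty$, to a probability measure $\mu$. Then there exist (on a suitable probability space) a sequence $\vec G=(G_i)_{i\ge 1}$ of independent standard Gaussian random variables, independent of $\vec X$, and a multivariate polynomial $P_\infty$ of degree at most $d$, possibly involving countably many variables, such that the law of $P_\infty(\vec X,\vec G)$ is $\mu$.
   Context: Polynomials may involve countably many variables: for a sequence $\vec Y=(Y_i)_{i\ge1}$ of independent, centered, unit-variance random variables with finite moments of all orders, "$P(\vec Y)$ with $P$ a polynomial of degree at most $d$, possibly in countably many variables" means an element of the $L^2(\mathbf P)$-closure of the linear space of all (ordinary) polynomials of total degree at most $d$ in finitely many of the $Y_i$. Here $(\vec X,\vec G)$ is regarded as one such sequence of independent variables. *)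

theory Defs
  imports "HOL-Probability.Probability" "HOL-Library.Poly_Mapping"
begin

text \<open>
  Polynomials in finitely many of the indeterminates indexed by \<open>'i\<close>: finitely supported
  maps from monomials (exponent vectors of finite support) to coefficients.
\<close>

type_synonym 'i real_mpoly = "('i \<Rightarrow>\<^sub>0 nat) \<Rightarrow>\<^sub>0 real"

definition monom_degree :: "('i \<Rightarrow>\<^sub>0 nat) \<Rightarrow> nat" where
  "monom_degree m = (\<Sum>i\<in>Poly_Mapping.keys m. Poly_Mapping.lookup m i)"

definition total_degree_le :: "'i real_mpoly \<Rightarrow> nat \<Rightarrow> bool" where
  "total_degree_le p d \<longleftrightarrow> (\<forall>m\<in>Poly_Mapping.keys p. monom_degree m \<le> d)"

definition eval_mpoly :: "'i real_mpoly \<Rightarrow> ('i \<Rightarrow> real) \<Rightarrow> real" where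
  "eval_mpoly p y =
     (\<Sum>m\<in>Poly_Mapping.keys p.
        Poly_Mapping.lookup p m * (\<Prod>i\<in>Poly_Mapping.keys m. y i ^ Poly_Mapping.lookup m i))"

definition square_integrable :: "'a measure \<Rightarrow> ('a \<Rightarrow> real) set" where
  "square_integrable M = {f \<in> borel_measurable M. integrable M (\<lambda>\<omega>. (f \<omega>)\<^sup>2)}"

text \<open>
  The elements are functions rather than classes modulo null sets; every representative of an
  element of the closure belongs to the set.
\<close>

definition L2_closure :: "'a measure \<Rightarrow> ('a \<Rightarrow> real) set \<Rightarrow> ('a \<Rightarrow> real) set" where
  "L2_closure M S =
     {f \<in> square_integrable M.
        \<forall>e>0. \<exists>g\<in>S \<inter> square_integrable M. sqrt (\<integral>\<omega>. (f \<omega> - g \<omega>)\<^sup>2 \<partial>M) < e}"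

definition ordinary_polynomials ::
  "('i \<Rightarrow> 'a \<Rightarrow> real) \<Rightarrow> nat \<Rightarrow> ('a \<Rightarrow> real) set" where
  "ordinary_polynomials Y d =
     {(\<lambda>\<omega>. eval_mpoly p (\<lambda>i. Y i \<omega>)) | p. total_degree_le p d}"

text \<open>
  The random variables \<open>P(Y)\<close>, with \<open>P\<close> a polynomial of degree at most \<open>d\<close>, possibly in
  countably many variables.
\<close>

definition polynomials :: "'a measure \<Rightarrow> ('i \<Rightarrow> 'a \<Rightarrow> real) \<Rightarrow> nat \<Rightarrow> ('a \<Rightarrow> real) set" where
  "polynomials M Y d = L2_closure M (ordinary_polynomials Y d)"

text \<open>
  When the \<open>Y i\<close> have moments of all orders, ordinary polynomials are square integrable, so the
  intersection in the definition of the closure discards nothing.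
\<close>

definition all_moments :: "'a measure \<Rightarrow> ('a \<Rightarrow> real) set" where
  "all_moments M = {f \<in> borel_measurable M. \<forall>p::nat. integrable M (\<lambda>\<omega>. \<bar>f \<omega>\<bar> ^ p)}"

lemma all_moments_const: "finite_measure M \<Longrightarrow> (\<lambda>_. c) \<in> all_moments M"
  by (auto simp: all_moments_def finite_measure.integrable_const)

lemma all_moments_mult:
  assumes "f \<in> all_moments M" "g \<in> all_moments M"
  shows "(\<lambda>\<omega>. f \<omega> * g \<omega>) \<in> all_moments M"
proof -
  have [measurable]: "f \<in> borel_measurable M" "g \<in> borel_measurable M"
    using assms by (auto simp: all_moments_def)
  have "integrable M (\<lambda>\<omega>. \<bar>f \<omega> * g \<omega>\<bar> ^ p)" for p :: nat
  proof (rule Bochner_Integration.integrable_bound)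
    show "integrable M (\<lambda>\<omega>. \<bar>f \<omega>\<bar> ^ (2 * p) + \<bar>g \<omega>\<bar> ^ (2 * p))"
      using assms by (auto simp: all_moments_def)
    have "a * b \<le> a\<^sup>2 + b\<^sup>2" if "0 \<le> a" "0 \<le> b" for a b :: real
      using sum_squares_bound[of a b] mult_nonneg_nonneg[OF that] by linarith
    from this[of "\<bar>x\<bar> ^ p" "\<bar>y\<bar> ^ p" for x y]
    show "AE \<omega> in M. norm (\<bar>f \<omega> * g \<omega>\<bar> ^ p) \<le> norm (\<bar>f \<omega>\<bar> ^ (2 * p) + \<bar>g \<omega>\<bar> ^ (2 * p))"
      by (intro AE_I2) (simp add: abs_mult power_mult_distrib power_even_eq)
  qed measurable
  then show ?thesis by (simp add: all_moments_def)
qed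

lemma all_moments_add:
  assumes "f \<in> all_moments M" "g \<in> all_moments M"
  shows "(\<lambda>\<omega>. f \<omega> + g \<omega>) \<in> all_moments M"
proof -
  have [measurable]: "f \<in> borel_measurable M" "g \<in> borel_measurable M"
    using assms by (auto simp: all_moments_def)
  have "integrable M (\<lambda>\<omega>. \<bar>f \<omega> + g \<omega>\<bar> ^ p)" for p :: nat
  proof (rule Bochner_Integration.integrable_bound)
    show "integrable M (\<lambda>\<omega>. 2 ^ p * (\<bar>f \<omega>\<bar> ^ p + \<bar>g \<omega>\<bar> ^ p))"
      using assms by (auto simp: all_moments_def)
    have "\<bar>x + y\<bar> ^ p \<le> 2 ^ p * (\<bar>x\<bar> ^ p + \<bar>y\<bar> ^ p)" for x y :: real
    proof -
      have "\<bar>x + y\<bar> ^ p \<le> (2 * max \<bar>x\<bar> \<bar>y\<bar>) ^ p"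
        by (intro power_mono) auto
      also have "\<dots> = 2 ^ p * max \<bar>x\<bar> \<bar>y\<bar> ^ p"
        by (simp add: power_mult_distrib)
      also have "\<dots> \<le> 2 ^ p * (\<bar>x\<bar> ^ p + \<bar>y\<bar> ^ p)"
        by (intro mult_left_mono) (auto simp: max_def)
      finally show ?thesis .
    qed
    then show "AE \<omega> in M. norm (\<bar>f \<omega> + g \<omega>\<bar> ^ p) \<le> norm (2 ^ p * (\<bar>f \<omega>\<bar> ^ p + \<bar>g \<omega>\<bar> ^ p))"
      by (intro AE_I2) (simp add: abs_mult)
  qed measurable
  then show ?thesis by (simp add: all_moments_def)
qed

lemma all_moments_sum:
  assumes "finite_measure M" "\<And>i. i \<in> I \<Longrightarrow> f i \<in> all_moments M"
  shows "(\<lambda>\<omega>. \<Sum>i\<in>I. f i \<omega>) \<in> all_moments M"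
  using assms(2)
  by (induction I rule: infinite_finite_induct)
     (simp_all add: all_moments_const[OF assms(1)] all_moments_add)

lemma all_moments_prod:
  assumes "finite_measure M" "\<And>i. i \<in> I \<Longrightarrow> f i \<in> all_moments M"
  shows "(\<lambda>\<omega>. \<Prod>i\<in>I. f i \<omega>) \<in> all_moments M"
  using assms(2)
  by (induction I rule: infinite_finite_induct)
     (simp_all add: all_moments_const[OF assms(1)] all_moments_mult)

lemma all_moments_power:
  assumes "finite_measure M" "f \<in> all_moments M"
  shows "(\<lambda>\<omega>. f \<omega> ^ n) \<in> all_moments M"
  by (induction n) (simp_all add: all_moments_const[OF assms(1)] all_moments_mult assms(2))

lemma ordinary_polynomials_square_integrable:
  assumes "finite_measure M" "\<And>i. Y i \<in> all_moments M"
  shows "ordinary_polynomials Y d \<subseteq> square_integrable M"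
proof -
  have "(\<lambda>\<omega>. eval_mpoly p (\<lambda>i. Y i \<omega>)) \<in> all_moments M" for p
    unfolding eval_mpoly_def
    by (intro all_moments_sum all_moments_mult all_moments_prod all_moments_power
        all_moments_const assms)
  moreover have "all_moments M \<subseteq> square_integrable M"
    by (auto simp: all_moments_def square_integrable_def dest!: spec[of _ 2])
  ultimately show ?thesis
    by (auto simp: ordinary_polynomials_def)
qed

lemma ordinary_polynomials_subset_polynomials:
  assumes "finite_measure M" "\<And>i. Y i \<in> all_moments M"
  shows "ordinary_polynomials Y d \<subseteq> polynomials M Y d"
proof
  fix f assume f: "f \<in> ordinary_polynomials Y d"
  with ordinary_polynomials_square_integrable[of M Y d, OF assms] have "f \<in> square_integrable M"
    by blast
  with f show "f \<in> polynomials M Y d"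
    unfolding polynomials_def L2_closure_def by (auto intro!: bexI[of _ f])
qed

end

theory Submission
  imports Defs
begin

text \<open>
  Limits are taken along a free ultrafilter \<open>U\<close> on the naturals, so that all bounded sequences converge.
  Expanding in orthonormal polynomials of the \<open>X i\<close> gives hypercontractivity, which bounds the second
  moments of the \<open>P n\<close> and makes \<open>lim\<^sub>U E (F n * G n)\<close> an inner product on bounded sequences of
  polynomials of degree at most \<open>d\<close>. Projecting a sequence of degree \<open>k\<close> onto the closed span of the
  products of sequences of lower degree and of the sequences \<open>X (\<iota> n)\<close> leaves a remainder orthogonal to
  all of these; by induction every bounded sequence is a limit of polynomials in such remainders and in the
  \<open>X (\<iota> n)\<close>. Orthogonality to products forces the influences and the contractions of a remainder to
  vanish. Replacing the \<open>X i\<close> by random signs (Lindeberg) and Stein's identity on the discrete cube then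
  show that the remainders are asymptotically jointly Gaussian and independent of any finitely many
  \<open>X (\<iota> n)\<close>, while distinct index sequences give independent copies of \<open>X 0\<close>. Substituting these
  limits into the approximating polynomials yields a Cauchy sequence of polynomials in the \<open>X i\<close> and
  \<open>G i\<close>, whose \<open>L\<^sup>2\<close> limit has law \<open>\<mu>\<close>.
\<close>

subsection \<open>Random variables with all moments\<close>

text \<open>A bounded sequence of polynomials can fail to be asymptotically Gaussian for two
  reasons: a single variable keeps a fixed share of the variance, or the sequence correlates with
  products of sequences of lower degree. The guilty variable and the factors may change with n. This
  is why the generators are \<open>X (\<iota> n)\<close> for arbitrary index sequences \<iota>: a
  worst choice made separately for each n is again a sequence, so orthogonality to all sequences
  amounts to smallness uniform over all choices. Along an ultrafilter no subsequence has to be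
  extracted for these uncountably many tests. Signs replace the \<open>X i\<close> before Stein's
  identity is used because their squares are 1: products of monomials are monomials, and
  contractions become finite sums over disjoint sets. Laws are tested only with
  \<open>cos (t * x + c)\<close>, which carries the information of characteristic functions and
  stays real and bounded. In the limit a remainder of degree k becomes a linear form in Gaussians,
  so the substitution never raises the degree.\<close>

lemma all_moments_integrable:
  assumes "f \<in> all_moments M"
  shows "integrable M f"
proof -
  have "integrable M (\<lambda>w. \<bar>f w\<bar> ^ 1)" "f \<in> borel_measurable M"
    using assms unfolding all_moments_def by blast+
  then show ?thesis by (simp add: integrable_abs_iff)
qed

lemma all_moments_measurable: "f \<in> all_moments M ==> f \<in> borel_measurable M"
  by (simp add: all_moments_def)

lemma all_moments_bounded:
  assumes "finite_measure M" "f \<in> borel_measurable M" "\<And>w. \<bar>f w\<bar> \<le> C"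
  shows "f \<in> all_moments M"
proof -
  have "integrable M (\<lambda>w. \<bar>f w\<bar> ^ p)" for p :: nat
    using assms by (intro finite_measure.integrable_const_bound[of M _ "C ^ p"])
      (auto intro!: AE_I2 power_mono)
  then show ?thesis using assms by (simp add: all_moments_def)
qed

lemma all_moments_scale:
  assumes "finite_measure M" "f \<in> all_moments M"
  shows "(\<lambda>w. c * f w) \<in> all_moments M" "(\<lambda>w. f w * c) \<in> all_moments M"
    "(\<lambda>w. f w / c) \<in> all_moments M" "(\<lambda>w. - f w) \<in> all_moments M"
proof -
  show *: "(\<lambda>w. c * f w) \<in> all_moments M" for c
    by (intro all_moments_mult all_moments_const assms)
  show "(\<lambda>w. f w * c) \<in> all_moments M" "(\<lambda>w. f w / c) \<in> all_moments M"
    "(\<lambda>w. - f w) \<in> all_moments M"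
    using *[of c] *[of "1 / c"] *[of "- 1"] by (simp_all add: mult.commute)
qed

lemma all_moments_diff:
  assumes "finite_measure M" "f \<in> all_moments M" "g \<in> all_moments M"
  shows "(\<lambda>w. f w - g w) \<in> all_moments M"
  using all_moments_add[OF assms(2) all_moments_scale(4)[OF assms(1,3)]] by simp

lemma all_moments_abs: "f \<in> all_moments M ==> (\<lambda>w. \<bar>f w\<bar>) \<in> all_moments M"
  by (auto simp: all_moments_def)

context prob_space
begin

lemmas all_moments_closed =
  all_moments_const[OF finite_measure_axioms] all_moments_add all_moments_mult
  all_moments_sum[OF finite_measure_axioms] all_moments_prod[OF finite_measure_axioms]
  all_moments_power[OF finite_measure_axioms] all_moments_scale[OF finite_measure_axioms]
  all_moments_diff[OF finite_measure_axioms]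

lemma Cauchy_Schwarz_all_moments:
  assumes f: "f \<in> all_moments M" and g: "g \<in> all_moments M"
  shows "(expectation (\<lambda>w. f w * g w))^2
    \<le> expectation (\<lambda>w. (f w)^2) * expectation (\<lambda>w. (g w)^2)"
proof -
  define a b c where "a = expectation (\<lambda>w. (f w)^2)" and "b = expectation (\<lambda>w. f w * g w)"
    and "c = expectation (\<lambda>w. (g w)^2)"
  have q: "0 \<le> a * s^2 - 2 * b * s * t + c * t^2" for s t :: real
  proof -
    have "0 \<le> expectation (\<lambda>w. (s * f w - t * g w)^2)" by simp
    also have "(\<lambda>w. (s * f w - t * g w)^2) =
        (\<lambda>w. s^2 * (f w)^2 - 2 * s * t * (f w * g w) + t^2 * (g w)^2)"
      by (simp add: fun_eq_iff power2_eq_square algebra_simps)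
    also have "expectation ... = a * s^2 - 2 * b * s * t + c * t^2"
    proof -
      have [simp]: "integrable M (\<lambda>w. (f w)^2)" "integrable M (\<lambda>w. f w * g w)" "integrable M (\<lambda>w. (g w)^2)"
        by (intro all_moments_integrable all_moments_closed f g)+
      show ?thesis by (simp add: a_def b_def c_def)
    qed
    finally show ?thesis .
  qed
  have a0: "a \<ge> 0" "c \<ge> 0" by (simp_all add: a_def c_def)
  have "b^2 \<le> a * c"
  proof (cases "c = 0")
    case True
    have "b = 0"
    proof (rule ccontr)
      assume "b \<noteq> 0"
      \<comment> \<open>With \<open>c = 0\<close> the quadratic is affine in t; at
        \<open>t = (a + 1) / b\<close> it equals \<open>- a - 2\<close>, which is negative.\<close>
      have "0 \<le> a * 1^2 - 2 * b * 1 * ((a + 1) / b) + c * ((a + 1) / b)^2" by (rule q)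
      with \<open>b \<noteq> 0\<close> True a0 show False by simp
    qed
    with True show ?thesis by simp
  next
    case False
    then have "c > 0" using a0 by simp
    have "0 \<le> a * c^2 - 2 * b * c * b + c * b^2" by (rule q)
    then have "0 \<le> c * (a * c - b^2)" by (simp add: power2_eq_square algebra_simps)
    with \<open>c > 0\<close> show ?thesis by (simp add: zero_le_mult_iff)
  qed
  then show ?thesis by (simp add: a_def b_def c_def)
qed

lemma Cauchy_Schwarz_abs:
  assumes f: "f \<in> all_moments M" and g: "g \<in> all_moments M"
  shows "expectation (\<lambda>w. \<bar>f w * g w\<bar>)
    \<le> sqrt (expectation (\<lambda>w. (f w)^2)) * sqrt (expectation (\<lambda>w. (g w)^2))"
  using Cauchy_Schwarz_all_moments[OF all_moments_abs[OF f] all_moments_abs[OF g]]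
  by (auto simp: abs_mult real_sqrt_mult[symmetric] intro: real_le_rsqrt)

lemma expectation_abs_le_sqrt:
  assumes f: "f \<in> all_moments M"
  shows "expectation (\<lambda>w. \<bar>f w\<bar>) \<le> sqrt (expectation (\<lambda>w. (f w)^2))"
  using Cauchy_Schwarz_abs[OF f all_moments_closed(1)[of 1]] by (simp add: prob_space)

end

subsection \<open>Independent blocks\<close>

locale indep_reals = prob_space N for N :: "'w measure" +
  fixes W :: "'c => 'w => real"
  assumes indep_W: "indep_vars (\<lambda>_. borel) W UNIV"
begin

text \<open>Pulled back from the product space, so that independence of the restricted families over
  disjoint index sets is literally independence of \<open>sig A\<close> and \<open>sig B\<close>.
  Measurability for a block then serves as the certificate of independence.\<close>

definition sig :: "'c set => 'w measure" where
  "sig A = vimage_algebra (space N) (\<lambda>w. \<lambda>i\<in>A. W i w) (PiM A (\<lambda>_. borel))"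

lemma W_measurable [measurable]: "W i \<in> borel_measurable N"
  using indep_W by (auto simp: indep_vars_def)

lemma space_sig [simp]: "space (sig A) = space N"
  by (simp add: sig_def)

lemma W_sig: "i \<in> A ==> W i \<in> borel_measurable (sig A)"
proof -
  assume i: "i \<in> A"
  have "(\<lambda>w. \<lambda>i\<in>A. W i w) \<in> measurable (sig A) (PiM A (\<lambda>_. borel))"
    unfolding sig_def by (intro measurable_vimage_algebra1) (auto simp: space_PiM)
  then have "(\<lambda>w. (\<lambda>i\<in>A. W i w) i) \<in> borel_measurable (sig A)"
    using i by (rule measurable_compose[OF _ measurable_component_singleton])
  then show ?thesis using i by simp
qed

lemma sig_mono:
  assumes "A \<subseteq> B" "f \<in> borel_measurable (sig A)"
  shows "f \<in> borel_measurable (sig B)"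
proof -
  have "sets (sig A) \<subseteq> sets (sig B)"
    unfolding sig_def[of A] using assms(1)
    by (intro sets_image_in_sets measurable_restrict W_sig) auto
  then show ?thesis
    using assms(2) by (auto simp: measurable_def)
qed

lemma sig_measurable:
  assumes "f \<in> borel_measurable (sig A)"
  shows "f \<in> borel_measurable N"
proof -
  have "sets (sig A) \<subseteq> sets N"
    unfolding sig_def
    by (intro sets_image_in_sets measurable_restrict W_measurable) auto
  then show ?thesis
    using assms by (auto simp: measurable_def)
qed

lemma indep_var_sig:
  fixes f g :: "'w => real"
  assumes "A \<inter> B = {}" and f: "f \<in> borel_measurable (sig A)" and g: "g \<in> borel_measurable (sig B)"
  shows "indep_var borel f borel g"
proof -
  have "indep_var (PiM A (\<lambda>_. borel)) (\<lambda>w. \<lambda>i\<in>A. W i w) (PiM B (\<lambda>_. borel)) (\<lambda>w. \<lambda>i\<in>B. W i w)"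
    using indep_var_restrict[OF indep_W assms(1)] by simp
  then have ind: "indep_set (sets (sig A)) (sets (sig B))"
    by (simp add: indep_var_eq sig_def sets_vimage_algebra)
  have sub: "sigma_sets (space N) {h -` C \<inter> space N |C. C \<in> sets borel} \<subseteq> sets (sig D)"
    if "h \<in> borel_measurable (sig D)" for h :: "'w => real" and D
  proof -
    have "{h -` C \<inter> space N |C. C \<in> sets borel} \<subseteq> sets (sig D)"
      using measurable_sets[OF that] by auto
    then show ?thesis
      using sets.sigma_sets_subset[of "{h -` C \<inter> space N |C. C \<in> sets borel}" "sig D"] by simp
  qed
  have "indep_set (sigma_sets (space N) {f -` C \<inter> space N |C. C \<in> sets borel})
      (sigma_sets (space N) {g -` C \<inter> space N |C. C \<in> sets borel})"
    using ind sub[OF f] sub[OF g] unfolding indep_sets2_eq by (meson order_trans subsetD)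
  then show ?thesis
    using sig_measurable[OF f] sig_measurable[OF g] by (simp add: indep_var_eq)
qed

lemma expectation_mult_sig:
  assumes "A \<inter> B = {}" and f: "f \<in> borel_measurable (sig A)" and g: "g \<in> borel_measurable (sig B)"
    and "f \<in> all_moments N" "g \<in> all_moments N"
  shows "expectation (\<lambda>w. f w * g w) = expectation f * expectation g"
  by (rule indep_var_lebesgue_integral)
    (use indep_var_sig[OF assms(1-3)] assms(4,5) in \<open>auto intro: all_moments_integrable\<close>)

end

text \<open>Letters are independent across positions and only orthonormal within one, since
  \<open>h k (X i)\<close> for different k are functions of the same variable. The blocks
  \<open>blk i\<close> exist because in a Lindeberg hybrid one position may be realized by a whole
  row of independent signs.\<close>

locale letters = indep_reals N W for N :: "'w measure" and W :: "'c => 'w => real" +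
  fixes blk :: "nat => 'c set" and \<xi> :: "nat => nat => 'w => real" and K :: "nat set" and B :: real
  assumes disj: "\<And>i j. i \<noteq> j ==> blk i \<inter> blk j = {}"
    and finite_K: "finite K"
    and \<xi>_sig: "\<And>i k. k \<in> K ==> \<xi> i k \<in> borel_measurable (sig (blk i))"
    and \<xi>_moments: "\<And>i k. k \<in> K ==> \<xi> i k \<in> all_moments N"
    and \<xi>_mean: "\<And>i k. k \<in> K ==> expectation (\<xi> i k) = 0"
    and \<xi>_orth: "\<And>i k l. k \<in> K ==> l \<in> K ==>
        expectation (\<lambda>w. \<xi> i k w * \<xi> i l w) = (if k = l then 1 else 0)"
    and \<xi>_fourth: "\<And>i k. k \<in> K ==> expectation (\<lambda>w. \<xi> i k w ^ 4) \<le> B"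
    and B_ge_1: "B \<ge> 1"

section \<open>Words: products of letters from distinct positions\<close>

definition words :: "nat set => nat set => nat => (nat \<times> nat) set set" where
  "words K I D = {S. S \<subseteq> I \<times> K \<and> inj_on fst S \<and> card S \<le> D}"

lemma finite_words: "finite K ==> finite I ==> finite (words K I D)"
  unfolding words_def by (rule finite_subset[of _ "Pow (I \<times> K)"]) auto

lemma words_finite: "finite K ==> finite I ==> S \<in> words K I D ==> finite S"
  unfolding words_def by (auto intro: finite_subset)

lemma words_0: "finite K ==> finite I ==> words K I 0 = {{}}"
proof -
  assume "finite K" "finite I"
  then have "S = {}" if "S \<in> words K I 0" for S
    using words_finite[OF _ _ that] that by (simp add: words_def)
  moreover have "{} \<in> words K I 0" by (simp add: words_def)
  ultimately show ?thesis by blast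
qed

lemma words_empty: "words K {} D = {{}}"
  by (auto simp: words_def)

lemma words_mono: "I \<subseteq> J ==> D \<le> E ==> words K I D \<subseteq> words K J E"
  by (auto simp: words_def)

lemma words_subset: "S \<in> words K I D ==> T \<subseteq> S ==> finite S ==> T \<in> words K I D"
  using card_mono[of S T] by (auto simp: words_def intro: inj_on_subset)

text \<open>A word over \<open>insert r I\<close> either avoids \<open>r\<close> or has exactly one
  letter there, by injectivity of \<open>fst\<close>; removing it lowers the length bound by one.
  Inductions over positions rest on this split.\<close>

lemma words_insert:
  assumes "r \<notin> I" "finite K" "finite I"
  shows "words K (insert r I) (Suc D) =
    words K I (Suc D) \<union> (\<Union>k\<in>K. insert (r, k) ` words K I D)"
proof (intro set_eqI iffI)
  fix S assume S: "S \<in> words K (insert r I) (Suc D)"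
  then have fin: "finite S" using words_finite assms by blast
  show "S \<in> words K I (Suc D) \<union> (\<Union>k\<in>K. insert (r, k) ` words K I D)"
  proof (cases "r \<in> fst ` S")
    case False
    have "S \<subseteq> I \<times> K"
    proof
      fix l assume l: "l \<in> S"
      with False have "fst l \<noteq> r" by blast
      with l S show "l \<in> I \<times> K" by (auto simp: words_def)
    qed
    then show ?thesis using S by (simp add: words_def)
  next
    case True
    then obtain k where k: "(r, k) \<in> S" by auto
    then have "k \<in> K" using S by (auto simp: words_def)
    moreover have "S - {(r, k)} \<in> words K I D"
    proof -
      have "fst l \<noteq> r" if "l \<in> S - {(r, k)}" for l
        using that k S inj_onD[of fst S l "(r, k)"] by (auto simp: words_def)
      then have "S - {(r, k)} \<subseteq> I \<times> K" using S by (fastforce simp: words_def)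
      moreover have "inj_on fst (S - {(r, k)})" using S by (auto simp: words_def intro: inj_on_subset)
      moreover have "card S \<le> Suc D" using S by (simp add: words_def)
      ultimately show ?thesis using k fin by (simp add: words_def)
    qed
    moreover have "S = insert (r, k) (S - {(r, k)})" using k by auto
    ultimately show ?thesis by blast
  qed
next
  fix S assume "S \<in> words K I (Suc D) \<union> (\<Union>k\<in>K. insert (r, k) ` words K I D)"
  then consider "S \<in> words K I (Suc D)" | k T where "k \<in> K" "T \<in> words K I D" "S = insert (r, k) T"
    by blast
  then show "S \<in> words K (insert r I) (Suc D)"
  proof cases
    case 1
    then show ?thesis using words_mono[of I "insert r I" "Suc D" "Suc D" K] by auto
  next
    case 2
    then have "finite T" using words_finite assms by blast
    moreover have "r \<notin> fst ` T" using 2 assms by (auto simp: words_def)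
    moreover have "(r, k) \<notin> T" using 2 assms by (auto simp: words_def)
    ultimately show ?thesis using 2 by (auto simp: words_def)
  qed
qed

lemma sum_words_insert:
  fixes \<phi> :: "(nat \<times> nat) set => 'v :: comm_monoid_add"
  assumes "r \<notin> I" "finite K" "finite I"
  shows "(\<Sum>S\<in>words K (insert r I) (Suc D). \<phi> S) =
    (\<Sum>S\<in>words K I (Suc D). \<phi> S) + (\<Sum>k\<in>K. \<Sum>S\<in>words K I D. \<phi> (insert (r, k) S))"
proof -
  have nr: "(r, k) \<notin> S" if "S \<in> words K I D'" for S k D'
    using that assms(1) by (auto simp: words_def)
  have inj: "inj_on (insert (r, k)) (words K I D)" for k
    by (rule inj_onI) (metis nr insert_ident)
  have "(\<Sum>S\<in>words K (insert r I) (Suc D). \<phi> S) =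
      (\<Sum>S\<in>words K I (Suc D). \<phi> S) + (\<Sum>S\<in>(\<Union>k\<in>K. insert (r, k) ` words K I D). \<phi> S)"
    unfolding words_insert[OF assms]
    using nr by (intro sum.union_disjoint finite_words finite_UN_I finite_imageI assms) blast+
  also have "(\<Sum>S\<in>(\<Union>k\<in>K. insert (r, k) ` words K I D). \<phi> S) =
      (\<Sum>k\<in>K. \<Sum>S\<in>insert (r, k) ` words K I D. \<phi> S)"
  proof (intro sum.UNION_disjoint ballI impI assms finite_imageI finite_words)
    fix k l assume "k \<in> K" "l \<in> K" "k \<noteq> l"
    have "insert (r, k) S \<noteq> insert (r, l) T" if "S \<in> words K I D" "T \<in> words K I D" for S T
    proof
      assume "insert (r, k) S = insert (r, l) T"
      then have "(r, k) \<in> insert (r, l) T" by blast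
      then show False using \<open>k \<noteq> l\<close> nr[OF that(2)] by simp
    qed
    then show "insert (r, k) ` words K I D \<inter> insert (r, l) ` words K I D = {}"
      by blast
  qed
  finally show ?thesis by (simp add: sum.reindex[OF inj])
qed

context letters
begin

abbreviation sigB :: "nat set => 'w measure" where "sigB I \<equiv> sig (\<Union>i\<in>I. blk i)"

definition xi :: "(nat \<times> nat) set => 'w => real" where
  "xi S w = (\<Prod>(i, k)\<in>S. \<xi> i k w)"

definition ev :: "nat set => nat => ((nat \<times> nat) set => real) => 'w => real" where
  "ev I D f w = (\<Sum>S\<in>words K I D. f S * xi S w)"

lemma xi_empty [simp]: "xi {} w = 1"
  by (simp add: xi_def)

lemma xi_insert: "finite S ==> (r, k) \<notin> S ==> xi (insert (r, k) S) w = \<xi> r k w * xi S w"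
  by (simp add: xi_def)

lemma xi_sigB:
  assumes "S \<subseteq> I \<times> K" shows "xi S \<in> borel_measurable (sigB I)"
proof -
  have "\<xi> i k \<in> borel_measurable (sigB I)" if "(i, k) \<in> S" for i k
    using that assms by (intro sig_mono[OF _ \<xi>_sig[of k i]]) auto
  then show ?thesis unfolding xi_def by (auto simp: case_prod_beta)
qed

lemma xi_moments: "S \<subseteq> I \<times> K ==> xi S \<in> all_moments N"
  unfolding xi_def case_prod_beta by (intro all_moments_closed \<xi>_moments) auto

lemma ev_sigB: "ev I D f \<in> borel_measurable (sigB I)"
  unfolding ev_def
  by (intro borel_measurable_sum borel_measurable_times borel_measurable_const xi_sigB)
    (auto simp: words_def)

lemma ev_moments: "ev I D f \<in> all_moments N"
  unfolding ev_def
  by (intro all_moments_closed xi_moments[of _ I]) (auto simp: words_def)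

lemma ev_empty [simp]: "ev {} D f w = f {}"
  by (simp add: ev_def words_empty)

lemma ev_0: "finite I ==> ev I 0 f w = f {}"
  by (simp add: ev_def words_0 finite_K)

text \<open>The discrete Taylor formula in position \<open>r\<close>: the cofactor of each
  \<open>\<xi> r k\<close> is a word sum over \<open>I\<close>, hence independent of the letters at
  \<open>r\<close>. Parseval, hypercontractivity and the Lindeberg step all start from it.\<close>

lemma ev_insert:
  assumes "r \<notin> I" "finite I"
  shows "ev (insert r I) (Suc D) f w =
    ev I (Suc D) f w + (\<Sum>k\<in>K. \<xi> r k w * ev I D (\<lambda>S. f (insert (r, k) S)) w)"
proof -
  have "xi (insert (r, k) S) w = \<xi> r k w * xi S w" if "S \<in> words K I D" for k S
    using that assms words_finite[OF finite_K assms(2) that]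
    by (intro xi_insert) (auto simp: words_def)
  then show ?thesis
    unfolding ev_def sum_words_insert[OF assms(1) finite_K assms(2)]
    by (simp add: sum_distrib_left mult_ac)
qed

lemma expectation_letter_mult:
  assumes "r \<notin> I" "\<phi> \<in> borel_measurable (sig (blk r))" "\<phi> \<in> all_moments N"
    "F \<in> borel_measurable (sigB I)" "F \<in> all_moments N"
  shows "expectation (\<lambda>w. \<phi> w * F w) = expectation \<phi> * expectation F"
proof (rule expectation_mult_sig[OF _ assms(2,4,3,5)])
  have "blk r \<inter> blk i = {}" if "i \<in> I" for i
    using that assms(1) by (intro disj) auto
  then show "blk r \<inter> (\<Union>i\<in>I. blk i) = {}" by auto
qed

lemma expectation_letter_combination:
  assumes "r \<notin> I" "\<And>k. k \<in> K ==> F k \<in> borel_measurable (sigB I)"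
    "\<And>k. k \<in> K ==> F k \<in> all_moments N" "G \<in> borel_measurable (sigB I)" "G \<in> all_moments N"
  shows "expectation (\<lambda>w. (\<Sum>k\<in>K. \<xi> r k w * F k w) * G w) = 0"
proof -
  have "expectation (\<lambda>w. (\<Sum>k\<in>K. \<xi> r k w * F k w) * G w) =
      (\<Sum>k\<in>K. expectation (\<lambda>w. \<xi> r k w * (F k w * G w)))"
    unfolding sum_distrib_right
    by (subst Bochner_Integration.integral_sum)
      (auto intro!: all_moments_integrable all_moments_closed \<xi>_moments assms simp: mult.assoc)
  also have "... = (\<Sum>k\<in>K. expectation (\<xi> r k) * expectation (\<lambda>w. F k w * G w))"
    by (intro sum.cong refl expectation_letter_mult[OF assms(1)] \<xi>_sig \<xi>_moments
        all_moments_closed assms borel_measurable_times)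
  finally show ?thesis by (simp add: \<xi>_mean)
qed

text \<open>Only the covariances of the letters at \<open>r\<close> enter, so the value is the same
  for any two orthonormal families of letters. This is what makes the second-order terms agree in
  Lindeberg's comparison.\<close>

lemma expectation_letter_combination_mult:
  assumes "r \<notin> I" "\<And>k. k \<in> K ==> F k \<in> borel_measurable (sigB I)"
    "\<And>k. k \<in> K ==> F k \<in> all_moments N" "\<And>k. k \<in> K ==> G k \<in> borel_measurable (sigB I)"
    "\<And>k. k \<in> K ==> G k \<in> all_moments N" "H \<in> borel_measurable (sigB I)" "H \<in> all_moments N"
  shows "expectation (\<lambda>w. (\<Sum>k\<in>K. \<xi> r k w * F k w) * (\<Sum>k\<in>K. \<xi> r k w * G k w) * H w) =
    (\<Sum>k\<in>K. expectation (\<lambda>w. F k w * G k w * H w))"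
proof -
  have "expectation (\<lambda>w. (\<Sum>k\<in>K. \<xi> r k w * F k w) * (\<Sum>k\<in>K. \<xi> r k w * G k w) * H w) =
      expectation (\<lambda>w. \<Sum>k\<in>K. \<Sum>l\<in>K. (\<xi> r k w * \<xi> r l w) * (F k w * G l w * H w))"
    by (intro Bochner_Integration.integral_cong refl, subst sum_product)
      (simp add: sum_distrib_right sum_distrib_left mult_ac)
  also have "... = (\<Sum>k\<in>K. \<Sum>l\<in>K. expectation (\<lambda>w. (\<xi> r k w * \<xi> r l w) * (F k w * G l w * H w)))"
    by (subst Bochner_Integration.integral_sum
        , (intro all_moments_integrable all_moments_closed \<xi>_moments assms; assumption)
        , intro sum.cong refl Bochner_Integration.integral_sum all_moments_integrable
          all_moments_closed \<xi>_moments assms)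
  also have "... = (\<Sum>k\<in>K. \<Sum>l\<in>K. expectation (\<lambda>w. \<xi> r k w * \<xi> r l w) *
      expectation (\<lambda>w. F k w * G l w * H w))"
    by (intro sum.cong refl expectation_letter_mult[OF assms(1)] \<xi>_sig \<xi>_moments
        all_moments_closed assms borel_measurable_times)
  also have "... = (\<Sum>k\<in>K. \<Sum>l\<in>K. (if k = l then expectation (\<lambda>w. F k w * G l w * H w) else 0))"
    by (intro sum.cong refl) (simp add: \<xi>_orth)
  finally show ?thesis by (simp add: finite_K)
qed

text \<open>Parseval by induction over the positions: the cross terms are linear in the letters at
  the new position and have mean zero.\<close>

lemma expectation_ev_mult:
  assumes "finite I"
  shows "expectation (\<lambda>w. ev I D f w * ev I D g w) = (\<Sum>S\<in>words K I D. f S * g S)"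
  using assms
proof (induction I arbitrary: D f g rule: finite_induct)
  case empty
  then show ?case by (simp add: words_empty prob_space)
next
  case (insert r I)
  show ?case
  proof (cases D)
    case 0
    with insert show ?thesis by (simp add: ev_0 words_0 finite_K prob_space)
  next
    case (Suc D')
    let ?F = "ev I (Suc D') f" and ?G = "ev I (Suc D') g"
    let ?f = "\<lambda>k. ev I D' (\<lambda>S. f (insert (r, k) S))" and ?g = "\<lambda>k. ev I D' (\<lambda>S. g (insert (r, k) S))"
    let ?\<Delta> = "\<lambda>w. \<Sum>k\<in>K. \<xi> r k w * ?f k w" and ?\<Gamma> = "\<lambda>w. \<Sum>k\<in>K. \<xi> r k w * ?g k w"
    have int: "integrable N (\<lambda>w. ?F w * ?G w)" "integrable N (\<lambda>w. ?\<Delta> w * ?G w)"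
      "integrable N (\<lambda>w. ?\<Gamma> w * ?F w)" "integrable N (\<lambda>w. ?\<Delta> w * ?\<Gamma> w * 1)"
      by (intro all_moments_integrable all_moments_closed ev_moments \<xi>_moments; assumption)+
    have "expectation (\<lambda>w. ev (insert r I) D f w * ev (insert r I) D g w) =
       expectation (\<lambda>w. ?F w * ?G w + ?\<Delta> w * ?G w + ?\<Gamma> w * ?F w + ?\<Delta> w * ?\<Gamma> w * 1)"
      unfolding Suc ev_insert[OF insert(2,1)] by (simp add: algebra_simps)
    also have "... = expectation (\<lambda>w. ?F w * ?G w) + expectation (\<lambda>w. ?\<Delta> w * ?G w)
        + expectation (\<lambda>w. ?\<Gamma> w * ?F w) + expectation (\<lambda>w. ?\<Delta> w * ?\<Gamma> w * 1)"
      using int by (simp only: Bochner_Integration.integral_add Bochner_Integration.integrable_add)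
    also have "expectation (\<lambda>w. ?\<Delta> w * ?G w) = 0"
      by (intro expectation_letter_combination[OF insert(2)] ev_sigB ev_moments)
    also have "expectation (\<lambda>w. ?\<Gamma> w * ?F w) = 0"
      by (intro expectation_letter_combination[OF insert(2)] ev_sigB ev_moments)
    also have "expectation (\<lambda>w. ?\<Delta> w * ?\<Gamma> w * 1) = (\<Sum>k\<in>K. expectation (\<lambda>w. ?f k w * ?g k w * 1))"
      by (intro expectation_letter_combination_mult[OF insert(2)] ev_sigB ev_moments
          all_moments_closed borel_measurable_const)
    finally show ?thesis
      by (simp add: insert.IH Suc sum_words_insert[OF insert(2) finite_K insert(1)])
  qed
qed

lemma expectation_ev_square:
  "finite I ==> expectation (\<lambda>w. (ev I D f w)^2) = (\<Sum>S\<in>words K I D. (f S)^2)"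
  using expectation_ev_mult[of I D f f] by (simp add: power2_eq_square)

section \<open>Hypercontractivity: fourth moments from second moments\<close>

definition hyper :: real where "hyper = 16 * (1 + real (card K)) ^ 3 * B"

lemma hyper_ge_1: "hyper \<ge> 1"
proof -
  have "1 * 1 \<le> (1 + real (card K)) ^ 3 * B"
    by (intro mult_mono B_ge_1) auto
  then show ?thesis by (simp add: hyper_def)
qed

lemma sum_power4_le:
  fixes a :: "'k => real"
  assumes "finite A"
  shows "(\<Sum>k\<in>A. a k) ^ 4 \<le> real (card A) ^ 3 * (\<Sum>k\<in>A. a k ^ 4)"
proof -
  have "((\<Sum>k\<in>A. a k)^2)^2 \<le> (real (card A) * (\<Sum>k\<in>A. (a k)^2))^2"
    using Cauchy_Schwarz_ineq_sum[of "\<lambda>_. 1" a A] by (intro power_mono) auto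
  also have "... = (real (card A))^2 * (\<Sum>k\<in>A. (a k)^2)^2" by (simp add: power_mult_distrib)
  also have "... \<le> (real (card A))^2 * (real (card A) * (\<Sum>k\<in>A. ((a k)^2)^2))"
    using Cauchy_Schwarz_ineq_sum[of "\<lambda>_. 1" "\<lambda>k. (a k)^2" A] by (intro mult_left_mono) auto
  finally show ?thesis by (simp add: power2_eq_square numeral_eq_Suc mult_ac)
qed

lemma sum_squares_le_square_sum:
  fixes a :: "'k => real"
  assumes "\<And>k. k \<in> A ==> 0 \<le> a k"
  shows "(\<Sum>k\<in>A. (a k)^2) \<le> (\<Sum>k\<in>A. a k)^2"
  using assms
proof (induction A rule: infinite_finite_induct)
  case (insert k A)
  have "0 \<le> a k * (\<Sum>k\<in>A. a k)" using insert by (intro mult_nonneg_nonneg sum_nonneg) auto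
  moreover have "(\<Sum>k\<in>A. (a k)^2) \<le> (\<Sum>k\<in>A. a k)^2" using insert by auto
  ultimately show ?case using insert by (simp add: power2_sum)
qed auto

text \<open>Induction over positions. With \<open>F\<close> the part free of \<open>r\<close> and
  \<Delta> the part linear in the letters at \<open>r\<close>, the cofactors in \<Delta> have length
  bound \<open>D'\<close> only, and the spare factor \<open>hyper\<close> pays for the fourth
  moments of the letters.\<close>

theorem fourth_moment_le:
  assumes "finite I"
  shows "expectation (\<lambda>w. ev I D f w ^ 4) \<le> hyper ^ D * (\<Sum>S\<in>words K I D. (f S)^2)^2"
  using assms
proof (induction I arbitrary: D f rule: finite_induct)
  case empty
  have "f {} ^ 4 \<le> hyper ^ D * f {} ^ 4"
    using hyper_ge_1 by (simp add: mult_le_cancel_right1 one_le_power)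
  then show ?case by (simp add: words_empty prob_space power_mult[symmetric])
next
  case (insert r I)
  show ?case
  proof (cases D)
    case 0
    with insert show ?thesis by (simp add: ev_0 words_0 finite_K prob_space power_mult[symmetric])
  next
    case (Suc D')
    define F \<Delta> where "F = ev I (Suc D') f"
      and "\<Delta> = (\<lambda>w. \<Sum>k\<in>K. \<xi> r k w * ev I D' (\<lambda>S. f (insert (r, k) S)) w)"
    let ?f = "\<lambda>k. ev I D' (\<lambda>S. f (insert (r, k) S))"
    define a b where "a = (\<Sum>S\<in>words K I (Suc D'). (f S)^2)"
      and "b = (\<Sum>k\<in>K. \<Sum>S\<in>words K I D'. (f (insert (r, k) S))^2)"
    have ab: "a \<ge> 0" "b \<ge> 0" by (auto simp: a_def b_def intro!: sum_nonneg)
    define C where "C = hyper ^ D'"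
    have C: "C \<ge> 1" unfolding C_def by (simp add: hyper_ge_1 one_le_power)
    have FM: "F \<in> all_moments N" "\<Delta> \<in> all_moments N"
      unfolding F_def \<Delta>_def by (intro all_moments_closed ev_moments \<xi>_moments; assumption)+
    have int: "integrable N (\<lambda>w. F w ^ 4)" "integrable N (\<lambda>w. \<Delta> w * F w ^ 3)"
      "integrable N (\<lambda>w. (F w)^2 * (\<Delta> w)^2)" "integrable N (\<lambda>w. \<Delta> w ^ 4)"
      "integrable N (\<lambda>w. (F w + \<Delta> w) ^ 4)"
      by (intro all_moments_integrable all_moments_closed FM)+
    \<comment> \<open>The term \<open>4 * x * y ^ 3\<close> is absorbed by completing a square,
      because the mean of \<open>F w * \<Delta> w ^ 3\<close> need not vanish for letters without
      symmetry.\<close>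
    have pt: "(x + y) ^ 4 \<le> x ^ 4 + 4 * (y * x ^ 3) + 8 * (x^2 * y^2) + 3 * y ^ 4" for x y :: real
    proof -
      have "0 \<le> 2 * (y * (x - y))^2" by simp
      also have "... = x ^ 4 + 4 * (y * x ^ 3) + 8 * (x^2 * y^2) + 3 * y ^ 4 - (x + y) ^ 4"
        by (simp add: power2_eq_square power3_eq_cube power4_eq_xxxx algebra_simps)
      finally show ?thesis by simp
    qed
    have "expectation (\<lambda>w. (F w + \<Delta> w) ^ 4) \<le> expectation (\<lambda>w. F w ^ 4 + 4 * (\<Delta> w * F w ^ 3)
        + 8 * ((F w)^2 * (\<Delta> w)^2) + 3 * \<Delta> w ^ 4)"
      by (intro integral_mono int Bochner_Integration.integrable_add
          Bochner_Integration.integrable_mult_right pt)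
    also have "... = expectation (\<lambda>w. F w ^ 4) + 4 * expectation (\<lambda>w. \<Delta> w * F w ^ 3)
        + 8 * expectation (\<lambda>w. (F w)^2 * (\<Delta> w)^2) + 3 * expectation (\<lambda>w. \<Delta> w ^ 4)"
      using int by simp
    also have "expectation (\<lambda>w. \<Delta> w * F w ^ 3) = 0"
      unfolding \<Delta>_def F_def
      by (intro expectation_letter_combination[OF insert(2)] ev_sigB ev_moments
          borel_measurable_power all_moments_closed)
    finally have 1: "expectation (\<lambda>w. (F w + \<Delta> w) ^ 4) \<le> expectation (\<lambda>w. F w ^ 4)
        + 8 * expectation (\<lambda>w. (F w)^2 * (\<Delta> w)^2) + 3 * expectation (\<lambda>w. \<Delta> w ^ 4)" by simp
    have F4: "expectation (\<lambda>w. F w ^ 4) \<le> hyper * C * a^2"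
      using insert.IH[of "Suc D'" f] by (simp add: F_def a_def C_def)
    \<comment> \<open>\<open>hyper\<close> is chosen with \<open>16 * m \<le> hyper\<close>:
      Cauchy-Schwarz then bounds the mixed term with a quarter of \<open>hyper\<close>, its
      coefficient 8 becomes the 2 in \<open>(a + b)^2\<close>, and \<open>3 * m\<close> fits under
      \<open>hyper\<close>. The \<open>1 +\<close> inside \<open>hyper\<close> keeps it at least 1
      when \<open>K\<close> is empty.\<close>
    define m where "m = real (card K) ^ 3 * B"
    have m: "m \<ge> 0" using B_ge_1 by (simp add: m_def)
    have hm: "16 * m \<le> hyper"
      unfolding m_def hyper_def using B_ge_1 by (simp add: power_mono mult_right_mono)
    have "expectation (\<lambda>w. \<Delta> w ^ 4) \<le>
        expectation (\<lambda>w. real (card K) ^ 3 * (\<Sum>k\<in>K. \<xi> r k w ^ 4 * ?f k w ^ 4))"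
      unfolding \<Delta>_def
      by (intro integral_mono all_moments_integrable all_moments_closed ev_moments \<xi>_moments)
        (auto simp: power_mult_distrib[symmetric] intro!: sum_power4_le finite_K)
    also have "... = real (card K) ^ 3 * (\<Sum>k\<in>K. expectation (\<lambda>w. \<xi> r k w ^ 4 * ?f k w ^ 4))"
      by (simp, subst Bochner_Integration.integral_sum)
        (auto intro!: all_moments_integrable all_moments_closed ev_moments \<xi>_moments)
    also have "... = real (card K) ^ 3 * (\<Sum>k\<in>K. expectation (\<lambda>w. \<xi> r k w ^ 4) * expectation (\<lambda>w. ?f k w ^ 4))"
      by (intro arg_cong[where f="\<lambda>x. real (card K) ^ 3 * x"] sum.cong refl
          expectation_letter_mult[OF insert(2)] borel_measurable_power \<xi>_sig ev_sigB
          all_moments_closed ev_moments \<xi>_moments)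
    also have "... \<le> real (card K) ^ 3 * (\<Sum>k\<in>K. B * (C * (\<Sum>S\<in>words K I D'. (f (insert (r, k) S))^2)^2))"
      using insert.IH[of D'] B_ge_1
      by (intro mult_left_mono sum_mono mult_mono \<xi>_fourth) (auto simp: C_def)
    also have "... = m * C * (\<Sum>k\<in>K. (\<Sum>S\<in>words K I D'. (f (insert (r, k) S))^2)^2)"
      by (simp add: m_def sum_distrib_left mult_ac)
    also have "... \<le> m * C * b^2"
    proof (intro mult_left_mono)
      show "(\<Sum>k\<in>K. (\<Sum>S\<in>words K I D'. (f (insert (r, k) S))^2)^2) \<le> b^2"
        unfolding b_def by (intro sum_squares_le_square_sum sum_nonneg) auto
    qed (use m C in auto)
    finally have D4: "expectation (\<lambda>w. \<Delta> w ^ 4) \<le> m * C * b^2" .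
    have "expectation (\<lambda>w. (F w)^2 * (\<Delta> w)^2) \<le> hyper / 4 * C * (a * b)"
    proof (rule power2_le_imp_le)
      have "(expectation (\<lambda>w. (F w)^2 * (\<Delta> w)^2))^2 \<le> expectation (\<lambda>w. F w ^ 4) * expectation (\<lambda>w. \<Delta> w ^ 4)"
        using Cauchy_Schwarz_all_moments[of "\<lambda>w. (F w)^2" "\<lambda>w. (\<Delta> w)^2"]
        by (simp add: all_moments_closed FM power_mult[symmetric])
      also have "... \<le> (hyper * C * a^2) * (m * C * b^2)"
        using C hyper_ge_1 by (intro mult_mono F4 D4) auto
      also have "... \<le> (hyper * C * a^2) * (hyper / 16 * C * b^2)"
        using C hyper_ge_1 hm by (intro mult_left_mono mult_right_mono) auto
      finally show "(expectation (\<lambda>w. (F w)^2 * (\<Delta> w)^2))^2 \<le> (hyper / 4 * C * (a * b))^2"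
        by (simp add: power2_eq_square mult_ac)
    qed (use ab C hyper_ge_1 in auto)
    with 1 F4 D4 have "expectation (\<lambda>w. (F w + \<Delta> w) ^ 4) \<le>
        hyper * C * a^2 + 8 * (hyper / 4 * C * (a * b)) + 3 * (m * C * b^2)" by linarith
    also have "3 * (m * C * b^2) \<le> hyper * (C * b^2)"
    proof -
      have "(3 * m) * (C * b^2) \<le> hyper * (C * b^2)"
        using hm m C by (intro mult_right_mono) auto
      then show ?thesis by (simp add: mult_ac)
    qed
    also have "hyper * C * a^2 + 8 * (hyper / 4 * C * (a * b)) + hyper * (C * b^2) = hyper * C * (a + b)^2"
      by (simp add: power2_eq_square algebra_simps)
    finally show ?thesis
      by (simp add: Suc ev_insert[OF insert(2,1)] F_def \<Delta>_def C_def a_def b_def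
          sum_words_insert[OF insert(2) finite_K insert(1)])
  qed
qed

end

subsection \<open>Gram--Schmidt for a positive semidefinite form\<close>

text \<open>Since \<open>sqrt 0 = 0\<close> and division by 0 gives 0, a residual of norm zero
  yields the zero function, and dependent families are processed like all others. This covers
  variables with finite support and degenerate Gaussian covariances.\<close>

fun gram_schmidt :: "(('z => real) => ('z => real) => real) => (nat => 'z => real) => nat => 'z => real" where
  "gram_schmidt b v k =
    (let r = (\<lambda>z. v k z - (\<Sum>j\<in>{..<k}. b (v k) (gram_schmidt b v j) * gram_schmidt b v j z))
     in (\<lambda>z. r z / sqrt (b r r)))"

declare gram_schmidt.simps [simp del]

text \<open>The carrier consists of functions on an arbitrary type, so that one construction serves
  real polynomials under the law of \<open>X 0\<close> and sequences of random variables coded as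
  functions on pairs.\<close>

locale psd_form =
  fixes b :: "('z => real) => ('z => real) => real" and S :: "('z => real) set"
  assumes S_add: "\<And>f g. f \<in> S ==> g \<in> S ==> (\<lambda>z. f z + g z) \<in> S"
    and S_scale: "\<And>f c. f \<in> S ==> (\<lambda>z. c * f z) \<in> S"
    and b_sym: "\<And>f g. f \<in> S ==> g \<in> S ==> b f g = b g f"
    and b_add: "\<And>f g h. f \<in> S ==> g \<in> S ==> h \<in> S ==> b (\<lambda>z. f z + g z) h = b f h + b g h"
    and b_scale: "\<And>f h c. f \<in> S ==> h \<in> S ==> b (\<lambda>z. c * f z) h = c * b f h"
    and b_nonneg: "\<And>f. f \<in> S ==> 0 \<le> b f f"
begin

lemma S_diff: "f \<in> S ==> g \<in> S ==> (\<lambda>z. f z - g z) \<in> S"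
  using S_add[of f "\<lambda>z. -1 * g z"] S_scale[of g "-1"] by simp

lemma b_diff: "f \<in> S ==> g \<in> S ==> h \<in> S ==> b (\<lambda>z. f z - g z) h = b f h - b g h"
  using b_add[of f "\<lambda>z. -1 * g z" h] S_scale[of g "-1"] b_scale[of g h "-1"] by simp

lemma S_zero: "f \<in> S ==> (\<lambda>z. 0) \<in> S"
  using S_scale[of f 0] by simp

lemma S_sum: "h \<in> S ==> (\<And>j. j \<in> J ==> f j \<in> S) ==> (\<lambda>z. \<Sum>j\<in>J. f j z) \<in> S"
  by (induction J rule: infinite_finite_induct) (auto intro: S_zero S_add)

lemma b_sum:
  assumes "h \<in> S" "\<And>j. j \<in> J ==> f j \<in> S"
  shows "b (\<lambda>z. \<Sum>j\<in>J. f j z) h = (\<Sum>j\<in>J. b (f j) h)"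
  using assms
proof (induction J rule: infinite_finite_induct)
  case (insert x F)
  then show ?case by (simp add: b_add S_sum)
qed (use b_scale[of h h 0] in auto)

lemma gram_schmidt_step:
  assumes v: "\<And>k. v k \<in> S"
  defines "e \<equiv> gram_schmidt b v"
  defines "r \<equiv> (\<lambda>k z. v k z - (\<Sum>j\<in>{..<k}. b (v k) (e j) * e j z))"
  shows gram_schmidt_eq: "e k = (\<lambda>z. r k z / sqrt (b (r k) (r k)))"
    and gram_schmidt_mem: "e k \<in> S"
    and gram_schmidt_res_mem: "r k \<in> S"
proof -
  show eq: "e k = (\<lambda>z. r k z / sqrt (b (r k) (r k)))" for k
    unfolding e_def r_def by (subst gram_schmidt.simps) (simp add: Let_def)
  have r: "r k \<in> S" if "\<And>j. j < k ==> e j \<in> S" for k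
    unfolding r_def using that by (intro S_diff v S_sum[OF v] S_scale) auto
  show e: "e k \<in> S" for k
  proof (induction k rule: less_induct)
    case (less k)
    have "(\<lambda>z. (1 / sqrt (b (r k) (r k))) * r k z) \<in> S" by (intro S_scale r less)
    then show ?case by (subst eq) simp
  qed
  then show "r k \<in> S" by (rule r)
qed

text \<open>For the last claim: a null residual gives \<open>e k = 0\<close>, so nothing more is
  subtracted; otherwise \<open>r k = s * e k\<close> with s the norm of \<open>r k\<close>, and the
  coefficient of \<open>v k\<close> along \<open>e k\<close> is exactly s.\<close>

lemma gram_schmidt_orthonormal:
  assumes v: "\<And>k. v k \<in> S"
  defines "e \<equiv> gram_schmidt b v"
  shows "j \<noteq> k ==> b (e j) (e k) = 0"
    and "b (e k) (e k) = 1 \<or> e k = (\<lambda>_. 0) \<and> b (e k) (e k) = 0"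
    and "b (\<lambda>z. v k z - (\<Sum>j\<le>k. b (v k) (e j) * e j z))
           (\<lambda>z. v k z - (\<Sum>j\<le>k. b (v k) (e j) * e j z)) = 0"
proof -
  define r where "r = (\<lambda>k z. v k z - (\<Sum>j\<in>{..<k}. b (v k) (e j) * e j z))"
  have gs: "e k = (\<lambda>z. r k z / sqrt (b (r k) (r k)))" "e k \<in> S" "r k \<in> S" for k
    using gram_schmidt_step[where v = v and k = k, OF v] by (auto simp: e_def r_def)
  have eq: "e k = (\<lambda>z. (1 / sqrt (b (r k) (r k))) * r k z)" for k using gs(1)[of k] by simp
  have brk: "b (r k) h = b (v k) h - (\<Sum>j<k. b (v k) (e j) * b (e j) h)" if "h \<in> S" for k h
  proof -
    have "b (r k) h = b (v k) h - b (\<lambda>z. \<Sum>j<k. b (v k) (e j) * e j z) h"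
      unfolding r_def using that gs(2) v by (subst b_diff) (auto intro!: S_sum[OF v] S_scale)
    also have "b (\<lambda>z. \<Sum>j<k. b (v k) (e j) * e j z) h = (\<Sum>j<k. b (\<lambda>z. b (v k) (e j) * e j z) h)"
      by (intro b_sum that S_scale gs)
    finally show ?thesis using that gs(2) by (simp add: b_scale)
  qed
  have norm: "b (e k) (e k) = 1 \<or> e k = (\<lambda>_. 0) \<and> b (e k) (e k) = 0" for k
  proof (cases "b (r k) (r k) = 0")
    case True
    then have "e k = (\<lambda>_. 0)" by (subst eq) simp
    moreover have "b (\<lambda>_. 0) (e k) = 0" using b_scale[OF gs(3)[of k] gs(2)[of k], of 0] by simp
    ultimately show ?thesis by simp
  next
    case False
    then have pos: "b (r k) (r k) > 0" using b_nonneg[OF gs(3)[of k]] by simp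
    have "b (e k) (e k) = (1 / sqrt (b (r k) (r k))) * b (r k) (e k)"
      by (subst eq, subst b_scale) (auto intro: gs)
    also have "b (r k) (e k) = b (e k) (r k)" by (intro b_sym gs)
    also have "... = (1 / sqrt (b (r k) (r k))) * b (r k) (r k)"
      by (subst eq, subst b_scale) (auto intro: gs)
    finally show ?thesis using pos by (simp add: field_simps)
  qed
  then show "b (e k) (e k) = 1 \<or> e k = (\<lambda>_. 0) \<and> b (e k) (e k) = 0" .
  have idem: "b h (e j) * b (e j) (e j) = b h (e j)" if "h \<in> S" for j h
  proof (cases "b (e j) (e j) = 1")
    case False
    then have "e j = (\<lambda>_. 0)" using norm by blast
    moreover have "b (\<lambda>_. 0) h = 0" using b_scale[OF that that, of 0] by simp
    ultimately have "b h (e j) = 0" using b_sym[OF that gs(2)[of j]] by simp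
    then show ?thesis by simp
  qed simp
  have lt: "b (e j) (e k) = 0" if "j < k" for j k
    using that
  proof (induction k arbitrary: j rule: less_induct)
    case (less k)
    have "(\<Sum>i<k. b (v k) (e i) * b (e i) (e j)) = (\<Sum>i<k. if i = j then b (v k) (e j) else 0)"
    proof (intro sum.cong refl)
      fix i assume "i \<in> {..<k}"
      show "b (v k) (e i) * b (e i) (e j) = (if i = j then b (v k) (e j) else 0)"
        using less.IH[of i j] less.IH[of j i] less.prems \<open>i \<in> {..<k}\<close> b_sym[OF gs(2)[of i] gs(2)[of j]]
          idem[OF v] by (cases i j rule: linorder_cases) auto
    qed
    then have "b (r k) (e j) = 0" using less.prems brk[OF gs(2)] by simp
    then have "b (e k) (e j) = 0"
      by (subst eq, subst b_scale) (auto intro: gs)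
    then show ?case using b_sym[OF gs(2)[of j] gs(2)[of k]] by simp
  qed
  show orth: "j \<noteq> k ==> b (e j) (e k) = 0" for j k
    using lt[of j k] lt[of k j] b_sym[OF gs(2)[of j] gs(2)[of k]] by (cases j k rule: linorder_cases) auto
  define c where "c = b (v k) (e k)"
  have res: "(\<lambda>z. v k z - (\<Sum>j\<le>k. b (v k) (e j) * e j z)) = (\<lambda>z. r k z - c * e k z)"
    by (auto simp: r_def c_def lessThan_Suc_atMost[symmetric] fun_eq_iff)
  have c: "b (r k) (e k) = c"
    using brk[OF gs(2), of k k] orth by (simp add: c_def)
  show "b (\<lambda>z. v k z - (\<Sum>j\<le>k. b (v k) (e j) * e j z))
           (\<lambda>z. v k z - (\<Sum>j\<le>k. b (v k) (e j) * e j z)) = 0"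
  proof (cases "b (r k) (r k) = 0")
    case True
    then have "e k = (\<lambda>_. 0)" by (subst eq) simp
    then show ?thesis using True by (simp add: res)
  next
    case False
    define s where "s = sqrt (b (r k) (r k))"
    have s: "s > 0" using False b_nonneg[OF gs(3)[of k]] by (simp add: s_def)
    have rk: "r k = (\<lambda>z. s * e k z)" using s by (subst eq) (simp add: s_def)
    have "b (e k) (e k) = 1"
      using norm[of k] rk False b_scale[OF gs(2)[of k] gs(2)[of k], of 0] by auto
    then have "c = s" using c b_scale[OF gs(2)[of k] gs(2)[of k], of s] unfolding rk by simp
    then have "(\<lambda>z. r k z - c * e k z) = (\<lambda>_. 0)" using rk by (simp add: fun_eq_iff)
    moreover have "b (\<lambda>_. 0) (\<lambda>_. 0) = 0" using b_scale[OF gs(2)[of k] S_zero[OF gs(2)[of k]], of 0] by simp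
    ultimately show ?thesis by (simp add: res)
  qed
qed

end

subsection \<open>The algebra of ordinary polynomials\<close>

definition mon :: "('i \<Rightarrow>\<^sub>0 nat) => ('i => real) => real" where
  "mon m y = (\<Prod>i\<in>Poly_Mapping.keys m. y i ^ Poly_Mapping.lookup m i)"

lemma mon_superset:
  "finite A ==> Poly_Mapping.keys m \<subseteq> A ==> mon m y = (\<Prod>i\<in>A. y i ^ Poly_Mapping.lookup m i)"
  unfolding mon_def by (rule prod.mono_neutral_left) (auto simp: in_keys_iff)

lemma monom_degree_superset:
  "finite A ==> Poly_Mapping.keys m \<subseteq> A ==> monom_degree m = (\<Sum>i\<in>A. Poly_Mapping.lookup m i)"
  unfolding monom_degree_def by (rule sum.mono_neutral_left) (auto simp: in_keys_iff)

lemma mon_add: "mon (m + m') y = mon m y * mon m' y"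
proof -
  let ?A = "Poly_Mapping.keys m \<union> Poly_Mapping.keys m'"
  have "Poly_Mapping.keys (m + m') \<subseteq> ?A" by (rule keys_add)
  then show ?thesis
    by (simp add: mon_superset[of ?A] lookup_add power_add prod.distrib)
qed

lemma monom_degree_add: "monom_degree (m + m') = monom_degree m + monom_degree m'"
proof -
  let ?A = "Poly_Mapping.keys m \<union> Poly_Mapping.keys m'"
  have "Poly_Mapping.keys (m + m') \<subseteq> ?A" by (rule keys_add)
  then show ?thesis
    by (simp add: monom_degree_superset[of ?A] lookup_add sum.distrib)
qed

lemma eval_mpoly_mon: "eval_mpoly p y = (\<Sum>m\<in>Poly_Mapping.keys p. Poly_Mapping.lookup p m * mon m y)"
  by (simp add: eval_mpoly_def mon_def)

lemma eval_mpoly_superset: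
  "finite A ==> Poly_Mapping.keys p \<subseteq> A ==> eval_mpoly p y = (\<Sum>m\<in>A. Poly_Mapping.lookup p m * mon m y)"
  unfolding eval_mpoly_mon by (rule sum.mono_neutral_left) (auto simp: in_keys_iff)

lemma eval_mpoly_add: "eval_mpoly (p + q) y = eval_mpoly p y + eval_mpoly q y"
proof -
  let ?A = "Poly_Mapping.keys p \<union> Poly_Mapping.keys q"
  have "Poly_Mapping.keys (p + q) \<subseteq> ?A" by (rule keys_add)
  then show ?thesis
    by (simp add: eval_mpoly_superset[of ?A] lookup_add sum.distrib algebra_simps)
qed

lemma eval_mpoly_sum: "eval_mpoly (\<Sum>j\<in>J. p j) y = (\<Sum>j\<in>J. eval_mpoly (p j) y)"
  by (induction J rule: infinite_finite_induct) (auto simp: eval_mpoly_add eval_mpoly_def[of 0])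

lemma eval_mpoly_single: "eval_mpoly (Poly_Mapping.single m c) y = c * mon m y"
  by (cases "c = 0") (simp_all add: eval_mpoly_mon)

lemma mpoly_expand: "p = (\<Sum>m\<in>Poly_Mapping.keys p. Poly_Mapping.single m (Poly_Mapping.lookup p m))"
  by (rule poly_mapping_eqI) (simp add: lookup_sum lookup_single when_def in_keys_iff)

lemma eval_mpoly_mult:
  fixes p q :: "'i real_mpoly"
  shows "eval_mpoly (p * q) y = eval_mpoly p y * eval_mpoly q y"
proof -
  have "p * q = (\<Sum>m\<in>Poly_Mapping.keys p. \<Sum>m'\<in>Poly_Mapping.keys q.
      Poly_Mapping.single (m + m') (Poly_Mapping.lookup p m * Poly_Mapping.lookup q m'))"
    by (subst mpoly_expand[of p], subst mpoly_expand[of q]) (simp add: sum_product mult_single)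
  then have "eval_mpoly (p * q) y = (\<Sum>m\<in>Poly_Mapping.keys p. \<Sum>m'\<in>Poly_Mapping.keys q.
      (Poly_Mapping.lookup p m * Poly_Mapping.lookup q m') * (mon m y * mon m' y))"
    by (simp add: eval_mpoly_sum eval_mpoly_single mon_add)
  also have "... = eval_mpoly p y * eval_mpoly q y"
    by (simp add: eval_mpoly_mon sum_product mult_ac)
  finally show ?thesis .
qed

lemma total_degree_le_add: "total_degree_le p k ==> total_degree_le q k ==> total_degree_le (p + q) k"
  unfolding total_degree_le_def using keys_add[of p q] by blast

lemma total_degree_le_mult:
  fixes p q :: "'i real_mpoly"
  shows "total_degree_le p k ==> total_degree_le q l ==> total_degree_le (p * q) (k + l)"
  unfolding total_degree_le_def using keys_mult[of p q] by (fastforce simp: monom_degree_add)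

lemma total_degree_le_single: "monom_degree m \<le> k ==> total_degree_le (Poly_Mapping.single m c) k"
  by (auto simp: total_degree_le_def)

lemma ordinary_polynomials_mono: "k \<le> l ==> ordinary_polynomials Y k \<subseteq> ordinary_polynomials Y l"
  unfolding ordinary_polynomials_def total_degree_le_def by force

lemma ordinary_polynomials_add:
  "f \<in> ordinary_polynomials Y k ==> g \<in> ordinary_polynomials Y k ==>
    (\<lambda>w. f w + g w) \<in> ordinary_polynomials Y k"
  unfolding ordinary_polynomials_def by (auto simp: eval_mpoly_add[symmetric] intro: total_degree_le_add)

lemma ordinary_polynomials_mult:
  "f \<in> ordinary_polynomials Y k ==> g \<in> ordinary_polynomials Y l ==>
    (\<lambda>w. f w * g w) \<in> ordinary_polynomials Y (k + l)"
  unfolding ordinary_polynomials_def by (auto simp: eval_mpoly_mult[symmetric] intro: total_degree_le_mult)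

lemma ordinary_polynomials_const: "(\<lambda>w. c) \<in> ordinary_polynomials Y k"
proof -
  have "(\<lambda>w. c) = (\<lambda>w. eval_mpoly (Poly_Mapping.single 0 c) (\<lambda>i. Y i w))"
    by (simp add: eval_mpoly_single mon_def)
  then show ?thesis unfolding ordinary_polynomials_def
    by (auto intro!: exI[of _ "Poly_Mapping.single 0 c"] total_degree_le_single simp: monom_degree_def)
qed

lemma ordinary_polynomials_var: "1 \<le> k ==> Y i \<in> ordinary_polynomials Y k"
proof -
  assume k: "1 \<le> k"
  let ?p = "Poly_Mapping.single (Poly_Mapping.single i 1) 1"
  have "Y i = (\<lambda>w. eval_mpoly ?p (\<lambda>i. Y i w))"
    by (simp add: eval_mpoly_single mon_def)
  then show ?thesis unfolding ordinary_polynomials_def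
    using k by (auto intro!: exI[of _ ?p] total_degree_le_single simp: monom_degree_def)
qed

lemma ordinary_polynomials_scale:
  assumes "f \<in> ordinary_polynomials Y k" shows "(\<lambda>w. c * f w) \<in> ordinary_polynomials Y k"
  using ordinary_polynomials_mult[OF ordinary_polynomials_const[of c Y 0] assms] by simp

lemma ordinary_polynomials_sum:
  "(\<And>j. j \<in> J ==> f j \<in> ordinary_polynomials Y k) ==> (\<lambda>w. \<Sum>j\<in>J. f j w) \<in> ordinary_polynomials Y k"
  by (induction J rule: infinite_finite_induct)
    (auto intro: ordinary_polynomials_const ordinary_polynomials_add)

lemma ordinary_polynomials_power:
  assumes "f \<in> ordinary_polynomials Y k" shows "(\<lambda>w. f w ^ n) \<in> ordinary_polynomials Y (n * k)"
  by (induction n) (auto intro: ordinary_polynomials_const ordinary_polynomials_mult assms)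

lemma ordinary_polynomials_prod:
  "finite J ==> (\<And>j. j \<in> J ==> f j \<in> ordinary_polynomials Y (n j)) ==>
    (\<lambda>w. \<Prod>j\<in>J. f j w) \<in> ordinary_polynomials Y (\<Sum>j\<in>J. n j)"
  by (induction J rule: finite_induct)
    (auto intro: ordinary_polynomials_const ordinary_polynomials_mult)

lemma ordinary_polynomials_all_moments:
  assumes "finite_measure M" "\<And>i. Y i \<in> all_moments M" "f \<in> ordinary_polynomials Y k"
  shows "f \<in> all_moments M"
  using assms(3) unfolding ordinary_polynomials_def eval_mpoly_def
  by (auto intro!: all_moments_sum all_moments_mult all_moments_prod all_moments_power
      all_moments_const assms)

subsection \<open>Expansion of polynomials in orthonormal words\<close>

definition polyfun :: "nat => (real => real) set" where
  "polyfun k = {f. \<exists>a. f = (\<lambda>x. \<Sum>j\<le>k. a j * x ^ j)}"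

lemma polyfun_mono:
  assumes "k \<le> l" shows "polyfun k \<subseteq> polyfun l"
proof
  fix f assume "f \<in> polyfun k"
  then obtain a where a: "f = (\<lambda>x. \<Sum>j\<le>k. a j * x ^ j)" by (auto simp: polyfun_def)
  have "f = (\<lambda>x. \<Sum>j\<le>l. (if j \<le> k then a j else 0) * x ^ j)"
    unfolding a fun_eq_iff using assms by (intro allI sum.mono_neutral_cong_left) auto
  then show "f \<in> polyfun l" unfolding polyfun_def by (intro CollectI exI)
qed

lemma polyfun_add: "f \<in> polyfun k ==> g \<in> polyfun k ==> (\<lambda>x. f x + g x) \<in> polyfun k"
proof -
  assume "f \<in> polyfun k" "g \<in> polyfun k"
  then obtain a c where "f = (\<lambda>x. \<Sum>j\<le>k. a j * x ^ j)" "g = (\<lambda>x. \<Sum>j\<le>k. c j * x ^ j)"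
    unfolding polyfun_def by blast
  then have "(\<lambda>x. f x + g x) = (\<lambda>x. \<Sum>j\<le>k. (a j + c j) * x ^ j)"
    by (simp add: sum.distrib algebra_simps)
  then show ?thesis unfolding polyfun_def by (intro CollectI exI)
qed

lemma polyfun_scale: "f \<in> polyfun k ==> (\<lambda>x. c * f x) \<in> polyfun k"
proof -
  assume "f \<in> polyfun k"
  then obtain a where "f = (\<lambda>x. \<Sum>j\<le>k. a j * x ^ j)"
    unfolding polyfun_def by blast
  then have "(\<lambda>x. c * f x) = (\<lambda>x. \<Sum>j\<le>k. (c * a j) * x ^ j)"
    by (simp add: sum_distrib_left mult.assoc)
  then show ?thesis unfolding polyfun_def by (intro CollectI exI)
qed

lemma polyfun_sum: "(\<And>j. j \<in> J ==> f j \<in> polyfun k) ==> (\<lambda>x. \<Sum>j\<in>J. f j x) \<in> polyfun k"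
proof (induction J rule: infinite_finite_induct)
  case (insert x F)
  then show ?case using polyfun_add[of "f x" k "\<lambda>z. \<Sum>j\<in>F. f j z"] by simp
qed (auto simp: polyfun_def intro!: exI[of _ "\<lambda>_. 0"])

lemma polyfun_monomial: "(\<lambda>x. x ^ k) \<in> polyfun k"
  unfolding polyfun_def
  by (intro CollectI exI[of _ "\<lambda>j. if j = k then 1 else 0"]) (simp add: if_distrib[of "\<lambda>c. c * _"] cong: if_cong)

lemma polyfun_measurable: "f \<in> polyfun k ==> f \<in> borel_measurable borel"
  unfolding polyfun_def by auto

text \<open>An upper bound for the degree of the polynomial attached to a word, as
  \<open>h k\<close> has degree at most k. The cardinality of a word counts variables
  instead.\<close>

definition wt :: "(nat \<times> nat) set => nat" where "wt S = (\<Sum>l\<in>S. snd l)"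

locale iid = prob_space M for M :: "'a measure" +
  fixes X :: "nat => 'a => real" and d :: nat
  assumes X_indep: "indep_vars (\<lambda>_. borel) X UNIV"
    and X_ident: "\<And>i. distr M borel (X i) = distr M borel (X 0)"
    and X_integrable: "\<And>p::nat. integrable M (\<lambda>w. \<bar>X 0 w\<bar> ^ p)"
begin

sublocale indep_reals M X
  by unfold_locales (rule X_indep)

lemma expectation_X:
  fixes f :: "real => real"
  assumes [measurable]: "f \<in> borel_measurable borel"
  shows "expectation (\<lambda>w. f (X i w)) = expectation (\<lambda>w. f (X 0 w))"
  using integral_distr[OF W_measurable[of i] assms] integral_distr[OF W_measurable[of 0] assms]
    X_ident[of i] by simp

lemma X_moments: "X i \<in> all_moments M"
proof -
  have "integrable M (\<lambda>w. \<bar>X i w\<bar> ^ p)" for p :: nat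
    using integrable_distr_eq[OF W_measurable[of i], of "\<lambda>x. \<bar>x\<bar> ^ p"]
      integrable_distr_eq[OF W_measurable[of 0], of "\<lambda>x. \<bar>x\<bar> ^ p"] X_ident[of i] X_integrable[of p]
    by simp
  then show ?thesis by (simp add: all_moments_def)
qed

lemma polyfun_moments:
  assumes "f \<in> polyfun k" shows "(\<lambda>w. f (X i w)) \<in> all_moments M"
  using assms unfolding polyfun_def by (auto intro!: all_moments_closed X_moments)

section \<open>Orthonormal polynomials for the law of \<open>X 0\<close>\<close>

definition bX :: "(real => real) => (real => real) => real" where
  "bX f g = expectation (\<lambda>w. f (X 0 w) * g (X 0 w))"

sublocale bX: psd_form bX "\<Union>k. polyfun k"
proof
  fix f g h :: "real => real" and c :: real
  assume f: "f \<in> (\<Union>k. polyfun k)"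
  show "(\<lambda>z. c * f z) \<in> (\<Union>k. polyfun k)" using f by (auto intro: polyfun_scale)
  show "0 \<le> bX f f" by (simp add: bX_def)
  have fm: "(\<lambda>w. f (X 0 w)) \<in> all_moments M" using f by (auto intro: polyfun_moments)
  { assume h: "h \<in> (\<Union>k. polyfun k)"
    then have hm: "(\<lambda>w. h (X 0 w)) \<in> all_moments M" by (auto intro: polyfun_moments)
    show "bX (\<lambda>z. c * f z) h = c * bX f h"
      by (simp add: bX_def mult.assoc)
    assume g: "g \<in> (\<Union>k. polyfun k)"
    then have gm: "(\<lambda>w. g (X 0 w)) \<in> all_moments M" by (auto intro: polyfun_moments)
    show "bX (\<lambda>z. f z + g z) h = bX f h + bX g h"
      unfolding bX_def distrib_right
      by (intro Bochner_Integration.integral_add all_moments_integrable all_moments_closed fm gm hm) }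
  assume g: "g \<in> (\<Union>k. polyfun k)"
  show "bX f g = bX g f" by (simp add: bX_def mult.commute)
  from f g obtain k l where "f \<in> polyfun k" "g \<in> polyfun l" by auto
  then have "f \<in> polyfun (max k l)" "g \<in> polyfun (max k l)"
    using polyfun_mono[of k "max k l"] polyfun_mono[of l "max k l"] by auto
  then show "(\<lambda>z. f z + g z) \<in> (\<Union>k. polyfun k)" by (auto intro: polyfun_add)
qed

definition h :: "nat => real => real" where "h = gram_schmidt bX (\<lambda>k x. x ^ k)"

lemma monomial_mem: "(\<lambda>x. x ^ k) \<in> (\<Union>k. polyfun k)"
  using polyfun_monomial by blast

lemma h_polyfun: "h k \<in> polyfun k"
proof (induction k rule: less_induct)
  case (less k)
  define r where "r = (\<lambda>x. x ^ k - (\<Sum>j<k. bX (\<lambda>x. x ^ k) (h j) * h j x))"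
  have "(\<lambda>x. x ^ k + (\<Sum>j<k. - bX (\<lambda>x. x ^ k) (h j) * h j x)) \<in> polyfun k"
  proof (intro polyfun_add polyfun_monomial polyfun_sum polyfun_scale)
    fix j assume "j \<in> {..<k}"
    then show "h j \<in> polyfun k" using less[of j] polyfun_mono[of j k] by auto
  qed
  then have "r \<in> polyfun k" by (simp add: r_def sum_negf)
  moreover have "h k = (\<lambda>x. r x / sqrt (bX r r))"
    using bX.gram_schmidt_eq[of "\<lambda>k x. x ^ k" k, OF monomial_mem] by (simp add: h_def r_def)
  then have "h k = (\<lambda>x. (1 / sqrt (bX r r)) * r x)" by simp
  ultimately show ?case using polyfun_scale by metis
qed

lemmas h_orthonormal = bX.gram_schmidt_orthonormal[of "\<lambda>k x. x ^ k", OF monomial_mem, folded h_def]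

lemma h_0: "h 0 = (\<lambda>_. 1)"
  unfolding h_def by (subst gram_schmidt.simps) (simp add: Let_def bX_def prob_space)

lemma h_measurable [measurable]: "h k \<in> borel_measurable borel"
  using h_polyfun polyfun_measurable by blast

lemma h_moments: "(\<lambda>w. h k (X i w)) \<in> all_moments M"
  using h_polyfun polyfun_moments by blast

text \<open>Letters exist only for degrees at which Gram-Schmidt does not degenerate; a law with
  finitely many atoms loses the high ones. Degree 0 is left out because \<open>h 0 = 1\<close> is
  represented by the empty word.\<close>

definition K :: "nat set" where "K = {k \<in> {1..d}. bX (h k) (h k) = 1}"

definition B :: real where "B = 1 + (\<Sum>k\<in>K. expectation (\<lambda>w. h k (X 0 w) ^ 4))"

sublocale letters M X "\<lambda>i. {i}" "\<lambda>i k w. h k (X i w)" K B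
proof
  show "finite K" by (simp add: K_def)
  show "1 \<le> B" unfolding B_def by (auto intro!: sum_nonneg)
  show "(\<lambda>w. h k (X i w)) \<in> borel_measurable (sig {i})" for i k
    by (intro measurable_compose[OF _ h_measurable] W_sig) simp
  show "(\<lambda>w. h k (X i w)) \<in> all_moments M" for i k by (rule h_moments)
  show "expectation (\<lambda>w. h k (X i w)) = 0" if "k \<in> K" for i k
    using h_orthonormal(1)[of k 0] that unfolding h_0 by (subst expectation_X) (auto simp: bX_def K_def)
  show "expectation (\<lambda>w. h k (X i w) * h l (X i w)) = (if k = l then 1 else 0)" if "k \<in> K" "l \<in> K" for i k l
    using h_orthonormal(1)[of k l] that
    by (subst expectation_X[of "\<lambda>x. h k x * h l x"]) (auto simp: bX_def K_def)
  show "expectation (\<lambda>w. h k (X i w) ^ 4) \<le> B" if "k \<in> K" for i k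
  proof -
    have "expectation (\<lambda>w. h k (X 0 w) ^ 4) \<le> (\<Sum>k\<in>K. expectation (\<lambda>w. h k (X 0 w) ^ 4))"
      using that \<open>finite K\<close> by (intro member_le_sum) auto
    then show ?thesis by (subst expectation_X[of "\<lambda>x. h k x ^ 4"]) (auto simp: B_def)
  qed
qed auto

text \<open>The Gram-Schmidt residual has norm zero, hence vanishes almost surely under the law of
  \<open>X 0\<close>, and the identity travels to \<open>X i\<close> because the laws agree.
  Dropping the vanishing \<open>h j\<close> leaves the index set \<open>K\<close>.\<close>

lemma power_expansion:
  assumes "m \<le> d"
  shows "AE w in M. X i w ^ m = bX (\<lambda>x. x ^ m) (h 0) +
    (\<Sum>j\<in>{j \<in> K. j \<le> m}. bX (\<lambda>x. x ^ m) (h j) * h j (X i w))"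
proof -
  define r where "r = (\<lambda>x. x ^ m - (\<Sum>j\<le>m. bX (\<lambda>x. x ^ m) (h j) * h j x))"
  have [measurable]: "r \<in> borel_measurable borel" by (simp add: r_def)
  have "bX r r = 0" using h_orthonormal(3)[of m] by (simp add: r_def)
  moreover have "integrable M (\<lambda>w. r (X 0 w) * r (X 0 w))"
    unfolding r_def by (intro all_moments_integrable all_moments_closed X_moments h_moments)
  ultimately have "AE w in M. r (X 0 w) * r (X 0 w) = 0"
    unfolding bX_def by (subst (asm) integral_nonneg_eq_0_iff_AE) auto
  then have "AE w in M. r (X 0 w) = 0" by eventually_elim simp
  then have "AE x in distr M borel (X 0). r x = 0"
    by (subst AE_distr_iff) (auto simp: W_measurable)
  then have "AE x in distr M borel (X i). r x = 0" by (subst X_ident)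
  then have "AE w in M. r (X i w) = 0"
    by (subst (asm) AE_distr_iff) (auto simp: W_measurable)
  then have ae: "AE w in M. r (X i w) = 0" .
  have eq: "(\<Sum>j\<le>m. bX (\<lambda>x. x ^ m) (h j) * h j x) = bX (\<lambda>x. x ^ m) (h 0) +
      (\<Sum>j\<in>{j \<in> K. j \<le> m}. bX (\<lambda>x. x ^ m) (h j) * h j x)" for x
  proof -
    have "(\<Sum>j\<le>m. bX (\<lambda>x. x ^ m) (h j) * h j x) =
        (\<Sum>j\<in>insert 0 {j \<in> K. j \<le> m}. bX (\<lambda>x. x ^ m) (h j) * h j x)"
    proof (intro sum.mono_neutral_right ballI)
      fix j assume j: "j \<in> {..m} - insert 0 {j \<in> K. j \<le> m}"
      then have "bX (h j) (h j) \<noteq> 1" using assms by (auto simp: K_def)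
      then show "bX (\<lambda>x. x ^ m) (h j) * h j x = 0" using h_orthonormal(2)[of j] by auto
    qed auto
    then show ?thesis by (simp add: K_def h_0)
  qed
  show ?thesis using ae by eventually_elim (simp add: r_def eq)
qed

section \<open>Word expansions graded by weight\<close>

lemma wt_insert: "finite S ==> l \<notin> S ==> wt (insert l S) = snd l + wt S"
  by (simp add: wt_def)

lemma card_le_wt: "S \<subseteq> I \<times> K ==> finite S ==> card S \<le> wt S"
proof -
  assume "S \<subseteq> I \<times> K" "finite S"
  then have "(\<Sum>l\<in>S. 1) \<le> wt S" unfolding wt_def by (intro sum_mono) (auto simp: K_def)
  then show ?thesis by simp
qed

text \<open>Equality is almost sure because powers of \<open>X i\<close> expand only up to null
  sets. The length bound is always \<open>d\<close>, and the weight bound k carries the degree; each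
  letter has weight at least 1, so no word of weight at most \<open>d\<close> is cut off.\<close>

definition word_sums :: "nat => nat set => ('a => real) set" where
  "word_sums k I = {F. \<exists>f. (\<forall>S\<in>words K I d. f S \<noteq> 0 --> wt S \<le> k) \<and> (AE w in M. F w = ev I d f w)}"

lemma word_sumsI:
  "(\<And>S. S \<in> words K I d ==> f S \<noteq> 0 ==> wt S \<le> k) ==> AE w in M. F w = ev I d f w ==> F \<in> word_sums k I"
  by (auto simp: word_sums_def)

lemma word_sums_mono:
  assumes F: "F \<in> word_sums k I" and "k \<le> l" "I \<subseteq> J" "finite J"
  shows "F \<in> word_sums l J"
proof -
  obtain f where f: "\<And>S. S \<in> words K I d ==> f S \<noteq> 0 ==> wt S \<le> k" "AE w in M. F w = ev I d f w"
    using F by (auto simp: word_sums_def)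
  define g where "g S = (if S \<in> words K I d then f S else 0)" for S
  have "ev J d g w = ev I d f w" for w
    unfolding ev_def using assms words_mono[of I J d d K] finite_words[OF finite_K assms(4), of d]
    by (intro sum.mono_neutral_cong_right) (auto simp: g_def)
  then have "AE w in M. F w = ev J d g w" using f(2) by simp
  then show ?thesis using assms f(1) by (intro word_sumsI[where f = g]) (auto simp: g_def split: if_splits intro: order_trans)
qed

lemma word_sums_scale:
  assumes F: "F \<in> word_sums k I" shows "(\<lambda>w. c * F w) \<in> word_sums k I"
proof -
  obtain f where f: "\<And>S. S \<in> words K I d ==> f S \<noteq> 0 ==> wt S \<le> k" "AE w in M. F w = ev I d f w"
    using F by (auto simp: word_sums_def)
  have "AE w in M. c * F w = ev I d (\<lambda>S. c * f S) w"
    using f(2) by eventually_elim (simp add: ev_def sum_distrib_left mult.assoc)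
  then show ?thesis using f(1) by (intro word_sumsI[where f = "\<lambda>S. c * f S"]) auto
qed

lemma word_sums_add:
  assumes F: "F \<in> word_sums k I" and G: "G \<in> word_sums k I" shows "(\<lambda>w. F w + G w) \<in> word_sums k I"
proof -
  obtain f where f: "\<And>S. S \<in> words K I d ==> f S \<noteq> 0 ==> wt S \<le> k" "AE w in M. F w = ev I d f w"
    using F by (auto simp: word_sums_def)
  obtain g where g: "\<And>S. S \<in> words K I d ==> g S \<noteq> 0 ==> wt S \<le> k" "AE w in M. G w = ev I d g w"
    using G by (auto simp: word_sums_def)
  have "AE w in M. F w + G w = ev I d (\<lambda>S. f S + g S) w"
    using f(2) g(2) by eventually_elim (simp add: ev_def sum.distrib distrib_right)
  then show ?thesis
  proof (rule word_sumsI[rotated])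
    fix S assume S: "S \<in> words K I d" "f S + g S \<noteq> 0"
    then have "f S \<noteq> 0 \<or> g S \<noteq> 0" by auto
    then show "wt S \<le> k" using f(1)[OF S(1)] g(1)[OF S(1)] by blast
  qed
qed

lemma word_sums_const: "finite I ==> (\<lambda>w. c) \<in> word_sums k I"
proof -
  assume I: "finite I"
  have "{} \<in> words K I d" by (simp add: words_def)
  then have "(\<Sum>S\<in>words K I d. (if S = {} then c else 0) * xi S w) = c" for w
    using finite_words[OF finite_K I, of d]
    by (subst sum.mono_neutral_cong_right[where S = "{{}}" and h = "\<lambda>_. c"]) auto
  then show ?thesis
    by (intro word_sumsI[where f = "\<lambda>S. if S = {} then c else 0"]) (auto simp: ev_def wt_def split: if_splits)
qed

lemma word_sums_sum:
  assumes "finite I" "\<And>j. j \<in> J ==> F j \<in> word_sums k I"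
  shows "(\<lambda>w. \<Sum>j\<in>J. F j w) \<in> word_sums k I"
  using assms(2)
proof (induction J rule: infinite_finite_induct)
  case (insert j J)
  have "(\<lambda>w. F j w + (\<Sum>j\<in>J. F j w)) \<in> word_sums k I"
    using insert by (intro word_sums_add) simp_all
  then show ?case using insert.hyps by simp
qed (simp_all add: word_sums_const[OF assms(1)])

lemma word_sums_letter_mult:
  assumes F: "F \<in> word_sums k I" and r: "r \<notin> I" "finite I" and j: "j \<in> K" "k + j \<le> d"
  shows "(\<lambda>w. h j (X r w) * F w) \<in> word_sums (k + j) (insert r I)"
proof -
  obtain f where f: "\<And>S. S \<in> words K I d ==> f S \<noteq> 0 ==> wt S \<le> k" "AE w in M. F w = ev I d f w"
    using F by (auto simp: word_sums_def)
  have "1 \<le> j" using j by (simp add: K_def)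
  then obtain d' where d': "d = Suc d'" using j(2) by (cases d) auto
  define g where "g S = (if (r, j) \<in> S then f (S - {(r, j)}) else 0)" for S
  have nr: "(r, i) \<notin> S" if "S \<in> words K I D" for S i D
    using that r by (auto simp: words_def)
  have eq: "ev (insert r I) d g w = h j (X r w) * ev I d f w" for w
  proof -
    have "ev I (Suc d') g w = 0"
      unfolding ev_def by (intro sum.neutral) (auto simp: g_def nr)
    moreover have "ev I d' (\<lambda>S. g (insert (r, i) S)) w = (if i = j then ev I d f w else 0)" for i
    proof (cases "i = j")
      case True
      have "ev I d' (\<lambda>S. g (insert (r, j) S)) w = ev I d' f w"
        unfolding ev_def g_def using nr by (intro sum.cong refl) auto
      also have "... = ev I d f w"
        unfolding ev_def
      proof (intro sum.mono_neutral_left ballI finite_words finite_K r words_mono order_refl)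
        fix S assume S: "S \<in> words K I d - words K I d'"
        \<comment> \<open>Words of full length \<open>d\<close> carry no coefficient: their weight
          would be at least \<open>d\<close>, whereas \<open>k + j \<le> d\<close> and
          \<open>1 \<le> j\<close> leave at most \<open>d'\<close>.\<close>
        have "f S = 0"
        proof (rule ccontr)
          assume "f S \<noteq> 0"
          have Sw: "S \<in> words K I d" using S by simp
          then have "wt S \<le> k" using f(1) \<open>f S \<noteq> 0\<close> by blast
          moreover have "card S \<le> wt S"
            using Sw words_finite[OF finite_K r(2) Sw] by (intro card_le_wt[of S I]) (simp_all add: words_def)
          ultimately have "card S \<le> d'" using j(2) \<open>1 \<le> j\<close> d' by linarith
          then have "S \<in> words K I d'" using Sw by (simp add: words_def)
          then show False using S by simp
        qed
        then show "f S * xi S w = 0" by simp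
      qed (simp add: d')
      finally show ?thesis using True by simp
    next
      case False
      then show ?thesis using nr unfolding ev_def by (auto intro!: sum.neutral simp: g_def)
    qed
    ultimately have "ev (insert r I) d g w = (\<Sum>i\<in>K. h i (X r w) * (if i = j then ev I d f w else 0))"
      using ev_insert[OF r, of d' g w] by (simp add: d'[symmetric])
    also have "... = h j (X r w) * ev I d f w"
      using j(1) by (simp add: if_distrib[of "\<lambda>c. _ * c"] finite_K cong: if_cong)
    finally show ?thesis .
  qed
  have "AE w in M. h j (X r w) * F w = ev (insert r I) d g w"
    using f(2) by eventually_elim (simp add: eq)
  then show ?thesis
  proof (rule word_sumsI[rotated])
    fix S assume S: "S \<in> words K (insert r I) d" "g S \<noteq> 0"
    then have rS: "(r, j) \<in> S" "f (S - {(r, j)}) \<noteq> 0" by (auto simp: g_def split: if_splits)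
    have fin: "finite S" using S(1) words_finite[OF finite_K] r by blast
    have "S - {(r, j)} \<in> words K I d"
    proof -
      have "fst l \<noteq> r" if "l \<in> S - {(r, j)}" for l
        using that rS S inj_onD[of fst S l "(r, j)"] by (auto simp: words_def)
      then have "S - {(r, j)} \<subseteq> I \<times> K" using S(1) by (fastforce simp: words_def)
      moreover have "inj_on fst (S - {(r, j)})" using S by (auto simp: words_def intro: inj_on_subset)
      moreover have "card S \<le> d" using S by (simp add: words_def)
      ultimately show ?thesis using rS fin by (simp add: words_def)
    qed
    then have "wt (S - {(r, j)}) \<le> k" using f(1) rS by blast
    moreover have "wt S = j + wt (S - {(r, j)})"
      using wt_insert[of "S - {(r, j)}" "(r, j)"] rS(1) fin by (simp add: insert_absorb)
    ultimately show "wt S \<le> k + j" by simp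
  qed
qed

lemma word_sums_cong_AE:
  assumes F: "F \<in> word_sums k I" and FG: "AE w in M. G w = F w"
  shows "G \<in> word_sums k I"
proof -
  obtain f where f: "\<And>S. S \<in> words K I d ==> f S \<noteq> 0 ==> wt S \<le> k" "AE w in M. F w = ev I d f w"
    using F by (auto simp: word_sums_def)
  have "AE w in M. G w = ev I d f w" using f(2) FG by eventually_elim simp
  then show ?thesis using f(1) by (rule word_sumsI[rotated])
qed

lemma monomial_word_sums:
  assumes "finite A" "(\<Sum>i\<in>A. m i) \<le> d"
  shows "(\<lambda>w. \<Prod>i\<in>A. X i w ^ m i) \<in> word_sums (\<Sum>i\<in>A. m i) A"
  using assms
proof (induction A rule: finite_induct)
  case empty
  then show ?case using word_sums_const[of "{}" 1 0] by simp
next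
  case (insert r A)
  let ?F = "\<lambda>w. \<Prod>i\<in>A. X i w ^ m i" and ?k = "\<Sum>i\<in>A. m i"
  have F: "?F \<in> word_sums ?k A" using insert by simp
  have "(\<lambda>w. bX (\<lambda>x. x ^ m r) (h 0) * ?F w + (\<Sum>j\<in>{j \<in> K. j \<le> m r}. bX (\<lambda>x. x ^ m r) (h j) * (h j (X r w) * ?F w)))
      \<in> word_sums (m r + ?k) (insert r A)"
  proof (intro word_sums_add word_sums_scale word_sums_sum)
    show "?F \<in> word_sums (m r + ?k) (insert r A)"
      by (rule word_sums_mono[OF F]) (use insert.hyps in auto)
    fix j assume j: "j \<in> {j \<in> K. j \<le> m r}"
    have "(\<lambda>w. h j (X r w) * ?F w) \<in> word_sums (?k + j) (insert r A)"
      using j insert.hyps insert.prems by (intro word_sums_letter_mult[OF F]) simp_all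
    then show "(\<lambda>w. h j (X r w) * ?F w) \<in> word_sums (m r + ?k) (insert r A)"
      by (rule word_sums_mono) (use j insert.hyps in simp_all)
  qed (use insert.hyps in simp)
  moreover have "AE w in M. X r w ^ m r * ?F w =
     bX (\<lambda>x. x ^ m r) (h 0) * ?F w + (\<Sum>j\<in>{j \<in> K. j \<le> m r}. bX (\<lambda>x. x ^ m r) (h j) * (h j (X r w) * ?F w))"
  proof -
    have "m r \<le> d" using insert.prems insert.hyps by simp
    from power_expansion[OF this, of r] show ?thesis
      by eventually_elim (simp add: distrib_right sum_distrib_right mult.assoc)
  qed
  ultimately have "(\<lambda>w. X r w ^ m r * ?F w) \<in> word_sums (m r + ?k) (insert r A)"
    by (rule word_sums_cong_AE)
  then show ?case using insert.hyps by simp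
qed

section \<open>Coefficients of ordinary polynomials\<close>

definition coef :: "('a => real) => (nat \<times> nat) set => real" where
  "coef F S = expectation (\<lambda>w. F w * xi S w)"

lemma ordinary_moments: "F \<in> ordinary_polynomials X k ==> F \<in> all_moments M"
  using ordinary_polynomials_all_moments[OF finite_measure_axioms X_moments] .

lemma expectation_ev_xi:
  assumes "finite I" "S \<in> words K I D"
  shows "expectation (\<lambda>w. ev I D f w * xi S w) = f S"
proof -
  have fin: "finite (words K I D)" using finite_words finite_K assms by blast
  have "xi S = ev I D (\<lambda>T. if T = S then 1 else 0)"
    using assms fin by (simp add: ev_def fun_eq_iff if_distrib[of "\<lambda>c. c * _"] cong: if_cong)
  then show ?thesis
    using expectation_ev_mult[OF assms(1), of D f "\<lambda>T. if T = S then 1 else 0"] assms fin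
    by (simp add: if_distrib[of "\<lambda>c. _ * c"] cong: if_cong)
qed

text \<open>The coefficients are inner products with words and so do not depend on the set of
  positions: one function \<open>coef F\<close> serves every large \<open>J\<close>. The second
  claim is the link from degree bounds to coefficient arrays.\<close>

lemma ordinary_polynomial_words:
  assumes F: "F \<in> ordinary_polynomials X k" and "k \<le> d"
  shows "\<exists>I. finite I \<and> (\<forall>J. finite J --> I \<subseteq> J --> (AE w in M. F w = ev J d (coef F) w))"
    and "\<And>J S. finite J ==> S \<in> words K J d ==> wt S > k ==> coef F S = 0"
proof -
  obtain p where p: "F = (\<lambda>w. eval_mpoly p (\<lambda>i. X i w))" "total_degree_le p k"
    using F by (auto simp: ordinary_polynomials_def)
  define I where "I = (\<Union>m\<in>Poly_Mapping.keys p. Poly_Mapping.keys m)"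
  have I: "finite I" by (simp add: I_def)
  have "(\<lambda>w. \<Sum>m\<in>Poly_Mapping.keys p. Poly_Mapping.lookup p m * mon m (\<lambda>i. X i w)) \<in> word_sums k I"
  proof (intro word_sums_sum I word_sums_scale)
    fix m assume m: "m \<in> Poly_Mapping.keys p"
    have "(\<Sum>i\<in>Poly_Mapping.keys m. Poly_Mapping.lookup m i) \<le> k"
      using p(2) m by (auto simp: total_degree_le_def monom_degree_def)
    then show "(\<lambda>w. mon m (\<lambda>i. X i w)) \<in> word_sums k I"
      unfolding mon_def using assms(2) m I
      by (intro word_sums_mono[OF monomial_word_sums]) (auto simp: I_def)
  qed
  then have FI: "F \<in> word_sums k I" by (simp add: p(1) eval_mpoly_mon)
  have *: "(AE w in M. F w = ev J d (coef F) w) \<and> (\<forall>S\<in>words K J d. wt S > k --> coef F S = 0)"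
    if J: "finite J" "I \<subseteq> J" for J
  proof -
    have "F \<in> word_sums k J" using FI J by (intro word_sums_mono[OF FI]) auto
    then obtain f where f: "\<And>S. S \<in> words K J d ==> f S \<noteq> 0 ==> wt S \<le> k" "AE w in M. F w = ev J d f w"
      by (auto simp: word_sums_def)
    have cf: "coef F S = f S" if S: "S \<in> words K J d" for S
    proof -
      have "coef F S = expectation (\<lambda>w. ev J d f w * xi S w)"
        unfolding coef_def
      proof (rule integral_cong_AE)
        have [measurable]: "xi S \<in> borel_measurable M" "F \<in> borel_measurable M" "ev J d f \<in> borel_measurable M"
          using xi_moments[of S J] S ordinary_moments[OF F] ev_moments[of J d f]
          by (auto simp: words_def intro: all_moments_measurable)
        show "(\<lambda>w. F w * xi S w) \<in> borel_measurable M" by measurable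
        show "(\<lambda>w. ev J d f w * xi S w) \<in> borel_measurable M" by measurable
        show "AE w in M. F w * xi S w = ev J d f w * xi S w" using f(2) by eventually_elim simp
      qed
      then show ?thesis using expectation_ev_xi[OF J(1) S] by simp
    qed
    then have "ev J d (coef F) w = ev J d f w" for w by (simp add: ev_def)
    then show ?thesis using f cf by force
  qed
  then show "\<exists>I. finite I \<and> (\<forall>J. finite J --> I \<subseteq> J --> (AE w in M. F w = ev J d (coef F) w))"
    using I by blast
  show "coef F S = 0" if "finite J" "S \<in> words K J d" "wt S > k" for J S
    using *[of "I \<union> J"] I that words_mono[of J "I \<union> J" d d K] by auto
qed

end

subsection \<open>Ultrafilter limits\<close>

locale free_ultrafilter =
  fixes U :: "nat filter"
  assumes U_nontrivial: "U \<noteq> bot"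
    and U_le: "U \<le> sequentially"
    and U_ultra: "\<And>P. eventually P U \<or> eventually (\<lambda>n. \<not> P n) U"

text \<open>Zorn's lemma for proper filters below \<open>sequentially\<close>, ordered so that finer
  filters are larger. The infimum of a chain is proper because an eventual property of it is already
  eventual for one member.\<close>

lemma free_ultrafilter_exists: "\<exists>U. free_ultrafilter U"
proof -
  let ?A = "{F :: nat filter. F \<noteq> bot \<and> F \<le> sequentially}"
  define r where "r = {(F, G). F \<in> ?A \<and> G \<in> ?A \<and> G \<le> F}"
  have field: "Field r = ?A" by (auto simp: r_def Field_def)
  have po: "Partial_order r"
    unfolding partial_order_on_def preorder_on_def refl_on_def antisym_def trans_def
    by (auto simp: field) (auto simp: r_def)
  have "\<exists>m\<in>Field r. \<forall>a\<in>Field r. (m, a) \<in> r --> a = m"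
  proof (rule Zorns_po_lemma[OF po])
    fix C assume C: "C \<in> Chains r"
    have CA: "C \<subseteq> ?A" using C by (auto simp: Chains_def r_def)
    show "\<exists>u\<in>Field r. \<forall>a\<in>C. (a, u) \<in> r"
    proof (cases "C = {}")
      case True
      have "sequentially \<in> ?A" by (simp add: trivial_limit_sequentially[unfolded trivial_limit_def])
      then show ?thesis using True unfolding field by (intro bexI[of _ sequentially]) auto
    next
      case False
      have dir: "\<exists>z\<in>C. z \<le> inf x y" if "x \<in> C" "y \<in> C" for x y
        using C that by (fastforce simp: Chains_def r_def)
      have "Inf C \<noteq> bot"
      proof
        assume "Inf C = bot"
        then have "eventually (\<lambda>_. False) (Inf C)" by simp
        then obtain F where "F \<in> C" "eventually (\<lambda>_. False) F"
          using eventually_Inf_base[OF False dir] by auto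
        then show False using CA by (auto simp: eventually_False)
      qed
      moreover have "Inf C \<le> sequentially"
      proof -
        obtain F where F: "F \<in> C" using False by blast
        have "Inf C \<le> F" using F by (rule Inf_lower)
        also have "F \<le> sequentially" using F CA by blast
        finally show ?thesis .
      qed
      ultimately have "Inf C \<in> ?A" by simp
      moreover have "(a, Inf C) \<in> r" if "a \<in> C" for a
        using subsetD[OF CA that] \<open>Inf C \<in> ?A\<close> Inf_lower[OF that] by (simp add: r_def)
      ultimately show ?thesis unfolding field by (intro bexI[of _ "Inf C"]) auto
    qed
  qed
  then obtain U where U: "U \<in> ?A" and min: "\<And>F. F \<in> ?A ==> F \<le> U ==> F = U"
    unfolding field by (auto simp: r_def)
  have "eventually P U \<or> eventually (\<lambda>n. \<not> P n) U" for P
  proof (rule ccontr)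
    assume neg: "\<not> ?thesis"
    \<comment> \<open>If neither \<open>P\<close> nor its negation is eventual, adjoining the set
      where \<open>P\<close> holds gives a strictly finer proper filter, against minimality.\<close>
    let ?F = "inf U (principal {n. P n})"
    have "?F \<noteq> bot"
    proof
      assume "?F = bot"
      then have "eventually (\<lambda>_. False) ?F" by simp
      then have "eventually (\<lambda>n. \<not> P n) U" by (simp add: eventually_inf_principal)
      then show False using neg by simp
    qed
    moreover have "?F \<le> sequentially" using U by (intro le_infI1) simp
    ultimately have "?F = U" by (intro min) auto
    moreover have "eventually P ?F" by (simp add: eventually_inf_principal)
    ultimately show False using neg by simp
  qed
  then have "free_ultrafilter U" using U by (intro free_ultrafilter.intro) auto
  then show ?thesis ..
qed

context free_ultrafilter
begin

lemma not_eventually_U: "\<not> eventually P U \<longleftrightarrow> eventually (\<lambda>n. \<not> P n) U"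
  using U_ultra[of P] U_nontrivial eventually_conj[of P U "\<lambda>n. \<not> P n"]
  by (auto simp: eventually_False)

lemma eventually_U_ex: "eventually P U ==> \<exists>n. P n"
  using eventually_happens U_nontrivial by blast

lemma U_sequentially: "eventually P sequentially ==> eventually P U"
  using U_le by (simp add: le_filter_def)

lemma U_tendsto: "f \<longlonglongrightarrow> l ==> (f \<longlongrightarrow> l) U"
  using tendsto_mono[OF U_le] .

lemma U_converges:
  fixes f :: "nat => real"
  assumes "\<And>n. \<bar>f n\<bar> \<le> C"
  shows "(f \<longlongrightarrow> Lim U f) U"
proof -
  define A where "A = {x. eventually (\<lambda>n. x \<le> f n) U}"
  have low: "- C \<in> A" unfolding A_def using assms by (auto intro!: always_eventually simp: abs_le_iff minus_le_iff)
  have up: "x \<le> C" if xA: "x \<in> A" for x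
  proof -
    obtain n where "x \<le> f n" using xA eventually_U_ex[of "\<lambda>n. x \<le> f n"] by (auto simp: A_def)
    then show ?thesis using assms[of n] by linarith
  qed
  have bdd: "bdd_above A" by (rule bdd_aboveI[of A C]) (rule up)
  have "(f \<longlongrightarrow> Sup A) U"
  proof (rule order_tendstoI)
    fix a assume "a < Sup A"
    then obtain x where "x \<in> A" "a < x" using less_cSup_iff[of A a] low bdd by auto
    then show "eventually (\<lambda>n. a < f n) U" by (auto simp: A_def elim!: eventually_mono)
  next
    fix a assume "Sup A < a"
    then have "a \<notin> A" using cSup_upper[OF _ bdd] by fastforce
    then have "\<not> eventually (\<lambda>n. a \<le> f n) U" by (simp add: A_def)
    then show "eventually (\<lambda>n. f n < a) U" unfolding not_eventually_U by (simp add: not_le)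
  qed
  then show ?thesis using tendsto_Lim[OF U_nontrivial] by metis
qed

lemma Lim_eqI: "(f \<longlongrightarrow> l) U ==> Lim U f = l" for f :: "nat => real"
  using tendsto_Lim[OF U_nontrivial] .

end

subsection \<open>Bounded sequences of polynomials\<close>

context iid
begin

lemma fourth_moment_ordinary:
  assumes F: "F \<in> ordinary_polynomials X k" and "k \<le> d"
  shows "expectation (\<lambda>w. F w ^ 4) \<le> hyper ^ d * (expectation (\<lambda>w. (F w)^2))^2"
proof -
  obtain I where fin: "finite I"
    and rep: "\<forall>J. finite J --> I \<subseteq> J --> (AE w in M. F w = ev J d (coef F) w)"
    using ordinary_polynomial_words(1)[OF assms] by blast
  note I = fin rep[rule_format, OF fin order_refl]
  have [measurable]: "F \<in> borel_measurable M" "ev I d (coef F) \<in> borel_measurable M"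
    using ordinary_moments[OF F] ev_moments[of I d] by (auto intro: all_moments_measurable)
  have "expectation (\<lambda>w. F w ^ n) = expectation (\<lambda>w. ev I d (coef F) w ^ n)" for n
  proof (rule integral_cong_AE)
    show "AE w in M. F w ^ n = ev I d (coef F) w ^ n" using I(2) by eventually_elim simp
  qed measurable
  then show ?thesis
    using fourth_moment_le[OF I(1), of d "coef F"] expectation_ev_square[OF I(1), of d "coef F"] by simp
qed

text \<open>Cauchy-Schwarz and hypercontractivity: products are controlled by the second moments of
  the factors alone, as if one of them were bounded.\<close>

lemma expectation_product_square_le:
  assumes A: "A \<in> ordinary_polynomials X i" "i \<le> d" and Z: "Z \<in> ordinary_polynomials X j" "j \<le> d"
  shows "expectation (\<lambda>w. (A w * Z w)^2) \<le>
    hyper ^ d * (expectation (\<lambda>w. (A w)^2) * expectation (\<lambda>w. (Z w)^2))"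
proof (rule power2_le_imp_le)
  let ?a = "expectation (\<lambda>w. (A w)^2)" and ?b = "expectation (\<lambda>w. (Z w)^2)"
  have ms: "A \<in> all_moments M" "Z \<in> all_moments M"
    using ordinary_moments A Z by auto
  have H: "hyper ^ d \<ge> 0" using hyper_ge_1 by simp
  have "(expectation (\<lambda>w. (A w)^2 * (Z w)^2))^2 \<le> expectation (\<lambda>w. ((A w)^2)^2) * expectation (\<lambda>w. ((Z w)^2)^2)"
    by (intro Cauchy_Schwarz_all_moments all_moments_closed ms)
  also have "... = expectation (\<lambda>w. A w ^ 4) * expectation (\<lambda>w. Z w ^ 4)"
    by (simp add: power_mult[symmetric])
  also have "... \<le> (hyper ^ d * ?a^2) * (hyper ^ d * ?b^2)"
    using H by (intro mult_mono fourth_moment_ordinary[OF A] fourth_moment_ordinary[OF Z]) auto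
  finally show "(expectation (\<lambda>w. (A w * Z w)^2))^2 \<le> (hyper ^ d * (?a * ?b))^2"
    by (simp add: power_mult_distrib power2_eq_square mult_ac)
  show "0 \<le> hyper ^ d * (?a * ?b)" using H by simp
qed

end

section \<open>The limiting inner product and its completeness\<close>

type_synonym 'a rvseq = "nat => 'a => real"

locale iid_ultra = iid M X d + free_ultrafilter U
  for M :: "'a measure" and X d U
begin

abbreviation sq :: "('a => real) => real" where "sq f \<equiv> expectation (\<lambda>w. (f w)^2)"

definition bseq :: "nat => 'a rvseq set" where
  "bseq k = {F. (\<forall>n. F n \<in> ordinary_polynomials X k) \<and> (\<exists>C. \<forall>n. sq (F n) \<le> C)}"

definition ip :: "'a rvseq => 'a rvseq => real" where
  "ip F G = Lim U (\<lambda>n. expectation (\<lambda>w. F n w * G n w))"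

lemma bseq_poly: "F \<in> bseq k ==> F n \<in> ordinary_polynomials X k"
  by (simp add: bseq_def)

lemma bseq_moments: "F \<in> bseq k ==> F n \<in> all_moments M"
  using bseq_poly ordinary_moments by blast

lemma bseq_bound:
  assumes "F \<in> bseq k" obtains C where "C \<ge> 0" "\<And>n. sq (F n) \<le> C"
proof -
  obtain C where C: "\<And>n. sq (F n) \<le> C" using assms by (auto simp: bseq_def)
  have "0 \<le> sq (F 0)" by simp
  then have "C \<ge> 0" using C[of 0] by linarith
  then show thesis using C that by blast
qed

lemma bseqI: "(\<And>n. F n \<in> ordinary_polynomials X k) ==> (\<And>n. sq (F n) \<le> C) ==> F \<in> bseq k"
  by (auto simp: bseq_def)

lemma bseq_mono: "F \<in> bseq k ==> k \<le> l ==> F \<in> bseq l"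
  using ordinary_polynomials_mono[of k l X] by (auto simp: bseq_def)

lemma ip_tendsto:
  assumes F: "F \<in> bseq k" and G: "G \<in> bseq l"
  shows "((\<lambda>n. expectation (\<lambda>w. F n w * G n w)) \<longlongrightarrow> ip F G) U"
proof -
  obtain C where C: "C \<ge> 0" "\<And>n. sq (F n) \<le> C" using bseq_bound[OF F] by blast
  obtain D where D: "D \<ge> 0" "\<And>n. sq (G n) \<le> D" using bseq_bound[OF G] by blast
  have "\<bar>expectation (\<lambda>w. F n w * G n w)\<bar> \<le> sqrt (C * D)" for n
  proof -
    have "(expectation (\<lambda>w. F n w * G n w))^2 \<le> sq (F n) * sq (G n)"
      by (intro Cauchy_Schwarz_all_moments bseq_moments[OF F] bseq_moments[OF G])
    also have "... \<le> C * D" using C D by (intro mult_mono) auto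
    finally show ?thesis by (rule real_le_rsqrt[of "\<bar>_\<bar>", simplified])
  qed
  then show ?thesis unfolding ip_def by (rule U_converges)
qed

lemma ip_eqI:
  "((\<lambda>n. expectation (\<lambda>w. F n w * G n w)) \<longlongrightarrow> l) U ==> ip F G = l"
  unfolding ip_def by (rule Lim_eqI)

lemma sq_tendsto: "F \<in> bseq k ==> ((\<lambda>n. sq (F n)) \<longlongrightarrow> ip F F) U"
  using ip_tendsto[of F k F k] by (simp add: power2_eq_square)

lemma ip_nonneg: "F \<in> bseq k ==> 0 \<le> ip F F"
  using tendsto_lowerbound[OF sq_tendsto _ U_nontrivial, of F k 0] by simp

lemma ip_sym: "ip F G = ip G F"
  by (simp add: ip_def mult.commute)

lemma sq_add_le:
  assumes "f \<in> all_moments M" "g \<in> all_moments M"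
  shows "sq (\<lambda>w. f w + g w) \<le> 2 * sq f + 2 * sq g"
proof -
  have i: "integrable M (\<lambda>w. (f w + g w)^2)" "integrable M (\<lambda>w. (f w)^2)" "integrable M (\<lambda>w. (g w)^2)"
    by (intro all_moments_integrable all_moments_closed assms)+
  have "sq (\<lambda>w. f w + g w) \<le> expectation (\<lambda>w. 2 * (f w)^2 + 2 * (g w)^2)"
  proof (intro integral_mono i Bochner_Integration.integrable_add integrable_mult_right)
    fix w
    have "0 \<le> (f w - g w)^2" by simp
    then show "(f w + g w)^2 \<le> 2 * (f w)^2 + 2 * (g w)^2" by (simp add: power2_sum power2_diff)
  qed
  also have "... = 2 * sq f + 2 * sq g" using i by simp
  finally show ?thesis .
qed

lemma bseq_add:
  assumes F: "F \<in> bseq k" and G: "G \<in> bseq k"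
  shows "(\<lambda>n w. F n w + G n w) \<in> bseq k"
proof -
  obtain C where C: "\<And>n. sq (F n) \<le> C" using bseq_bound[OF F] by blast
  obtain D where D: "\<And>n. sq (G n) \<le> D" using bseq_bound[OF G] by blast
  show ?thesis
  proof (rule bseqI[where C = "2 * C + 2 * D"])
    fix n
    show "(\<lambda>w. F n w + G n w) \<in> ordinary_polynomials X k"
      by (intro ordinary_polynomials_add bseq_poly F G)
    show "sq (\<lambda>w. F n w + G n w) \<le> 2 * C + 2 * D"
      using sq_add_le[OF bseq_moments[OF F] bseq_moments[OF G], of n n] C[of n] D[of n] by linarith
  qed
qed

lemma bseq_scale:
  assumes F: "F \<in> bseq k" shows "(\<lambda>n w. c * F n w) \<in> bseq k"
proof -
  obtain C where C: "\<And>n. sq (F n) \<le> C" using bseq_bound[OF F] by blast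
  show ?thesis
  proof (rule bseqI[where C = "c^2 * C"])
    fix n
    show "(\<lambda>w. c * F n w) \<in> ordinary_polynomials X k"
      by (intro ordinary_polynomials_scale bseq_poly F)
    show "sq (\<lambda>w. c * F n w) \<le> c^2 * C"
      using C[of n] by (simp add: power_mult_distrib mult_left_mono)
  qed
qed

lemma bseq_diff:
  assumes F: "F \<in> bseq k" and G: "G \<in> bseq k"
  shows "(\<lambda>n w. F n w - G n w) \<in> bseq k"
  using bseq_add[OF F bseq_scale[OF G, of "-1"]] by simp

lemma bseq_const: "(\<lambda>n w. c) \<in> bseq k"
  by (rule bseqI[where C = "c^2"]) (auto simp: prob_space intro: ordinary_polynomials_const)

lemma bseq_var: "1 \<le> k ==> (\<lambda>n. X (\<iota> n)) \<in> bseq k"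
proof (rule bseqI[where C = "sq (X 0)"])
  fix n
  show "sq (X (\<iota> n)) \<le> sq (X 0)" using expectation_X[of "\<lambda>x. x^2" "\<iota> n"] by simp
qed (rule ordinary_polynomials_var)

text \<open>The second claim makes multiplication continuous for the seminorm of \<open>ip\<close>;
  this is what lets approximations of two factors be multiplied in
  \<open>approx_mult\<close>.\<close>

lemma bseq_mult:
  assumes A: "A \<in> bseq i" and Z: "Z \<in> bseq j" and "i + j \<le> k" "k \<le> d"
  shows "(\<lambda>n w. A n w * Z n w) \<in> bseq k"
    and "ip (\<lambda>n w. A n w * Z n w) (\<lambda>n w. A n w * Z n w) \<le> hyper ^ d * (ip A A * ip Z Z)"
proof -
  obtain C where C: "C \<ge> 0" "\<And>n. sq (A n) \<le> C" using bseq_bound[OF A] by blast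
  obtain D where D: "D \<ge> 0" "\<And>n. sq (Z n) \<le> D" using bseq_bound[OF Z] by blast
  have H: "hyper ^ d \<ge> 0" using hyper_ge_1 by simp
  have *: "sq (\<lambda>w. A n w * Z n w) \<le> hyper ^ d * (sq (A n) * sq (Z n))" for n
    using assms(3,4) by (intro expectation_product_square_le[OF bseq_poly[OF A] _ bseq_poly[OF Z]]) auto
  show mem: "(\<lambda>n w. A n w * Z n w) \<in> bseq k"
  proof (rule bseqI[where C = "hyper ^ d * (C * D)"])
    fix n
    show "(\<lambda>w. A n w * Z n w) \<in> ordinary_polynomials X k"
      using ordinary_polynomials_mult[OF bseq_poly[OF A] bseq_poly[OF Z], of n n]
        ordinary_polynomials_mono[OF assms(3), of X] by blast
    have "hyper ^ d * (sq (A n) * sq (Z n)) \<le> hyper ^ d * (C * D)"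
      using C D H by (intro mult_left_mono mult_mono) auto
    with * show "sq (\<lambda>w. A n w * Z n w) \<le> hyper ^ d * (C * D)" by (rule order_trans)
  qed
  have lim: "((\<lambda>n. hyper ^ d * (sq (A n) * sq (Z n))) \<longlongrightarrow> hyper ^ d * (ip A A * ip Z Z)) U"
    by (intro tendsto_mult tendsto_const sq_tendsto[OF A] sq_tendsto[OF Z])
  show "ip (\<lambda>n w. A n w * Z n w) (\<lambda>n w. A n w * Z n w) \<le> hyper ^ d * (ip A A * ip Z Z)"
    using tendsto_le[OF U_nontrivial lim sq_tendsto[OF mem]] * by simp
qed

lemma ip_add:
  assumes F: "F \<in> bseq k" and G: "G \<in> bseq k" and H: "H \<in> bseq l"
  shows "ip (\<lambda>n w. F n w + G n w) H = ip F H + ip G H"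
proof (rule ip_eqI)
  have "expectation (\<lambda>w. (F n w + G n w) * H n w) =
      expectation (\<lambda>w. F n w * H n w) + expectation (\<lambda>w. G n w * H n w)" for n
    unfolding distrib_right
    by (intro Bochner_Integration.integral_add all_moments_integrable all_moments_closed
        bseq_moments[OF F] bseq_moments[OF G] bseq_moments[OF H])
  then show "((\<lambda>n. expectation (\<lambda>w. (F n w + G n w) * H n w)) \<longlongrightarrow> ip F H + ip G H) U"
    by (simp only:) (intro tendsto_add ip_tendsto[OF F H] ip_tendsto[OF G H])
qed

lemma ip_scale:
  assumes F: "F \<in> bseq k" and H: "H \<in> bseq l"
  shows "ip (\<lambda>n w. c * F n w) H = c * ip F H"
proof (rule ip_eqI)
  show "((\<lambda>n. expectation (\<lambda>w. c * F n w * H n w)) \<longlongrightarrow> c * ip F H) U"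
    by (simp add: mult.assoc) (intro tendsto_mult tendsto_const ip_tendsto[OF F H])
qed

lemma ip_diff:
  assumes F: "F \<in> bseq k" and G: "G \<in> bseq k" and H: "H \<in> bseq l"
  shows "ip (\<lambda>n w. F n w - G n w) H = ip F H - ip G H"
  using ip_add[OF F bseq_scale[OF G, of "-1"] H] ip_scale[OF G H, of "-1"] by simp

lemma ip_Cauchy_Schwarz:
  assumes F: "F \<in> bseq k" and G: "G \<in> bseq l"
  shows "(ip F G)^2 \<le> ip F F * ip G G"
proof (rule tendsto_le[OF U_nontrivial])
  show "((\<lambda>n. sq (F n) * sq (G n)) \<longlongrightarrow> ip F F * ip G G) U"
    by (intro tendsto_mult sq_tendsto[OF F] sq_tendsto[OF G])
  show "((\<lambda>n. (expectation (\<lambda>w. F n w * G n w))^2) \<longlongrightarrow> (ip F G)^2) U"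
    by (intro tendsto_power ip_tendsto[OF F G])
  show "\<forall>\<^sub>F n in U. (expectation (\<lambda>w. F n w * G n w))^2 \<le> sq (F n) * sq (G n)"
    by (intro always_eventually allI Cauchy_Schwarz_all_moments bseq_moments[OF F] bseq_moments[OF G])
qed

lemma ip_square_add_le:
  assumes F: "F \<in> bseq k" and G: "G \<in> bseq k"
  shows "ip (\<lambda>n w. F n w + G n w) (\<lambda>n w. F n w + G n w) \<le> 2 * ip F F + 2 * ip G G"
proof (rule tendsto_le[OF U_nontrivial])
  show "((\<lambda>n. 2 * sq (F n) + 2 * sq (G n)) \<longlongrightarrow> 2 * ip F F + 2 * ip G G) U"
    by (intro tendsto_intros sq_tendsto[OF F] sq_tendsto[OF G])
  show "((\<lambda>n. sq (\<lambda>w. F n w + G n w)) \<longlongrightarrow> ip (\<lambda>n w. F n w + G n w) (\<lambda>n w. F n w + G n w)) U"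
    by (rule sq_tendsto[OF bseq_add[OF F G]])
  show "\<forall>\<^sub>F n in U. sq (\<lambda>w. F n w + G n w) \<le> 2 * sq (F n) + 2 * sq (G n)"
    by (intro always_eventually allI sq_add_le bseq_moments[OF F] bseq_moments[OF G])
qed

text \<open>Countable saturation of the ultraproduct: the diagonal sequence is a limit in the seminorm of \<open>ip\<close>.\<close>

lemma saturation:
  assumes w: "\<And>i. w i \<in> bseq k"
    and cauchy: "\<And>i j. ip (\<lambda>n u. w i n u - w j n u) (\<lambda>n u. w i n u - w j n u)
        \<le> 2 / real (Suc i) + 2 / real (Suc j)"
  obtains v where "v \<in> bseq k"
    and "\<And>i. ip (\<lambda>n u. w i n u - v n u) (\<lambda>n u. w i n u - v n u) \<le> 6 / real (Suc i)"
proof -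
  define E where "E i j n = sq (\<lambda>u. w i n u - w j n u)" for i j n
  \<comment> \<open>The constant 3, against 2 in the hypothesis, leaves the slack by which a bound
    on the limit becomes a bound for U-many n.\<close>
  define good where "good J n \<longleftrightarrow> (\<forall>i\<le>J. \<forall>j\<le>J. E i j n \<le> 3 / real (Suc i) + 3 / real (Suc j))" for J n
  have ev_good: "eventually (good J) U" for J
  proof -
    have "eventually (\<lambda>n. E i j n < 3 / real (Suc i) + 3 / real (Suc j)) U" for i j
    proof (rule order_tendstoD)
      show "((\<lambda>n. E i j n) \<longlongrightarrow> ip (\<lambda>n u. w i n u - w j n u) (\<lambda>n u. w i n u - w j n u)) U"
        unfolding E_def by (rule sq_tendsto[OF bseq_diff[OF w w]])
      have "2 / real (Suc i) + 2 / real (Suc j) < 3 / real (Suc i) + 3 / real (Suc j)"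
        by (intro add_strict_mono divide_strict_right_mono) auto
      then show "ip (\<lambda>n u. w i n u - w j n u) (\<lambda>n u. w i n u - w j n u) < 3 / real (Suc i) + 3 / real (Suc j)"
        using cauchy[of i j] by linarith
    qed
    then have "eventually (\<lambda>n. \<forall>i\<in>{..J}. \<forall>j\<in>{..J}. E i j n < 3 / real (Suc i) + 3 / real (Suc j)) U"
      by (intro eventually_ball_finite finite_atMost ballI)
    then show ?thesis by eventually_elim (auto simp: good_def intro: less_imp_le)
  qed
  define A where "A n = {J. J \<le> n \<and> (J = 0 \<or> good J n)}" for n
  define jn where "jn n = Max (A n)" for n
  have A: "finite (A n)" "0 \<in> A n" for n by (auto simp: A_def)
  have jn: "jn n \<in> A n" for n unfolding jn_def using A[of n] by (intro Max_in) auto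
  have jn_ge: "J \<le> jn n" if "J \<in> A n" for J n unfolding jn_def using A[of n] that by (intro Max_ge) auto
  define v where "v n = w (jn n) n" for n
  have key: "sq (\<lambda>u. w i n u - v n u) \<le> 6 / real (Suc i)" if "i = 0 \<or> good i n" "i \<le> n" for i n
  proof -
    have "i \<in> A n" using that by (simp add: A_def)
    then have ij: "i \<le> jn n" by (rule jn_ge)
    show ?thesis
    proof (cases "jn n = 0")
      case True
      then show ?thesis using ij by (simp add: v_def)
    next
      case False
      then have "good (jn n) n" using jn[of n] by (simp add: A_def)
      then have "E i (jn n) n \<le> 3 / real (Suc i) + 3 / real (Suc (jn n))" using ij by (simp add: good_def)
      also have "3 / real (Suc (jn n)) \<le> 3 / real (Suc i)" using ij by (intro divide_left_mono) auto
      finally show ?thesis by (simp add: E_def v_def)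
    qed
  qed
  show thesis
  proof
    obtain C where C: "\<And>n. sq (w 0 n) \<le> C" using bseq_bound[OF w] by blast
    show vb: "v \<in> bseq k"
    proof (rule bseqI[where C = "2 * C + 12"])
      fix n
      show "v n \<in> ordinary_polynomials X k" unfolding v_def by (rule bseq_poly[OF w])
      have "sq (v n) = sq (\<lambda>u. w 0 n u + (-1) * (w 0 n u - v n u))" by simp
      also have "... \<le> 2 * sq (w 0 n) + 2 * sq (\<lambda>u. (-1) * (w 0 n u - v n u))"
        unfolding v_def by (intro sq_add_le all_moments_closed bseq_moments[OF w])
      also have "sq (\<lambda>u. (-1) * (w 0 n u - v n u)) = sq (\<lambda>u. w 0 n u - v n u)"
        by (simp add: power2_commute)
      finally show "sq (v n) \<le> 2 * C + 12" using C[of n] key[of 0 n] by simp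
    qed
    fix i
    have "eventually (\<lambda>n. n \<ge> i) U" by (intro U_sequentially eventually_ge_at_top)
    then have "eventually (\<lambda>n. sq (\<lambda>u. w i n u - v n u) \<le> 6 / real (Suc i)) U"
      using ev_good[of i] by eventually_elim (rule key, auto)
    then show "ip (\<lambda>n u. w i n u - v n u) (\<lambda>n u. w i n u - v n u) \<le> 6 / real (Suc i)"
      using tendsto_upperbound[OF sq_tendsto[OF bseq_diff[OF w vb]] _ U_nontrivial] by simp
  qed
qed

lemma quadratic_nonneg_imp:
  fixes a b c :: real
  assumes "\<And>t. 0 \<le> a - 2 * t * b + t^2 * c" "c \<ge> 0"
  shows "b^2 \<le> a * c"
proof (cases "c = 0")
  case True
  have "b = 0"
  proof (rule ccontr)
    assume "b \<noteq> 0"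
    have "0 \<le> a" using assms(1)[of 0] by simp
    moreover have "0 \<le> a - 2 * ((a + 1) / b) * b + ((a + 1) / b)^2 * c" by (rule assms)
    ultimately show False using True \<open>b \<noteq> 0\<close> by simp
  qed
  then show ?thesis using True by simp
next
  case False
  then have c: "c > 0" using assms(2) by simp
  have "0 \<le> a - 2 * (b / c) * b + (b / c)^2 * c" by (rule assms)
  also have "... = (a * c - b^2) / c" using c by (simp add: field_simps power2_eq_square)
  finally show ?thesis using c by (simp add: zero_le_divide_iff)
qed

text \<open>\<open>W\<close> need not be closed, so the nearest point is found in
  \<open>bseq k\<close>: a minimizing sequence in \<open>W\<close> is Cauchy by the parallelogram
  law, and \<open>saturation\<close> supplies its limit. Hence \<open>F - g\<close> is only
  approximated by elements of \<open>W\<close>.\<close>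

lemma projection:
  assumes F: "F \<in> bseq k" and W: "W \<subseteq> bseq k" "(\<lambda>n \<omega>. 0) \<in> W"
    and W_add: "\<And>u v. u \<in> W ==> v \<in> W ==> (\<lambda>n \<omega>. u n \<omega> + v n \<omega>) \<in> W"
    and W_scale: "\<And>u c. u \<in> W ==> (\<lambda>n \<omega>. c * u n \<omega>) \<in> W"
  obtains g where "g \<in> bseq k" "\<And>w. w \<in> W ==> ip g w = 0"
    and "\<And>e. e > 0 ==> \<exists>w\<in>W. ip (\<lambda>n \<omega>. F n \<omega> - g n \<omega> - w n \<omega>) (\<lambda>n \<omega>. F n \<omega> - g n \<omega> - w n \<omega>) < e"
proof -
  define q where "q u = ip (\<lambda>n \<omega>. F n \<omega> - u n \<omega>) (\<lambda>n \<omega>. F n \<omega> - u n \<omega>)" for u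
  have Wb: "u \<in> W ==> u \<in> bseq k" for u using W(1) by blast
  define \<delta> where "\<delta> = Inf (q ` W)"
  have q0: "q u \<ge> 0" if "u \<in> W" for u
    unfolding q_def by (rule ip_nonneg[OF bseq_diff[OF F Wb[OF that]]])
  have bdd: "bdd_below (q ` W)" using q0 by (intro bdd_belowI[of _ 0]) auto
  have qd: "\<delta> \<le> q u" if "u \<in> W" for u
    unfolding \<delta>_def using that by (intro cInf_lower bdd) auto
  have "\<exists>u\<in>W. q u < \<delta> + 1 / real (Suc j)" for j
    using cInf_lessD[of "q ` W" "\<delta> + 1 / real (Suc j)"] W(2) by (auto simp: \<delta>_def)
  then obtain w where w: "\<And>j. w j \<in> W" "\<And>j. q (w j) < \<delta> + 1 / real (Suc j)" by metis
  define a where "a j = (\<lambda>n \<omega>. F n \<omega> - w j n \<omega>)" for j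
  have ab: "a j \<in> bseq k" for j unfolding a_def by (intro bseq_diff F Wb w)
  have qa: "q (w j) = ip (a j) (a j)" for j by (simp add: q_def a_def)
  \<comment> \<open>Minimality of \<open>w j\<close> up to \<open>1 / Suc j\<close> gives
    orthogonality up to an explicit defect, read off from the discriminant of a quadratic in
    t.\<close>
  have orth: "(ip (a j) u)^2 \<le> 1 / real (Suc j) * ip u u" if u: "u \<in> W" for j u
  proof (rule quadratic_nonneg_imp)
    fix t :: real
    have ub: "u \<in> bseq k" using Wb u .
    have tu: "(\<lambda>n \<omega>. t * u n \<omega>) \<in> bseq k" by (rule bseq_scale[OF ub])
    have "\<delta> \<le> q (\<lambda>n \<omega>. w j n \<omega> + t * u n \<omega>)" by (intro qd W_add W_scale w u)
    also have "... = ip (\<lambda>n \<omega>. a j n \<omega> - t * u n \<omega>) (\<lambda>n \<omega>. a j n \<omega> - t * u n \<omega>)"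
      by (simp add: q_def a_def diff_diff_eq)
    also have "... = ip (a j) (\<lambda>n \<omega>. a j n \<omega> - t * u n \<omega>) - ip (\<lambda>n \<omega>. t * u n \<omega>) (\<lambda>n \<omega>. a j n \<omega> - t * u n \<omega>)"
      by (rule ip_diff[OF ab tu bseq_diff[OF ab tu]])
    also have "ip (a j) (\<lambda>n \<omega>. a j n \<omega> - t * u n \<omega>) = ip (a j) (a j) - t * ip (a j) u"
      by (subst ip_sym, subst ip_diff[OF ab tu ab], subst ip_scale[OF ub ab]) (simp add: ip_sym)
    also have "ip (\<lambda>n \<omega>. t * u n \<omega>) (\<lambda>n \<omega>. a j n \<omega> - t * u n \<omega>) = t * (ip (a j) u - t * ip u u)"
      by (subst ip_scale[OF ub bseq_diff[OF ab tu]], subst ip_sym, subst ip_diff[OF ab tu ub], subst ip_scale[OF ub ub]) simp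
    finally show "0 \<le> 1 / real (Suc j) - 2 * t * ip (a j) u + t^2 * ip u u"
      using w(2)[of j] by (simp add: qa power2_eq_square algebra_simps)
  qed (use ip_nonneg Wb u in blast)
  have cauchy: "ip (\<lambda>n \<omega>. w i n \<omega> - w j n \<omega>) (\<lambda>n \<omega>. w i n \<omega> - w j n \<omega>) \<le> 2 / real (Suc i) + 2 / real (Suc j)" for i j
  proof -
    \<comment> \<open>The midpoint of \<open>w i\<close> and \<open>w j\<close> stays in
      \<open>W\<close>; the parallelogram law then yields exactly the rate that
      \<open>saturation\<close> asks for.\<close>
    have m: "(\<lambda>n \<omega>. (1/2) * (w i n \<omega> + w j n \<omega>)) \<in> W" by (intro W_add W_scale w)
    have sum: "(\<lambda>n \<omega>. a i n \<omega> + a j n \<omega>) \<in> bseq k" and dif: "(\<lambda>n \<omega>. a j n \<omega> - a i n \<omega>) \<in> bseq k"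
      by (intro bseq_add bseq_diff ab)+
    have "4 * \<delta> \<le> 4 * q (\<lambda>n \<omega>. (1/2) * (w i n \<omega> + w j n \<omega>))" using qd[OF m] by simp
    also have "... = ip (\<lambda>n \<omega>. a i n \<omega> + a j n \<omega>) (\<lambda>n \<omega>. a i n \<omega> + a j n \<omega>)"
    proof -
      have hb: "(\<lambda>n \<omega>. (1/2) * (a i n \<omega> + a j n \<omega>)) \<in> bseq k" by (rule bseq_scale[OF sum])
      have eq: "(\<lambda>n \<omega>. F n \<omega> - (1/2) * (w i n \<omega> + w j n \<omega>)) = (\<lambda>n \<omega>. (1/2) * (a i n \<omega> + a j n \<omega>))"
        by (simp add: a_def fun_eq_iff field_simps)
      show ?thesis unfolding q_def eq
        by (subst ip_scale[OF sum hb], subst ip_sym, subst ip_scale[OF sum sum]) simp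
    qed
    also have "... = ip (a i) (a i) + 2 * ip (a i) (a j) + ip (a j) (a j)"
      by (subst ip_add[OF ab ab sum], subst (1 2) ip_sym, subst (1 2) ip_add[OF ab ab ab]) (simp add: ip_sym)
    finally have "4 * \<delta> \<le> ip (a i) (a i) + 2 * ip (a i) (a j) + ip (a j) (a j)" .
    moreover have dd: "ip (\<lambda>n \<omega>. a j n \<omega> - a i n \<omega>) (\<lambda>n \<omega>. a j n \<omega> - a i n \<omega>) = ip (a i) (a i) - 2 * ip (a i) (a j) + ip (a j) (a j)"
      by (subst ip_diff[OF ab ab dif], subst (1 2) ip_sym, subst (1 2) ip_diff[OF ab ab ab]) (simp add: ip_sym)
    moreover have "(\<lambda>n \<omega>. a j n \<omega> - a i n \<omega>) = (\<lambda>n \<omega>. w i n \<omega> - w j n \<omega>)" by (simp add: a_def)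
    note dd[unfolded this]
    moreover have "2 / real (Suc i) = 2 * (1 / real (Suc i))" "2 / real (Suc j) = 2 * (1 / real (Suc j))"
      by simp_all
    ultimately show ?thesis using w(2)[of i] w(2)[of j] unfolding qa by linarith
  qed
  obtain v where v: "v \<in> bseq k"
    "\<And>i. ip (\<lambda>n \<omega>. w i n \<omega> - v n \<omega>) (\<lambda>n \<omega>. w i n \<omega> - v n \<omega>) \<le> 6 / real (Suc i)"
    using saturation[OF Wb[OF w(1)] cauchy] by blast
  show thesis
  proof (rule that[of "\<lambda>n \<omega>. F n \<omega> - v n \<omega>"])
    show gb: "(\<lambda>n \<omega>. F n \<omega> - v n \<omega>) \<in> bseq k" by (intro bseq_diff F v)
    show "ip (\<lambda>n \<omega>. F n \<omega> - v n \<omega>) u = 0" if u: "u \<in> W" for u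
    proof -
      have ub: "u \<in> bseq k" using Wb u .
      have "\<bar>ip (\<lambda>n \<omega>. F n \<omega> - v n \<omega>) u\<bar> \<le> sqrt (1 / real (Suc i) * ip u u) + sqrt (6 / real (Suc i) * ip u u)" for i
      proof -
        have wv: "(\<lambda>n \<omega>. w i n \<omega> - v n \<omega>) \<in> bseq k" by (intro bseq_diff Wb w v)
        have "(\<lambda>n \<omega>. F n \<omega> - v n \<omega>) = (\<lambda>n \<omega>. a i n \<omega> + (w i n \<omega> - v n \<omega>))" by (simp add: a_def)
        then have "ip (\<lambda>n \<omega>. F n \<omega> - v n \<omega>) u = ip (a i) u + ip (\<lambda>n \<omega>. w i n \<omega> - v n \<omega>) u"
          using ip_add[OF ab wv ub] by simp
        moreover have "\<bar>ip (a i) u\<bar> \<le> sqrt (1 / real (Suc i) * ip u u)"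
          using orth[OF u, of i] by (intro real_le_rsqrt) simp
        moreover have "(ip (\<lambda>n \<omega>. w i n \<omega> - v n \<omega>) u)^2 \<le> 6 / real (Suc i) * ip u u"
          using ip_Cauchy_Schwarz[OF wv ub] mult_right_mono[OF v(2)[of i] ip_nonneg[OF ub]] by linarith
        then have "\<bar>ip (\<lambda>n \<omega>. w i n \<omega> - v n \<omega>) u\<bar> \<le> sqrt (6 / real (Suc i) * ip u u)"
          by (intro real_le_rsqrt) simp
        ultimately show ?thesis by linarith
      qed
      moreover have "(\<lambda>i. sqrt (1 / real (Suc i) * ip u u) + sqrt (6 / real (Suc i) * ip u u)) \<longlonglongrightarrow> sqrt (0 * ip u u) + sqrt (0 * ip u u)"
        by (intro tendsto_intros LIMSEQ_Suc[OF lim_const_over_n])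
      ultimately have "\<bar>ip (\<lambda>n \<omega>. F n \<omega> - v n \<omega>) u\<bar> \<le> 0"
        using LIMSEQ_le_const by fastforce
      then show ?thesis by simp
    qed
    fix e :: real assume "e > 0"
    then obtain i where i: "6 / e < real i" using reals_Archimedean2 by blast
    have "6 / real (Suc i) < e" using i \<open>e > 0\<close> by (simp add: field_simps)
    moreover have "ip (\<lambda>n \<omega>. v n \<omega> - w i n \<omega>) (\<lambda>n \<omega>. v n \<omega> - w i n \<omega>) = ip (\<lambda>n \<omega>. w i n \<omega> - v n \<omega>) (\<lambda>n \<omega>. w i n \<omega> - v n \<omega>)"
      by (simp add: ip_def algebra_simps)
    moreover have "(\<lambda>n \<omega>. F n \<omega> - (F n \<omega> - v n \<omega>) - w i n \<omega>) = (\<lambda>n \<omega>. v n \<omega> - w i n \<omega>)" by simp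
    ultimately show "\<exists>w\<in>W. ip (\<lambda>n \<omega>. F n \<omega> - (F n \<omega> - v n \<omega>) - w n \<omega>) (\<lambda>n \<omega>. F n \<omega> - (F n \<omega> - v n \<omega>) - w n \<omega>) < e"
      using v(2)[of i] w(1)[of i] by (intro bexI[of _ "w i"]) auto
  qed
qed

end

subsection \<open>New elements and the structure of bounded sequences\<close>

inductive_set lin_span :: "'a rvseq set => 'a rvseq set" for T :: "'a rvseq set" where
  zero: "(\<lambda>n w. 0) \<in> lin_span T"
| base: "t \<in> T ==> t \<in> lin_span T"
| add: "u \<in> lin_span T ==> v \<in> lin_span T ==> (\<lambda>n w. u n w + v n w) \<in> lin_span T"
| scale: "u \<in> lin_span T ==> (\<lambda>n w. c * u n w) \<in> lin_span T"

text \<open>Pairs of a degree bound and a sequence, because a sequence of functions does not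
  determine its degree. An element of \<open>GN\<close> enters with its own degree j, although its
  limit will be a linear form in Gaussians.\<close>

inductive_set alg :: "(nat => 'a => real) => (nat => nat) set => (nat \<times> 'a rvseq) set => (nat \<times> 'a rvseq) set"
  for X :: "nat => 'a => real" and GI :: "(nat => nat) set" and GN :: "(nat \<times> 'a rvseq) set" where
  const: "(k, \<lambda>n w. c) \<in> alg X GI GN"
| var: "\<iota> \<in> GI ==> 1 \<le> k ==> (k, \<lambda>n. X (\<iota> n)) \<in> alg X GI GN"
| new: "(j, g) \<in> GN ==> 1 \<le> j ==> j \<le> k ==> (k, g) \<in> alg X GI GN"
| add: "(k, F) \<in> alg X GI GN ==> (k, G) \<in> alg X GI GN ==> (k, \<lambda>n w. F n w + G n w) \<in> alg X GI GN"
| mult: "(i, F) \<in> alg X GI GN ==> (j, G) \<in> alg X GI GN ==> i + j \<le> k ==>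
    (k, \<lambda>n w. F n w * G n w) \<in> alg X GI GN"

lemma alg_mono: "(k, F) \<in> alg X GI GN ==> GI \<subseteq> GI' ==> GN \<subseteq> GN' ==> (k, F) \<in> alg X GI' GN'"
  by (induction k F rule: alg.induct) (auto intro: alg.intros)

text \<open>Each element of the algebra is a finite expression. A sequence of approximations
  therefore involves only countably many generators, which can be enumerated by the
  naturals.\<close>

lemma alg_finite_generators:
  "(k, F) \<in> alg X GI GN ==>
    \<exists>GI' GN'. finite GI' \<and> finite GN' \<and> GI' \<subseteq> GI \<and> GN' \<subseteq> GN \<and> (k, F) \<in> alg X GI' GN'"
proof (induction k F rule: alg.induct)
  case (const k c)
  show ?case by (intro exI[of _ "{}"]) (auto intro: alg.const)
next
  case (var \<iota> k)
  then show ?case by (intro exI[of _ "{\<iota>}"] exI[of _ "{}"]) (auto intro: alg.var)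
next
  case (new j g k)
  then show ?case by (intro exI[of _ "{}"] exI[of _ "{(j, g)}"]) (auto intro: alg.new)
next
  case (add k F G)
  obtain A1 B1 A2 B2 where *: "finite A1" "finite B1" "A1 \<subseteq> GI" "B1 \<subseteq> GN" "(k, F) \<in> alg X A1 B1"
    "finite A2" "finite B2" "A2 \<subseteq> GI" "B2 \<subseteq> GN" "(k, G) \<in> alg X A2 B2"
    using add.IH by (elim exE conjE)
  have "(k, F) \<in> alg X (A1 \<union> A2) (B1 \<union> B2)" "(k, G) \<in> alg X (A1 \<union> A2) (B1 \<union> B2)"
    using * by (auto intro: alg_mono)
  then have "(k, \<lambda>n w. F n w + G n w) \<in> alg X (A1 \<union> A2) (B1 \<union> B2)" by (rule alg.add)
  then show ?case using * by (intro exI[of _ "A1 \<union> A2"] exI[of _ "B1 \<union> B2"]) auto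
next
  case (mult i F j G k)
  obtain A1 B1 A2 B2 where *: "finite A1" "finite B1" "A1 \<subseteq> GI" "B1 \<subseteq> GN" "(i, F) \<in> alg X A1 B1"
    "finite A2" "finite B2" "A2 \<subseteq> GI" "B2 \<subseteq> GN" "(j, G) \<in> alg X A2 B2"
    using mult.IH by (elim exE conjE)
  have "(i, F) \<in> alg X (A1 \<union> A2) (B1 \<union> B2)" "(j, G) \<in> alg X (A1 \<union> A2) (B1 \<union> B2)"
    using * by (auto intro: alg_mono)
  then have "(k, \<lambda>n w. F n w * G n w) \<in> alg X (A1 \<union> A2) (B1 \<union> B2)"
    using mult.hyps(3) by (rule alg.mult)
  then show ?case using * by (intro exI[of _ "A1 \<union> A2"] exI[of _ "B1 \<union> B2"]) auto
qed

lemma ordinary_polynomials_0: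
  assumes "f \<in> ordinary_polynomials Y 0" shows "\<exists>c. f = (\<lambda>w. c)"
proof -
  obtain p where p: "f = (\<lambda>w. eval_mpoly p (\<lambda>i. Y i w))" "total_degree_le p 0"
    using assms by (auto simp: ordinary_polynomials_def)
  have empty: "Poly_Mapping.keys m = {}" if "m \<in> Poly_Mapping.keys p" for m
  proof (rule equals0I)
    fix i assume i: "i \<in> Poly_Mapping.keys m"
    have "monom_degree m = 0" using p(2) that by (auto simp: total_degree_le_def)
    then have "Poly_Mapping.lookup m i = 0" using i by (simp add: monom_degree_def)
    then show False using i by (simp add: in_keys_iff)
  qed
  have "f = (\<lambda>w. \<Sum>m\<in>Poly_Mapping.keys p. Poly_Mapping.lookup p m)"
    unfolding p(1) eval_mpoly_def by (intro ext sum.cong refl) (simp only: empty prod.empty mult_1_right)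
  then show ?thesis by blast
qed

context iid_ultra
begin

text \<open>Both factors must have degree below k, which excludes trivial factorizations of
  \<open>g\<close> itself; degree 0 is allowed for one of them, so the choice of a constant factor
  covers all sequences of lower degree. At \<open>k = 1\<close> the last clause expels the single
  variables, which keep their own law in the limit.\<close>

definition New :: "nat => 'a rvseq set" where
  "New k = {g \<in> bseq k. (\<forall>i j A C. A \<in> bseq i --> C \<in> bseq j --> i + j \<le> k --> i < k --> j < k -->
      ip g (\<lambda>n w. A n w * C n w) = 0) \<and> (\<forall>\<iota>. ip g (\<lambda>n. X (\<iota> n)) = 0)}"

lemma New_bseq: "g \<in> New k ==> g \<in> bseq k"
  by (simp add: New_def)

lemma New_mult:
  "g \<in> New k ==> A \<in> bseq i ==> C \<in> bseq j ==> i + j \<le> k ==> i < k ==> j < k ==>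
    ip g (\<lambda>n w. A n w * C n w) = 0"
  unfolding New_def by blast

lemma New_var: "g \<in> New k ==> ip g (\<lambda>n. X (\<iota> n)) = 0"
  by (simp add: New_def)

lemma New_lower: "g \<in> New k ==> A \<in> bseq i ==> i < k ==> ip g A = 0"
  using New_mult[of g k A i "\<lambda>n w. 1" 0] bseq_const[of 1 0] by simp

abbreviation New_all :: "(nat \<times> 'a rvseq) set" where "New_all \<equiv> {(k, g). g \<in> New k}"

lemma alg_bseq: "(k, F) \<in> alg X GI New_all ==> k \<le> d ==> F \<in> bseq k"
proof (induction k F rule: alg.induct)
  case (new j g k)
  then show ?case using New_bseq[of g j] bseq_mono[of g j k] by simp
next
  case (mult i F j G k)
  then show ?case by (intro bseq_mult(1)[of F i G j]) simp_all
qed (simp_all add: bseq_const bseq_var bseq_add)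

definition approx :: "nat => 'a rvseq set" where
  "approx k = {F \<in> bseq k. \<forall>e>0. \<exists>A. (k, A) \<in> alg X UNIV New_all \<and>
     ip (\<lambda>n w. F n w - A n w) (\<lambda>n w. F n w - A n w) < e}"

lemma approxE:
  assumes "F \<in> approx k" "e > 0" "k \<le> d"
  obtains A where "(k, A) \<in> alg X UNIV New_all" "A \<in> bseq k"
    "ip (\<lambda>n w. F n w - A n w) (\<lambda>n w. F n w - A n w) < e"
proof -
  obtain A where "(k, A) \<in> alg X UNIV New_all" "ip (\<lambda>n w. F n w - A n w) (\<lambda>n w. F n w - A n w) < e"
    using assms unfolding approx_def by blast
  then show thesis using that[of A] alg_bseq[of k A UNIV] assms(3) by simp
qed

lemma approx_bseq: "F \<in> approx k ==> F \<in> bseq k"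
  by (simp add: approx_def)

lemma alg_approx:
  assumes "(k, F) \<in> alg X UNIV New_all" "k \<le> d" shows "F \<in> approx k"
proof -
  have "ip (\<lambda>n w. F n w - F n w) (\<lambda>n w. F n w - F n w) = 0"
    by (rule ip_eqI) simp
  then show ?thesis unfolding approx_def using alg_bseq[OF assms] assms(1) by force
qed

lemma approx_closed:
  assumes "F \<in> bseq k" "k \<le> d"
    and "\<And>e. e > 0 ==> \<exists>G\<in>approx k. ip (\<lambda>n w. F n w - G n w) (\<lambda>n w. F n w - G n w) < e"
  shows "F \<in> approx k"
  unfolding approx_def
proof (intro CollectI conjI allI impI assms(1))
  fix e :: real assume "e > 0"
  then obtain G where G: "G \<in> approx k" "ip (\<lambda>n w. F n w - G n w) (\<lambda>n w. F n w - G n w) < e / 4"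
    using assms(3)[of "e / 4"] by auto
  obtain A where A: "(k, A) \<in> alg X UNIV New_all" "A \<in> bseq k"
    "ip (\<lambda>n w. G n w - A n w) (\<lambda>n w. G n w - A n w) < e / 4"
    using approxE[OF G(1), of "e / 4"] \<open>e > 0\<close> assms(2) by auto
  have "ip (\<lambda>n w. (F n w - G n w) + (G n w - A n w)) (\<lambda>n w. (F n w - G n w) + (G n w - A n w)) \<le>
    2 * ip (\<lambda>n w. F n w - G n w) (\<lambda>n w. F n w - G n w) + 2 * ip (\<lambda>n w. G n w - A n w) (\<lambda>n w. G n w - A n w)"
    by (rule ip_square_add_le[OF bseq_diff[OF assms(1) approx_bseq[OF G(1)]] bseq_diff[OF approx_bseq[OF G(1)] A(2)]])
  then have "ip (\<lambda>n w. F n w - A n w) (\<lambda>n w. F n w - A n w) < e" using G(2) A(3) by simp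
  then show "\<exists>A. (k, A) \<in> alg X UNIV New_all \<and> ip (\<lambda>n w. F n w - A n w) (\<lambda>n w. F n w - A n w) < e"
    using A(1) by blast
qed

lemma approx_add:
  assumes F: "F \<in> approx k" and G: "G \<in> approx k" and "k \<le> d"
  shows "(\<lambda>n w. F n w + G n w) \<in> approx k"
proof (rule approx_closed[OF bseq_add[OF approx_bseq[OF F] approx_bseq[OF G]] assms(3)])
  fix e :: real assume e: "e > 0"
  obtain A where A: "(k, A) \<in> alg X UNIV New_all" "A \<in> bseq k"
    "ip (\<lambda>n w. F n w - A n w) (\<lambda>n w. F n w - A n w) < e / 4"
    using approxE[OF F, of "e / 4"] e assms(3) by auto
  obtain C where C: "(k, C) \<in> alg X UNIV New_all" "C \<in> bseq k"
    "ip (\<lambda>n w. G n w - C n w) (\<lambda>n w. G n w - C n w) < e / 4"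
    using approxE[OF G, of "e / 4"] e assms(3) by auto
  have "ip (\<lambda>n w. (F n w - A n w) + (G n w - C n w)) (\<lambda>n w. (F n w - A n w) + (G n w - C n w)) \<le>
    2 * ip (\<lambda>n w. F n w - A n w) (\<lambda>n w. F n w - A n w) + 2 * ip (\<lambda>n w. G n w - C n w) (\<lambda>n w. G n w - C n w)"
    by (rule ip_square_add_le[OF bseq_diff[OF approx_bseq[OF F] A(2)] bseq_diff[OF approx_bseq[OF G] C(2)]])
  then have "ip (\<lambda>n w. (F n w + G n w) - (A n w + C n w)) (\<lambda>n w. (F n w + G n w) - (A n w + C n w)) < e"
    using A(3) C(3) by (simp add: algebra_simps)
  moreover have "(\<lambda>n w. A n w + C n w) \<in> approx k"
    by (intro alg_approx alg.add A C assms)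
  ultimately show "\<exists>H\<in>approx k. ip (\<lambda>n w. (F n w + G n w) - H n w) (\<lambda>n w. (F n w + G n w) - H n w) < e"
    by (intro bexI)
qed

lemma approx_mult:
  assumes F: "F \<in> approx i" and G: "G \<in> approx j" and ij: "i + j \<le> k" and k: "k \<le> d"
  shows "(\<lambda>n w. F n w * G n w) \<in> approx k"
proof (rule approx_closed[OF bseq_mult(1)[OF approx_bseq[OF F] approx_bseq[OF G] ij k] k])
  have i: "i \<le> d" and j: "j \<le> d" using ij k by auto
  fix e :: real assume e: "e > 0"
  define q where "q = hyper ^ d"
  have H: "q > 0" using hyper_ge_1 by (simp add: q_def)
  define c where "c = ip G G + 1"
  have c: "c > 0" using ip_nonneg[OF approx_bseq[OF G]] by (simp add: c_def)
  obtain A where A: "(i, A) \<in> alg X UNIV New_all" "A \<in> bseq i"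
    "ip (\<lambda>n w. F n w - A n w) (\<lambda>n w. F n w - A n w) < e / (4 * q * c)"
    using approxE[OF F, of "e / (4 * q * c)"] e i H c by auto
  define c' where "c' = ip A A + 1"
  have c': "c' > 0" using ip_nonneg[OF A(2)] by (simp add: c'_def)
  obtain C where C: "(j, C) \<in> alg X UNIV New_all" "C \<in> bseq j"
    "ip (\<lambda>n w. G n w - C n w) (\<lambda>n w. G n w - C n w) < e / (4 * q * c')"
    using approxE[OF G, of "e / (4 * q * c')"] e j H c' by auto
  have FA: "(\<lambda>n w. F n w - A n w) \<in> bseq i" by (intro bseq_diff approx_bseq F A)
  have GC: "(\<lambda>n w. G n w - C n w) \<in> bseq j" by (intro bseq_diff approx_bseq G C)
  note m1 = bseq_mult[OF FA approx_bseq[OF G] ij k, folded q_def] and m2 = bseq_mult[OF A(2) GC ij k, folded q_def]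
  have "q * (ip (\<lambda>n w. F n w - A n w) (\<lambda>n w. F n w - A n w) * ip G G) \<le> q * (e / (4 * q * c) * c)"
    using A(3) H c e by (intro mult_left_mono mult_mono) (auto simp: c_def ip_nonneg[OF approx_bseq[OF G]])
  also have "... = e / 4" using H c by simp
  finally have b1: "q * (ip (\<lambda>n w. F n w - A n w) (\<lambda>n w. F n w - A n w) * ip G G) \<le> e / 4" .
  have "q * (ip A A * ip (\<lambda>n w. G n w - C n w) (\<lambda>n w. G n w - C n w)) \<le>
      q * (ip A A * (e / (4 * q * c')))"
    using C(3) H ip_nonneg[OF A(2)] by (intro mult_left_mono) auto
  also have "... < q * (c' * (e / (4 * q * c')))"
    using H c' e by (intro mult_strict_left_mono mult_strict_right_mono) (auto simp: c'_def)
  also have "... = e / 4" using H c' by simp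
  finally have b2: "q * (ip A A * ip (\<lambda>n w. G n w - C n w) (\<lambda>n w. G n w - C n w)) < e / 4" .
  have "ip (\<lambda>n w. (F n w - A n w) * G n w + A n w * (G n w - C n w)) (\<lambda>n w. (F n w - A n w) * G n w + A n w * (G n w - C n w)) \<le>
    2 * ip (\<lambda>n w. (F n w - A n w) * G n w) (\<lambda>n w. (F n w - A n w) * G n w) +
    2 * ip (\<lambda>n w. A n w * (G n w - C n w)) (\<lambda>n w. A n w * (G n w - C n w))"
    by (rule ip_square_add_le[OF m1(1) m2(1)])
  then have "ip (\<lambda>n w. (F n w - A n w) * G n w + A n w * (G n w - C n w)) (\<lambda>n w. (F n w - A n w) * G n w + A n w * (G n w - C n w)) < e"
    using b1 b2 m1(2) m2(2) by linarith
  moreover have "(\<lambda>n w. (F n w - A n w) * G n w + A n w * (G n w - C n w)) = (\<lambda>n w. F n w * G n w - A n w * C n w)"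
    by (simp add: fun_eq_iff algebra_simps)
  ultimately have "ip (\<lambda>n w. F n w * G n w - A n w * C n w) (\<lambda>n w. F n w * G n w - A n w * C n w) < e"
    by simp
  moreover have "(\<lambda>n w. A n w * C n w) \<in> approx k"
    by (intro alg_approx k) (rule alg.mult[OF A(1) C(1) ij])
  ultimately show "\<exists>H\<in>approx k. ip (\<lambda>n w. F n w * G n w - H n w) (\<lambda>n w. F n w * G n w - H n w) < e"
    by (intro bexI)
qed

lemma approx_const: "k \<le> d ==> (\<lambda>n w. c) \<in> approx k"
  by (intro alg_approx alg.const)

definition decomposables :: "nat => 'a rvseq set" where
  "decomposables k = {\<lambda>n w. A n w * C n w | i j A C. A \<in> bseq i \<and> C \<in> bseq j \<and> i + j \<le> k \<and> i < k \<and> j < k} \<union>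
     {\<lambda>n. X (\<iota> n) | \<iota>. True}"

text \<open>Strong induction on the degree: the factors of decomposable sequences have smaller
  degree, so the span of the decomposables is approximable. The part of \<open>F\<close> orthogonal
  to that span satisfies the definition of \<open>New k\<close> and is itself a generator.\<close>

theorem bseq_approx:
  assumes "F \<in> bseq k" "k \<le> d" shows "F \<in> approx k"
  using assms
proof (induction k arbitrary: F rule: less_induct)
  case (less k)
  show ?case
  proof (cases "k = 0")
    case True
    have "\<exists>c. F n = (\<lambda>\<omega>. c)" for n
      using bseq_poly[OF less.prems(1), of n] True by (intro ordinary_polynomials_0) simp
    then obtain c where c: "\<And>n. F n = (\<lambda>\<omega>. c n)" by metis
    obtain C where C: "C \<ge> 0" "\<And>n. sq (F n) \<le> C" using bseq_bound[OF less.prems(1)] by blast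
    have "\<bar>c n\<bar> \<le> sqrt C" for n
      using C(2)[of n] by (intro real_le_rsqrt) (simp add: c prob_space)
    \<comment> \<open>In degree 0 the sequence consists of bounded numbers, and their ultralimit is
      the approximating constant.\<close>
    then have lim: "(c \<longlongrightarrow> Lim U c) U" by (rule U_converges)
    have "((\<lambda>n. (c n - Lim U c) * (c n - Lim U c)) \<longlongrightarrow> (Lim U c - Lim U c) * (Lim U c - Lim U c)) U"
      by (intro tendsto_intros lim)
    then have "ip (\<lambda>n \<omega>. F n \<omega> - Lim U c) (\<lambda>n \<omega>. F n \<omega> - Lim U c) = 0"
      by (intro ip_eqI) (simp add: c prob_space)
    then show ?thesis
      using approx_const[of k "Lim U c"] less.prems
      by (intro approx_closed[OF less.prems]) (auto intro!: bexI[of _ "\<lambda>n \<omega>. Lim U c"])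
  next
    case False
    let ?W = "lin_span (decomposables k)"
    have Wa: "w \<in> approx k" if "w \<in> ?W" for w
      using that
    proof (induction w rule: lin_span.induct)
      case zero
      show ?case using less.prems(2) by (rule approx_const)
    next
      case (base t)
      then consider (m) i j A C where "A \<in> bseq i" "C \<in> bseq j" "i + j \<le> k" "i < k" "j < k" "t = (\<lambda>n \<omega>. A n \<omega> * C n \<omega>)"
        | (v) \<iota> where "t = (\<lambda>n. X (\<iota> n))" unfolding decomposables_def by blast
      then show ?case
      proof cases
        case m
        have "A \<in> approx i" "C \<in> approx j" using m less.prems by (auto intro!: less.IH)
        then show ?thesis unfolding m(6) using m(3) less.prems(2) by (rule approx_mult)
      next
        case v
        then show ?thesis using False less.prems by (auto intro!: alg_approx alg.var)
      qed
    next
      case (add u v)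
      then show ?case using less.prems(2) by (intro approx_add)
    next
      case (scale u c)
      have "(\<lambda>n \<omega>. c) \<in> approx 0" by (rule approx_const) simp
      then show ?case by (rule approx_mult) (use scale less.prems in auto)
    qed
    then have "?W \<subseteq> bseq k" using approx_bseq by blast
    then obtain g where g: "g \<in> bseq k" "\<And>w. w \<in> ?W ==> ip g w = 0"
      "\<And>e. e > 0 ==> \<exists>w\<in>?W. ip (\<lambda>n \<omega>. F n \<omega> - g n \<omega> - w n \<omega>) (\<lambda>n \<omega>. F n \<omega> - g n \<omega> - w n \<omega>) < e"
      using projection[OF less.prems(1), of ?W, OF _ lin_span.zero lin_span.add lin_span.scale] by blast
    have "g \<in> New k" unfolding New_def
    proof (intro CollectI conjI allI impI g(1))
      fix i j A C assume "A \<in> bseq i" "C \<in> bseq j" "i + j \<le> k" "i < k" "j < k"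
      then have "(\<lambda>n \<omega>. A n \<omega> * C n \<omega>) \<in> decomposables k" unfolding decomposables_def by blast
      then show "ip g (\<lambda>n \<omega>. A n \<omega> * C n \<omega>) = 0" by (intro g(2) lin_span.base)
    next
      fix \<iota>
      have "(\<lambda>n. X (\<iota> n)) \<in> decomposables k" unfolding decomposables_def by blast
      then show "ip g (\<lambda>n. X (\<iota> n)) = 0" by (intro g(2) lin_span.base)
    qed
    then have ga: "g \<in> approx k"
      using False less.prems by (intro alg_approx alg.new[of k]) auto
    show ?thesis
    proof (rule approx_closed[OF less.prems])
      fix e :: real assume "e > 0"
      then obtain w where w: "w \<in> ?W" "ip (\<lambda>n \<omega>. F n \<omega> - g n \<omega> - w n \<omega>) (\<lambda>n \<omega>. F n \<omega> - g n \<omega> - w n \<omega>) < e"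
        using g(3) by blast
      have "(\<lambda>n \<omega>. g n \<omega> + w n \<omega>) \<in> approx k" by (intro approx_add ga Wa w less.prems)
      then show "\<exists>G\<in>approx k. ip (\<lambda>n \<omega>. F n \<omega> - G n \<omega>) (\<lambda>n \<omega>. F n \<omega> - G n \<omega>) < e"
        using w(2) by (intro bexI[of _ "\<lambda>n \<omega>. g n \<omega> + w n \<omega>"]) (simp_all add: diff_diff_eq)
    qed
  qed
qed

end

subsection \<open>New elements have negligible influences and contractions\<close>

lemma card_splitting_subsets:
  assumes "finite I" "A \<subseteq> I" "C \<subseteq> I" "A \<inter> C = {}"
  shows "real (card {R \<in> Pow I. A \<subseteq> R \<and> C \<inter> R = {}}) * 2 ^ (card A + card C) = 2 ^ card I"
proof -
  have fin: "finite A" "finite C" using assms finite_subset by blast+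
  have "{R \<in> Pow I. A \<subseteq> R \<and> C \<inter> R = {}} = (\<lambda>R. A \<union> R) ` Pow (I - (A \<union> C))"
  proof (intro set_eqI iffI)
    fix R assume "R \<in> {R \<in> Pow I. A \<subseteq> R \<and> C \<inter> R = {}}"
    then show "R \<in> (\<lambda>R. A \<union> R) ` Pow (I - (A \<union> C))" by (intro image_eqI[of _ _ "R - A"]) auto
  qed (use assms in auto)
  moreover have "inj_on (\<lambda>R. A \<union> R) (Pow (I - (A \<union> C)))" by (rule inj_onI) blast
  ultimately have "card {R \<in> Pow I. A \<subseteq> R \<and> C \<inter> R = {}} = 2 ^ card (I - (A \<union> C))"
    using assms(1) by (simp add: card_image card_Pow)
  moreover have "card (I - (A \<union> C)) + (card A + card C) = card I"
    using assms fin card_mono[of I "A \<union> C"] by (simp add: card_Diff_subset card_Un_disjoint)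
  ultimately show ?thesis by (simp add: power_add[symmetric])
qed

text \<open>Decoupling: a uniformly random subset R of \<open>I\<close> keeps each contributing pair
  with probability \<open>1 / 2 ^ N\<close>, so the restricted sums average to the total times this
  number, and some R does at least as well. Afterwards the two indices live on complementary sets of
  positions.\<close>

lemma exists_splitting:
  fixes c :: "'s => 't => real"
  assumes "finite I" "finite P" "finite Q"
    and A: "\<And>s t. s \<in> P ==> t \<in> Q ==> c s t \<noteq> 0 ==>
      \<phi> s \<subseteq> I \<and> \<psi> t \<subseteq> I \<and> \<phi> s \<inter> \<psi> t = {} \<and> card (\<phi> s) + card (\<psi> t) = N"
  shows "\<exists>R\<subseteq>I. \<bar>\<Sum>s\<in>P. \<Sum>t\<in>Q. c s t\<bar> \<le> 2 ^ N * \<bar>\<Sum>s\<in>{s \<in> P. \<phi> s \<subseteq> R}. \<Sum>t\<in>{t \<in> Q. \<psi> t \<inter> R = {}}. c s t\<bar>"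
proof (rule ccontr)
  define T where "T = (\<Sum>s\<in>P. \<Sum>t\<in>Q. c s t)"
  define D where "D R = (\<Sum>s\<in>{s \<in> P. \<phi> s \<subseteq> R}. \<Sum>t\<in>{t \<in> Q. \<psi> t \<inter> R = {}}. c s t)" for R
  assume "\<not> ?thesis"
  then have lt: "2 ^ N * \<bar>D R\<bar> < \<bar>T\<bar>" if "R \<subseteq> I" for R using that by (auto simp: T_def D_def not_le)
  have D_eq: "D R = (\<Sum>s\<in>P. \<Sum>t\<in>Q. if \<phi> s \<subseteq> R \<and> \<psi> t \<inter> R = {} then c s t else 0)" for R
    unfolding D_def using assms(2,3)
    by (subst sum.inter_filter[OF assms(2)], intro sum.cong refl)
      (auto simp: sum.inter_filter[OF assms(3)])
  have "(\<Sum>R\<in>Pow I. D R) = (\<Sum>s\<in>P. \<Sum>t\<in>Q. \<Sum>R\<in>Pow I. if \<phi> s \<subseteq> R \<and> \<psi> t \<inter> R = {} then c s t else 0)"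
    unfolding D_eq by (subst sum.swap, intro sum.cong refl, subst sum.swap, rule refl)
  also have "... = (\<Sum>s\<in>P. \<Sum>t\<in>Q. c s t * (2 ^ card I / 2 ^ N))"
  proof (intro sum.cong refl)
    fix s t assume st: "s \<in> P" "t \<in> Q"
    show "(\<Sum>R\<in>Pow I. if \<phi> s \<subseteq> R \<and> \<psi> t \<inter> R = {} then c s t else 0) = c s t * (2 ^ card I / 2 ^ N)"
    proof (cases "c s t = 0")
      case False
      note a = A[OF st False]
      have "(\<Sum>R\<in>Pow I. if \<phi> s \<subseteq> R \<and> \<psi> t \<inter> R = {} then c s t else 0) =
          real (card {R \<in> Pow I. \<phi> s \<subseteq> R \<and> \<psi> t \<inter> R = {}}) * c s t"
        using assms(1) by (subst sum.inter_filter[symmetric]) auto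
      moreover have "real (card {R \<in> Pow I. \<phi> s \<subseteq> R \<and> \<psi> t \<inter> R = {}}) * 2 ^ N = 2 ^ card I"
        using card_splitting_subsets[OF assms(1), of "\<phi> s" "\<psi> t"] a by simp
      ultimately show ?thesis by (simp add: field_simps)
    next
      case True
      then show ?thesis by (auto intro!: sum.neutral)
    qed
  qed
  also have "... = T * (2 ^ card I / 2 ^ N)" by (simp only: T_def sum_distrib_right)
  finally have "T * 2 ^ card I = 2 ^ N * (\<Sum>R\<in>Pow I. D R)" by (simp add: field_simps)
  then have "\<bar>T * 2 ^ card I\<bar> = \<bar>2 ^ N * (\<Sum>R\<in>Pow I. D R)\<bar>" by (rule arg_cong)
  then have "\<bar>T\<bar> * 2 ^ card I = 2 ^ N * \<bar>\<Sum>R\<in>Pow I. D R\<bar>" by (simp add: abs_mult)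
  also have "... \<le> (\<Sum>R\<in>Pow I. 2 ^ N * \<bar>D R\<bar>)"
    unfolding sum_distrib_left[symmetric] by (intro mult_left_mono sum_abs) auto
  also have "... < (\<Sum>R\<in>Pow I. \<bar>T\<bar>)"
    using assms(1) by (intro sum_strict_mono lt) auto
  also have "... = \<bar>T\<bar> * 2 ^ card I" using assms(1) by (simp add: card_Pow)
  finally show False by simp
qed

section \<open>Influences and contractions of a coefficient array\<close>

context iid
begin

abbreviation wds :: "nat => (nat \<times> nat) set set" where "wds m \<equiv> words K {..<m} d"

definition infl :: "nat => ((nat \<times> nat) set => real) => nat => real" where
  "infl m f i = (\<Sum>S\<in>{S \<in> wds m. i \<in> fst ` S}. (f S)^2)"

text \<open>The coefficient array read as a matrix indexed by pairs of disjoint words, that is, a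
  flattening of the tensor \<open>f\<close>.\<close>

definition glue :: "nat => ((nat \<times> nat) set => real) => (nat \<times> nat) set => (nat \<times> nat) set => real" where
  "glue m f \<alpha> \<beta> = (if \<alpha> \<inter> \<beta> = {} \<and> \<alpha> \<union> \<beta> \<in> wds m then f (\<alpha> \<union> \<beta>) else 0)"

definition bil :: "nat => ((nat \<times> nat) set => real) => ((nat \<times> nat) set => real) => ((nat \<times> nat) set => real) => nat => nat => real" where
  "bil m f a b p q = (\<Sum>\<alpha>\<in>{\<alpha> \<in> wds m. card \<alpha> = p}. \<Sum>\<beta>\<in>{\<beta> \<in> wds m. card \<beta> = q}. glue m f \<alpha> \<beta> * a \<alpha> * b \<beta>)"

definition infl_le :: "((nat \<times> nat) set => real) => real => bool" where
  "infl_le f e \<longleftrightarrow> (\<forall>m i. infl m f i \<le> e)"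

text \<open>A bound, uniform in m, for the operator norms of all flattenings with both blocks
  nonempty. It is phrased with two test vectors because these become the coefficients of the two
  factors in the definition of \<open>New\<close>.\<close>

definition bil_le :: "((nat \<times> nat) set => real) => real => bool" where
  "bil_le f e \<longleftrightarrow> (\<forall>m a b p q. (\<Sum>S\<in>wds m. (a S)^2) \<le> 1 --> (\<Sum>S\<in>wds m. (b S)^2) \<le> 1 -->
     1 \<le> p --> 1 \<le> q --> \<bar>bil m f a b p q\<bar> \<le> e)"

lemma finite_wds: "finite (wds m)"
  by (intro finite_words finite_K) simp

lemma wds_finite: "S \<in> wds m ==> finite S"
  by (rule words_finite[OF finite_K]) simp_all

lemma coef_bessel:
  assumes F: "F \<in> ordinary_polynomials X k" and "k \<le> d"
  shows "(\<Sum>S\<in>wds m. (coef F S)^2) \<le> expectation (\<lambda>w. (F w)^2)"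
proof -
  obtain I where fin: "finite I"
    and rep: "\<forall>J. finite J --> I \<subseteq> J --> (AE w in M. F w = ev J d (coef F) w)"
    using ordinary_polynomial_words(1)[OF assms] by blast
  define J where "J = I \<union> {..<m}"
  have J: "finite J" "I \<subseteq> J" using fin by (auto simp: J_def)
  have [measurable]: "F \<in> borel_measurable M" "ev J d (coef F) \<in> borel_measurable M"
    using ordinary_moments[OF F] ev_moments[of J d] by (auto intro: all_moments_measurable)
  have "expectation (\<lambda>w. (F w)^2) = expectation (\<lambda>w. (ev J d (coef F) w)^2)"
  proof (rule integral_cong_AE)
    show "AE w in M. (F w)^2 = (ev J d (coef F) w)^2" using rep[rule_format, OF J] by eventually_elim simp
  qed measurable
  also have "... = (\<Sum>S\<in>words K J d. (coef F S)^2)" by (rule expectation_ev_square[OF J(1)])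
  also have "... \<ge> (\<Sum>S\<in>wds m. (coef F S)^2)"
    using words_mono[of "{..<m}" J d d K] by (intro sum_mono2 finite_words finite_K J) (auto simp: J_def)
  finally show ?thesis .
qed

lemma xi_polynomial:
  assumes "S \<subseteq> I \<times> K" "finite S" shows "xi S \<in> ordinary_polynomials X (wt S)"
proof -
  have "(\<lambda>w. h (snd l) (X (fst l) w)) \<in> ordinary_polynomials X (snd l)" for l
  proof -
    obtain a where a: "h (snd l) = (\<lambda>x. \<Sum>j\<le>snd l. a j * x ^ j)"
      using h_polyfun[of "snd l"] by (auto simp: polyfun_def)
    have "(\<lambda>w. a j * X (fst l) w ^ j) \<in> ordinary_polynomials X (snd l)" if "j \<le> snd l" for j
    proof (rule ordinary_polynomials_scale)
      have "(\<lambda>w. X (fst l) w ^ j) \<in> ordinary_polynomials X (j * 1)"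
        by (intro ordinary_polynomials_power ordinary_polynomials_var) simp
      then show "(\<lambda>w. X (fst l) w ^ j) \<in> ordinary_polynomials X (snd l)"
        using ordinary_polynomials_mono[OF that, of X] by auto
    qed
    then show ?thesis unfolding a by (intro ordinary_polynomials_sum) simp
  qed
  then have "(\<lambda>w. \<Prod>l\<in>S. h (snd l) (X (fst l) w)) \<in> ordinary_polynomials X (\<Sum>l\<in>S. snd l)"
    by (intro ordinary_polynomials_prod assms(2)) blast
  then show ?thesis by (simp add: xi_def[abs_def] wt_def case_prod_beta)
qed

lemma xi_union:
  assumes "finite \<alpha>" "finite \<beta>" "\<alpha> \<inter> \<beta> = {}"
  shows "xi (\<alpha> \<union> \<beta>) w = xi \<alpha> w * xi \<beta> w"
  unfolding xi_def using assms by (rule prod.union_disjoint)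

lemma expectation_word_sum_mult:
  assumes F: "F \<in> all_moments M" and "finite P" "\<And>S. S \<in> P ==> S \<subseteq> UNIV \<times> K" "A \<in> all_moments M"
  shows "expectation (\<lambda>w. F w * (A w * (\<Sum>S\<in>P. c S * xi S w))) = (\<Sum>S\<in>P. c S * expectation (\<lambda>w. F w * (A w * xi S w)))"
proof -
  have xm: "S \<in> P ==> xi S \<in> all_moments M" for S using assms(3) by (intro xi_moments[of S UNIV])
  have "expectation (\<lambda>w. F w * (A w * (\<Sum>S\<in>P. c S * xi S w))) = expectation (\<lambda>w. \<Sum>S\<in>P. c S * (F w * (A w * xi S w)))"
    by (simp add: sum_distrib_left mult_ac)
  also have "... = (\<Sum>S\<in>P. expectation (\<lambda>w. c S * (F w * (A w * xi S w))))"
    by (intro Bochner_Integration.integral_sum all_moments_integrable all_moments_closed F assms(4) xm)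
  finally show ?thesis by simp
qed

lemma word_sum_norm:
  assumes "P \<subseteq> wds m"
  shows "expectation (\<lambda>w. (\<Sum>S\<in>P. c S * xi S w)^2) = (\<Sum>S\<in>P. (c S)^2)"
proof -
  have "(\<Sum>S\<in>P. c S * xi S w) = ev {..<m} d (\<lambda>S. if S \<in> P then c S else 0) w" for w
    unfolding ev_def using assms finite_wds by (intro sum.mono_neutral_cong_left) auto
  then have "expectation (\<lambda>w. (\<Sum>S\<in>P. c S * xi S w)^2) = (\<Sum>S\<in>wds m. (if S \<in> P then c S else 0)^2)"
    using expectation_ev_square[of "{..<m}" d "\<lambda>S. if S \<in> P then c S else 0"] by simp
  also have "... = (\<Sum>S\<in>P. (c S)^2)"
    using assms finite_wds by (intro sum.mono_neutral_cong_right) auto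
  finally show ?thesis .
qed

lemma coef_add:
  assumes "F \<in> all_moments M" "G \<in> all_moments M" "S \<in> wds m"
  shows "coef (\<lambda>w. F w + G w) S = coef F S + coef G S"
proof -
  have "xi S \<in> all_moments M" using assms(3) by (intro xi_moments[of S "{..<m}"]) (auto simp: words_def)
  then show ?thesis unfolding coef_def distrib_right
    by (intro Bochner_Integration.integral_add all_moments_integrable all_moments_closed assms)
qed

lemma coef_scale: "coef (\<lambda>w. c * F w) S = c * coef F S"
  by (simp add: coef_def mult.assoc)

lemma infl_cong: "(\<And>S. S \<in> wds m ==> f S = g S) ==> infl m f i = infl m g i"
  unfolding infl_def by (rule sum.cong) auto

lemma bil_cong: "(\<And>S. S \<in> wds m ==> f S = g S) ==> bil m f a b p q = bil m g a b p q"
  unfolding bil_def glue_def by (intro sum.cong refl) auto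

lemma infl_add: "infl m (\<lambda>S. f S + g S) i \<le> 2 * infl m f i + 2 * infl m g i"
proof -
  have "(x + y)^2 \<le> 2 * x^2 + 2 * y^2" for x y :: real
    using zero_le_power2[of "x - y"] by (simp add: power2_sum power2_diff)
  then have "infl m (\<lambda>S. f S + g S) i \<le> (\<Sum>S\<in>{S \<in> wds m. i \<in> fst ` S}. 2 * (f S)^2 + 2 * (g S)^2)"
    unfolding infl_def by (intro sum_mono)
  then show ?thesis by (simp add: infl_def sum.distrib sum_distrib_left)
qed

lemma bil_add: "bil m (\<lambda>S. f S + g S) a b p q = bil m f a b p q + bil m g a b p q"
  unfolding bil_def glue_def sum.distrib[symmetric] by (intro sum.cong refl) (auto simp: algebra_simps)

lemma infl_scale: "infl m (\<lambda>S. c * f S) i = c^2 * infl m f i"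
  by (simp add: infl_def power_mult_distrib sum_distrib_left)

lemma bil_scale: "bil m (\<lambda>S. c * f S) a b p q = c * bil m f a b p q"
  unfolding bil_def glue_def sum_distrib_left by (intro sum.cong refl) (auto simp: algebra_simps)

end

section \<open>Remainders are negligible\<close>

context iid_ultra
begin

text \<open>Smallness is required uniformly over all positions and all test vectors, for U-many n.
  Remainders of every degree are placed in \<open>bseq d\<close>, so that those of different degrees
  can be combined linearly.\<close>

definition Negl :: "'a rvseq set" where
  "Negl = {F \<in> bseq d. ((\<lambda>n. expectation (F n)) \<longlongrightarrow> 0) U \<and>
     (\<forall>e>0. eventually (\<lambda>n. infl_le (coef (F n)) (e)) U) \<and>
     (\<forall>e>0. eventually (\<lambda>n. bil_le (coef (F n)) (e)) U)}"

lemma bseq_power_var: "(\<lambda>n w. X (\<iota> n) w ^ j) \<in> bseq j"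
proof (rule bseqI[where C = "sq (\<lambda>w. X 0 w ^ j)"])
  fix n
  show "(\<lambda>w. X (\<iota> n) w ^ j) \<in> ordinary_polynomials X j"
    using ordinary_polynomials_power[OF ordinary_polynomials_var[of 1 X "\<iota> n"], of j] by simp
  show "sq (\<lambda>w. X (\<iota> n) w ^ j) \<le> sq (\<lambda>w. X 0 w ^ j)"
    using expectation_X[of "\<lambda>x. (x ^ j)^2" "\<iota> n"] by simp
qed

text \<open>A power below k has lower degree; the power k splits into a single variable times its
  power \<open>k - 1\<close> when \<open>k \<ge> 2\<close>, and for \<open>k = 1\<close>
  orthogonality to single variables is used.\<close>

lemma New_single_letter:
  assumes g: "g \<in> New k" and k: "1 \<le> k" "k \<le> d" and "\<kappa> \<le> k"
  shows "((\<lambda>n. expectation (\<lambda>w. g n w * h \<kappa> (X (\<iota> n) w))) \<longlongrightarrow> 0) U"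
proof -
  obtain a where a: "h \<kappa> = (\<lambda>x. \<Sum>j\<le>\<kappa>. a j * x ^ j)"
    using h_polyfun[of \<kappa>] by (auto simp: polyfun_def)
  have *: "((\<lambda>n. expectation (\<lambda>w. g n w * X (\<iota> n) w ^ j)) \<longlongrightarrow> 0) U" if j: "j \<le> \<kappa>" for j
  proof -
    have "ip g (\<lambda>n w. X (\<iota> n) w ^ j) = 0"
    proof (cases "j < k")
      case True
      then show ?thesis using New_lower[OF g bseq_power_var] by blast
    next
      case False
      then have jk: "j = k" using j assms(4) by simp
      show ?thesis
      proof (cases "k = 1")
        case True
        then show ?thesis using New_var[OF g, of \<iota>] jk by simp
      next
        case False
        have "ip g (\<lambda>n w. X (\<iota> n) w ^ 1 * X (\<iota> n) w ^ (k - 1)) = 0"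
          using k False by (intro New_mult[OF g bseq_power_var bseq_power_var]) auto
        then show ?thesis using k by (simp add: jk power_eq_if)
      qed
    qed
    then show ?thesis using ip_tendsto[OF New_bseq[OF g] bseq_power_var[of \<iota> j]] by simp
  qed
  have "expectation (\<lambda>w. g n w * h \<kappa> (X (\<iota> n) w)) = (\<Sum>j\<le>\<kappa>. a j * expectation (\<lambda>w. g n w * X (\<iota> n) w ^ j))" for n
  proof -
    have "expectation (\<lambda>w. g n w * h \<kappa> (X (\<iota> n) w)) = expectation (\<lambda>w. \<Sum>j\<le>\<kappa>. a j * (g n w * X (\<iota> n) w ^ j))"
      unfolding a by (simp add: sum_distrib_left mult_ac)
    also have "... = (\<Sum>j\<le>\<kappa>. expectation (\<lambda>w. a j * (g n w * X (\<iota> n) w ^ j)))"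
      by (intro Bochner_Integration.integral_sum all_moments_integrable all_moments_closed
          bseq_moments[OF New_bseq[OF g]] X_moments)
    finally show ?thesis by simp
  qed
  moreover have "((\<lambda>n. \<Sum>j\<le>\<kappa>. a j * expectation (\<lambda>w. g n w * X (\<iota> n) w ^ j)) \<longlongrightarrow> (\<Sum>j\<le>\<kappa>. a j * 0)) U"
    by (intro tendsto_intros *) simp
  ultimately show ?thesis by simp
qed

lemma word_sum_bseq:
  assumes "\<And>n. P n \<subseteq> wds (m n)" "\<And>n S. S \<in> P n ==> c n S \<noteq> 0 ==> wt S \<le> k" "\<And>n. (\<Sum>S\<in>P n. (c n S)^2) \<le> C"
  shows "(\<lambda>n w. \<Sum>S\<in>P n. c n S * xi S w) \<in> bseq k"
proof (rule bseqI[where C = C])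
  fix n
  show "(\<lambda>w. \<Sum>S\<in>P n. c n S * xi S w) \<in> ordinary_polynomials X k"
  proof (rule ordinary_polynomials_sum)
    fix S assume S: "S \<in> P n"
    have Sw: "S \<in> wds (m n)" using assms(1)[of n] S by blast
    show "(\<lambda>w. c n S * xi S w) \<in> ordinary_polynomials X k"
    proof (cases "c n S = 0")
      case True
      then show ?thesis using ordinary_polynomials_const[of 0 X k] by simp
    next
      case False
      have "xi S \<in> ordinary_polynomials X (wt S)"
        using Sw wds_finite[OF Sw] by (intro xi_polynomial[of S UNIV]) (auto simp: words_def)
      then show ?thesis
        using ordinary_polynomials_mono[OF assms(2)[OF S False], of X]
        by (intro ordinary_polynomials_scale) blast
    qed
  qed
  show "sq (\<lambda>w. \<Sum>S\<in>P n. c n S * xi S w) \<le> C"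
    using assms(3) word_sum_norm[OF assms(1)] by simp
qed

text \<open>Test \<open>g\<close> against \<open>h \<kappa> (X (\<iota> n))\<close> times the
  partial derivative of \<open>g\<close> in that letter. For \<open>\<kappa> < k\<close> the factors
  have degrees \<kappa> and \<open>k - \<kappa>\<close>, and the pairing returns the sum of the
  squared coefficients of the words with that letter: the influence is itself an inner product with
  a decomposable sequence.\<close>

lemma New_infl:
  assumes g: "g \<in> New k" and k: "1 \<le> k" "k \<le> d"
  shows "((\<lambda>n. infl (m n) (coef (g n)) (\<iota> n)) \<longlongrightarrow> 0) U"
proof -
  obtain d' where d': "d = Suc d'" using k by (cases d) auto
  define I where "I n = {..<m n} - {\<iota> n}" for n
  define c where "c \<kappa> n S = coef (g n) (insert (\<iota> n, \<kappa>) S)" for \<kappa> n S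
  define P where "P n = (if \<iota> n < m n then words K (I n) d' else {})" for n
  have gb: "g \<in> bseq k" using g by (rule New_bseq)
  have gm: "g n \<in> all_moments M" for n by (rule bseq_moments[OF gb])
  obtain C where C: "C \<ge> 0" "\<And>n. sq (g n) \<le> C" using bseq_bound[OF gb] by blast
  have Psub: "P n \<subseteq> wds (m n)" for n
    unfolding P_def I_def using words_mono[of "{..<m n} - {\<iota> n}" "{..<m n}" d' d K] by (auto simp: d')
  have nr: "(\<iota> n, \<kappa>) \<notin> S" if "S \<in> P n" for n \<kappa> S
    using that by (auto simp: P_def I_def words_def split: if_splits)
  have ins: "insert (\<iota> n, \<kappa>) S \<in> wds (m n)" if "S \<in> P n" "\<kappa> \<in> K" for n \<kappa> S
  proof -
    have i: "\<iota> n < m n" "S \<in> words K (I n) d'" using that by (auto simp: P_def split: if_splits)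
    have "{..<m n} = insert (\<iota> n) (I n)" using i by (auto simp: I_def)
    moreover have "insert (\<iota> n, \<kappa>) S \<in> words K (insert (\<iota> n) (I n)) (Suc d')"
      using i that by (subst words_insert) (auto simp: I_def finite_K)
    ultimately show ?thesis by (simp add: d')
  qed
  have infl_eq: "infl (m n) (coef (g n)) (\<iota> n) = (\<Sum>\<kappa>\<in>K. \<Sum>S\<in>P n. (c \<kappa> n S)^2)" for n
  proof (cases "\<iota> n < m n")
    case True
    have e: "{..<m n} = insert (\<iota> n) (I n)" using True by (auto simp: I_def)
    have "infl (m n) (coef (g n)) (\<iota> n) = (\<Sum>S\<in>wds (m n). if \<iota> n \<in> fst ` S then (coef (g n) S)^2 else 0)"
      unfolding infl_def by (rule sum.inter_filter[OF finite_wds])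
    also have "... = (\<Sum>S\<in>words K (I n) d. if \<iota> n \<in> fst ` S then (coef (g n) S)^2 else 0) +
        (\<Sum>\<kappa>\<in>K. \<Sum>S\<in>words K (I n) d'. if \<iota> n \<in> fst ` (insert (\<iota> n, \<kappa>) S) then (c \<kappa> n S)^2 else 0)"
      using sum_words_insert[of "\<iota> n" "I n" K "\<lambda>S. if \<iota> n \<in> fst ` S then (coef (g n) S)^2 else 0" d'] finite_K
      by (simp add: e[symmetric] d'[symmetric] c_def) (simp add: I_def)
    also have "(\<Sum>S\<in>words K (I n) d. if \<iota> n \<in> fst ` S then (coef (g n) S)^2 else 0) = 0"
      by (intro sum.neutral) (auto simp: words_def I_def)
    finally show ?thesis using True by (simp add: P_def)
  next
    case False
    then have "{S \<in> wds (m n). \<iota> n \<in> fst ` S} = {}" by (auto simp: words_def)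
    then have "infl (m n) (coef (g n)) (\<iota> n) = 0" unfolding infl_def by (simp only: sum.empty)
    then show ?thesis using False by (simp add: P_def)
  qed
  have czero: "wt S + \<kappa> \<le> k" if "S \<in> P n" "\<kappa> \<in> K" "c \<kappa> n S \<noteq> 0" for n \<kappa> S
  proof (rule ccontr)
    assume "\<not> wt S + \<kappa> \<le> k"
    moreover have "wt (insert (\<iota> n, \<kappa>) S) = \<kappa> + wt S"
      using nr[OF that(1)] wds_finite[of S "m n"] Psub[of n] that(1) by (subst wt_insert) auto
    ultimately have "coef (g n) (insert (\<iota> n, \<kappa>) S) = 0"
      using ins[OF that(1,2)] by (intro ordinary_polynomial_words(2)[OF bseq_poly[OF gb] k(2), of "{..<m n}"]) auto
    then show False using that(3) by (simp add: c_def)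
  qed
  have bess: "(\<Sum>S\<in>P n. (c \<kappa> n S)^2) \<le> C" if "\<kappa> \<in> K" for n \<kappa>
  proof -
    have inj: "inj_on (insert (\<iota> n, \<kappa>)) (P n)" by (rule inj_onI) (metis nr insert_ident)
    have "(\<Sum>S\<in>P n. (c \<kappa> n S)^2) = (\<Sum>S\<in>insert (\<iota> n, \<kappa>) ` P n. (coef (g n) S)^2)"
      by (simp add: sum.reindex[OF inj] c_def)
    also have "... \<le> (\<Sum>S\<in>wds (m n). (coef (g n) S)^2)"
      using ins[OF _ that] by (intro sum_mono2 finite_wds) auto
    also have "... \<le> C" using coef_bessel[OF bseq_poly[OF gb] k(2), of n "m n"] C(2)[of n] by simp
    finally show ?thesis .
  qed
  have hb: "(\<lambda>n w. h \<kappa> (X (\<iota> n) w)) \<in> bseq \<kappa>" if \<kappa>: "\<kappa> \<in> K" for \<kappa>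
  proof (rule bseqI[where C = "sq (\<lambda>w. h \<kappa> (X 0 w))"])
    fix n
    have "xi {(\<iota> n, \<kappa>)} \<in> ordinary_polynomials X (wt {(\<iota> n, \<kappa>)})"
      using \<kappa> by (intro xi_polynomial[of _ UNIV]) auto
    then show "(\<lambda>w. h \<kappa> (X (\<iota> n) w)) \<in> ordinary_polynomials X \<kappa>"
      by (simp add: xi_def[abs_def] wt_def)
    show "sq (\<lambda>w. h \<kappa> (X (\<iota> n) w)) \<le> sq (\<lambda>w. h \<kappa> (X 0 w))"
      using expectation_X[of "\<lambda>x. (h \<kappa> x)^2" "\<iota> n"] by simp
  qed
  have "((\<lambda>n. \<Sum>S\<in>P n. (c \<kappa> n S)^2) \<longlongrightarrow> 0) U" if \<kappa>: "\<kappa> \<in> K" for \<kappa>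
  proof (cases "\<kappa> < k")
    case True
    have Fb: "(\<lambda>n w. \<Sum>S\<in>P n. c \<kappa> n S * xi S w) \<in> bseq (k - \<kappa>)"
    proof (rule word_sum_bseq[where C = C, OF Psub])
      show "wt S \<le> k - \<kappa>" if "S \<in> P n" "c \<kappa> n S \<noteq> 0" for n S using czero[OF that(1) \<kappa> that(2)] by simp
    qed (rule bess[OF \<kappa>])
    have "ip g (\<lambda>n w. h \<kappa> (X (\<iota> n) w) * (\<Sum>S\<in>P n. c \<kappa> n S * xi S w)) = 0"
      using True \<kappa> by (intro New_mult[OF g hb[OF \<kappa>] Fb]) (auto simp: K_def)
    moreover have "((\<lambda>n. expectation (\<lambda>w. g n w * (h \<kappa> (X (\<iota> n) w) * (\<Sum>S\<in>P n. c \<kappa> n S * xi S w)))) \<longlongrightarrow>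
        ip g (\<lambda>n w. h \<kappa> (X (\<iota> n) w) * (\<Sum>S\<in>P n. c \<kappa> n S * xi S w))) U"
      using True by (intro ip_tendsto[OF gb bseq_mult(1)[OF hb[OF \<kappa>] Fb _ k(2)]]) simp
    moreover have "expectation (\<lambda>w. g n w * (h \<kappa> (X (\<iota> n) w) * (\<Sum>S\<in>P n. c \<kappa> n S * xi S w))) = (\<Sum>S\<in>P n. (c \<kappa> n S)^2)" for n
    proof -
      have fP: "finite (P n)" using finite_subset[OF Psub finite_wds] .
      have "expectation (\<lambda>w. g n w * (h \<kappa> (X (\<iota> n) w) * (\<Sum>S\<in>P n. c \<kappa> n S * xi S w))) =
          (\<Sum>S\<in>P n. c \<kappa> n S * expectation (\<lambda>w. g n w * (h \<kappa> (X (\<iota> n) w) * xi S w)))"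
        using Psub[of n] by (intro expectation_word_sum_mult gm h_moments fP) (auto simp: words_def)
      also have "... = (\<Sum>S\<in>P n. c \<kappa> n S * c \<kappa> n S)"
      proof (intro sum.cong refl)
        fix S assume S: "S \<in> P n"
        have "finite S" using wds_finite[of S "m n"] Psub[of n] S by blast
        then show "c \<kappa> n S * expectation (\<lambda>w. g n w * (h \<kappa> (X (\<iota> n) w) * xi S w)) = c \<kappa> n S * c \<kappa> n S"
          using nr[OF S] by (simp add: c_def coef_def xi_insert)
      qed
      finally show ?thesis by (simp add: power2_eq_square)
    qed
    ultimately show ?thesis by simp
  next
    case False
    \<comment> \<open>For \<open>\<kappa> \<ge> k\<close> the weight bound leaves at most the
      one-letter word with \<open>\<kappa> = k\<close>, which \<open>New_single_letter\<close>
      treats.\<close>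
    have le: "(\<Sum>S\<in>P n. (c \<kappa> n S)^2) \<le> (if \<kappa> = k then (coef (g n) {(\<iota> n, \<kappa>)})^2 else 0)" for n
    proof -
      have fP: "finite (P n)" using finite_subset[OF Psub finite_wds] .
      have "S = {} \<and> \<kappa> = k" if S: "S \<in> P n" "c \<kappa> n S \<noteq> 0" for S
      proof -
        have "wt S = 0" "\<kappa> = k" using czero[OF S(1) \<kappa> S(2)] False by auto
        moreover have "card S \<le> wt S"
          using Psub[of n] S(1) wds_finite[of S "m n"] by (intro card_le_wt[of S UNIV]) (auto simp: words_def)
        ultimately show ?thesis using Psub[of n] S(1) wds_finite[of S "m n"] by auto
      qed
      then have "(\<Sum>S\<in>P n. (c \<kappa> n S)^2) \<le> (\<Sum>S\<in>P n. if S = {} \<and> \<kappa> = k then (c \<kappa> n S)^2 else 0)"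
        by (intro sum_mono) auto
      also have "... \<le> (if \<kappa> = k then (c \<kappa> n {})^2 else 0)"
        using fP by (auto simp: sum.delta' if_distrib cong: if_cong)
      finally show ?thesis by (simp only: c_def[of \<kappa> n "{}"])
    qed
    have ce: "coef (g n) {(\<iota> n, \<kappa>)} = expectation (\<lambda>w. g n w * h \<kappa> (X (\<iota> n) w))" for n
      by (simp add: coef_def xi_def)
    have lim: "((\<lambda>n. if \<kappa> = k then (expectation (\<lambda>w. g n w * h \<kappa> (X (\<iota> n) w)))^2 else 0) \<longlongrightarrow> 0) U"
    proof (cases "\<kappa> = k")
      case True
      have "((\<lambda>n. (expectation (\<lambda>w. g n w * h \<kappa> (X (\<iota> n) w)))^2) \<longlongrightarrow> 0^2) U"
        using True by (intro tendsto_power New_single_letter[OF g k]) simp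
      then show ?thesis using True by simp
    qed simp
    show ?thesis
    proof (rule Lim_null_comparison[OF always_eventually lim], intro allI)
      fix n
      have "0 \<le> (\<Sum>S\<in>P n. (c \<kappa> n S)^2)" by (intro sum_nonneg) simp
      then show "norm (\<Sum>S\<in>P n. (c \<kappa> n S)^2) \<le> (if \<kappa> = k then (expectation (\<lambda>w. g n w * h \<kappa> (X (\<iota> n) w)))^2 else 0)"
        using le[of n] by (simp only: ce real_norm_def abs_of_nonneg)
    qed
  qed
  then have "((\<lambda>n. \<Sum>\<kappa>\<in>K. \<Sum>S\<in>P n. (c \<kappa> n S)^2) \<longlongrightarrow> (\<Sum>\<kappa>\<in>K. 0)) U" by (intro tendsto_sum)
  then show ?thesis by (simp add: infl_eq)
qed

lemma wt_le:
  assumes "S \<in> wds m" shows "wt S \<le> d * d"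
proof -
  have "wt S \<le> (\<Sum>l\<in>S. d)"
    unfolding wt_def using assms by (intro sum_mono) (auto simp: words_def K_def)
  also have "... \<le> d * d" using assms by (simp add: words_def)
  finally show ?thesis .
qed

text \<open>The bilinear form is the pairing of \<open>g\<close> with a product of two word sums,
  provided that their positions are disjoint; a decoupling set \<open>R n\<close>, chosen for each
  n, ensures this at the cost of a factor \<open>2 ^ d\<close>. Sorting both sums by weight makes
  the degrees additive, and total weights beyond k meet vanishing coefficients.\<close>

lemma New_bil:
  assumes g: "g \<in> New k" and k: "1 \<le> k" "k \<le> d"
    and a: "\<And>n. (\<Sum>S\<in>wds (m n). (a n S)^2) \<le> 1" and b: "\<And>n. (\<Sum>S\<in>wds (m n). (b n S)^2) \<le> 1"
    and pq: "\<And>n. 1 \<le> p n" "\<And>n. 1 \<le> q n"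
  shows "((\<lambda>n. bil (m n) (coef (g n)) (a n) (b n) (p n) (q n)) \<longlongrightarrow> 0) U"
proof -
  have gb: "g \<in> bseq k" using g by (rule New_bseq)
  have gm: "g n \<in> all_moments M" for n by (rule bseq_moments[OF gb])
  define c where "c n \<alpha> \<beta> = glue (m n) (coef (g n)) \<alpha> \<beta> * a n \<alpha> * b n \<beta>" for n \<alpha> \<beta>
  have glue: "fst ` \<alpha> \<inter> fst ` \<beta> = {} \<and> card (fst ` \<alpha>) = card \<alpha> \<and> card (fst ` \<beta>) = card \<beta> \<and> card \<alpha> + card \<beta> \<le> d"
    if "c n \<alpha> \<beta> \<noteq> 0" "\<alpha> \<in> wds (m n)" "\<beta> \<in> wds (m n)" for n \<alpha> \<beta>
  proof -
    have ab: "\<alpha> \<inter> \<beta> = {}" "\<alpha> \<union> \<beta> \<in> wds (m n)" using that(1) by (auto simp: c_def glue_def split: if_splits)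
    then have inj: "inj_on fst (\<alpha> \<union> \<beta>)" by (simp add: words_def)
    have "fst ` \<alpha> \<inter> fst ` \<beta> = fst ` (\<alpha> \<inter> \<beta>)" by (rule inj_on_image_Int[OF inj, symmetric]) auto
    moreover have "card (\<alpha> \<union> \<beta>) = card \<alpha> + card \<beta>"
      using ab(1) wds_finite[OF that(2)] wds_finite[OF that(3)] by (intro card_Un_disjoint)
    moreover have "card (\<alpha> \<union> \<beta>) \<le> d" using ab(2) by (simp add: words_def)
    moreover have "card (fst ` \<alpha>) = card \<alpha>" "card (fst ` \<beta>) = card \<beta>"
      using that(2,3) by (auto simp: words_def card_image)
    ultimately show ?thesis using ab(1) by simp
  qed
  define P0 Q0 where "P0 n = {\<alpha> \<in> wds (m n). card \<alpha> = p n}" and "Q0 n = {\<beta> \<in> wds (m n). card \<beta> = q n}" for n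
  define good where "good n R \<longleftrightarrow> R \<subseteq> {..<m n} \<and> \<bar>\<Sum>\<alpha>\<in>P0 n. \<Sum>\<beta>\<in>Q0 n. c n \<alpha> \<beta>\<bar> \<le> 2 ^ (p n + q n) *
      \<bar>\<Sum>\<alpha>\<in>{\<alpha> \<in> P0 n. fst ` \<alpha> \<subseteq> R}. \<Sum>\<beta>\<in>{\<beta> \<in> Q0 n. fst ` \<beta> \<inter> R = {}}. c n \<alpha> \<beta>\<bar>" for n R
  have "\<exists>R. good n R" for n
    unfolding good_def
  proof (rule exists_splitting)
    show "finite (P0 n)" "finite (Q0 n)" using finite_wds by (auto simp: P0_def Q0_def)
    fix \<alpha> \<beta> assume "\<alpha> \<in> P0 n" "\<beta> \<in> Q0 n" and nz: "c n \<alpha> \<beta> \<noteq> 0"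
    then have w: "\<alpha> \<in> wds (m n)" "\<beta> \<in> wds (m n)" "card \<alpha> = p n" "card \<beta> = q n" by (auto simp: P0_def Q0_def)
    have "fst ` \<alpha> \<subseteq> {..<m n}" "fst ` \<beta> \<subseteq> {..<m n}" using w(1,2) by (auto simp: words_def)
    then show "fst ` \<alpha> \<subseteq> {..<m n} \<and> fst ` \<beta> \<subseteq> {..<m n} \<and> fst ` \<alpha> \<inter> fst ` \<beta> = {} \<and> card (fst ` \<alpha>) + card (fst ` \<beta>) = p n + q n"
      using glue[OF nz w(1,2)] w(3,4) by simp
  qed simp
  then obtain R where good: "\<And>n. good n (R n)" by metis
  have R: "\<bar>\<Sum>\<alpha>\<in>P0 n. \<Sum>\<beta>\<in>Q0 n. c n \<alpha> \<beta>\<bar> \<le> 2 ^ (p n + q n) *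
      \<bar>\<Sum>\<alpha>\<in>{\<alpha> \<in> P0 n. fst ` \<alpha> \<subseteq> R n}. \<Sum>\<beta>\<in>{\<beta> \<in> Q0 n. fst ` \<beta> \<inter> R n = {}}. c n \<alpha> \<beta>\<bar>" for n
    using good[of n] by (simp add: good_def)
  \<comment> \<open>The condition \<open>p n + q n \<le> d\<close> empties \<open>P n\<close> when
    the unions would be too long to be words; the bilinear form vanishes in that case.\<close>
  define P Q where "P n = {\<alpha> \<in> P0 n. fst ` \<alpha> \<subseteq> R n \<and> p n + q n \<le> d}" and "Q n = {\<beta> \<in> Q0 n. fst ` \<beta> \<inter> R n = {}}" for n
  define D where "D n = (\<Sum>\<alpha>\<in>P n. \<Sum>\<beta>\<in>Q n. c n \<alpha> \<beta>)" for n
  have Pw: "P n \<subseteq> wds (m n)" and Qw: "Q n \<subseteq> wds (m n)" for n by (auto simp: P_def Q_def P0_def Q0_def)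
  have fPQ: "finite (P n)" "finite (Q n)" for n
    using finite_subset[OF Pw finite_wds] finite_subset[OF Qw finite_wds] .
  have bound: "\<bar>bil (m n) (coef (g n)) (a n) (b n) (p n) (q n)\<bar> \<le> 2 ^ d * \<bar>D n\<bar>" for n
  proof (cases "p n + q n \<le> d")
    case True
    have "\<bar>bil (m n) (coef (g n)) (a n) (b n) (p n) (q n)\<bar> \<le> 2 ^ (p n + q n) * \<bar>D n\<bar>"
      using R[of n] True by (simp add: bil_def c_def P0_def Q0_def D_def P_def Q_def)
    also have "... \<le> 2 ^ d * \<bar>D n\<bar>" using True by (intro mult_right_mono power_increasing) auto
    finally show ?thesis .
  next
    case False
    have "bil (m n) (coef (g n)) (a n) (b n) (p n) (q n) = 0"
      unfolding bil_def
    proof (intro sum.neutral ballI)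
      fix \<alpha> \<beta> assume w: "\<alpha> \<in> {\<alpha> \<in> wds (m n). card \<alpha> = p n}" "\<beta> \<in> {\<beta> \<in> wds (m n). card \<beta> = q n}"
      show "glue (m n) (coef (g n)) \<alpha> \<beta> * a n \<alpha> * b n \<beta> = 0"
        using glue[of n \<alpha> \<beta>] w False unfolding c_def by auto
    qed
    then show ?thesis by simp
  qed
  \<comment> \<open>A word has at most \<open>d\<close> letters, each of weight at most
    \<open>d\<close>, so finitely many weights suffice for all n.\<close>
  define T where "T = {..d * d}"
  define A where "A w n u = (\<Sum>\<alpha>\<in>{\<alpha> \<in> P n. wt \<alpha> = w}. a n \<alpha> * xi \<alpha> u)" for w n u
  define C where "C w n u = (\<Sum>\<beta>\<in>{\<beta> \<in> Q n. wt \<beta> = w}. b n \<beta> * xi \<beta> u)" for w n u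
  have Ab: "A w \<in> bseq w" for w
    unfolding A_def[abs_def]
  proof (rule word_sum_bseq[where C = 1 and m = m])
    show "(\<Sum>S\<in>{\<alpha> \<in> P n. wt \<alpha> = w}. (a n S)^2) \<le> 1" for n
      using Pw[of n] by (intro order_trans[OF sum_mono2 a[of n]] finite_wds) auto
  qed (use Pw in auto)
  have Cb: "C w \<in> bseq w" for w
    unfolding C_def[abs_def]
  proof (rule word_sum_bseq[where C = 1 and m = m])
    show "(\<Sum>S\<in>{\<beta> \<in> Q n. wt \<beta> = w}. (b n S)^2) \<le> 1" for n
      using Qw[of n] by (intro order_trans[OF sum_mono2 b[of n]] finite_wds) auto
  qed (use Qw in auto)
  have cE: "c n \<alpha> \<beta> = a n \<alpha> * b n \<beta> * expectation (\<lambda>u. g n u * (xi \<alpha> u * xi \<beta> u))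
      \<and> (wt \<alpha> + wt \<beta> > k --> expectation (\<lambda>u. g n u * (xi \<alpha> u * xi \<beta> u)) = 0) \<and> 1 \<le> wt \<alpha> \<and> 1 \<le> wt \<beta>"
    if al: "\<alpha> \<in> P n" and be: "\<beta> \<in> Q n" for n \<alpha> \<beta>
  proof -
    have w: "\<alpha> \<in> wds (m n)" "\<beta> \<in> wds (m n)" using Pw Qw al be by blast+
    note fin = wds_finite[OF w(1)] wds_finite[OF w(2)]
    have cards: "card \<alpha> = p n" "card \<beta> = q n" "p n + q n \<le> d" using al be by (auto simp: P_def Q_def P0_def Q0_def)
    have fd: "fst ` \<alpha> \<inter> fst ` \<beta> = {}" using al be by (auto simp: P_def Q_def)
    then have disj': "\<alpha> \<inter> \<beta> = {}" by blast
    have "inj_on fst (\<alpha> \<union> \<beta>)"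
      using w fd unfolding words_def inj_on_Un by auto
    moreover have "card (\<alpha> \<union> \<beta>) \<le> d" using cards card_Un_disjoint[OF fin disj'] by simp
    ultimately have un: "\<alpha> \<union> \<beta> \<in> wds (m n)" using w by (simp add: words_def)
    have ce: "coef (g n) (\<alpha> \<union> \<beta>) = expectation (\<lambda>u. g n u * (xi \<alpha> u * xi \<beta> u))"
      by (simp add: coef_def xi_union[OF fin disj'])
    have "wt (\<alpha> \<union> \<beta>) = wt \<alpha> + wt \<beta>" unfolding wt_def using fin disj' by (intro sum.union_disjoint)
    then have "coef (g n) (\<alpha> \<union> \<beta>) = 0" if "wt \<alpha> + wt \<beta> > k"
      using un that by (intro ordinary_polynomial_words(2)[OF bseq_poly[OF gb] k(2), of "{..<m n}"]) auto
    moreover have "card \<alpha> \<le> wt \<alpha>" "card \<beta> \<le> wt \<beta>"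
      using w fin by (auto intro!: card_le_wt[of _ UNIV] simp: words_def)
    ultimately show ?thesis
      using un disj' ce pq[of n] cards by (simp add: c_def glue_def)
  qed
  have EAC: "expectation (\<lambda>u. g n u * (A w n u * C w' n u)) = (\<Sum>\<alpha>\<in>{\<alpha> \<in> P n. wt \<alpha> = w}. \<Sum>\<beta>\<in>{\<beta> \<in> Q n. wt \<beta> = w'}. c n \<alpha> \<beta>)" for n w w'
  proof -
    have sub: "S \<subseteq> UNIV \<times> K" if "S \<in> P n \<or> S \<in> Q n" for S using that Pw[of n] Qw[of n] by (auto simp: words_def)
    have "expectation (\<lambda>u. g n u * (A w n u * C w' n u)) =
        (\<Sum>\<beta>\<in>{\<beta> \<in> Q n. wt \<beta> = w'}. b n \<beta> * expectation (\<lambda>u. g n u * (A w n u * xi \<beta> u)))"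
      unfolding C_def using fPQ[of n] sub by (intro expectation_word_sum_mult gm bseq_moments[OF Ab]) auto
    also have "... = (\<Sum>\<beta>\<in>{\<beta> \<in> Q n. wt \<beta> = w'}. b n \<beta> * (\<Sum>\<alpha>\<in>{\<alpha> \<in> P n. wt \<alpha> = w}. a n \<alpha> * expectation (\<lambda>u. g n u * (xi \<alpha> u * xi \<beta> u))))"
    proof (intro sum.cong refl arg_cong[where f = "\<lambda>x. _ * x"])
      fix \<beta> assume be: "\<beta> \<in> {\<beta> \<in> Q n. wt \<beta> = w'}"
      have "expectation (\<lambda>u. g n u * (xi \<beta> u * A w n u)) = (\<Sum>\<alpha>\<in>{\<alpha> \<in> P n. wt \<alpha> = w}. a n \<alpha> * expectation (\<lambda>u. g n u * (xi \<beta> u * xi \<alpha> u)))"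
        unfolding A_def using fPQ[of n] sub be by (intro expectation_word_sum_mult gm xi_moments[of \<beta> UNIV]) auto
      then show "expectation (\<lambda>u. g n u * (A w n u * xi \<beta> u)) = (\<Sum>\<alpha>\<in>{\<alpha> \<in> P n. wt \<alpha> = w}. a n \<alpha> * expectation (\<lambda>u. g n u * (xi \<alpha> u * xi \<beta> u)))"
        by (simp add: mult.commute[of "xi \<beta> _"])
    qed
    also have "... = (\<Sum>\<beta>\<in>{\<beta> \<in> Q n. wt \<beta> = w'}. \<Sum>\<alpha>\<in>{\<alpha> \<in> P n. wt \<alpha> = w}. c n \<alpha> \<beta>)"
      unfolding sum_distrib_left using cE by (intro sum.cong refl) (auto simp: mult_ac)
    finally show ?thesis by (subst sum.swap)
  qed
  have Deq: "D n = (\<Sum>w\<in>T. \<Sum>w'\<in>T. expectation (\<lambda>u. g n u * (A w n u * C w' n u)))" for n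
  proof -
    have T: "wt ` P n \<subseteq> T" "wt ` Q n \<subseteq> T" using Pw[of n] Qw[of n] wt_le by (auto simp: T_def)
    have fT: "finite T" by (simp add: T_def)
    have "D n = (\<Sum>w\<in>T. \<Sum>\<alpha>\<in>{\<alpha> \<in> P n. wt \<alpha> = w}. \<Sum>\<beta>\<in>Q n. c n \<alpha> \<beta>)"
      unfolding D_def by (rule sum.group[OF fPQ(1) fT T(1), symmetric])
    also have "... = (\<Sum>w\<in>T. \<Sum>\<alpha>\<in>{\<alpha> \<in> P n. wt \<alpha> = w}. \<Sum>w'\<in>T. \<Sum>\<beta>\<in>{\<beta> \<in> Q n. wt \<beta> = w'}. c n \<alpha> \<beta>)"
      by (intro sum.cong refl sum.group[OF fPQ(2) fT T(2), symmetric])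
    also have "... = (\<Sum>w\<in>T. \<Sum>w'\<in>T. \<Sum>\<alpha>\<in>{\<alpha> \<in> P n. wt \<alpha> = w}. \<Sum>\<beta>\<in>{\<beta> \<in> Q n. wt \<beta> = w'}. c n \<alpha> \<beta>)"
      by (intro sum.cong refl sum.swap)
    finally show ?thesis by (simp add: EAC)
  qed
  have "((\<lambda>n. expectation (\<lambda>u. g n u * (A w n u * C w' n u))) \<longlongrightarrow> 0) U" for w w'
  proof (cases "w + w' \<le> k \<and> 1 \<le> w \<and> 1 \<le> w'")
    case True
    then have "ip g (\<lambda>n u. A w n u * C w' n u) = 0"
      by (intro New_mult[OF g Ab Cb]) auto
    moreover have "((\<lambda>n. expectation (\<lambda>u. g n u * (A w n u * C w' n u))) \<longlongrightarrow> ip g (\<lambda>n u. A w n u * C w' n u)) U"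
      using True by (intro ip_tendsto[OF gb bseq_mult(1)[OF Ab Cb _ k(2)]]) simp
    ultimately show ?thesis by simp
  next
    case False
    have "expectation (\<lambda>u. g n u * (A w n u * C w' n u)) = 0" for n
      unfolding EAC
    proof (intro sum.neutral ballI)
      fix \<alpha> \<beta> assume "\<alpha> \<in> {\<alpha> \<in> P n. wt \<alpha> = w}" "\<beta> \<in> {\<beta> \<in> Q n. wt \<beta> = w'}"
      then show "c n \<alpha> \<beta> = 0" using cE[of \<alpha> n \<beta>] False by auto
    qed
    then show ?thesis by simp
  qed
  then have "((\<lambda>n. \<Sum>w\<in>T. \<Sum>w'\<in>T. expectation (\<lambda>u. g n u * (A w n u * C w' n u))) \<longlongrightarrow> (\<Sum>w\<in>T. \<Sum>w'\<in>T. 0)) U"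
    by (intro tendsto_sum)
  then have "(D \<longlongrightarrow> 0) U" by (simp add: Deq[abs_def])
  then have "((\<lambda>n. 2 ^ d * \<bar>D n\<bar>) \<longlongrightarrow> 2 ^ d * \<bar>0\<bar>) U" by (intro tendsto_intros)
  then have "((\<lambda>n. 2 ^ d * \<bar>D n\<bar>) \<longlongrightarrow> 0) U" by simp
  then show ?thesis by (rule Lim_null_comparison[rotated]) (simp add: bound always_eventually)
qed

text \<open>Uniformity by contradiction: if a bound is not eventual, it fails for U-many n by the
  ultrafilter dichotomy, and violating positions or test vectors chosen for each n form sequences to
  which \<open>New_infl\<close> or \<open>New_bil\<close> applies.\<close>

lemma New_Negl:
  assumes g: "g \<in> New k" and k: "1 \<le> k" "k \<le> d"
  shows "g \<in> Negl"
  unfolding Negl_def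
proof (intro CollectI conjI allI impI)
  have gb: "g \<in> bseq k" using g by (rule New_bseq)
  show "g \<in> bseq d" by (rule bseq_mono[OF gb k(2)])
  have "ip g (\<lambda>n w. 1) = 0" using k by (intro New_lower[OF g bseq_const[of 1 0]]) simp
  then show "((\<lambda>n. expectation (g n)) \<longlongrightarrow> 0) U" using ip_tendsto[OF gb bseq_const[of 1 0]] by simp
  fix e :: real assume e: "e > 0"
  show "eventually (\<lambda>n. infl_le (coef (g n)) e) U"
  proof (rule ccontr)
    assume "\<not> ?thesis"
    then have bad: "eventually (\<lambda>n. \<not> infl_le (coef (g n)) e) U"
      unfolding not_eventually_U .
    \<comment> \<open>The disjunction makes the choice possible for every n, including those where
      nothing is violated.\<close>
    have "\<exists>m i. infl_le (coef (g n)) e \<or> infl m (coef (g n)) i > e" for n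
      unfolding infl_le_def using not_le by blast
    then obtain m i where mi: "\<And>n. infl_le (coef (g n)) e \<or> infl (m n) (coef (g n)) (i n) > e"
      by metis
    have "eventually (\<lambda>n. infl (m n) (coef (g n)) (i n) < e) U"
      by (rule order_tendstoD(2)[OF New_infl[OF g k] e])
    with bad have "eventually (\<lambda>n. False) U"
    proof eventually_elim
      case (elim n)
      then show ?case using mi[of n] by auto
    qed
    then show False using U_nontrivial by (simp add: eventually_False)
  qed
  show "eventually (\<lambda>n. bil_le (coef (g n)) e) U"
  proof (rule ccontr)
    assume "\<not> ?thesis"
    then have bad: "eventually (\<lambda>n. \<not> bil_le (coef (g n)) e) U"
      unfolding not_eventually_U .
    define R where "R n m a b p q \<longleftrightarrow> (\<Sum>S\<in>wds m. (a S)^2) \<le> 1 \<and> (\<Sum>S\<in>wds m. (b S)^2) \<le> 1 \<and> 1 \<le> p \<and> 1 \<le> q \<and>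
      (bil_le (coef (g n)) e \<or> \<bar>bil m (coef (g n)) a b p q\<bar> > e)" for n m a b p q
    have "\<exists>m a b p q. R n m a b p q" for n
    proof (cases "bil_le (coef (g n)) e")
      case False
      then obtain m a b p q where "(\<Sum>S\<in>wds m. (a S)^2) \<le> 1" "(\<Sum>S\<in>wds m. (b S)^2) \<le> 1" "1 \<le> p" "1 \<le> q"
        "\<bar>bil m (coef (g n)) a b p q\<bar> > e"
        unfolding bil_le_def not_all not_imp not_le by blast
      then have "R n m a b p q" by (simp add: R_def)
      then show ?thesis by blast
    next
      case True
      then have "R n 0 (\<lambda>_. 0) (\<lambda>_. 0) 1 1" by (simp add: R_def)
      then show ?thesis by blast
    qed
    then obtain m a b p q where "\<And>n. R n (m n) (a n) (b n) (p n) (q n)" by metis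
    then have ab: "\<And>n. (\<Sum>S\<in>wds (m n). (a n S)^2) \<le> 1" "\<And>n. (\<Sum>S\<in>wds (m n). (b n S)^2) \<le> 1"
      "\<And>n. 1 \<le> p n" "\<And>n. 1 \<le> q n"
      and big: "\<And>n. bil_le (coef (g n)) e \<or> \<bar>bil (m n) (coef (g n)) (a n) (b n) (p n) (q n)\<bar> > e"
      unfolding R_def by blast+
    have "((\<lambda>n. \<bar>bil (m n) (coef (g n)) (a n) (b n) (p n) (q n)\<bar>) \<longlongrightarrow> \<bar>0\<bar>) U"
      by (intro tendsto_rabs New_bil[OF g k ab])
    then have "eventually (\<lambda>n. \<bar>bil (m n) (coef (g n)) (a n) (b n) (p n) (q n)\<bar> < e) U"
      using e by (intro order_tendstoD) auto
    with bad have "eventually (\<lambda>n. False) U"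
    proof eventually_elim
      case (elim n)
      then show ?case using big[of n] by auto
    qed
    then show False using U_nontrivial by (simp add: eventually_False)
  qed
qed

lemma Negl_infl_le: "F \<in> Negl ==> e > 0 ==> eventually (\<lambda>n. infl_le (coef (F n)) e) U"
  by (simp add: Negl_def)

lemma Negl_bil_le: "F \<in> Negl ==> e > 0 ==> eventually (\<lambda>n. bil_le (coef (F n)) e) U"
  by (simp add: Negl_def)

lemma Negl_bseq: "F \<in> Negl ==> F \<in> bseq d"
  by (simp add: Negl_def)

text \<open>With linear combinations again negligible, the joint limit of several remainders reduces
  to that of one sequence, as in the Cramer-Wold device.\<close>

lemma Negl_add:
  assumes F: "F \<in> Negl" and G: "G \<in> Negl" shows "(\<lambda>n w. F n w + G n w) \<in> Negl"
  unfolding Negl_def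
proof (intro CollectI conjI allI impI)
  have Fm: "F n \<in> all_moments M" and Gm: "G n \<in> all_moments M" for n
    using bseq_moments[OF Negl_bseq[OF F]] bseq_moments[OF Negl_bseq[OF G]] by auto
  show "(\<lambda>n w. F n w + G n w) \<in> bseq d" using F G by (intro bseq_add Negl_bseq)
  have "((\<lambda>n. expectation (F n) + expectation (G n)) \<longlongrightarrow> 0 + 0) U"
    using F G by (intro tendsto_add) (auto simp: Negl_def)
  then show "((\<lambda>n. expectation (\<lambda>w. F n w + G n w)) \<longlongrightarrow> 0) U"
    by (simp add: Bochner_Integration.integral_add all_moments_integrable[OF Fm] all_moments_integrable[OF Gm])
  have coef: "coef (\<lambda>w. F n w + G n w) S = coef (F n) S + coef (G n) S" if "S \<in> wds m" for n m S
    by (rule coef_add[OF Fm Gm that])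
  fix e :: real assume e: "e > 0"
  have "eventually (\<lambda>n. infl_le (coef (F n)) (e / 4)) U" "eventually (\<lambda>n. infl_le (coef (G n)) (e / 4)) U"
    using e by (auto intro!: Negl_infl_le F G)
  then show "eventually (\<lambda>n. infl_le (coef (\<lambda>w. F n w + G n w)) (e)) U"
  proof eventually_elim
    case (elim n)
    show ?case unfolding infl_le_def
    proof (intro allI)
      fix m i
      have "infl m (coef (\<lambda>w. F n w + G n w)) i = infl m (\<lambda>S. coef (F n) S + coef (G n) S) i"
        by (intro infl_cong coef)
      also have "... \<le> 2 * infl m (coef (F n)) i + 2 * infl m (coef (G n)) i" by (rule infl_add)
      also have "... \<le> 2 * (e / 4) + 2 * (e / 4)" using elim by (intro add_mono mult_left_mono) (auto simp: infl_le_def)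
      finally show "infl m (coef (\<lambda>w. F n w + G n w)) i \<le> e" by simp
    qed
  qed
  have "eventually (\<lambda>n. bil_le (coef (F n)) (e / 2)) U"
    "eventually (\<lambda>n. bil_le (coef (G n)) (e / 2)) U"
    using e by (auto intro!: Negl_bil_le F G)
  then show "eventually (\<lambda>n. bil_le (coef (\<lambda>w. F n w + G n w)) (e)) U"
  proof eventually_elim
    case (elim n)
    show ?case unfolding bil_le_def
    proof (intro allI impI)
      fix m p q :: nat and a b :: "(nat \<times> nat) set => real"
      assume *: "(\<Sum>S\<in>wds m. (a S)^2) \<le> 1" "(\<Sum>S\<in>wds m. (b S)^2) \<le> 1" "1 \<le> p" "1 \<le> q"
      have "bil m (coef (\<lambda>w. F n w + G n w)) a b p q = bil m (\<lambda>S. coef (F n) S + coef (G n) S) a b p q"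
        by (intro bil_cong coef)
      also have "... = bil m (coef (F n)) a b p q + bil m (coef (G n)) a b p q" by (rule bil_add)
      moreover have "\<bar>bil m (coef (F n)) a b p q\<bar> \<le> e / 2" "\<bar>bil m (coef (G n)) a b p q\<bar> \<le> e / 2"
        using elim * unfolding bil_le_def by blast+
      ultimately show "\<bar>bil m (coef (\<lambda>w. F n w + G n w)) a b p q\<bar> \<le> e" by linarith
    qed
  qed
qed

lemma Negl_scale:
  assumes F: "F \<in> Negl" shows "(\<lambda>n w. c * F n w) \<in> Negl"
  unfolding Negl_def
proof (intro CollectI conjI allI impI)
  show "(\<lambda>n w. c * F n w) \<in> bseq d" using F by (intro bseq_scale Negl_bseq)
  have "((\<lambda>n. c * expectation (F n)) \<longlongrightarrow> c * 0) U"
    using F by (intro tendsto_mult tendsto_const) (auto simp: Negl_def)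
  then show "((\<lambda>n. expectation (\<lambda>w. c * F n w)) \<longlongrightarrow> 0) U" by simp
  have coef: "coef (\<lambda>w. c * F n w) = (\<lambda>S. c * coef (F n) S)" for n
    by (rule ext) (rule coef_scale)
  fix e :: real assume e: "e > 0"
  define e1 where "e1 = e / (c^2 + 1)"
  have pos: "0 < c^2 + 1" using zero_le_power2[of c] by linarith
  have e1: "e1 > 0" using e pos by (simp add: e1_def)
  have e1e: "c^2 * e1 \<le> e" using e pos by (simp add: e1_def field_simps)
  have "eventually (\<lambda>n. infl_le (coef (F n)) (e1)) U" by (rule Negl_infl_le[OF F e1])
  then show "eventually (\<lambda>n. infl_le (coef (\<lambda>w. c * F n w)) (e)) U"
  proof eventually_elim
    case (elim n)
    show ?case unfolding infl_le_def
    proof (intro allI)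
      fix m i
      have "c^2 * infl m (coef (F n)) i \<le> c^2 * e1" using elim by (intro mult_left_mono) (auto simp: infl_le_def)
      then show "infl m (coef (\<lambda>w. c * F n w)) i \<le> e" unfolding coef infl_scale using e1e by linarith
    qed
  qed
  define e2 where "e2 = e / (\<bar>c\<bar> + 1)"
  have e2: "e2 > 0" using e by (simp add: e2_def add_nonneg_pos)
  have e2e: "\<bar>c\<bar> * e2 \<le> e" using e by (simp add: e2_def field_simps)
  have "eventually (\<lambda>n. bil_le (coef (F n)) (e2)) U"
    by (rule Negl_bil_le[OF F e2])
  then show "eventually (\<lambda>n. bil_le (coef (\<lambda>w. c * F n w)) (e)) U"
  proof eventually_elim
    case (elim n)
    show ?case unfolding bil_le_def
    proof (intro allI impI)
      fix m p q :: nat and a b :: "(nat \<times> nat) set => real"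
      assume *: "(\<Sum>S\<in>wds m. (a S)^2) \<le> 1" "(\<Sum>S\<in>wds m. (b S)^2) \<le> 1" "1 \<le> p" "1 \<le> q"
      then have "\<bar>bil m (coef (F n)) a b p q\<bar> \<le> e2" using elim unfolding bil_le_def by blast
      then have "\<bar>c\<bar> * \<bar>bil m (coef (F n)) a b p q\<bar> \<le> \<bar>c\<bar> * e2" by (intro mult_left_mono) auto
      then show "\<bar>bil m (coef (\<lambda>w. c * F n w)) a b p q\<bar> \<le> e"
        unfolding coef bil_scale abs_mult using e2e by linarith
    qed
  qed
qed

end

subsection \<open>A central limit theorem for Walsh polynomials\<close>

lemma sin_diff_le: "\<bar>sin y - y\<bar> \<le> y^2 / 2" for y :: real
  using Maclaurin_sin_bound[of y 2] by (simp add: sin_coeff_def numeral_2_eq_2)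

lemma sin_diff_le3: "\<bar>sin y - y\<bar> \<le> \<bar>y\<bar> ^ 3 / 6" for y :: real
  using Maclaurin_sin_bound[of y 3] by (simp add: sin_coeff_def numeral_3_eq_3)

lemma cos_half: "cos y = 1 - 2 * (sin (y / 2))^2" for y :: real
  using cos_double_sin[of "y / 2"] by simp

lemma cos_minus_1_le: "\<bar>cos y - 1\<bar> \<le> y^2 / 2" for y :: real
proof -
  have "(sin (y / 2))^2 \<le> (y / 2)^2"
    by (rule abs_le_square_iff[THEN iffD1, OF abs_sin_x_le_abs_x])
  then show ?thesis unfolding cos_half[of y] by (simp add: power_divide)
qed

lemma cos_Taylor3: "\<bar>cos y - 1 + y^2 / 2\<bar> \<le> \<bar>y\<bar> ^ 3 / 4" for y :: real
proof -
  have "cos y - 1 + y^2 / 2 = 2 * ((y / 2 - sin (y / 2)) * (y / 2 + sin (y / 2)))"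
    unfolding cos_half[of y] by (simp add: power2_eq_square algebra_simps)
  also have "\<bar>...\<bar> = 2 * (\<bar>sin (y / 2) - y / 2\<bar> * \<bar>y / 2 + sin (y / 2)\<bar>)"
    by (simp add: abs_mult abs_minus_commute)
  also have "... \<le> 2 * ((y / 2)^2 / 2 * \<bar>y\<bar>)"
  proof (intro mult_left_mono mult_mono sin_diff_le)
    show "\<bar>y / 2 + sin (y / 2)\<bar> \<le> \<bar>y\<bar>" using abs_sin_x_le_abs_x[of "y / 2"] by linarith
  qed auto
  also have "... = \<bar>y\<bar> ^ 3 / 4" by (simp add: power2_eq_square power3_eq_cube abs_mult_self_eq)
  finally show ?thesis .
qed

lemma cos_expand2: "\<bar>cos (x + y) - cos x + y * sin x\<bar> \<le> y^2" for x y :: real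
proof -
  have "cos (x + y) - cos x + y * sin x = cos x * (cos y - 1) - sin x * (sin y - y)"
    by (simp add: cos_add algebra_simps)
  also have "\<bar>...\<bar> \<le> \<bar>cos x\<bar> * \<bar>cos y - 1\<bar> + \<bar>sin x\<bar> * \<bar>sin y - y\<bar>"
    unfolding abs_mult[symmetric] by (rule abs_triangle_ineq4)
  also have "... \<le> 1 * (y^2 / 2) + 1 * (y^2 / 2)"
    by (intro add_mono mult_mono cos_minus_1_le sin_diff_le abs_cos_le_one abs_sin_le_one) auto
  finally show ?thesis by simp
qed

lemma cos_expand3: "\<bar>cos (x + y) - (cos x - y * sin x - y^2 / 2 * cos x)\<bar> \<le> \<bar>y\<bar> ^ 3" for x y :: real
proof -
  have "cos (x + y) - (cos x - y * sin x - y^2 / 2 * cos x) = cos x * (cos y - 1 + y^2 / 2) - sin x * (sin y - y)"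
    by (simp add: cos_add algebra_simps)
  also have "\<bar>...\<bar> \<le> \<bar>cos x\<bar> * \<bar>cos y - 1 + y^2 / 2\<bar> + \<bar>sin x\<bar> * \<bar>sin y - y\<bar>"
    unfolding abs_mult[symmetric] by (rule abs_triangle_ineq4)
  also have "... \<le> 1 * (\<bar>y\<bar> ^ 3 / 4) + 1 * (\<bar>y\<bar> ^ 3 / 6)"
    by (intro add_mono mult_mono cos_Taylor3 sin_diff_le3 abs_cos_le_one abs_sin_le_one) auto
  also have "... \<le> \<bar>y\<bar> ^ 3" using zero_le_power[of "\<bar>y\<bar>" 3] by simp
  finally show ?thesis .
qed

lemma cos_lipschitz: "\<bar>cos x - cos y\<bar> \<le> \<bar>x - y\<bar>" for x y :: real
proof -
  have "\<bar>cos x - cos y\<bar> = 2 * (\<bar>sin ((x + y) / 2)\<bar> * \<bar>sin ((y - x) / 2)\<bar>)"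
    by (simp add: cos_diff_cos abs_mult)
  also have "... \<le> 2 * (1 * \<bar>(y - x) / 2\<bar>)"
    by (intro mult_left_mono mult_mono abs_sin_x_le_abs_x abs_sin_le_one) auto
  finally show ?thesis by (simp add: abs_minus_commute)
qed

section \<open>Multilinear polynomials in random signs\<close>

locale walsh = indep_reals N W for N :: "'w measure" and W :: "'c => 'w => real" +
  fixes x :: "'c => 'w => real" and \<Lambda> :: "'c set"
  assumes x_sig: "\<And>l. l \<in> \<Lambda> ==> x l \<in> borel_measurable (sig {l})"
    and x_pm: "\<And>l w. l \<in> \<Lambda> ==> x l w = 1 \<or> x l w = -1"
    and x_mean: "\<And>l. l \<in> \<Lambda> ==> expectation (x l) = 0"
begin

definition xs :: "'c set => 'w => real" where "xs S w = (\<Prod>l\<in>S. x l w)"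

definition wsum :: "'c set => ('c set => real) => 'w => real" where
  "wsum L f w = (\<Sum>S\<in>Pow L. f S * xs S w)"

lemma x_abs: "l \<in> \<Lambda> ==> \<bar>x l w\<bar> = 1"
  using x_pm[of l w] by auto

lemma x_square: "l \<in> \<Lambda> ==> x l w * x l w = 1"
  using x_pm[of l w] by auto

lemma xs_abs: "S \<subseteq> \<Lambda> ==> \<bar>xs S w\<bar> \<le> 1"
  unfolding xs_def abs_prod using x_abs by (intro prod_le_1) (auto simp: subset_eq)

lemma xs_sig: "S \<subseteq> A ==> A \<subseteq> \<Lambda> ==> xs S \<in> borel_measurable (sig A)"
proof -
  assume S: "S \<subseteq> A" "A \<subseteq> \<Lambda>"
  have "x l \<in> borel_measurable (sig A)" if "l \<in> S" for l
    using that S by (intro sig_mono[OF _ x_sig[of l]]) auto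
  then show ?thesis unfolding xs_def by (intro borel_measurable_prod)
qed

lemma xs_moments: "S \<subseteq> \<Lambda> ==> xs S \<in> all_moments N"
  using xs_abs[of S] sig_measurable[OF xs_sig[of S \<Lambda>]]
  by (intro all_moments_bounded[OF finite_measure_axioms, of _ 1]) auto

lemma x_moments: "l \<in> \<Lambda> ==> x l \<in> all_moments N"
  using xs_moments[of "{l}"] by (simp add: xs_def[abs_def])

lemma wsum_sig: "L \<subseteq> \<Lambda> ==> wsum L f \<in> borel_measurable (sig L)"
  unfolding wsum_def by (intro borel_measurable_sum borel_measurable_times borel_measurable_const xs_sig) auto

lemma wsum_moments: "L \<subseteq> \<Lambda> ==> wsum L f \<in> all_moments N"
  unfolding wsum_def by (intro all_moments_closed xs_moments) auto

lemma xs_insert: "finite S ==> l \<notin> S ==> xs (insert l S) w = x l w * xs S w"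
  by (simp add: xs_def)

text \<open>Common signs square to 1 and cancel, which leaves the symmetric difference. With general
  letters the product of two monomials could leave the span of monomials.\<close>

lemma xs_mult:
  assumes "finite S" "finite T" "S \<subseteq> \<Lambda>"
  shows "xs S w * xs T w = xs ((S - T) \<union> (T - S)) w"
proof -
  have "xs S w = xs (S - T) w * xs (S \<inter> T) w" "xs T w = xs (T - S) w * xs (S \<inter> T) w"
    unfolding xs_def using assms
    by (subst prod.union_disjoint[symmetric]; auto intro!: prod.cong)+
  moreover have "xs (S \<inter> T) w * xs (S \<inter> T) w = 1"
    unfolding xs_def prod.distrib[symmetric] using assms by (intro prod.neutral) (auto simp: x_square)
  moreover have "xs ((S - T) \<union> (T - S)) w = xs (S - T) w * xs (T - S) w"
    unfolding xs_def using assms by (intro prod.union_disjoint) auto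
  ultimately show ?thesis by (simp add: mult_ac)
qed

lemma expectation_x_mult:
  assumes "l \<in> \<Lambda>" "l \<notin> A" "F \<in> borel_measurable (sig A)" "F \<in> all_moments N"
  shows "expectation (\<lambda>w. x l w * F w) = 0"
  using expectation_mult_sig[OF _ x_sig[OF assms(1)] assms(3) x_moments[OF assms(1)] assms(4)] x_mean[OF assms(1)] assms(2)
  by simp

lemma expectation_xs:
  assumes "finite S" "S \<subseteq> \<Lambda>"
  shows "expectation (xs S) = (if S = {} then 1 else 0)"
proof (cases "S = {}")
  case True
  then show ?thesis by (simp add: xs_def[abs_def] prob_space)
next
  case False
  then obtain l where l: "l \<in> S" by blast
  have "expectation (xs S) = expectation (\<lambda>w. x l w * xs (S - {l}) w)"
    using xs_insert[of "S - {l}" l] assms l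
    by (intro Bochner_Integration.integral_cong refl) (simp add: insert_absorb)
  also have "... = 0" using assms l
    by (intro expectation_x_mult[of l "S - {l}"] xs_sig xs_moments) auto
  finally show ?thesis using False by simp
qed

lemma expectation_xs_mult:
  assumes "finite S" "finite T" "S \<subseteq> \<Lambda>" "T \<subseteq> \<Lambda>"
  shows "expectation (\<lambda>w. xs S w * xs T w) = (if S = T then 1 else 0)"
proof -
  have "expectation (\<lambda>w. xs S w * xs T w) = expectation (xs ((S - T) \<union> (T - S)))"
    using xs_mult[OF assms(1-3)] by simp
  also have "... = (if (S - T) \<union> (T - S) = {} then 1 else 0)"
    using assms by (intro expectation_xs) auto
  also have "(S - T) \<union> (T - S) = {} \<longleftrightarrow> S = T" by blast
  finally show ?thesis .
qed

lemma expectation_wsum_square: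
  assumes "finite L" "L \<subseteq> \<Lambda>"
  shows "expectation (\<lambda>w. (wsum L f w)^2) = (\<Sum>S\<in>Pow L. (f S)^2)"
proof -
  have S: "S \<in> Pow L ==> finite S \<and> S \<subseteq> \<Lambda>" for S using assms finite_subset by auto
  have "expectation (\<lambda>w. (wsum L f w)^2) = expectation (\<lambda>w. \<Sum>S\<in>Pow L. \<Sum>T\<in>Pow L. (f S * f T) * (xs S w * xs T w))"
    unfolding power2_eq_square wsum_def sum_product by (simp add: mult_ac)
  also have "... = (\<Sum>S\<in>Pow L. expectation (\<lambda>w. \<Sum>T\<in>Pow L. (f S * f T) * (xs S w * xs T w)))"
    by (intro Bochner_Integration.integral_sum all_moments_integrable all_moments_closed xs_moments) (use S in auto)
  also have "... = (\<Sum>S\<in>Pow L. \<Sum>T\<in>Pow L. expectation (\<lambda>w. (f S * f T) * (xs S w * xs T w)))"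
    by (intro sum.cong refl Bochner_Integration.integral_sum all_moments_integrable all_moments_closed xs_moments) (use S in auto)
  also have "... = (\<Sum>S\<in>Pow L. \<Sum>T\<in>Pow L. if S = T then f S * f T else 0)"
    using S by (intro sum.cong refl) (simp add: expectation_xs_mult)
  also have "... = (\<Sum>S\<in>Pow L. f S * f S)" using assms by simp
  finally show ?thesis by (simp add: power2_eq_square)
qed

text \<open>The fibres of \<open>(\<alpha>, \<beta>) \<mapsto> \<alpha> \<union> \<beta>\<close> have at most \<open>2 ^ (p + q)\<close> elements.\<close>

lemma expectation_pair_sum_square_le:
  assumes L: "finite L" "L \<subseteq> \<Lambda>" and D: "finite D"
    and "\<And>\<alpha> \<beta>. (\<alpha>, \<beta>) \<in> D ==> \<alpha> \<subseteq> L \<and> \<beta> \<subseteq> L \<and> \<alpha> \<inter> \<beta> = {} \<and> card \<alpha> + card \<beta> \<le> n"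
  shows "expectation (\<lambda>w. (\<Sum>(\<alpha>, \<beta>)\<in>D. c \<alpha> \<beta> * xs (\<alpha> \<union> \<beta>) w)^2) \<le> 2 ^ n * (\<Sum>(\<alpha>, \<beta>)\<in>D. (c \<alpha> \<beta>)^2)"
proof -
  define fib where "fib u = {t \<in> D. fst t \<union> snd t = u}" for u
  define z where "z u = (\<Sum>t\<in>fib u. c (fst t) (snd t))" for u
  have sub: "(\<lambda>t. fst t \<union> snd t) ` D \<subseteq> Pow L" using assms(4) by force
  have fP: "finite (Pow L)" using L by simp
  have "(\<Sum>(\<alpha>, \<beta>)\<in>D. c \<alpha> \<beta> * xs (\<alpha> \<union> \<beta>) w) = wsum L z w" for w
  proof -
    have "(\<Sum>(\<alpha>, \<beta>)\<in>D. c \<alpha> \<beta> * xs (\<alpha> \<union> \<beta>) w) = (\<Sum>u\<in>Pow L. \<Sum>t\<in>fib u. c (fst t) (snd t) * xs (fst t \<union> snd t) w)"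
      unfolding fib_def case_prod_beta by (rule sum.group[OF D fP sub, symmetric])
    also have "... = (\<Sum>u\<in>Pow L. z u * xs u w)"
      unfolding z_def sum_distrib_right by (intro sum.cong refl) (auto simp: fib_def)
    finally show ?thesis by (simp add: wsum_def)
  qed
  then have "expectation (\<lambda>w. (\<Sum>(\<alpha>, \<beta>)\<in>D. c \<alpha> \<beta> * xs (\<alpha> \<union> \<beta>) w)^2) = (\<Sum>u\<in>Pow L. (z u)^2)"
    using expectation_wsum_square[OF L, of z] by simp
  also have "... \<le> (\<Sum>u\<in>Pow L. 2 ^ n * (\<Sum>t\<in>fib u. (c (fst t) (snd t))^2))"
  proof (intro sum_mono)
    fix u assume u: "u \<in> Pow L"
    have fu: "finite u" using u L finite_subset by blast
    have "(z u)^2 \<le> (\<Sum>t\<in>fib u. 1^2) * (\<Sum>t\<in>fib u. (c (fst t) (snd t))^2)"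
      unfolding z_def using Cauchy_Schwarz_ineq_sum[of "\<lambda>_. 1" "\<lambda>t. c (fst t) (snd t)" "fib u"] by simp
    also have "... \<le> 2 ^ n * (\<Sum>t\<in>fib u. (c (fst t) (snd t))^2)"
    proof (intro mult_right_mono sum_nonneg)
      have "real (card (fib u)) \<le> 2 ^ n"
      proof (cases "fib u = {}")
        case False
        then obtain t where t: "t \<in> D" "fst t \<union> snd t = u" by (auto simp: fib_def)
        have ab: "fst t \<inter> snd t = {}" "card (fst t) + card (snd t) \<le> n" "fst t \<subseteq> L" "snd t \<subseteq> L"
          using assms(4)[of "fst t" "snd t"] t(1) by auto
        have "card u = card (fst t) + card (snd t)"
          unfolding t(2)[symmetric] using ab L finite_subset by (intro card_Un_disjoint) auto
        then have cu: "card u \<le> n" using ab by simp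
        have snd_eq: "snd s = u - fst s" if "s \<in> fib u" for s
        proof -
          have "fst s \<inter> snd s = {}" "fst s \<union> snd s = u"
            using that assms(4)[of "fst s" "snd s"] by (auto simp: fib_def)
          then show ?thesis by blast
        qed
        have "inj_on fst (fib u)"
        proof (rule inj_onI)
          fix s t assume st: "s \<in> fib u" "t \<in> fib u" "fst s = fst t"
          then show "s = t" using snd_eq[OF st(1)] snd_eq[OF st(2)] by (simp add: prod_eq_iff)
        qed
        then have "card (fib u) = card (fst ` fib u)" by (simp add: card_image)
        also have "... \<le> card (Pow u)" using fu by (intro card_mono) (auto simp: fib_def)
        finally have "card (fib u) \<le> 2 ^ card u" using fu by (simp add: card_Pow)
        also have "(2::nat) ^ card u \<le> 2 ^ n" using cu by (intro power_increasing) auto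
        finally have "real (card (fib u)) \<le> real (2 ^ n)" by (simp only: of_nat_le_iff)
        then show ?thesis by simp
      qed simp
      then show "(\<Sum>t\<in>fib u. 1^2) \<le> (2::real) ^ n" by simp
    qed simp
    finally show "(z u)^2 \<le> 2 ^ n * (\<Sum>t\<in>fib u. (c (fst t) (snd t))^2)" .
  qed
  also have "... = 2 ^ n * (\<Sum>u\<in>Pow L. \<Sum>t\<in>fib u. (c (fst t) (snd t))^2)" by (simp add: sum_distrib_left)
  also have "(\<Sum>u\<in>Pow L. \<Sum>t\<in>fib u. (c (fst t) (snd t))^2) = (\<Sum>(\<alpha>, \<beta>)\<in>D. (c \<alpha> \<beta>)^2)"
    unfolding fib_def case_prod_beta by (rule sum.group[OF D fP sub])
  finally show ?thesis .
qed

end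

section \<open>Counting disjoint pairs and pointed sets\<close>

lemma sum_disjoint_pairs_le:
  fixes \<phi> :: "'c set => real"
  assumes "finite L" "\<And>S. \<phi> S \<ge> 0" "\<And>S. card S > d ==> \<phi> S = 0"
  shows "(\<Sum>\<beta>\<in>Pow L. \<Sum>V\<in>{V \<in> Pow L. \<beta> \<inter> V = {}}. \<phi> (\<beta> \<union> V)) \<le> 2 ^ d * (\<Sum>S\<in>Pow L. \<phi> S)"
proof -
  have "(\<Sum>\<beta>\<in>Pow L. \<Sum>V\<in>{V \<in> Pow L. \<beta> \<inter> V = {}}. \<phi> (\<beta> \<union> V)) = (\<Sum>t\<in>(SIGMA \<beta>:Pow L. {V \<in> Pow L. \<beta> \<inter> V = {}}). \<phi> (fst t \<union> snd t))"
    using assms(1) by (subst sum.Sigma) (auto simp: case_prod_beta)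
  also have "... = (\<Sum>t\<in>(SIGMA S:Pow L. Pow S). \<phi> (fst t))"
    by (rule sum.reindex_bij_witness[of _ "\<lambda>t. (snd t, fst t - snd t)" "\<lambda>t. (fst t \<union> snd t, fst t)"]) auto
  also have "... = (\<Sum>S\<in>Pow L. \<Sum>T\<in>Pow S. \<phi> S)"
    using assms(1) finite_subset by (subst sum.Sigma) (auto simp: case_prod_beta)
  also have "... \<le> (\<Sum>S\<in>Pow L. 2 ^ d * \<phi> S)"
  proof (intro sum_mono)
    fix S assume S: "S \<in> Pow L"
    then have fS: "finite S" using assms(1) finite_subset by blast
    show "(\<Sum>T\<in>Pow S. \<phi> S) \<le> 2 ^ d * \<phi> S"
    proof (cases "card S \<le> d")
      case True
      have "(2::real) ^ card S \<le> 2 ^ d" using True by (intro power_increasing) auto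
      then show ?thesis using fS assms(2)[of S] by (simp add: card_Pow mult_right_mono)
    next
      case False
      then show ?thesis using assms(3)[of S] by simp
    qed
  qed
  finally show ?thesis by (simp add: sum_distrib_left)
qed

text \<open>Both sides run over pointed sets: \<open>(l, S)\<close> corresponds to the set
  \<open>insert l S\<close> with marked point l.\<close>

lemma sum_pointed:
  fixes \<phi> :: "'c => 'c set => real"
  assumes "finite L"
  shows "(\<Sum>l\<in>L. \<Sum>S\<in>Pow (L - {l}). \<phi> l (insert l S)) = (\<Sum>T\<in>Pow L. \<Sum>l\<in>T. \<phi> l T)"
proof -
  have "(\<Sum>l\<in>L. \<Sum>S\<in>Pow (L - {l}). \<phi> l (insert l S)) = (\<Sum>t\<in>(SIGMA l:L. Pow (L - {l})). \<phi> (fst t) (insert (fst t) (snd t)))"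
    using assms by (subst sum.Sigma) (auto simp: case_prod_beta)
  also have "... = (\<Sum>t\<in>(SIGMA T:Pow L. T). \<phi> (snd t) (fst t))"
    by (rule sum.reindex_bij_witness[of _ "\<lambda>t. (snd t, fst t - {snd t})" "\<lambda>t. (insert (fst t) (snd t), fst t)"])
      (auto simp: insert_absorb)
  also have "... = (\<Sum>T\<in>Pow L. \<Sum>l\<in>T. \<phi> l T)"
    using assms finite_subset by (subst sum.Sigma) (auto simp: case_prod_beta)
  finally show ?thesis .
qed

text \<open>\<tau> bounds the operator norms of the flattenings of \<open>f\<close>, and
  \<open>mx\<close> the largest influence. The fourth moment bound for the derivatives is a
  hypothesis with constant \<open>H^2\<close>, to be filled in from the hypercontractivity of word
  sums.\<close>

locale walsh_polynomial = walsh N W x \<Lambda>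
  for N :: "'w measure" and W :: "'c => 'w => real" and x \<Lambda> +
  fixes L :: "'c set" and f :: "'c set => real" and d :: nat and \<tau> mx H :: real
  assumes L: "finite L" "L \<subseteq> \<Lambda>"
    and f_empty: "f {} = 0"
    and f_deg: "\<And>S. card S > d ==> f S = 0"
    and tau: "\<tau> \<ge> 0"
    and contraction: "\<And>p q b. 1 \<le> p ==> 1 \<le> q ==>
      (\<Sum>\<alpha>\<in>{\<alpha> \<in> Pow L. card \<alpha> = p}. (\<Sum>V\<in>{V \<in> Pow L. card V = q \<and> \<alpha> \<inter> V = {}}. f (\<alpha> \<union> V) * b V)^2) \<le> \<tau>^2 * (\<Sum>V\<in>Pow L. (b V)^2)"
    and influence: "\<And>l. l \<in> L ==> (\<Sum>S\<in>Pow (L - {l}). (f (insert l S))^2) \<le> mx"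
    and fourth: "\<And>l. l \<in> L ==> expectation (\<lambda>w. wsum (L - {l}) (\<lambda>S. f (insert l S)) w ^ 4) \<le>
      H^2 * (\<Sum>S\<in>Pow (L - {l}). (f (insert l S))^2)^2"
    and H: "H \<ge> 0"
begin

definition \<sigma>2 :: real where "\<sigma>2 = (\<Sum>S\<in>Pow L. (f S)^2)"

definition F :: "'w => real" where "F = wsum L f"

definition D0 :: "'c => 'w => real" where "D0 l = wsum (L - {l}) f"

definition D1 :: "'c => 'w => real" where "D1 l = wsum (L - {l}) (\<lambda>S. f (insert l S))"

text \<open>The discrete derivative of what results from \<open>F\<close> by the inverse of the
  number operator, the operator that multiplies the monomial of S by \<open>card S\<close>.\<close>

definition D1' :: "'c => 'w => real" where
  "D1' l = wsum (L - {l}) (\<lambda>S. f (insert l S) / real (card (insert l S)))"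

text \<open>The carre du champ of Stein's method, pairing the derivative of \<open>F\<close> with
  that of the inverse number operator applied to \<open>F\<close>. Its mean is the variance of
  \<open>F\<close>, and its fluctuations measure the distance to a Gaussian.\<close>

definition \<Gamma> :: "'w => real" where "\<Gamma> w = (\<Sum>l\<in>L. D1' l w * D1 l w)"

definition P3 :: "('c set \<times> 'c set \<times> 'c set) set" where
  "P3 = {(\<alpha>, \<beta>, V). \<alpha> \<subseteq> L \<and> \<beta> \<subseteq> L \<and> V \<subseteq> L \<and> \<alpha> \<inter> \<beta> = {} \<and> \<alpha> \<inter> V = {} \<and> \<beta> \<inter> V = {}}"

lemma finite_sub: "S \<subseteq> L ==> finite S"
  using L finite_subset by blast

lemma finite_P3: "finite P3"
  by (rule finite_subset[of _ "Pow L \<times> Pow L \<times> Pow L"]) (use L in \<open>auto simp: P3_def\<close>)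

lemma F_split: "l \<in> L ==> F w = D0 l w + x l w * D1 l w"
proof -
  assume l: "l \<in> L"
  have PL: "Pow L = Pow (L - {l}) \<union> insert l ` Pow (L - {l})"
    using Pow_insert[of l "L - {l}"] l by (simp add: insert_absorb)
  have inj: "inj_on (insert l) (Pow (L - {l}))" by (rule inj_onI) blast
  have "F w = D0 l w + (\<Sum>S\<in>insert l ` Pow (L - {l}). f S * xs S w)"
    unfolding F_def D0_def wsum_def PL using L by (intro sum.union_disjoint) auto
  also have "(\<Sum>S\<in>insert l ` Pow (L - {l}). f S * xs S w) = (\<Sum>S\<in>Pow (L - {l}). f (insert l S) * (x l w * xs S w))"
    unfolding sum.reindex[OF inj] comp_def using finite_sub by (intro sum.cong refl arg_cong2[where f = "(*)"] xs_insert) auto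
  finally show ?thesis by (simp add: D1_def wsum_def sum_distrib_left mult_ac)
qed

text \<open>Each nonempty set is produced once by each of its points, which the factor
  \<open>1 / card\<close> compensates; the empty set is absent as \<open>f {} = 0\<close>.\<close>

lemma F_eq_sum: "F w = (\<Sum>l\<in>L. x l w * D1' l w)"
proof -
  have "(\<Sum>l\<in>L. x l w * D1' l w) = (\<Sum>l\<in>L. \<Sum>S\<in>Pow (L - {l}). f (insert l S) / real (card (insert l S)) * xs (insert l S) w)"
    unfolding D1'_def wsum_def sum_distrib_left
  proof (intro sum.cong refl)
    fix l S assume "l \<in> L" "S \<in> Pow (L - {l})"
    then have "finite S" "l \<notin> S" using finite_sub by auto
    then show "x l w * (f (insert l S) / real (card (insert l S)) * xs S w) = f (insert l S) / real (card (insert l S)) * xs (insert l S) w"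
      by (simp add: xs_insert)
  qed
  also have "... = (\<Sum>T\<in>Pow L. \<Sum>l\<in>T. f T / real (card T) * xs T w)"
    by (rule sum_pointed[OF L(1)])
  also have "... = (\<Sum>T\<in>Pow L. f T * xs T w)"
  proof (intro sum.cong refl)
    fix T assume "T \<in> Pow L"
    then show "(\<Sum>l\<in>T. f T / real (card T) * xs T w) = f T * xs T w"
      using f_empty finite_sub[of T] by (cases "T = {}") auto
  qed
  finally show ?thesis by (simp add: F_def wsum_def)
qed

lemma sum_influence: "(\<Sum>l\<in>L. \<Sum>S\<in>Pow (L - {l}). (f (insert l S))^2) \<le> real d * \<sigma>2"
proof -
  have "(\<Sum>l\<in>L. \<Sum>S\<in>Pow (L - {l}). (f (insert l S))^2) = (\<Sum>T\<in>Pow L. \<Sum>l\<in>T. (f T)^2)"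
    by (rule sum_pointed[OF L(1)])
  also have "... \<le> (\<Sum>T\<in>Pow L. real d * (f T)^2)"
  proof (intro sum_mono)
    fix T
    show "(\<Sum>l\<in>T. (f T)^2) \<le> real d * (f T)^2"
      using f_deg[of T] by (cases "card T \<le> d") (auto intro: mult_right_mono)
  qed
  finally show ?thesis by (simp add: \<sigma>2_def sum_distrib_left)
qed

definition g :: "'w => 'c set \<times> 'c set \<times> 'c set => real" where
  "g w = (\<lambda>(\<alpha>, \<beta>, V). real (card V) / real (card \<alpha> + card V) * (f (\<alpha> \<union> V) * f (\<beta> \<union> V)) * xs (\<alpha> \<union> \<beta>) w)"

text \<open>Two sets containing l are coded by their private parts \<alpha>, \<beta> and the common
  part V, which contains l. The common signs cancel, and the sum over l in V gives the factor
  \<open>card V\<close>.\<close>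

lemma \<Gamma>_expand: "\<Gamma> w = (\<Sum>t\<in>P3. g w t)"
proof -
  define \<psi> where "\<psi> l S T = f (insert l S) / real (card (insert l S)) * f (insert l T) * (xs S w * xs T w)" for l S T
  have "\<Gamma> w = (\<Sum>l\<in>L. \<Sum>S\<in>Pow (L - {l}). \<Sum>T\<in>Pow (L - {l}). \<psi> l S T)"
    unfolding \<Gamma>_def D1_def D1'_def wsum_def sum_product \<psi>_def by (simp add: mult_ac)
  also have "... = (\<Sum>(l, S, T)\<in>(SIGMA l:L. Pow (L - {l}) \<times> Pow (L - {l})). \<psi> l S T)"
    using L by (simp add: sum.Sigma sum.cartesian_product case_prod_beta)
  also have "... = (\<Sum>((\<alpha>, \<beta>, V), l)\<in>(SIGMA t:P3. snd (snd t)). f (\<alpha> \<union> V) / real (card \<alpha> + card V) * f (\<beta> \<union> V) * xs (\<alpha> \<union> \<beta>) w)"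
  proof (rule sum.reindex_bij_witness[of _ "\<lambda>((\<alpha>, \<beta>, V), l). (l, \<alpha> \<union> (V - {l}), \<beta> \<union> (V - {l}))"
        "\<lambda>(l, S, T). ((S - T, T - S, insert l (S \<inter> T)), l)"], goal_cases)
    case (1 t)
    then show ?case by auto
  next
    case (2 t)
    then show ?case by (auto simp: P3_def)
  next
    case (3 t)
    then obtain \<alpha> \<beta> V l where t: "t = ((\<alpha>, \<beta>, V), l)" "l \<in> V" "(\<alpha>, \<beta>, V) \<in> P3" by auto
    have "(\<alpha> \<union> (V - {l})) - (\<beta> \<union> (V - {l})) = \<alpha>" "(\<beta> \<union> (V - {l})) - (\<alpha> \<union> (V - {l})) = \<beta>"
      "insert l ((\<alpha> \<union> (V - {l})) \<inter> (\<beta> \<union> (V - {l}))) = V" using t(2,3) by (auto simp: P3_def)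
    then show ?case by (simp add: t(1))
  next
    case (4 t)
    then show ?case by (auto simp: P3_def)
  next
    case (5 t)
    then obtain l S T where t: "t = (l, S, T)" "l \<in> L" "S \<subseteq> L - {l}" "T \<subseteq> L - {l}" by auto
    have fin: "finite S" "finite T" using t by (auto intro!: finite_sub)
    have e1: "(S - T) \<union> insert l (S \<inter> T) = insert l S" "(T - S) \<union> insert l (S \<inter> T) = insert l T" by auto
    have e2: "card (S - T) + card (insert l (S \<inter> T)) = card (insert l S)"
      unfolding e1(1)[symmetric] using t fin by (intro card_Un_disjoint[symmetric]) auto
    have "xs S w * xs T w = xs ((S - T) \<union> (T - S)) w"
      using fin t L by (intro xs_mult) auto
    moreover have "real (card (S - T)) + real (card (insert l (S \<inter> T))) = real (card (insert l S))"
      unfolding e2[symmetric] by simp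
    ultimately show ?case by (simp add: t(1) \<psi>_def e1 del: Un_insert_right)
  qed
  also have "... = (\<Sum>t\<in>(SIGMA t:P3. snd (snd t)). f (fst (fst t) \<union> snd (snd (fst t))) / real (card (fst (fst t)) + card (snd (snd (fst t)))) *
      f (fst (snd (fst t)) \<union> snd (snd (fst t))) * xs (fst (fst t) \<union> fst (snd (fst t))) w)"
    by (simp add: case_prod_beta)
  also have "... = (\<Sum>t\<in>P3. \<Sum>l\<in>snd (snd t). f (fst t \<union> snd (snd t)) / real (card (fst t) + card (snd (snd t))) *
      f (fst (snd t) \<union> snd (snd t)) * xs (fst t \<union> fst (snd t)) w)"
    using finite_P3 finite_sub by (subst sum.Sigma) (auto simp: P3_def case_prod_beta)
  also have "... = (\<Sum>t\<in>P3. g w t)"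
    by (intro sum.cong refl) (auto simp: g_def)
  finally show ?thesis .
qed

end

lemma square_div_abs: "t \<noteq> 0 ==> t^2 * C / \<bar>t\<bar> = \<bar>t\<bar> * C" for t C :: real
  by (cases "t > 0") (auto simp: power2_eq_square)

lemma square_div_nat_le:
  assumes "1 \<le> n" shows "(y / real n)^2 \<le> y^2"
proof -
  have "1 \<le> (real n)^2" using assms by (simp add: one_le_power)
  then have "y^2 * 1 \<le> y^2 * (real n)^2" by (intro mult_left_mono) auto
  then show ?thesis using assms by (simp add: power_divide divide_le_eq)
qed

section \<open>Concentration of \<open>\<Gamma>\<close> around the variance\<close>

context walsh_polynomial
begin

text \<open>The kernel of the contraction of \<open>f\<close> with itself over v common
  variables.\<close>

definition cc :: "nat => 'c set => 'c set => real" where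
  "cc v \<alpha> \<beta> = (\<Sum>V\<in>{V \<in> Pow L. card V = v \<and> \<alpha> \<inter> V = {} \<and> \<beta> \<inter> V = {}}. f (\<alpha> \<union> V) * f (\<beta> \<union> V))"

definition DD :: "nat => nat => ('c set \<times> 'c set) set" where
  "DD p q = {(\<alpha>, \<beta>). \<alpha> \<subseteq> L \<and> \<beta> \<subseteq> L \<and> \<alpha> \<inter> \<beta> = {} \<and> card \<alpha> = p \<and> card \<beta> = q}"

definition Z :: "nat \<times> nat \<times> nat => 'w => real" where
  "Z = (\<lambda>(p, q, v) w. \<Sum>(\<alpha>, \<beta>)\<in>DD p q. cc v \<alpha> \<beta> * xs (\<alpha> \<union> \<beta>) w)"

text \<open>The possible sizes of private and common parts. The case \<open>p = q = 0\<close> is the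
  diagonal, which produces \<sigma>2, and terms with \<open>v = 0\<close> have coefficient
  0.\<close>

definition J :: "(nat \<times> nat \<times> nat) set" where
  "J = {(p, q, v). p \<le> d \<and> q \<le> d \<and> 1 \<le> v \<and> v \<le> d \<and> 1 \<le> p + q}"

lemma finite_DD: "finite (DD p q)"
  by (rule finite_subset[of _ "Pow L \<times> Pow L"]) (use L in \<open>auto simp: DD_def\<close>)

lemma finite_J: "finite J" and card_J: "card J \<le> (d + 1) ^ 3"
proof -
  have sub: "J \<subseteq> {..d} \<times> {..d} \<times> {..d}" by (auto simp: J_def)
  then show "finite J" by (rule finite_subset) simp
  have "card J \<le> card ({..d} \<times> {..d} \<times> {..d})" using sub by (intro card_mono) auto
  then show "card J \<le> (d + 1) ^ 3" by (simp add: card_cartesian_product numeral_3_eq_3)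
qed

lemma \<sigma>2_nonneg: "\<sigma>2 \<ge> 0"
  by (simp add: \<sigma>2_def sum_nonneg)

lemma cc_sym: "cc v \<alpha> \<beta> = cc v \<beta> \<alpha>"
  unfolding cc_def by (intro sum.cong) (auto simp: mult.commute)

text \<open>For fixed \<beta> the function \<open>f (\<beta> \<union> V)\<close> of V is a test
  vector for the contraction hypothesis; the sum of its squared norms over \<beta> counts each set
  at most \<open>2 ^ d\<close> times.\<close>

lemma cc_sum_le:
  assumes "1 \<le> p" "1 \<le> v"
  shows "(\<Sum>\<beta>\<in>Pow L. \<Sum>\<alpha>\<in>{\<alpha> \<in> Pow L. card \<alpha> = p}. (cc v \<alpha> \<beta>)^2) \<le> \<tau>^2 * (2 ^ d * \<sigma>2)"
proof -
  have "(\<Sum>\<beta>\<in>Pow L. \<Sum>\<alpha>\<in>{\<alpha> \<in> Pow L. card \<alpha> = p}. (cc v \<alpha> \<beta>)^2) \<le>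
      (\<Sum>\<beta>\<in>Pow L. \<tau>^2 * (\<Sum>V\<in>{V \<in> Pow L. \<beta> \<inter> V = {}}. (f (\<beta> \<union> V))^2))"
  proof (intro sum_mono)
    fix \<beta> assume "\<beta> \<in> Pow L"
    define b where "b V = (if \<beta> \<inter> V = {} then f (\<beta> \<union> V) else 0)" for V
    have "cc v \<alpha> \<beta> = (\<Sum>V\<in>{V \<in> Pow L. card V = v \<and> \<alpha> \<inter> V = {}}. f (\<alpha> \<union> V) * b V)" for \<alpha>
      unfolding cc_def b_def by (intro sum.mono_neutral_cong_left) (use L in auto)
    then have "(\<Sum>\<alpha>\<in>{\<alpha> \<in> Pow L. card \<alpha> = p}. (cc v \<alpha> \<beta>)^2) \<le> \<tau>^2 * (\<Sum>V\<in>Pow L. (b V)^2)"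
      using contraction[OF assms, of b] by simp
    also have "(\<Sum>V\<in>Pow L. (b V)^2) = (\<Sum>V\<in>{V \<in> Pow L. \<beta> \<inter> V = {}}. (f (\<beta> \<union> V))^2)"
      unfolding b_def by (intro sum.mono_neutral_cong_right) (use L in auto)
    finally show "(\<Sum>\<alpha>\<in>{\<alpha> \<in> Pow L. card \<alpha> = p}. (cc v \<alpha> \<beta>)^2) \<le> \<tau>^2 * (\<Sum>V\<in>{V \<in> Pow L. \<beta> \<inter> V = {}}. (f (\<beta> \<union> V))^2)" .
  qed
  also have "... = \<tau>^2 * (\<Sum>\<beta>\<in>Pow L. \<Sum>V\<in>{V \<in> Pow L. \<beta> \<inter> V = {}}. (f (\<beta> \<union> V))^2)" by (simp add: sum_distrib_left)
  also have "... \<le> \<tau>^2 * (2 ^ d * \<sigma>2)"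
    unfolding \<sigma>2_def using L(1) f_deg by (intro mult_left_mono sum_disjoint_pairs_le) auto
  finally show ?thesis .
qed

lemma sum_DD_le:
  assumes "1 \<le> p + q" "1 \<le> v"
  shows "(\<Sum>(\<alpha>, \<beta>)\<in>DD p q. (cc v \<alpha> \<beta>)^2) \<le> \<tau>^2 * (2 ^ d * \<sigma>2)"
proof (cases "1 \<le> p")
  case True
  have "(\<Sum>(\<alpha>, \<beta>)\<in>DD p q. (cc v \<alpha> \<beta>)^2) \<le> (\<Sum>(\<alpha>, \<beta>)\<in>{\<alpha> \<in> Pow L. card \<alpha> = p} \<times> Pow L. (cc v \<alpha> \<beta>)^2)"
    using L by (intro sum_mono2) (auto simp: DD_def)
  also have "... = (\<Sum>\<alpha>\<in>{\<alpha> \<in> Pow L. card \<alpha> = p}. \<Sum>\<beta>\<in>Pow L. (cc v \<alpha> \<beta>)^2)" by (simp add: sum.cartesian_product)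
  also have "... = (\<Sum>\<beta>\<in>Pow L. \<Sum>\<alpha>\<in>{\<alpha> \<in> Pow L. card \<alpha> = p}. (cc v \<alpha> \<beta>)^2)" by (rule sum.swap)
  also have "... \<le> \<tau>^2 * (2 ^ d * \<sigma>2)" by (rule cc_sum_le[OF True assms(2)])
  finally show ?thesis .
next
  case False
  then have q: "1 \<le> q" using assms(1) by simp
  have "(\<Sum>(\<alpha>, \<beta>)\<in>DD p q. (cc v \<alpha> \<beta>)^2) \<le> (\<Sum>(\<alpha>, \<beta>)\<in>Pow L \<times> {\<beta> \<in> Pow L. card \<beta> = q}. (cc v \<alpha> \<beta>)^2)"
    using L by (intro sum_mono2) (auto simp: DD_def)
  also have "... = (\<Sum>\<alpha>\<in>Pow L. \<Sum>\<beta>\<in>{\<beta> \<in> Pow L. card \<beta> = q}. (cc v \<beta> \<alpha>)^2)"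
    by (simp add: sum.cartesian_product cc_sym[of v])
  also have "... \<le> \<tau>^2 * (2 ^ d * \<sigma>2)" by (rule cc_sum_le[OF q assms(2)])
  finally show ?thesis .
qed

lemma \<Gamma>_decompose: "\<Gamma> w - \<sigma>2 = (\<Sum>(p, q, v)\<in>J. real v / real (p + v) * Z (p, q, v) w)"
proof -
  define cards :: "'c set \<times> 'c set \<times> 'c set => nat \<times> nat \<times> nat" where
    "cards = (\<lambda>(\<alpha>, \<beta>, V). (card \<alpha>, card \<beta>, card V))"
  \<comment> \<open>The diagonal part: for empty \<alpha> and \<beta> the ratio of cardinalities is
    1 and the signs disappear. For empty V the ratio is \<open>0 / 0 = 0\<close>, in agreement with
    \<open>f {} = 0\<close>.\<close>
  define e :: "'c set \<times> 'c set \<times> 'c set => real" where "e = (\<lambda>(\<alpha>, \<beta>, V). if \<alpha> = {} \<and> \<beta> = {} then (f V)^2 else (0::real))"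
  have split: "g w t = e t + (if cards t \<in> J then g w t else 0)" if "t \<in> P3" for t
  proof -
    obtain \<alpha> \<beta> V where t: "t = (\<alpha>, \<beta>, V)" by (cases t) auto
    have sub: "\<alpha> \<subseteq> L" "\<beta> \<subseteq> L" "V \<subseteq> L" using that by (auto simp: t P3_def)
    note fin = finite_sub[OF sub(1)] finite_sub[OF sub(2)] finite_sub[OF sub(3)]
    show ?thesis
    proof (cases "\<alpha> = {} \<and> \<beta> = {}")
      case True
      have "g w t = (f V)^2"
        using True fin(3) f_empty by (cases "V = {}") (auto simp: t g_def xs_def power2_eq_square)
      then show ?thesis using True by (simp add: t e_def cards_def J_def)
    next
      case False
      then have pq: "1 \<le> card \<alpha> + card \<beta>" using fin(1,2) by (cases "\<alpha> = {}") (auto simp: Suc_le_eq card_gt_0_iff)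
      have "g w t = 0" if nJ: "cards t \<notin> J"
      proof -
        consider "card \<alpha> > d" | "card \<beta> > d" | "card V > d" | "card V = 0"
          using nJ pq unfolding cards_def t J_def by fastforce
        then have "f (\<alpha> \<union> V) = 0 \<or> f (\<beta> \<union> V) = 0 \<or> card V = 0"
        proof cases
          case 1
          have "card \<alpha> \<le> card (\<alpha> \<union> V)" using fin by (intro card_mono) auto
          with 1 have "f (\<alpha> \<union> V) = 0" by (intro f_deg) simp
          then show ?thesis by simp
        next
          case 2
          have "card \<beta> \<le> card (\<beta> \<union> V)" using fin by (intro card_mono) auto
          with 2 have "f (\<beta> \<union> V) = 0" by (intro f_deg) simp
          then show ?thesis by simp
        next
          case 3
          have "card V \<le> card (\<alpha> \<union> V)" using fin by (intro card_mono) auto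
          with 3 have "f (\<alpha> \<union> V) = 0" by (intro f_deg) simp
          then show ?thesis by simp
        qed simp
        then show ?thesis by (auto simp: t g_def)
      qed
      moreover have "e t = 0" using False by (auto simp: e_def t)
      ultimately show ?thesis by simp
    qed
  qed
  have "\<Gamma> w = (\<Sum>t\<in>P3. e t) + (\<Sum>t\<in>P3. if cards t \<in> J then g w t else 0)"
    unfolding \<Gamma>_expand sum.distrib[symmetric] by (intro sum.cong refl split)
  also have "(\<Sum>t\<in>P3. e t) = \<sigma>2"
  proof -
    have "(\<Sum>t\<in>P3. e t) = (\<Sum>t\<in>(\<lambda>V. ({}, {}, V)) ` Pow L. e t)"
      using finite_P3 by (intro sum.mono_neutral_right) (auto simp: P3_def e_def)
    also have "... = (\<Sum>V\<in>Pow L. e ({}, {}, V))" by (subst sum.reindex) (auto simp: inj_on_def)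
    finally show ?thesis by (simp add: e_def \<sigma>2_def)
  qed
  finally have "\<Gamma> w - \<sigma>2 = (\<Sum>t\<in>P3. if cards t \<in> J then g w t else 0)" by simp
  also have "... = (\<Sum>t\<in>{t \<in> P3. cards t \<in> J}. g w t)" by (rule sum.inter_filter[OF finite_P3, symmetric])
  also have "... = (\<Sum>j\<in>J. \<Sum>t\<in>{t \<in> {t \<in> P3. cards t \<in> J}. cards t = j}. g w t)"
    using finite_P3 by (intro sum.group[symmetric] finite_J) auto
  also have "... = (\<Sum>j\<in>J. (case j of (p, q, v) => real v / real (p + v) * Z (p, q, v) w))"
  proof (intro sum.cong refl)
    fix j assume j: "j \<in> J"
    obtain p q v where j': "j = (p, q, v)" by (cases j) auto
    define Vs where "Vs = (\<lambda>(\<alpha>, \<beta>). {V \<in> Pow L. card V = v \<and> \<alpha> \<inter> V = {} \<and> \<beta> \<inter> V = {}})"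
    have "(\<Sum>t\<in>{t \<in> {t \<in> P3. cards t \<in> J}. cards t = j}. g w t) =
        (\<Sum>t\<in>(SIGMA u:DD p q. Vs u). g w (fst (fst t), snd (fst t), snd t))"
      by (rule sum.reindex_bij_witness[of _ "\<lambda>t. (fst (fst t), snd (fst t), snd t)" "\<lambda>t. ((fst t, fst (snd t)), snd (snd t))"])
        (use j in \<open>auto simp: j' cards_def P3_def DD_def Vs_def\<close>)
    also have "... = (\<Sum>u\<in>DD p q. \<Sum>V\<in>Vs u. g w (fst u, snd u, V))"
      using finite_DD L by (subst sum.Sigma) (auto simp: Vs_def case_prod_beta)
    also have "... = (\<Sum>u\<in>DD p q. real v / real (p + v) * (cc v (fst u) (snd u) * xs (fst u \<union> snd u) w))"
    proof (intro sum.cong refl)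
      fix u assume u: "u \<in> DD p q"
      have "(\<Sum>V\<in>Vs u. g w (fst u, snd u, V)) = (\<Sum>V\<in>Vs u. real v / real (p + v) * ((f (fst u \<union> V) * f (snd u \<union> V)) * xs (fst u \<union> snd u) w))"
        using u by (intro sum.cong refl) (auto simp: g_def Vs_def DD_def case_prod_beta)
      then show "(\<Sum>V\<in>Vs u. g w (fst u, snd u, V)) = real v / real (p + v) * (cc v (fst u) (snd u) * xs (fst u \<union> snd u) w)"
        by (simp add: cc_def Vs_def case_prod_beta sum_distrib_left sum_distrib_right)
    qed
    finally show "(\<Sum>t\<in>{t \<in> {t \<in> P3. cards t \<in> J}. cards t = j}. g w t) = (case j of (p, q, v) => real v / real (p + v) * Z (p, q, v) w)"
      by (simp add: j' Z_def case_prod_beta sum_distrib_left)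
  qed
  finally show ?thesis .
qed

lemma Z_moments: "Z j \<in> all_moments N"
proof -
  obtain p q v where j: "j = (p, q, v)" by (cases j) auto
  show ?thesis unfolding j Z_def case_prod_conv case_prod_beta
    by (intro all_moments_closed xs_moments) (use L in \<open>auto simp: DD_def\<close>)
qed

text \<open>\<open>8 ^ d\<close> collects \<open>2 ^ (p + q)\<close> with
  \<open>p, q \<le> d\<close> from the fibres of the union map and \<open>2 ^ d\<close> from
  \<open>cc_sum_le\<close>.\<close>

lemma Z_square_le:
  assumes "j \<in> J" shows "expectation (\<lambda>w. (Z j w)^2) \<le> 8 ^ d * (\<tau>^2 * \<sigma>2)"
proof -
  obtain p q v where j: "j = (p, q, v)" by (cases j) auto
  have pqv: "p \<le> d" "q \<le> d" "1 \<le> v" "1 \<le> p + q" using assms by (auto simp: j J_def)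
  have "expectation (\<lambda>w. (Z j w)^2) \<le> 2 ^ (p + q) * (\<Sum>(\<alpha>, \<beta>)\<in>DD p q. (cc v \<alpha> \<beta>)^2)"
    unfolding j Z_def case_prod_conv by (intro expectation_pair_sum_square_le[OF L finite_DD]) (auto simp: DD_def)
  also have "... \<le> 2 ^ (d + d) * (\<tau>^2 * (2 ^ d * \<sigma>2))"
    using pqv by (intro mult_mono sum_DD_le power_increasing) (auto intro!: sum_nonneg)
  also have "... = 8 ^ d * (\<tau>^2 * \<sigma>2)"
  proof -
    have "(8::real) ^ d = 2 ^ d * 2 ^ d * 2 ^ d" by (simp add: power_mult_distrib[symmetric])
    then show ?thesis by (simp add: power_add)
  qed
  finally show ?thesis .
qed

lemma D_moments: "l \<in> L ==> D0 l \<in> all_moments N" "l \<in> L ==> D1 l \<in> all_moments N" "l \<in> L ==> D1' l \<in> all_moments N"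
  unfolding D0_def D1_def D1'_def using L by (auto intro!: wsum_moments)

lemma F_moments: "F \<in> all_moments N"
  unfolding F_def using L by (intro wsum_moments)

lemma \<Gamma>_moments: "\<Gamma> \<in> all_moments N"
  unfolding \<Gamma>_def by (intro all_moments_closed D_moments)

lemma \<Gamma>_deviation: "sqrt (expectation (\<lambda>w. (\<Gamma> w - \<sigma>2)^2)) \<le> real (d + 1) ^ 3 * 8 ^ d * \<tau> * sqrt \<sigma>2"
proof -
  have pt: "(\<Gamma> w - \<sigma>2)^2 \<le> real (card J) * (\<Sum>j\<in>J. (Z j w)^2)" for w
  proof -
    have "(\<Gamma> w - \<sigma>2)^2 = (\<Sum>j\<in>J. 1 * (real (snd (snd j)) / real (fst j + snd (snd j)) * Z j w))^2"
      by (simp add: \<Gamma>_decompose case_prod_beta)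
    also have "... \<le> (\<Sum>j\<in>J. 1^2) * (\<Sum>j\<in>J. (real (snd (snd j)) / real (fst j + snd (snd j)) * Z j w)^2)"
      by (rule Cauchy_Schwarz_ineq_sum)
    also have "... \<le> (\<Sum>j\<in>J. 1^2) * (\<Sum>j\<in>J. (Z j w)^2)"
    proof (intro mult_left_mono sum_mono)
      fix j :: "nat \<times> nat \<times> nat"
      have "(real (snd (snd j)) / real (fst j + snd (snd j)))^2 \<le> 1"
        by (intro power_le_one) (auto simp: divide_le_eq_1)
      then show "(real (snd (snd j)) / real (fst j + snd (snd j)) * Z j w)^2 \<le> (Z j w)^2"
        unfolding power_mult_distrib by (intro mult_left_le_one_le) auto
    qed (simp add: sum_nonneg)
    finally show ?thesis by simp
  qed
  have iZ: "integrable N (\<lambda>w. (Z j w)^2)" for j by (intro all_moments_integrable all_moments_closed Z_moments)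
  have "expectation (\<lambda>w. (\<Gamma> w - \<sigma>2)^2) \<le> expectation (\<lambda>w. real (card J) * (\<Sum>j\<in>J. (Z j w)^2))"
    by (intro integral_mono all_moments_integrable all_moments_closed \<Gamma>_moments Z_moments pt)
  also have "... = real (card J) * (\<Sum>j\<in>J. expectation (\<lambda>w. (Z j w)^2))"
    using iZ by (simp add: Bochner_Integration.integral_sum)
  also have "... \<le> real (card J) * (\<Sum>j\<in>J. 8 ^ d * (\<tau>^2 * \<sigma>2))"
    by (intro mult_left_mono sum_mono Z_square_le) auto
  also have "... = (real (card J))^2 * (8 ^ d * (\<tau>^2 * \<sigma>2))" by (simp add: power2_eq_square)
  also have "... \<le> (real (d + 1) ^ 3)^2 * ((8 ^ d)^2 * (\<tau>^2 * \<sigma>2))"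
  proof (intro mult_mono power_mono)
    have "real (card J) \<le> real ((d + 1) ^ 3)" using card_J by (simp only: of_nat_le_iff)
    then show "real (card J) \<le> real (d + 1) ^ 3" by (simp only: of_nat_power)
    show "(8::real) ^ d \<le> (8 ^ d)^2" by (simp add: power2_eq_square)
  qed (auto simp: \<sigma>2_nonneg tau)
  also have "... = (real (d + 1) ^ 3 * 8 ^ d * \<tau> * sqrt \<sigma>2)^2"
    using \<sigma>2_nonneg by (simp add: power_mult_distrib)
  finally show ?thesis
    by (intro real_le_lsqrt mult_nonneg_nonneg tau real_sqrt_ge_zero \<sigma>2_nonneg) auto
qed

lemma D1'_square_le: "l \<in> L ==> expectation (\<lambda>w. (D1' l w)^2) \<le> mx"
proof -
  assume l: "l \<in> L"
  have "expectation (\<lambda>w. (D1' l w)^2) = (\<Sum>S\<in>Pow (L - {l}). (f (insert l S) / real (card (insert l S)))^2)"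
    unfolding D1'_def using L by (intro expectation_wsum_square) auto
  also have "... \<le> (\<Sum>S\<in>Pow (L - {l}). (f (insert l S))^2)"
  proof (intro sum_mono)
    fix S assume "S \<in> Pow (L - {l})"
    then have "finite (insert l S)" using l by (intro finite_sub) auto
    then have "1 \<le> card (insert l S)" by (simp add: Suc_le_eq card_gt_0_iff)
    then show "(f (insert l S) / real (card (insert l S)))^2 \<le> (f (insert l S))^2" by (rule square_div_nat_le)
  qed
  also have "... \<le> mx" by (rule influence[OF l])
  finally show ?thesis .
qed

section \<open>Stein's identity on the cube and its integration\<close>

lemma trig_moments:
  assumes "G \<in> all_moments N"
  shows "(\<lambda>w. cos (G w)) \<in> all_moments N" "(\<lambda>w. sin (G w)) \<in> all_moments N"
  using all_moments_measurable[OF assms]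
  by (auto intro!: all_moments_bounded[OF finite_measure_axioms, of _ 1])

text \<open>Integration by parts in each sign. With \<open>F\<close> split at \<open>l\<close> into
  \<open>D0\<close> and the sign times \<open>D1\<close>, the addition formula for the sine is exact
  for signs, and the part that keeps a factor \<open>x l\<close> averages out. What remains,
  \<open>R l\<close>, differs from \<open>Q l\<close> by a Taylor error of order
  \<open>D1' * D1^2\<close>; Cauchy-Schwarz bounds its mean by the root of \<open>mx\<close>, the
  constant \<open>H\<close> and the influence of \<open>l\<close>.\<close>

lemma stein:
  assumes s: "0 \<le> s" "s \<le> 1"
  shows "\<bar>expectation (\<lambda>w. F w * sin (s * F w + c)) - s * expectation (\<lambda>w. \<Gamma> w * cos (s * F w + c))\<bar>
    \<le> 2 * sqrt mx * H * (real d * \<sigma>2)"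
proof -
  define R where "R l = (\<lambda>w. D1' l w * (cos (s * D0 l w + c) * sin (s * D1 l w)))" for l
  define Q where "Q l = (\<lambda>w. s * (D1' l w * D1 l w) * cos (s * F w + c))" for l
  have sF: "(\<lambda>w. s * F w + c) \<in> all_moments N" by (intro all_moments_closed F_moments)
  have sD: "l \<in> L ==> (\<lambda>w. s * D0 l w + c) \<in> all_moments N" "l \<in> L ==> (\<lambda>w. s * D1 l w) \<in> all_moments N" for l
    by (intro all_moments_closed D_moments; assumption)+
  have Rm: "l \<in> L ==> R l \<in> all_moments N" for l
    unfolding R_def by (intro all_moments_closed D_moments trig_moments sD)
  have Qm: "l \<in> L ==> Q l \<in> all_moments N" for l
    unfolding Q_def by (intro all_moments_closed D_moments trig_moments sF)
  have ER: "expectation (\<lambda>w. x l w * D1' l w * sin (s * F w + c)) = expectation (R l)" if l: "l \<in> L" for l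
  proof -
    have l\<Lambda>: "l \<in> \<Lambda>" using l L by blast
    define T where "T w = D1' l w * (sin (s * D0 l w + c) * cos (s * D1 l w))" for w
    have Tm: "T \<in> all_moments N"
      unfolding T_def by (intro all_moments_closed D_moments trig_moments sD l)
    have Ts: "T \<in> borel_measurable (sig (L - {l}))"
    proof -
      have [measurable]: "D0 l \<in> borel_measurable (sig (L - {l}))" "D1 l \<in> borel_measurable (sig (L - {l}))"
        "D1' l \<in> borel_measurable (sig (L - {l}))"
        unfolding D0_def D1_def D1'_def using L by (auto intro!: wsum_sig)
      show ?thesis unfolding T_def by measurable
    qed
    have pt: "x l w * D1' l w * sin (s * F w + c) = x l w * T w + R l w" for w
    proof -
      define u y where "u = s * D0 l w + c" and "y = s * D1 l w"
      have "s * F w + c = u + x l w * y" by (simp add: F_split[OF l] u_def y_def algebra_simps)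
      moreover have "sin (u + x l w * y) = sin u * cos y + x l w * (cos u * sin y)"
        using x_pm[OF l\<Lambda>, of w] by (auto simp: sin_add sin_diff)
      ultimately have "x l w * D1' l w * sin (s * F w + c) =
          x l w * (D1' l w * (sin u * cos y)) + (x l w * x l w) * (D1' l w * (cos u * sin y))"
        by (simp add: distrib_left mult_ac)
      then show ?thesis by (simp add: x_square[OF l\<Lambda>] T_def R_def u_def y_def)
    qed
    have "expectation (\<lambda>w. x l w * D1' l w * sin (s * F w + c)) = expectation (\<lambda>w. x l w * T w) + expectation (R l)"
      unfolding pt by (intro Bochner_Integration.integral_add all_moments_integrable all_moments_closed x_moments l\<Lambda> Tm Rm l)
    also have "expectation (\<lambda>w. x l w * T w) = 0"
      by (rule expectation_x_mult[OF l\<Lambda> _ Ts Tm]) simp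
    finally show ?thesis by simp
  qed
  have "expectation (\<lambda>w. F w * sin (s * F w + c)) = expectation (\<lambda>w. \<Sum>l\<in>L. x l w * D1' l w * sin (s * F w + c))"
    by (intro Bochner_Integration.integral_cong refl) (simp add: F_eq_sum sum_distrib_right)
  also have "... = (\<Sum>l\<in>L. expectation (\<lambda>w. x l w * D1' l w * sin (s * F w + c)))"
    by (intro Bochner_Integration.integral_sum all_moments_integrable all_moments_closed x_moments D_moments trig_moments sF)
      (use L in auto)
  also have "... = (\<Sum>l\<in>L. expectation (R l))" by (intro sum.cong refl ER)
  finally have 1: "expectation (\<lambda>w. F w * sin (s * F w + c)) = (\<Sum>l\<in>L. expectation (R l))" .
  have "s * expectation (\<lambda>w. \<Gamma> w * cos (s * F w + c)) = expectation (\<lambda>w. \<Sum>l\<in>L. Q l w)"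
    by (simp add: \<Gamma>_def Q_def sum_distrib_left sum_distrib_right mult.assoc flip: integral_mult_right_zero)
  also have "... = (\<Sum>l\<in>L. expectation (Q l))"
    by (intro Bochner_Integration.integral_sum all_moments_integrable Qm)
  finally have 2: "s * expectation (\<lambda>w. \<Gamma> w * cos (s * F w + c)) = (\<Sum>l\<in>L. expectation (Q l))" .
  have each: "\<bar>expectation (R l) - expectation (Q l)\<bar> \<le> 2 * sqrt mx * H * (\<Sum>S\<in>Pow (L - {l}). (f (insert l S))^2)" if l: "l \<in> L" for l
  proof -
    let ?a = "\<Sum>S\<in>Pow (L - {l}). (f (insert l S))^2"
    have l\<Lambda>: "l \<in> \<Lambda>" using l L by blast
    have pt: "\<bar>R l w - Q l w\<bar> \<le> 2 * \<bar>D1' l w * (D1 l w)^2\<bar>" for w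
    proof -
      define u y where "u = s * D0 l w + c" and "y = s * D1 l w"
      have sFu: "s * F w + c = u + x l w * y" by (simp add: F_split[OF l] u_def y_def algebra_simps)
      have "R l w - Q l w = D1' l w * (cos u * (sin y - y) + y * (cos u - cos (u + x l w * y)))"
      proof -
        have Rv: "R l w = D1' l w * (cos u * sin y)" by (simp add: R_def u_def y_def)
        have Qv: "Q l w = D1' l w * (y * cos (u + x l w * y))" unfolding Q_def sFu by (simp add: y_def)
        show ?thesis unfolding Rv Qv by (simp only: right_diff_distrib[symmetric] distrib_left[symmetric]) (simp add: algebra_simps)
      qed
      then have "\<bar>R l w - Q l w\<bar> = \<bar>D1' l w\<bar> * \<bar>cos u * (sin y - y) + y * (cos u - cos (u + x l w * y))\<bar>"
        by (simp add: abs_mult)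
      also have "\<bar>cos u * (sin y - y) + y * (cos u - cos (u + x l w * y))\<bar> \<le> \<bar>cos u\<bar> * \<bar>sin y - y\<bar> + \<bar>y\<bar> * \<bar>cos u - cos (u + x l w * y)\<bar>"
        unfolding abs_mult[symmetric] by (rule abs_triangle_ineq)
      also have "... \<le> 1 * (y^2 / 2) + \<bar>y\<bar> * \<bar>y\<bar>"
      proof (intro add_mono mult_mono order_refl abs_cos_le_one sin_diff_le)
        have "\<bar>cos u - cos (u + x l w * y)\<bar> \<le> \<bar>u - (u + x l w * y)\<bar>" by (rule cos_lipschitz)
        also have "... = \<bar>y\<bar>" by (simp add: abs_mult x_abs[OF l\<Lambda>])
        finally show "\<bar>cos u - cos (u + x l w * y)\<bar> \<le> \<bar>y\<bar>" .
      qed auto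
      also have "... \<le> 2 * y^2" by (simp add: power2_eq_square)
      also have "2 * y^2 \<le> 2 * (D1 l w)^2"
      proof -
        have "s^2 \<le> 1" using s by (simp add: power_le_one)
        then have "s^2 * (D1 l w)^2 \<le> (D1 l w)^2" by (intro mult_left_le_one_le) auto
        then show ?thesis by (simp add: y_def power_mult_distrib)
      qed
      finally have "\<bar>R l w - Q l w\<bar> \<le> \<bar>D1' l w\<bar> * (2 * (D1 l w)^2)" by (simp add: mult_left_mono)
      then show ?thesis by (simp add: abs_mult)
    qed
    have "\<bar>expectation (R l) - expectation (Q l)\<bar> = \<bar>expectation (\<lambda>w. R l w - Q l w)\<bar>"
      by (simp add: Bochner_Integration.integral_diff all_moments_integrable[OF Rm[OF l]] all_moments_integrable[OF Qm[OF l]])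
    also have "... \<le> expectation (\<lambda>w. \<bar>R l w - Q l w\<bar>)" by (rule integral_abs_bound)
    also have "... \<le> expectation (\<lambda>w. 2 * \<bar>D1' l w * (D1 l w)^2\<bar>)"
      by (intro integral_mono pt all_moments_integrable all_moments_abs all_moments_closed Rm Qm D_moments l)
    also have "... = 2 * expectation (\<lambda>w. \<bar>D1' l w * (D1 l w)^2\<bar>)" by simp
    also have "... \<le> 2 * (sqrt (expectation (\<lambda>w. (D1' l w)^2)) * sqrt (expectation (\<lambda>w. ((D1 l w)^2)^2)))"
      by (intro mult_left_mono Cauchy_Schwarz_abs all_moments_closed D_moments l) auto
    also have "... \<le> 2 * (sqrt mx * (H * ?a))"
    proof (intro mult_left_mono mult_mono real_sqrt_le_mono D1'_square_le l)
      have "expectation (\<lambda>w. ((D1 l w)^2)^2) \<le> (H * ?a)^2"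
        using fourth[OF l] by (simp add: D1_def power_mult_distrib power_mult[symmetric])
      then show "sqrt (expectation (\<lambda>w. ((D1 l w)^2)^2)) \<le> H * ?a"
        using H by (intro real_le_lsqrt) (auto intro!: mult_nonneg_nonneg sum_nonneg)
      have "0 \<le> expectation (\<lambda>w. (D1' l w)^2)" by simp
      then show "0 \<le> sqrt mx" using D1'_square_le[OF l] by (intro real_sqrt_ge_zero) linarith
    qed (auto simp: H)
    finally show ?thesis by (simp add: mult_ac)
  qed
  have "\<bar>expectation (\<lambda>w. F w * sin (s * F w + c)) - s * expectation (\<lambda>w. \<Gamma> w * cos (s * F w + c))\<bar>
      = \<bar>\<Sum>l\<in>L. expectation (R l) - expectation (Q l)\<bar>" by (simp add: 1 2 sum_subtractf)
  also have "... \<le> (\<Sum>l\<in>L. 2 * sqrt mx * H * (\<Sum>S\<in>Pow (L - {l}). (f (insert l S))^2))"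
    by (intro order_trans[OF sum_abs] sum_mono each)
  also have "... = 2 * sqrt mx * H * (\<Sum>l\<in>L. \<Sum>S\<in>Pow (L - {l}). (f (insert l S))^2)" by (simp add: sum_distrib_left)
  also have "... \<le> 2 * sqrt mx * H * (real d * \<sigma>2)"
  proof (cases "L = {}")
    case True
    then have "\<sigma>2 = 0" unfolding \<sigma>2_def using f_empty by simp
    then show ?thesis using True by simp
  next
    case False
    then obtain l where l: "l \<in> L" by blast
    have "0 \<le> (\<Sum>S\<in>Pow (L - {l}). (f (insert l S))^2)" by (intro sum_nonneg) simp
    then have "0 \<le> mx" using influence[OF l] by linarith
    then show ?thesis using H sum_influence by (intro mult_left_mono) auto
  qed
  finally show ?thesis .
qed

text \<open>The function \<open>a\<close> interpolates from \<open>cos c\<close> at 0 to the wanted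
  mean at 1. Stein's identity and the concentration of \<open>\<Gamma>\<close> make it an
  approximate solution of \<open>a' = - s * \<sigma>2 * a\<close>, which the factor
  \<open>exp (s^2 * \<sigma>2 / 2)\<close> integrates; the exponential growth of the error cancels
  when this factor is divided out at \<open>s = 1\<close>.\<close>

theorem walsh_clt:
  shows "\<bar>expectation (\<lambda>w. cos (F w + c)) - cos c * exp (- \<sigma>2 / 2)\<bar>
    \<le> real (d + 1) ^ 3 * 8 ^ d * \<tau> * sqrt \<sigma>2 + 2 * sqrt mx * H * (real d * \<sigma>2)"
proof -
  define \<eta> where "\<eta> = real (d + 1) ^ 3 * 8 ^ d * \<tau> * sqrt \<sigma>2 + 2 * sqrt mx * H * (real d * \<sigma>2)"
  define a where "a s = expectation (\<lambda>w. cos (s * F w + c))" for s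
  define a' where "a' s = - expectation (\<lambda>w. F w * sin (s * F w + c))" for s
  have sF: "(\<lambda>w. s * F w + c) \<in> all_moments N" for s by (intro all_moments_closed F_moments)
  \<comment> \<open>Differentiation under the mean: \<open>cos_expand2\<close> bounds the error of
    the difference quotient by \<open>\<bar>t\<bar>\<close> times the second moment of
    \<open>F\<close>.\<close>
  have deriv: "(a has_real_derivative a' s) (at s)" for s
  proof -
    let ?C = "expectation (\<lambda>w. (F w)^2)"
    have bound: "\<bar>(a (s + t) - a s) / t - a' s\<bar> \<le> \<bar>t\<bar> * ?C" if "t \<noteq> 0" for t
    proof -
      have i: "integrable N (\<lambda>w. cos ((s + t) * F w + c))" "integrable N (\<lambda>w. cos (s * F w + c))"
        "integrable N (\<lambda>w. F w * sin (s * F w + c))"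
        by (intro all_moments_integrable trig_moments all_moments_closed sF F_moments)+
      define G where "G w = cos ((s + t) * F w + c) - cos (s * F w + c) + t * (F w * sin (s * F w + c))" for w
      have eq: "a (s + t) - a s - t * a' s = expectation G"
        using i by (simp add: a_def a'_def G_def[abs_def])
      have iG: "integrable N G" unfolding G_def[abs_def]
        by (intro Bochner_Integration.integrable_add Bochner_Integration.integrable_diff
            Bochner_Integration.integrable_mult_right i)
      have pt: "\<bar>G w\<bar> \<le> t^2 * (F w)^2" for w
      proof -
        have "(s + t) * F w + c = (s * F w + c) + t * F w" by (simp add: distrib_right)
        then show ?thesis
          using cos_expand2[of "s * F w + c" "t * F w"] unfolding G_def by (simp only: power_mult_distrib mult.assoc)
      qed
      have "expectation (\<lambda>w. \<bar>G w\<bar>) \<le> expectation (\<lambda>w. t^2 * (F w)^2)"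
        by (intro integral_mono integrable_abs iG pt all_moments_integrable all_moments_closed F_moments)
      then have "expectation (\<lambda>w. \<bar>G w\<bar>) \<le> t^2 * ?C" by simp
      with integral_abs_bound[of N G] have "\<bar>expectation G\<bar> \<le> t^2 * ?C" by (rule order_trans)
      then have "\<bar>a (s + t) - a s - t * a' s\<bar> \<le> t^2 * ?C" unfolding eq .
      then have "\<bar>a (s + t) - a s - t * a' s\<bar> / \<bar>t\<bar> \<le> t^2 * ?C / \<bar>t\<bar>" by (rule divide_right_mono) simp
      also have "t^2 * ?C / \<bar>t\<bar> = \<bar>t\<bar> * ?C"
        by (rule square_div_abs[OF that])
      also have "\<bar>a (s + t) - a s - t * a' s\<bar> / \<bar>t\<bar> = \<bar>(a (s + t) - a s) / t - a' s\<bar>"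
        using that by (simp add: abs_divide[symmetric] diff_divide_distrib)
      finally show ?thesis .
    qed
    have "((\<lambda>t. \<bar>t\<bar> * ?C) \<longlongrightarrow> \<bar>0\<bar> * ?C) (at 0)" by (intro tendsto_intros)
    then have lim: "((\<lambda>t. \<bar>t\<bar> * ?C) \<longlongrightarrow> 0) (at 0)" by simp
    have "((\<lambda>t. (a (s + t) - a s) / t - a' s) \<longlongrightarrow> 0) (at 0)"
      by (rule Lim_null_comparison[OF _ lim]) (simp add: eventually_at_filter bound)
    then show ?thesis unfolding DERIV_def by (simp add: LIM_zero_iff)
  qed
  have ode: "\<bar>a' s + s * \<sigma>2 * a s\<bar> \<le> \<eta>" if s: "0 \<le> s" "s \<le> 1" for s
  proof -
    have i: "integrable N (\<lambda>w. \<Gamma> w * cos (s * F w + c))" "integrable N (\<lambda>w. cos (s * F w + c))"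
      by (intro all_moments_integrable trig_moments all_moments_closed sF \<Gamma>_moments)+
    define G where "G w = (\<Gamma> w - \<sigma>2) * cos (s * F w + c)" for w
    have eq: "expectation (\<lambda>w. \<Gamma> w * cos (s * F w + c)) - \<sigma>2 * a s = expectation G"
      using i by (simp add: a_def G_def[abs_def] left_diff_distrib)
    have iG: "integrable N G" unfolding G_def[abs_def]
      by (intro all_moments_integrable trig_moments all_moments_closed sF \<Gamma>_moments)
    have pt: "\<bar>G w\<bar> \<le> \<bar>\<Gamma> w - \<sigma>2\<bar>" for w
      unfolding G_def abs_mult by (intro mult_right_le_one_le) auto
    have "expectation (\<lambda>w. \<bar>G w\<bar>) \<le> expectation (\<lambda>w. \<bar>\<Gamma> w - \<sigma>2\<bar>)"
      by (intro integral_mono integrable_abs iG pt all_moments_integrable all_moments_closed \<Gamma>_moments)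
    also have "... \<le> sqrt (expectation (\<lambda>w. (\<Gamma> w - \<sigma>2)^2))"
      by (intro expectation_abs_le_sqrt all_moments_closed \<Gamma>_moments)
    also have "... \<le> real (d + 1) ^ 3 * 8 ^ d * \<tau> * sqrt \<sigma>2" by (rule \<Gamma>_deviation)
    finally have "\<bar>expectation G\<bar> \<le> real (d + 1) ^ 3 * 8 ^ d * \<tau> * sqrt \<sigma>2"
      using integral_abs_bound[of N G] by linarith
    then have g: "\<bar>expectation (\<lambda>w. \<Gamma> w * cos (s * F w + c)) - \<sigma>2 * a s\<bar> \<le> real (d + 1) ^ 3 * 8 ^ d * \<tau> * sqrt \<sigma>2"
      unfolding eq .
    have "\<bar>s * (expectation (\<lambda>w. \<Gamma> w * cos (s * F w + c)) - \<sigma>2 * a s)\<bar> \<le> 1 * (real (d + 1) ^ 3 * 8 ^ d * \<tau> * sqrt \<sigma>2)"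
      unfolding abs_mult using s g by (intro mult_mono) auto
    then have "\<bar>s * expectation (\<lambda>w. \<Gamma> w * cos (s * F w + c)) - s * \<sigma>2 * a s\<bar> \<le> real (d + 1) ^ 3 * 8 ^ d * \<tau> * sqrt \<sigma>2"
      by (simp add: algebra_simps)
    then show ?thesis using stein[OF s, of c] unfolding \<eta>_def a'_def by linarith
  qed
  define b where "b s = a s * exp (s^2 * \<sigma>2 / 2)" for s
  define b' where "b' s = (a' s + s * \<sigma>2 * a s) * exp (s^2 * \<sigma>2 / 2)" for s
  have bd: "(b has_real_derivative b' s) (at s)" for s
    unfolding b_def[abs_def] b'_def
    by (auto intro!: derivative_eq_intros deriv simp: algebra_simps)
  have "\<exists>z>0. z < 1 \<and> b 1 - b 0 = (1 - 0) * b' z"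
    by (rule MVT2) (auto intro: bd)
  then obtain z where z: "0 < z" "z < 1" "b 1 - b 0 = b' z" by auto
  have "\<eta> \<ge> 0" using ode[of 0] by (simp add: order_trans[OF abs_ge_zero])
  have "\<bar>b 1 - b 0\<bar> \<le> \<eta> * exp (\<sigma>2 / 2)"
  proof -
    have "z^2 \<le> 1" using z by (simp add: power_le_one)
    then have "z^2 * \<sigma>2 / 2 \<le> \<sigma>2 / 2" using \<sigma>2_nonneg by (simp add: mult_left_le_one_le)
    then show ?thesis unfolding z(3) b'_def abs_mult using ode[of z] z \<open>\<eta> \<ge> 0\<close> by (intro mult_mono) auto
  qed
  moreover have "b 1 - b 0 = (a 1 - cos c * exp (- \<sigma>2 / 2)) * exp (\<sigma>2 / 2)"
  proof -
    have "a 0 = cos c" by (simp add: a_def prob_space)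
    moreover have "exp (- \<sigma>2 / 2) * exp (\<sigma>2 / 2) = 1" by (simp add: exp_add[symmetric] del: exp_add)
    ultimately show ?thesis by (simp add: b_def left_diff_distrib mult.assoc)
  qed
  ultimately have "\<bar>a 1 - cos c * exp (- \<sigma>2 / 2)\<bar> * exp (\<sigma>2 / 2) \<le> \<eta> * exp (\<sigma>2 / 2)"
    by (simp add: abs_mult)
  then have "\<bar>a 1 - cos c * exp (- \<sigma>2 / 2)\<bar> \<le> \<eta>" by simp
  then show ?thesis by (simp add: \<eta>_def a_def)
qed

end

subsection \<open>Replacing the variables by random signs\<close>

context letters
begin

lemma cos_moments: "G \<in> all_moments N ==> (\<lambda>w. cos (G w)) \<in> all_moments N"
  and sin_moments: "G \<in> all_moments N ==> (\<lambda>w. sin (G w)) \<in> all_moments N"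
  by (auto intro!: all_moments_bounded[OF finite_measure_axioms, of _ 1] dest!: all_moments_measurable)

text \<open>The comparison term sees the letters at \<open>r\<close> only through their covariances,
  which all families share. Two families that agree away from \<open>r\<close> are therefore
  compared by applying the estimate to each of them.\<close>

lemma lindeberg_step:
  fixes f :: "(nat \<times> nat) set => real" and D r :: nat and I :: "nat set" and c :: real
  assumes r: "r \<notin> I" and I: "finite I"
  defines "F0 \<equiv> ev I (Suc D) f" and "Fk \<equiv> (\<lambda>k. ev I D (\<lambda>S. f (insert (r, k) S)))"
    and "a \<equiv> (\<Sum>k\<in>K. \<Sum>S\<in>words K I D. (f (insert (r, k) S))^2)"
  shows "\<bar>expectation (\<lambda>w. cos (ev (insert r I) (Suc D) f w + c)) -
    (expectation (\<lambda>w. cos (F0 w + c)) - (\<Sum>k\<in>K. expectation (\<lambda>w. Fk k w * Fk k w * cos (F0 w + c))) / 2)\<bar>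
    \<le> sqrt (hyper ^ Suc D) * (a * sqrt a)"
proof -
  define \<Delta> where "\<Delta> w = (\<Sum>k\<in>K. \<xi> r k w * Fk k w)" for w
  have a0: "a \<ge> 0" unfolding a_def by (intro sum_nonneg) simp
  have Fm: "F0 \<in> all_moments N" "\<And>k. Fk k \<in> all_moments N"
    unfolding F0_def Fk_def by (rule ev_moments)+
  have Fs: "F0 \<in> borel_measurable (sigB I)" "\<And>k. Fk k \<in> borel_measurable (sigB I)"
    unfolding F0_def Fk_def by (rule ev_sigB)+
  have Fc: "(\<lambda>w. F0 w + c) \<in> all_moments N" by (intro all_moments_closed Fm)
  note cm = cos_moments[OF Fc] and sm = sin_moments[OF Fc]
  have cs: "(\<lambda>w. cos (F0 w + c)) \<in> borel_measurable (sigB I)" "(\<lambda>w. sin (F0 w + c)) \<in> borel_measurable (sigB I)"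
    using Fs(1) by measurable
  have Dm: "\<Delta> \<in> all_moments N" unfolding \<Delta>_def[abs_def] by (intro all_moments_closed \<xi>_moments Fm)
  \<comment> \<open>\<Delta> is itself a word sum, over the words that meet \<open>r\<close>, so
    Parseval and hypercontractivity apply to it directly.\<close>
  define f' where "f' S = (if r \<in> fst ` S then f S else 0)" for S
  have nr: "r \<notin> fst ` S" if "S \<in> words K I D'" for S D' using that r by (auto simp: words_def)
  have \<Delta>_ev: "\<Delta> w = ev (insert r I) (Suc D) f' w" for w
  proof -
    have "ev I (Suc D) f' w = 0" unfolding ev_def by (intro sum.neutral) (auto simp: f'_def nr)
    moreover have "f' (insert (r, k) S) = f (insert (r, k) S)" for k S by (simp add: f'_def)
    ultimately show ?thesis by (simp add: ev_insert[OF r I] \<Delta>_def Fk_def)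
  qed
  have fa: "(\<Sum>S\<in>words K (insert r I) (Suc D). (f' S)^2) = a"
  proof -
    have "(\<Sum>S\<in>words K I (Suc D). (f' S)^2) = 0" by (intro sum.neutral) (auto simp: f'_def nr)
    moreover have "f' (insert (r, k) S) = f (insert (r, k) S)" for k S by (simp add: f'_def)
    ultimately show ?thesis by (simp add: sum_words_insert[OF r finite_K I] a_def)
  qed
  have D2: "expectation (\<lambda>w. (\<Delta> w)^2) = a"
    using expectation_ev_square[of "insert r I" "Suc D" f'] I by (simp add: \<Delta>_ev fa)
  have D4: "expectation (\<lambda>w. \<Delta> w ^ 4) \<le> hyper ^ Suc D * a^2"
    using fourth_moment_le[of "insert r I" "Suc D" f'] I by (simp add: \<Delta>_ev fa)
  define G where "G w = cos (F0 w + c + \<Delta> w) - (cos (F0 w + c) - \<Delta> w * sin (F0 w + c) - (\<Delta> w)^2 / 2 * cos (F0 w + c))" for w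
  have i: "integrable N (\<lambda>w. cos (F0 w + c + \<Delta> w))" "integrable N (\<lambda>w. cos (F0 w + c))"
    "integrable N (\<lambda>w. \<Delta> w * sin (F0 w + c))" "integrable N (\<lambda>w. \<Delta> w * \<Delta> w * cos (F0 w + c))"
    by (intro all_moments_integrable cos_moments all_moments_closed Fm Dm cm sm)+
  have Geq: "G = (\<lambda>w. cos (F0 w + c + \<Delta> w) - (cos (F0 w + c) - \<Delta> w * sin (F0 w + c) - (\<Delta> w * \<Delta> w * cos (F0 w + c)) / 2))"
    by (simp add: fun_eq_iff G_def power2_eq_square)
  have "expectation (\<lambda>w. \<Delta> w * sin (F0 w + c)) = 0"
    unfolding \<Delta>_def by (intro expectation_letter_combination[OF r] Fm Fs sm cs)
  moreover have "expectation (\<lambda>w. \<Delta> w * \<Delta> w * cos (F0 w + c)) = (\<Sum>k\<in>K. expectation (\<lambda>w. Fk k w * Fk k w * cos (F0 w + c)))"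
    unfolding \<Delta>_def by (intro expectation_letter_combination_mult[OF r] Fm Fs cm cs)
  ultimately have EG: "expectation G = expectation (\<lambda>w. cos (F0 w + c + \<Delta> w)) -
     (expectation (\<lambda>w. cos (F0 w + c)) - (\<Sum>k\<in>K. expectation (\<lambda>w. Fk k w * Fk k w * cos (F0 w + c))) / 2)"
    unfolding Geq using i by simp
  have iG: "integrable N G" unfolding Geq using i by simp
  have "expectation (\<lambda>w. \<bar>G w\<bar>) \<le> expectation (\<lambda>w. \<bar>\<Delta> w * (\<Delta> w)^2\<bar>)"
  proof (rule integral_mono)
    show "integrable N (\<lambda>w. \<bar>G w\<bar>)" by (intro integrable_abs iG)
    show "integrable N (\<lambda>w. \<bar>\<Delta> w * (\<Delta> w)^2\<bar>)"
      by (intro all_moments_integrable all_moments_abs all_moments_closed Dm)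
    show "\<bar>G w\<bar> \<le> \<bar>\<Delta> w * (\<Delta> w)^2\<bar>" for w
      using cos_expand3[of "F0 w + c" "\<Delta> w"] unfolding G_def
      by (simp add: abs_mult power2_eq_square power3_eq_cube mult.assoc)
  qed
  also have "... \<le> sqrt (expectation (\<lambda>w. (\<Delta> w)^2)) * sqrt (expectation (\<lambda>w. ((\<Delta> w)^2)^2))"
    by (intro Cauchy_Schwarz_abs all_moments_closed Dm)
  also have "... \<le> sqrt a * sqrt (hyper ^ Suc D * a^2)"
    using D2 D4 a0 by (intro mult_mono real_sqrt_le_mono) (auto simp: power_mult[symmetric])
  also have "... = sqrt (hyper ^ Suc D) * (a * sqrt a)"
    using a0 by (simp add: real_sqrt_mult)
  finally have fin: "expectation (\<lambda>w. \<bar>G w\<bar>) \<le> sqrt (hyper ^ Suc D) * (a * sqrt a)" .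
  have "\<bar>expectation G\<bar> \<le> sqrt (hyper ^ Suc D) * (a * sqrt a)"
    using integral_abs_bound[of N G] fin by (rule order_trans)
  moreover have "(\<lambda>w. cos (ev (insert r I) (Suc D) f w + c)) = (\<lambda>w. cos (F0 w + c + \<Delta> w))"
    by (simp add: ev_insert[OF r I] F0_def Fk_def \<Delta>_def add_ac)
  ultimately show ?thesis unfolding EG by (simp only:)
qed

end

section \<open>A product space carrying copies of the variables and random signs\<close>

lemma indep_reals_PiM:
  fixes Q :: "'c => real measure"
  assumes Q: "\<And>i. prob_space (Q i)" "\<And>i. sets (Q i) = sets borel"
  shows "indep_reals (PiM UNIV Q) (\<lambda>i x. x i)"
    and "distr (PiM UNIV Q) borel (\<lambda>x. x i) = Q i"
proof -
  interpret P: prob_space "PiM UNIV Q" by (rule prob_space_PiM) (rule Q)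
  have sets_P: "sets (PiM UNIV Q) = sets (PiM UNIV (\<lambda>_. borel :: real measure))"
    by (intro sets_PiM_cong refl Q)
  have m: "(\<lambda>x. x i) \<in> borel_measurable (PiM UNIV Q)" for i
    using measurable_component_singleton[of i UNIV "\<lambda>_. borel :: real measure"]
    by (simp add: measurable_cong_sets[OF sets_P refl])
  show comp: "distr (PiM UNIV Q) borel (\<lambda>x. x i) = Q i" for i
  proof -
    have "distr (PiM UNIV Q) borel (\<lambda>x. x i) = distr (PiM UNIV Q) (Q i) (\<lambda>x. x i)"
      by (intro distr_cong refl) (simp add: Q)
    also have "... = Q i" by (rule distr_PiM_component) (auto intro: Q)
    finally show ?thesis .
  qed
  have "distr (PiM UNIV Q) (PiM UNIV (\<lambda>_. borel)) (\<lambda>x. \<lambda>i\<in>UNIV. x i) = PiM UNIV Q"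
    by (simp add: restrict_UNIV distr_id2 sets_P)
  then have "P.indep_vars (\<lambda>_. borel) (\<lambda>i x. x i) UNIV"
    by (subst P.indep_vars_iff_distr_eq_PiM) (simp_all add: m comp)
  then show "indep_reals (PiM UNIV Q) (\<lambda>i x. x i)" by unfold_locales
qed

definition rad :: "real measure" where
  "rad = distr (measure_pmf (pmf_of_set {-1, 1 :: real})) borel (\<lambda>x. x)"

text \<open>Makes the letters equal to 1 or -1 at every point, as \<open>walsh\<close> requires, and
  not merely almost surely under \<open>rad\<close>.\<close>

definition sg :: "real => real" where "sg x = (if x \<ge> 0 then 1 else -1)"

lemma prob_space_rad: "prob_space rad"
  unfolding rad_def by (rule prob_space.prob_space_distr[OF prob_space_measure_pmf]) simp

lemma sg_measurable [measurable]: "sg \<in> borel_measurable borel"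
  unfolding sg_def[abs_def] by measurable

lemma integral_rad_sg: "(\<integral>x. sg x \<partial>rad) = 0"
proof -
  have "(\<integral>x. sg x \<partial>rad) = (\<integral>x. sg x \<partial>measure_pmf (pmf_of_set {-1, 1 :: real}))"
    unfolding rad_def by (rule integral_distr) simp_all
  also have "... = 0" by (subst integral_pmf_of_set) (auto simp: sg_def)
  finally show ?thesis .
qed

context iid
begin

text \<open>Coordinate \<open>(i, 0)\<close> carries a copy of \<open>X 0\<close>, and
  \<open>(i, k)\<close> with \<open>k \<ge> 1\<close> a random sign for the letter k at position i.
  As all of them share one space, hybrids differ only in the coordinates they read.\<close>

definition NN :: "(nat \<times> nat => real) measure" where
  "NN = PiM UNIV (\<lambda>l. if snd l = 0 then distr M borel (X 0) else rad)"

lemma NN_factors: "prob_space (if snd l = 0 then distr M borel (X 0) else rad)"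
    "sets (if snd l = 0 then distr M borel (X 0) else rad) = sets borel"
  using prob_space_distr[OF W_measurable[of 0]] prob_space_rad by (auto simp: rad_def)

lemma NN_indep: "indep_reals NN (\<lambda>l x. x l)"
  unfolding NN_def by (rule indep_reals_PiM(1)) (rule NN_factors)+

lemma NN_marginal: "distr NN borel (\<lambda>x. x l) = (if snd l = 0 then distr M borel (X 0) else rad)"
  unfolding NN_def by (rule indep_reals_PiM(2)) (rule NN_factors)+

lemma NN_coordinate [measurable]: "(\<lambda>x. x l) \<in> borel_measurable NN"
  using indep_reals.W_measurable[OF NN_indep] .

lemma integral_NN_0:
  assumes [measurable]: "(f :: real => real) \<in> borel_measurable borel"
  shows "(\<integral>x. f (x (i, 0)) \<partial>NN) = expectation (\<lambda>w. f (X 0 w))"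
  using integral_distr[OF NN_coordinate[of "(i, 0)"] assms] integral_distr[OF W_measurable[of 0] assms]
  by (simp add: NN_marginal)

lemma integrable_NN_0:
  assumes [measurable]: "(f :: real => real) \<in> borel_measurable borel"
  shows "integrable NN (\<lambda>x. f (x (i, 0))) \<longleftrightarrow> integrable M (\<lambda>w. f (X 0 w))"
  using integrable_distr_eq[OF NN_coordinate[of "(i, 0)"] assms] integrable_distr_eq[OF W_measurable[of 0] assms]
  by (simp add: NN_marginal)

text \<open>Before the replacement the letters at a position are dependent functions of one
  variable, afterwards they are independent signs; both families are centred and orthonormal, so the
  terms up to second order agree.\<close>

definition hyb :: "nat set => nat => nat => (nat \<times> nat => real) => real" where
  "hyb J i k x = (if i \<in> J then sg (x (i, k)) else h k (x (i, 0)))"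

lemma NN_walsh: "walsh NN (\<lambda>l x. x l) (\<lambda>l x. sg (x l)) {l. snd l \<noteq> 0}"
proof -
  interpret n: indep_reals NN "\<lambda>l x. x l" by (rule NN_indep)
  show ?thesis
  proof
    fix l :: "nat \<times> nat" assume l: "l \<in> {l. snd l \<noteq> 0}"
    show "(\<lambda>x. sg (x l)) \<in> borel_measurable (n.sig {l})"
      by (intro measurable_compose[OF _ sg_measurable] n.W_sig) simp
    show "sg (x l) = 1 \<or> sg (x l) = - 1" for x by (simp add: sg_def)
    have "(\<integral>x. sg (x l) \<partial>NN) = (\<integral>y. sg y \<partial>distr NN borel (\<lambda>x. x l))"
      by (rule integral_distr[symmetric]) simp_all
    then show "n.expectation (\<lambda>x. sg (x l)) = 0" using l by (simp add: NN_marginal integral_rad_sg)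
  qed
qed

lemma letters_hyb: "letters NN (\<lambda>l x. x l) (\<lambda>i. {i} \<times> UNIV) (hyb J) K B"
proof -
  interpret w: walsh NN "\<lambda>l x. x l" "\<lambda>l x. sg (x l)" "{l. snd l \<noteq> 0}" by (rule NN_walsh)
  have hm: "(\<lambda>x. h k (x (i, 0))) \<in> all_moments NN" for i k
    using h_moments[of k 0] integrable_NN_0[of "\<lambda>y. \<bar>h k y\<bar> ^ _" i]
    by (auto simp: all_moments_def)
  have sgm: "(\<lambda>x. sg (x l)) \<in> all_moments NN" for l
    by (rule all_moments_bounded[OF w.finite_measure_axioms, of _ 1]) (auto simp: sg_def)
  have K0: "k \<noteq> 0" if "k \<in> K" for k using that by (auto simp: K_def)
  have sg2: "sg y * sg y = 1" "sg y ^ 4 = 1" for y by (auto simp: sg_def)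
  show ?thesis
  proof
    show "finite K" by (rule finite_K)
    show "1 \<le> B" by (rule B_ge_1)
    fix i k assume k: "k \<in> K"
    show "hyb J i k \<in> all_moments NN"
      using hm[of k i] sgm[of "(i, k)"] by (cases "i \<in> J") (simp_all add: hyb_def[abs_def])
    show "hyb J i k \<in> borel_measurable (w.sig ({i} \<times> UNIV))"
    proof (cases "i \<in> J")
      case True
      have "(\<lambda>x. sg (x (i, k))) \<in> borel_measurable (w.sig ({i} \<times> UNIV))"
        by (intro measurable_compose[OF _ sg_measurable] w.W_sig) simp
      then show ?thesis using True by (simp add: hyb_def[abs_def])
    next
      case False
      have "(\<lambda>x. h k (x (i, 0))) \<in> borel_measurable (w.sig ({i} \<times> UNIV))"
        by (intro measurable_compose[OF _ h_measurable] w.W_sig) simp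
      then show ?thesis using False by (simp add: hyb_def[abs_def])
    qed
    show "w.expectation (hyb J i k) = 0"
      using w.x_mean[of "(i, k)"] K0[OF k] integral_NN_0[of "h k" i] \<xi>_mean[OF k, of 0]
      by (cases "i \<in> J") (simp_all add: hyb_def[abs_def])
    show "w.expectation (\<lambda>x. hyb J i k x ^ 4) \<le> B"
      using integral_NN_0[of "\<lambda>y. h k y ^ 4" i] \<xi>_fourth[OF k, of 0] B_ge_1
      by (cases "i \<in> J") (simp_all add: hyb_def[abs_def] sg2 w.prob_space)
    fix l assume l: "l \<in> K"
    show "w.expectation (\<lambda>x. hyb J i k x * hyb J i l x) = (if k = l then 1 else 0)"
    proof (cases "i \<in> J")
      case True
      have "w.expectation (\<lambda>x. w.xs {(i, k)} x * w.xs {(i, l)} x) = (if {(i, k)} = {(i, l)} then 1 else 0)"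
        by (rule w.expectation_xs_mult) (use K0[OF k] K0[OF l] in auto)
      then show ?thesis using True by (simp add: hyb_def[abs_def] w.xs_def)
    next
      case False
      then show ?thesis
        using integral_NN_0[of "\<lambda>y. h k y * h l y" i] \<xi>_orth[OF k l, of 0] by (simp add: hyb_def[abs_def])
    qed
  qed auto
qed

abbreviation hev :: "nat set => nat set => nat => ((nat \<times> nat) set => real) => (nat \<times> nat => real) => real" where
  "hev J \<equiv> letters.ev (hyb J) K"

lemma hev_eq: "hev J I D f x = (\<Sum>S\<in>words K I D. f S * (\<Prod>(i, k)\<in>S. hyb J i k x))"
proof -
  interpret l: letters NN "\<lambda>l x. x l" "\<lambda>i. {i} \<times> UNIV" "hyb J" K B by (rule letters_hyb)
  show ?thesis by (simp add: l.ev_def l.xi_def)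
qed

lemma hev_cong:
  assumes "\<And>i. i \<in> I ==> i \<in> J \<longleftrightarrow> i \<in> J'"
  shows "hev J I D f x = hev J' I D f x"
  unfolding hev_eq
proof (intro sum.cong refl arg_cong2[where f = "(*)"] prod.cong)
  fix S l assume "S \<in> words K I D" "l \<in> S"
  then have "fst l \<in> I" by (auto simp: words_def)
  then show "(case l of (i, k) => hyb J i k x) = (case l of (i, k) => hyb J' i k x)"
    using assms by (cases l) (simp add: hyb_def)
qed

text \<open>Both sides are the same function of an independent sequence with the common law of the
  \<open>X i\<close>, since the empty hybrid reads only the coordinates
  \<open>(i, 0)\<close>.\<close>

lemma letter_law_transfer: "(\<integral>x. cos (hev {} {..<m} d f x + c) \<partial>NN) = expectation (\<lambda>w. cos (ev {..<m} d f w + c))"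
proof -
  define \<Phi> where "\<Phi> y = (\<Sum>S\<in>wds m. f S * (\<Prod>l\<in>S. h (snd l) (y (fst l))))" for y :: "nat => real"
  let ?P = "PiM UNIV (\<lambda>_::nat. borel :: real measure)"
  have [measurable]: "\<Phi> \<in> borel_measurable ?P" unfolding \<Phi>_def by measurable
  have l1: "distr M ?P (\<lambda>w i. X i w) = PiM UNIV (\<lambda>_. distr M borel (X 0))"
  proof -
    have "distr M ?P (\<lambda>w. \<lambda>i\<in>UNIV. X i w) = PiM UNIV (\<lambda>i. distr M borel (X i))"
      using X_indep by (subst (asm) indep_vars_iff_distr_eq_PiM) simp_all
    moreover have "PiM UNIV (\<lambda>i. distr M borel (X i)) = PiM UNIV (\<lambda>_. distr M borel (X 0))"
      by (intro PiM_cong refl X_ident)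
    ultimately show ?thesis by (simp add: restrict_UNIV)
  qed
  have l2: "distr NN ?P (\<lambda>x i. x (i, 0)) = PiM UNIV (\<lambda>_. distr M borel (X 0))"
  proof -
    define Q where "Q l = (if snd l = 0 then distr M borel (X 0) else rad)" for l :: "nat \<times> nat"
    have Q0: "Q (i, 0) = distr M borel (X 0)" for i by (simp add: Q_def)
    have NQ: "NN = PiM UNIV Q" by (simp add: NN_def Q_def[abs_def])
    have "distr (PiM UNIV Q) (PiM UNIV (\<lambda>i. Q (i, 0))) (\<lambda>x. \<lambda>i\<in>UNIV. x (i, 0)) = PiM UNIV (\<lambda>i. Q (i, 0))"
    proof (rule distr_PiM_reindex)
      show "prob_space (Q l)" for l using NN_factors(1)[of l] by (simp add: Q_def)
    qed (auto simp: inj_on_def)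
    then have "distr NN (PiM UNIV (\<lambda>i::nat. distr M borel (X 0))) (\<lambda>x i. x (i, 0)) = PiM UNIV (\<lambda>_. distr M borel (X 0))"
      unfolding Q0 NQ by (simp add: restrict_UNIV)
    moreover have "distr NN ?P (\<lambda>x i. x (i, 0)) = distr NN (PiM UNIV (\<lambda>i::nat. distr M borel (X 0))) (\<lambda>x i. x (i, 0))"
      by (intro distr_cong refl sets_PiM_cong) simp_all
    ultimately show ?thesis by simp
  qed
  have "(\<integral>x. cos (hev {} {..<m} d f x + c) \<partial>NN) = (\<integral>x. cos (\<Phi> (\<lambda>i. x (i, 0)) + c) \<partial>NN)"
    by (simp add: hev_eq \<Phi>_def hyb_def case_prod_beta)
  also have "... = (\<integral>y. cos (\<Phi> y + c) \<partial>distr NN ?P (\<lambda>x i. x (i, 0)))"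
    by (rule integral_distr[symmetric]) (auto intro!: measurable_PiM_single' simp: space_PiM)
  also have "... = (\<integral>y. cos (\<Phi> y + c) \<partial>distr M ?P (\<lambda>w i. X i w))" by (simp only: l1 l2)
  also have "... = expectation (\<lambda>w. cos (\<Phi> (\<lambda>i. X i w) + c))"
    by (rule integral_distr) (auto intro!: measurable_PiM_single' simp: space_PiM)
  also have "... = expectation (\<lambda>w. cos (ev {..<m} d f w + c))"
    by (simp add: ev_def xi_def \<Phi>_def case_prod_beta)
  finally show ?thesis .
qed

end

section \<open>Lindeberg replacement and the central limit theorem for word sums\<close>

context iid
begin

declare NN_coordinate [measurable del]

lemma infl_nonneg: "infl m f r \<ge> 0"
  unfolding infl_def by (intro sum_nonneg) simp

lemma infl_eq_insert:
  assumes D: "d = Suc D" and r: "r < m"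
  shows "(\<Sum>k\<in>K. \<Sum>S\<in>words K ({..<m} - {r}) D. (f (insert (r, k) S))^2) = infl m f r"
proof -
  define \<phi> where "\<phi> S = (if r \<in> fst ` S then (f S)^2 else 0)" for S
  have e: "{..<m} = insert r ({..<m} - {r})" using r by auto
  have "infl m f r = (\<Sum>S\<in>wds m. \<phi> S)"
    unfolding infl_def \<phi>_def by (intro sum.mono_neutral_cong_left finite_wds) auto
  also have "... = (\<Sum>S\<in>words K (insert r ({..<m} - {r})) (Suc D). \<phi> S)"
    using e D by simp
  also have "... = (\<Sum>S\<in>words K ({..<m} - {r}) (Suc D). \<phi> S) + (\<Sum>k\<in>K. \<Sum>S\<in>words K ({..<m} - {r}) D. \<phi> (insert (r, k) S))"
    by (rule sum_words_insert) (auto simp: finite_K)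
  also have "(\<Sum>S\<in>words K ({..<m} - {r}) (Suc D). \<phi> S) = 0"
    by (intro sum.neutral ballI) (auto simp: \<phi>_def words_def)
  finally show ?thesis by (simp add: \<phi>_def)
qed

lemma sum_infl_le: "(\<Sum>r<m. infl m f r) \<le> real d * (\<Sum>S\<in>wds m. (f S)^2)"
proof -
  have "(\<Sum>r<m. infl m f r) = (\<Sum>r<m. \<Sum>S\<in>wds m. if r \<in> fst ` S then (f S)^2 else 0)"
    unfolding infl_def by (intro sum.cong refl sum.mono_neutral_cong_left finite_wds) auto
  also have "... = (\<Sum>S\<in>wds m. \<Sum>r<m. if r \<in> fst ` S then (f S)^2 else 0)" by (rule sum.swap)
  also have "... \<le> (\<Sum>S\<in>wds m. real d * (f S)^2)"
  proof (rule sum_mono)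
    fix S assume S: "S \<in> wds m"
    have "(\<Sum>r<m. if r \<in> fst ` S then (f S)^2 else 0) = (\<Sum>r\<in>{r \<in> {..<m}. r \<in> fst ` S}. (f S)^2)"
      by (subst sum.inter_filter[symmetric]) auto
    also have "... = real (card {r \<in> {..<m}. r \<in> fst ` S}) * (f S)^2" by simp
    also have "... \<le> real d * (f S)^2"
    proof (intro mult_right_mono)
      have "card {r \<in> {..<m}. r \<in> fst ` S} \<le> card (fst ` S)"
        using wds_finite[OF S] by (intro card_mono) auto
      also have "... \<le> card S" by (rule card_image_le[OF wds_finite[OF S]])
      also have "... \<le> d" using S by (simp add: words_def)
      finally show "real (card {r \<in> {..<m}. r \<in> fst ` S}) \<le> real d" by simp
    qed simp
    finally show "(\<Sum>r<m. if r \<in> fst ` S then (f S)^2 else 0) \<le> real d * (f S)^2" .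
  qed
  finally show ?thesis by (simp add: sum_distrib_left)
qed

text \<open>\<open>mid\<close> involves only positions other than \<open>r\<close>, where the two
  hybrids coincide, so it is the comparison term for both.\<close>

lemma hev_step:
  assumes D: "d = Suc D" and r: "r < m" "r \<notin> J"
  shows "\<bar>(\<integral>x. cos (hev (insert r J) {..<m} d f x + c) \<partial>NN) - (\<integral>x. cos (hev J {..<m} d f x + c) \<partial>NN)\<bar>
    \<le> 2 * (sqrt (hyper ^ d) * (infl m f r * sqrt (infl m f r)))"
proof -
  interpret a: letters NN "\<lambda>l x. x l" "\<lambda>i. {i} \<times> UNIV" "hyb J" K B by (rule letters_hyb)
  interpret b: letters NN "\<lambda>l x. x l" "\<lambda>i. {i} \<times> UNIV" "hyb (insert r J)" K B by (rule letters_hyb)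
  define I where "I = {..<m} - {r}"
  have I: "finite I" "r \<notin> I" "insert r I = {..<m}" using r by (auto simp: I_def)
  have cong: "hev (insert r J) I D' g = hev J I D' g" for D' g
    by (intro ext hev_cong) (auto simp: I_def)
  define mid where "mid = (\<integral>x. cos (hev J I (Suc D) f x + c) \<partial>NN) - (\<Sum>k\<in>K. \<integral>x. hev J I D (\<lambda>S. f (insert (r, k) S)) x * hev J I D (\<lambda>S. f (insert (r, k) S)) x * cos (hev J I (Suc D) f x + c) \<partial>NN) / 2"
  note ia = infl_eq_insert[OF D r(1), of f, folded I_def]
  have "\<bar>(\<integral>x. cos (hev J {..<m} d f x + c) \<partial>NN) - mid\<bar> \<le> sqrt (hyper ^ d) * (infl m f r * sqrt (infl m f r))"
    using a.lindeberg_step[OF I(2,1), of D f c] unfolding I(3) ia mid_def D[symmetric] .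
  moreover have "\<bar>(\<integral>x. cos (hev (insert r J) {..<m} d f x + c) \<partial>NN) - mid\<bar> \<le> sqrt (hyper ^ d) * (infl m f r * sqrt (infl m f r))"
    using b.lindeberg_step[OF I(2,1), of D f c] unfolding I(3) ia mid_def D[symmetric] cong .
  ultimately show ?thesis by linarith
qed

text \<open>The error at a position is the power 3/2 of its influence; the root is bounded by that
  of \<open>mx\<close>, and the influences sum to at most \<open>d\<close> times the sum of the
  squared coefficients.\<close>

lemma lindeberg:
  assumes D: "d = Suc D" and infl: "infl_le f mx"
  shows "\<bar>(\<integral>x. cos (hev {..<m} {..<m} d f x + c) \<partial>NN) - expectation (\<lambda>w. cos (ev {..<m} d f w + c))\<bar>
    \<le> 2 * sqrt mx * sqrt (hyper ^ d) * (real d * (\<Sum>S\<in>wds m. (f S)^2))"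
proof -
  define T where "T J = (\<integral>x. cos (hev J {..<m} d f x + c) \<partial>NN)" for J
  have h0: "sqrt (hyper ^ d) \<ge> 0" using hyper_ge_1 by simp
  have "\<bar>T {..<k} - T {}\<bar> \<le> (\<Sum>r<k. 2 * (sqrt (hyper ^ d) * (infl m f r * sqrt (infl m f r))))" if "k \<le> m" for k
    using that
  proof (induction k)
    case (Suc k)
    have "\<bar>T (insert k {..<k}) - T {..<k}\<bar> \<le> 2 * (sqrt (hyper ^ d) * (infl m f k * sqrt (infl m f k)))"
      unfolding T_def by (rule hev_step[OF D]) (use Suc in auto)
    with Suc show ?case by (simp add: lessThan_Suc)
  qed simp
  then have "\<bar>T {..<m} - T {}\<bar> \<le> (\<Sum>r<m. 2 * (sqrt (hyper ^ d) * (infl m f r * sqrt (infl m f r))))" by simp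
  also have "... \<le> (\<Sum>r<m. 2 * (sqrt (hyper ^ d) * (infl m f r * sqrt mx)))"
    using infl h0 by (intro sum_mono mult_left_mono) (auto simp: infl_le_def infl_nonneg)
  also have "... = 2 * sqrt mx * sqrt (hyper ^ d) * (\<Sum>r<m. infl m f r)"
    unfolding sum_distrib_left by (intro sum.cong refl) (simp only: mult_ac)
  also have "... \<le> 2 * sqrt mx * sqrt (hyper ^ d) * (real d * (\<Sum>S\<in>wds m. (f S)^2))"
  proof (intro mult_left_mono sum_infl_le)
    have "mx \<ge> 0" using infl infl_nonneg[of m f 0] by (auto simp: infl_le_def intro: order_trans)
    then show "0 \<le> 2 * sqrt mx * sqrt (hyper ^ d)" using h0 by simp
  qed
  finally show ?thesis by (simp add: T_def letter_law_transfer)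
qed

lemma bil_le_scale:
  assumes bl: "bil_le f e" and pq: "1 \<le> p" "1 \<le> q"
  shows "bil m f a b p q \<le> e * sqrt (\<Sum>S\<in>wds m. (a S)^2) * sqrt (\<Sum>S\<in>wds m. (b S)^2)"
proof -
  define A where "A = sqrt (\<Sum>S\<in>wds m. (a S)^2)"
  define A' where "A' = sqrt (\<Sum>S\<in>wds m. (b S)^2)"
  have sq: "A^2 = (\<Sum>S\<in>wds m. (a S)^2)" "A'^2 = (\<Sum>S\<in>wds m. (b S)^2)"
    by (simp_all add: A_def A'_def sum_nonneg)
  have nn: "A \<ge> 0" "A' \<ge> 0" by (simp_all add: A_def A'_def sum_nonneg)
  consider "A = 0" | "A' = 0" | "A > 0" "A' > 0" using nn by force
  then show ?thesis
  proof cases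
    case 1
    then have "\<forall>S\<in>wds m. (a S)^2 = 0" using sq(1) finite_wds by (subst sum_nonneg_eq_0_iff[symmetric]) simp_all
    then have "bil m f a b p q = 0" unfolding bil_def by (intro sum.neutral ballI) simp
    then show ?thesis using 1 by (simp add: A_def[symmetric])
  next
    case 2
    then have "\<forall>S\<in>wds m. (b S)^2 = 0" using sq(2) finite_wds by (subst sum_nonneg_eq_0_iff[symmetric]) simp_all
    then have "bil m f a b p q = 0" unfolding bil_def by (intro sum.neutral ballI) simp
    then show ?thesis using 2 by (simp add: A'_def[symmetric])
  next
    case 3
    have n: "(\<Sum>S\<in>wds m. (a S / A)^2) \<le> 1" "(\<Sum>S\<in>wds m. (b S / A')^2) \<le> 1"
      using 3 by (simp_all add: power_divide sum_divide_distrib[symmetric] sq[symmetric])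
    have "\<bar>bil m f (\<lambda>S. a S / A) (\<lambda>S. b S / A') p q\<bar> \<le> e"
      using bl n pq by (simp add: bil_le_def)
    moreover have "bil m f (\<lambda>S. a S / A) (\<lambda>S. b S / A') p q = bil m f a b p q / (A * A')"
      unfolding bil_def sum_divide_distrib by (intro sum.cong refl) (simp add: field_simps)
    ultimately have "bil m f a b p q / (A * A') \<le> e" by (metis abs_le_D1)
    then show ?thesis using 3 by (simp add: A_def[symmetric] A'_def[symmetric] field_simps)
  qed
qed

text \<open>After the replacement all letters are independent signs indexed by
  \<open>{..<m} \<times> K\<close>, so the word sum is a Walsh polynomial, with \<open>f\<close>
  extended by 0 to sets that are not words. The factor 4 adds the influence terms of Lindeberg and
  Stein, 2 each.\<close>

theorem ev_clt:
  fixes m :: nat and c :: real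
  assumes D: "d = Suc D" and infl: "infl_le f mx" and bl: "bil_le f \<tau>" and \<tau>: "\<tau> \<ge> 0" and f0: "f {} = 0"
  defines "\<sigma> \<equiv> (\<Sum>S\<in>wds m. (f S)^2)"
  shows "\<bar>expectation (\<lambda>u. cos (ev {..<m} d f u + c)) - cos c * exp (- \<sigma> / 2)\<bar>
    \<le> real (d + 1) ^ 3 * 8 ^ d * \<tau> * sqrt \<sigma> + 4 * sqrt mx * sqrt (hyper ^ d) * (real d * \<sigma>)"
proof -
  interpret w: walsh NN "\<lambda>l x. x l" "\<lambda>l x. sg (x l)" "{l. snd l \<noteq> 0}" by (rule NN_walsh)
  interpret b: letters NN "\<lambda>l x. x l" "\<lambda>i. {i} \<times> UNIV" "hyb {..<m}" K B by (rule letters_hyb)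
  define L where "L = {..<m} \<times> K"
  define f' where "f' S = (if S \<in> wds m then f S else 0)" for S
  have finL: "finite L" by (simp add: L_def finite_K)
  have K0: "0 \<notin> K" by (simp add: K_def)
  have sub: "wds m \<subseteq> Pow L" by (auto simp: words_def L_def)
  have hev_wsum: "hev {..<m} {..<m} d g x = w.wsum L (\<lambda>S. if S \<in> wds m then g S else 0) x" for g x
  proof -
    have "w.wsum L (\<lambda>S. if S \<in> wds m then g S else 0) x = (\<Sum>S\<in>wds m. g S * w.xs S x)"
      unfolding w.wsum_def using sub finL by (intro sum.mono_neutral_cong_right) auto
    also have "... = (\<Sum>S\<in>wds m. g S * (\<Prod>(i, k)\<in>S. hyb {..<m} i k x))"
    proof (intro sum.cong refl arg_cong2[where f = "(*)"])
      fix S assume S: "S \<in> wds m"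
      show "w.xs S x = (\<Prod>(i, k)\<in>S. hyb {..<m} i k x)"
        unfolding w.xs_def using S by (intro prod.cong refl) (auto simp: words_def hyb_def)
    qed
    finally show ?thesis by (simp add: hev_eq)
  qed
  have inj: "inj_on (insert l) (Pow (L - {l}))" for l by (intro inj_onI) blast
  have im: "insert l ` Pow (L - {l}) = {S \<in> Pow L. l \<in> S}" if "l \<in> L" for l
  proof (intro equalityI subsetI)
    fix S assume S: "S \<in> {S \<in> Pow L. l \<in> S}"
    then have "S = insert l (S - {l})" "S - {l} \<in> Pow (L - {l})" by auto
    then show "S \<in> insert l ` Pow (L - {l})" by blast
  qed (use that in auto)
  have pointed: "(\<Sum>S\<in>Pow (L - {l}). (f' (insert l S))^2) = (\<Sum>S\<in>wds m. (if l \<in> S then f S else 0)^2)" if "l \<in> L" for l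
  proof -
    have "(\<Sum>S\<in>Pow (L - {l}). (f' (insert l S))^2) = (\<Sum>S\<in>{S \<in> Pow L. l \<in> S}. (f' S)^2)"
      unfolding im[OF \<open>l \<in> L\<close>, symmetric] by (simp add: sum.reindex[OF inj])
    also have "... = (\<Sum>S\<in>{S \<in> wds m. l \<in> S}. (f S)^2)"
      using sub finL by (intro sum.mono_neutral_cong_right) (auto simp: f'_def)
    also have "... = (\<Sum>S\<in>wds m. (if l \<in> S then f S else 0)^2)"
      by (intro sum.mono_neutral_cong_left finite_wds) auto
    finally show ?thesis .
  qed
  define H where "H = sqrt (hyper ^ d)"
  have H2: "H^2 = hyper ^ d" using hyper_ge_1 by (simp add: H_def)
  interpret wp: walsh_polynomial NN "\<lambda>l x. x l" "\<lambda>l x. sg (x l)" "{l. snd l \<noteq> 0}" L f' d \<tau> mx H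
  proof
    show "finite L" by (rule finL)
    show "L \<subseteq> {l. snd l \<noteq> 0}" unfolding L_def using K0 by (intro subsetI CollectI notI) (metis mem_Sigma_iff prod.collapse)
    show "f' {} = 0" by (simp add: f'_def f0)
    show "f' S = 0" if "card S > d" for S using that by (auto simp: f'_def words_def)
    show "\<tau> \<ge> 0" by (rule \<tau>)
    show "H \<ge> 0" using hyper_ge_1 by (simp add: H_def)
    fix l assume l: "l \<in> L"
    have "(\<Sum>S\<in>wds m. (if l \<in> S then f S else 0)^2) \<le> infl m f (fst l)"
      unfolding infl_def by (subst sum.inter_filter[OF finite_wds]) (intro sum_mono, auto)
    also have "... \<le> mx" using infl by (simp add: infl_le_def)
    finally show "(\<Sum>S\<in>Pow (L - {l}). (f' (insert l S))^2) \<le> mx" using pointed[OF l] by simp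
    \<comment> \<open>Multiplication by the sign at \<open>l\<close> turns the derivative into the
      sum over the words containing \<open>l\<close>, and the fourth power of a sign is 1;
      hypercontractivity of word sums then applies.\<close>
    have "w.wsum (L - {l}) (\<lambda>S. f' (insert l S)) x ^ 4 = hev {..<m} {..<m} d (\<lambda>S. if l \<in> S then f S else 0) x ^ 4" for x
    proof -
      have "hev {..<m} {..<m} d (\<lambda>S. if l \<in> S then f S else 0) x = (\<Sum>S\<in>{S \<in> Pow L. l \<in> S}. f' S * w.xs S x)"
        unfolding hev_wsum w.wsum_def using finL by (intro sum.mono_neutral_cong_right) (auto simp: f'_def)
      also have "... = (\<Sum>S\<in>Pow (L - {l}). f' (insert l S) * w.xs (insert l S) x)"
        unfolding im[OF \<open>l \<in> L\<close>, symmetric] by (simp add: sum.reindex[OF inj])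
      also have "... = (\<Sum>S\<in>Pow (L - {l}). f' (insert l S) * (sg (x l) * w.xs S x))"
      proof (intro sum.cong refl arg_cong2[where f = "(*)"] w.xs_insert)
        fix S assume "S \<in> Pow (L - {l})"
        then show "finite S" "l \<notin> S" using finL finite_subset[of S L] by auto
      qed
      also have "... = sg (x l) * w.wsum (L - {l}) (\<lambda>S. f' (insert l S)) x"
        by (simp add: w.wsum_def sum_distrib_left mult_ac)
      finally show ?thesis by (simp add: power_mult_distrib sg_def)
    qed
    then show "w.expectation (\<lambda>x. w.wsum (L - {l}) (\<lambda>S. f' (insert l S)) x ^ 4) \<le> H^2 * (\<Sum>S\<in>Pow (L - {l}). (f' (insert l S))^2)^2"
      using b.fourth_moment_le[of "{..<m}" d "\<lambda>S. if l \<in> S then f S else 0"] by (simp add: H2 pointed[OF l])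
  next
    fix p q :: nat and b :: "(nat \<times> nat) set => real" assume pq: "1 \<le> p" "1 \<le> q"
    \<comment> \<open>Duality: testing the bilinear form with \<open>g\<close> itself bounds the
      squared norm \<open>A\<close> by \<tau> times \<open>sqrt A\<close> times the norm of
      \<open>b\<close>; division by \<open>sqrt A\<close> gives the operator norm.\<close>
    define g where "g \<alpha> = (\<Sum>V\<in>{V \<in> Pow L. card V = q \<and> \<alpha> \<inter> V = {}}. f' (\<alpha> \<union> V) * b V)" for \<alpha>
    have part: "\<alpha> \<in> wds m \<and> V \<in> wds m" if "\<alpha> \<union> V \<in> wds m" for \<alpha> V
      using words_subset[OF that _ wds_finite[OF that]] by simp
    have g_eq: "g \<alpha> = (\<Sum>V\<in>{V \<in> wds m. card V = q}. glue m f \<alpha> V * b V)" for \<alpha>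
      unfolding g_def
    proof (rule sum.mono_neutral_cong)
      show "finite {V \<in> wds m. card V = q}" using finite_wds by simp
      show "finite {V \<in> Pow L. card V = q \<and> \<alpha> \<inter> V = {}}" using finL by simp
      show "glue m f \<alpha> V * b V = 0" if V: "V \<in> {V \<in> wds m. card V = q} - {V \<in> Pow L. card V = q \<and> \<alpha> \<inter> V = {}}" for V
      proof -
        have "V \<in> Pow L" using V sub by blast
        then have "\<alpha> \<inter> V \<noteq> {}" using V by simp
        then show ?thesis by (simp add: glue_def)
      qed
      show "f' (\<alpha> \<union> V) * b V = 0" if V: "V \<in> {V \<in> Pow L. card V = q \<and> \<alpha> \<inter> V = {}} - {V \<in> wds m. card V = q}" for V
      proof -
        have "V \<notin> wds m" using V by blast
        then have "\<alpha> \<union> V \<notin> wds m" using part[of \<alpha> V] by argo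
        then show ?thesis by (simp add: f'_def)
      qed
      show "f' (\<alpha> \<union> V) * b V = glue m f \<alpha> V * b V" if V: "V \<in> {V \<in> Pow L. card V = q \<and> \<alpha> \<inter> V = {}} \<inter> {V \<in> wds m. card V = q}" for V
        using V by (simp add: f'_def glue_def)
    qed
    have g0: "g \<alpha> = 0" if "\<alpha> \<notin> wds m" for \<alpha>
      unfolding g_eq
    proof (intro sum.neutral ballI)
      fix V
      have "\<alpha> \<union> V \<notin> wds m" using part[of \<alpha> V] that by argo
      then show "glue m f \<alpha> V * b V = 0" by (simp add: glue_def)
    qed
    define A where "A = (\<Sum>\<alpha>\<in>{\<alpha> \<in> wds m. card \<alpha> = p}. (g \<alpha>)^2)"
    define g' where "g' \<alpha> = (if card \<alpha> = p then g \<alpha> else 0)" for \<alpha>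
    have A0: "A \<ge> 0" unfolding A_def by (intro sum_nonneg) simp
    have A1: "(\<Sum>\<alpha>\<in>wds m. (g' \<alpha>)^2) = A"
      unfolding A_def g'_def by (intro sum.mono_neutral_cong_right finite_wds) auto
    have "A = bil m f g' b p q"
    proof -
      have "g \<alpha> * g \<alpha> = (\<Sum>V\<in>{V \<in> wds m. card V = q}. glue m f \<alpha> V * g \<alpha> * b V)" for \<alpha>
      proof -
        have "g \<alpha> * g \<alpha> = g \<alpha> * (\<Sum>V\<in>{V \<in> wds m. card V = q}. glue m f \<alpha> V * b V)" by (subst (2) g_eq) (rule refl)
        then show ?thesis by (simp add: sum_distrib_left mult_ac)
      qed
      then show ?thesis unfolding A_def bil_def power2_eq_square by (intro sum.cong refl) (simp add: g'_def)
    qed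
    also have "... \<le> \<tau> * sqrt A * sqrt (\<Sum>V\<in>wds m. (b V)^2)"
      using bil_le_scale[OF bl pq, of m g' b] by (simp add: A1)
    finally have le: "A \<le> \<tau> * sqrt A * sqrt (\<Sum>V\<in>wds m. (b V)^2)" .
    have "A \<le> \<tau>^2 * (\<Sum>V\<in>wds m. (b V)^2)"
    proof (cases "A = 0")
      case True then show ?thesis by (simp add: sum_nonneg)
    next
      case False
      then have p: "sqrt A > 0" using A0 by simp
      have "sqrt A * sqrt A \<le> (\<tau> * sqrt (\<Sum>V\<in>wds m. (b V)^2)) * sqrt A" using le A0 by (simp add: mult_ac)
      then have "sqrt A \<le> \<tau> * sqrt (\<Sum>V\<in>wds m. (b V)^2)" using p by (simp only: mult_le_cancel_right_pos)
      then have "(sqrt A)^2 \<le> (\<tau> * sqrt (\<Sum>V\<in>wds m. (b V)^2))^2" using p by (intro power_mono) auto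
      then show ?thesis using A0 by (simp add: power_mult_distrib sum_nonneg)
    qed
    also have "... \<le> \<tau>^2 * (\<Sum>V\<in>Pow L. (b V)^2)"
      using sub finL by (intro mult_left_mono sum_mono2) auto
    finally have "A \<le> \<tau>^2 * (\<Sum>V\<in>Pow L. (b V)^2)" .
    moreover have "(\<Sum>\<alpha>\<in>{\<alpha> \<in> Pow L. card \<alpha> = p}. (g \<alpha>)^2) = A"
      unfolding A_def
    proof (rule sum.mono_neutral_right)
      show "\<forall>\<alpha>\<in>{\<alpha> \<in> Pow L. card \<alpha> = p} - {\<alpha> \<in> wds m. card \<alpha> = p}. (g \<alpha>)^2 = 0"
      proof
        fix \<alpha> assume "\<alpha> \<in> {\<alpha> \<in> Pow L. card \<alpha> = p} - {\<alpha> \<in> wds m. card \<alpha> = p}"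
        then have "\<alpha> \<notin> wds m" by blast
        then show "(g \<alpha>)^2 = 0" by (simp add: g0)
      qed
    qed (use sub finL in auto)
    ultimately show "(\<Sum>\<alpha>\<in>{\<alpha> \<in> Pow L. card \<alpha> = p}. (\<Sum>V\<in>{V \<in> Pow L. card V = q \<and> \<alpha> \<inter> V = {}}. f' (\<alpha> \<union> V) * b V)^2) \<le> \<tau>^2 * (\<Sum>V\<in>Pow L. (b V)^2)"
      by (simp add: g_def)
  qed
  have s2: "wp.\<sigma>2 = \<sigma>"
    unfolding wp.\<sigma>2_def \<sigma>_def using sub finL by (intro sum.mono_neutral_cong_right) (auto simp: f'_def)
  have F: "wp.F = hev {..<m} {..<m} d f"
  proof
    fix x
    show "wp.F x = hev {..<m} {..<m} d f x"
      unfolding wp.F_def hev_wsum by (simp only: f'_def[abs_def])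
  qed
  have "\<bar>(\<integral>x. cos (hev {..<m} {..<m} d f x + c) \<partial>NN) - cos c * exp (- \<sigma> / 2)\<bar> \<le> real (d + 1) ^ 3 * 8 ^ d * \<tau> * sqrt \<sigma> + 2 * sqrt mx * H * (real d * \<sigma>)"
    using wp.walsh_clt[of c] unfolding s2 F .
  moreover have "\<bar>(\<integral>x. cos (hev {..<m} {..<m} d f x + c) \<partial>NN) - expectation (\<lambda>u. cos (ev {..<m} d f u + c))\<bar> \<le> 2 * sqrt mx * H * (real d * \<sigma>)"
    using lindeberg[OF D infl, of m c] unfolding H_def \<sigma>_def .
  ultimately show ?thesis unfolding H_def by linarith
qed


section \<open>Joint limits with finitely many variables\<close>

lemma bil_le_restrict:
  assumes "bil_le f e"
  shows "bil_le (\<lambda>S. if S \<noteq> {} \<and> fst ` S \<inter> C = {} then f S else 0) e"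
  unfolding bil_le_def
proof (intro allI impI)
  fix m p q :: nat and a b :: "(nat \<times> nat) set => real"
  assume a: "(\<Sum>S\<in>wds m. (a S)^2) \<le> 1" and b: "(\<Sum>S\<in>wds m. (b S)^2) \<le> 1" and pq: "1 \<le> p" "1 \<le> q"
  define r where "r g S = (if fst ` S \<inter> C = {} then g S else 0 :: real)" for g and S :: "(nat \<times> nat) set"
  have r_le: "(\<Sum>S\<in>wds m. (r g S)^2) \<le> (\<Sum>S\<in>wds m. (g S)^2)" for g
    by (intro sum_mono) (simp add: r_def)
  \<comment> \<open>A union avoids \<open>C\<close> exactly when both parts do, so the restriction
    can be moved to the test vectors, whose norms only decrease.\<close>
  have "bil m (\<lambda>S. if S \<noteq> {} \<and> fst ` S \<inter> C = {} then f S else 0) a b p q = bil m f (r a) (r b) p q"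
    unfolding bil_def
  proof (intro sum.cong refl)
    fix \<alpha> \<beta> assume "\<alpha> \<in> {\<alpha> \<in> wds m. card \<alpha> = p}"
    then have ne: "\<alpha> \<union> \<beta> \<noteq> {}" using pq by auto
    have "fst ` (\<alpha> \<union> \<beta>) \<inter> C = {} \<longleftrightarrow> fst ` \<alpha> \<inter> C = {} \<and> fst ` \<beta> \<inter> C = {}" by (simp add: image_Un Int_Un_distrib2)
    then show "glue m (\<lambda>S. if S \<noteq> {} \<and> fst ` S \<inter> C = {} then f S else 0) \<alpha> \<beta> * a \<alpha> * b \<beta> = glue m f \<alpha> \<beta> * r a \<alpha> * r b \<beta>"
      using ne by (simp add: glue_def r_def)
  qed
  moreover have "\<bar>bil m f (r a) (r b) p q\<bar> \<le> e"
    using assms pq order_trans[OF r_le a] order_trans[OF r_le b] by (simp add: bil_le_def)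
  ultimately show "\<bar>bil m (\<lambda>S. if S \<noteq> {} \<and> fst ` S \<inter> C = {} then f S else 0) a b p q\<bar> \<le> e" by simp
qed

lemma exp_minus_diff_le:
  fixes a b :: real assumes "0 \<le> a" "a \<le> b" shows "\<bar>exp (- a) - exp (- b)\<bar> \<le> b - a"
proof -
  have "exp (- b) = exp (- a) * exp (- (b - a))" by (simp add: exp_add[symmetric])
  then have "exp (- a) - exp (- b) = exp (- a) * (1 - exp (- (b - a)))" by (simp add: algebra_simps)
  also have "... \<le> 1 * (b - a)"
  proof (rule mult_mono)
    show "1 - exp (- (b - a)) \<le> b - a" using exp_ge_add_one_self[of "- (b - a)"] by linarith
  qed (use assms in auto)
  finally have "exp (- a) - exp (- b) \<le> b - a" by simp
  moreover have "exp (- b) \<le> exp (- a)" using assms by simp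
  ultimately show ?thesis by linarith
qed

lemma expectation_bounded_le_1:
  fixes G :: "'a => real"
  assumes "G \<in> borel_measurable M" "\<And>w. \<bar>G w\<bar> \<le> 1" shows "\<bar>expectation G\<bar> \<le> 1"
proof -
  have m: "G \<in> all_moments M" by (rule all_moments_bounded[OF finite_measure_axioms assms])
  have "expectation (\<lambda>w. \<bar>G w\<bar>) \<le> expectation (\<lambda>w. 1)"
    by (intro integral_mono assms(2) all_moments_integrable all_moments_abs m all_moments_closed)
  then have "expectation (\<lambda>w. \<bar>G w\<bar>) \<le> 1" by (simp add: prob_space)
  with integral_abs_bound[of M G] show ?thesis by (rule order_trans)
qed

text \<open>Removing from \<open>F\<close> its mean and all words that meet \<open>C\<close> leaves
  \<open>Z\<close>, independent of \<open>Y\<close>. The removed mass is at most \<delta>: the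
  squared mean plus one influence for each element of \<open>C\<close>. Cosine and sine of
  \<open>Z\<close> come from \<open>ev_clt\<close> with phases 0 and \<open>pi / 2\<close>.\<close>

lemma joint_clt:
  fixes F Y :: "'a => real" and C :: "nat set"
  assumes D: "d = Suc D" and F: "F \<in> ordinary_polynomials X d"
    and infl: "infl_le (coef F) mx" and bl: "bil_le (coef F) \<tau>" and \<tau>: "\<tau> \<ge> 0"
    and C: "finite C" and Y: "Y \<in> borel_measurable (sig C)"
  defines "s \<equiv> expectation (\<lambda>w. (F w)^2)" and "\<delta> \<equiv> (expectation F)^2 + real (card C) * mx"
  shows "\<bar>expectation (\<lambda>w. cos (Y w + F w)) - expectation (\<lambda>w. cos (Y w)) * exp (- s / 2)\<bar>
    \<le> 2 * (real (d + 1) ^ 3 * 8 ^ d * \<tau> * sqrt s + 4 * sqrt mx * sqrt (hyper ^ d) * (real d * s)) + sqrt \<delta> + \<delta> / 2"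
proof -
  define f where "f = coef F"
  define f0 where "f0 S = (if S \<noteq> {} \<and> fst ` S \<inter> C = {} then f S else 0)" for S
  have Fm: "F \<in> all_moments M" by (rule ordinary_moments[OF F])
  obtain I where "finite I" and rep: "\<forall>J. finite J --> I \<subseteq> J --> (AE w in M. F w = ev J d (coef F) w)"
    using ordinary_polynomial_words(1)[OF F order_refl] by auto
  obtain m where "I \<subseteq> {..<m}" using finite_nat_iff_bounded[of I] \<open>finite I\<close> by auto
  then have AE: "AE w in M. F w = ev {..<m} d f w" using rep unfolding f_def by simp
  define Z where "Z = ev {..<m} d f0"
  have Zm: "Z \<in> all_moments M" unfolding Z_def by (rule ev_moments)
  define J where "J = {..<m} - C"
  have Zs: "Z \<in> borel_measurable (sigB J)"
  proof -
    have "Z = ev J d f0"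
    proof
      fix w
      show "Z w = ev J d f0 w" unfolding Z_def ev_def
        by (rule sum.mono_neutral_right[OF finite_wds]) (auto simp: words_def J_def f0_def)
    qed
    then show ?thesis using ev_sigB by simp
  qed
  have dis: "C \<inter> (\<Union>i\<in>J. {i}) = {}" by (auto simp: J_def)
  define \<sigma> where "\<sigma> = (\<Sum>S\<in>wds m. (f0 S)^2)"
  have s_eq: "s = (\<Sum>S\<in>wds m. (f S)^2)"
  proof -
    have "s = expectation (\<lambda>w. (ev {..<m} d f w)^2)"
      unfolding s_def
    proof (rule integral_cong_AE)
      show "AE w in M. (F w)^2 = (ev {..<m} d f w)^2" using AE by eventually_elim simp
    qed (intro all_moments_measurable all_moments_closed Fm ev_moments)+
    then show ?thesis by (simp add: expectation_ev_square)
  qed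
  define \<epsilon> where "\<epsilon> = (\<Sum>S\<in>wds m. (f S - f0 S)^2)"
  have mx0: "mx \<ge> 0" using infl infl_nonneg[of m "coef F" 0] by (auto simp: infl_le_def intro: order_trans)
  have \<epsilon>_le: "\<epsilon> \<le> \<delta>"
  proof -
    have "(f S - f0 S)^2 \<le> (if S = {} then (f S)^2 else 0) + (\<Sum>c\<in>C. if c \<in> fst ` S then (f S)^2 else 0)" for S
    proof (cases "fst ` S \<inter> C = {}")
      case True
      have "0 \<le> (\<Sum>c\<in>C. if c \<in> fst ` S then (f S)^2 else 0)" by (intro sum_nonneg) simp
      then show ?thesis using True by (simp add: f0_def)
    next
      case False
      then obtain c where c: "c \<in> C" "c \<in> fst ` S" by auto
      have "(f S)^2 = (if c \<in> fst ` S then (f S)^2 else 0)" using c by simp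
      also have "... \<le> (\<Sum>c\<in>C. if c \<in> fst ` S then (f S)^2 else 0)"
        by (rule member_le_sum) (use c C in auto)
      finally show ?thesis using False by (auto simp: f0_def)
    qed
    then have "\<epsilon> \<le> (\<Sum>S\<in>wds m. (if S = {} then (f S)^2 else 0) + (\<Sum>c\<in>C. if c \<in> fst ` S then (f S)^2 else 0))"
      unfolding \<epsilon>_def by (intro sum_mono)
    also have "... = (\<Sum>S\<in>wds m. if S = {} then (f S)^2 else 0) + (\<Sum>c\<in>C. \<Sum>S\<in>wds m. if c \<in> fst ` S then (f S)^2 else 0)"
      by (simp add: sum.distrib sum.swap[of _ C])
    also have "(\<Sum>c\<in>C. \<Sum>S\<in>wds m. if c \<in> fst ` S then (f S)^2 else 0) = (\<Sum>c\<in>C. infl m f c)"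
      unfolding infl_def by (intro sum.cong refl sum.mono_neutral_cong_right finite_wds) auto
    also have "... \<le> (\<Sum>c\<in>C. mx)" using infl by (intro sum_mono) (simp add: infl_le_def f_def)
    also have "(\<Sum>S\<in>wds m. if S = {} then (f S)^2 else 0) = (f {})^2"
      by (subst sum.delta[OF finite_wds]) (simp add: words_def)
    also have "f {} = expectation F" by (simp add: f_def coef_def)
    finally show ?thesis by (simp add: \<delta>_def)
  qed
  have \<epsilon>0: "\<epsilon> \<ge> 0" unfolding \<epsilon>_def by (intro sum_nonneg) simp
  have \<epsilon>_eq: "s - \<sigma> = \<epsilon>"
    unfolding s_eq \<sigma>_def \<epsilon>_def sum_subtractf[symmetric] by (intro sum.cong refl) (simp add: f0_def)
  have \<sigma>0: "\<sigma> \<ge> 0" unfolding \<sigma>_def by (intro sum_nonneg) simp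
  have "expectation (\<lambda>w. (F w - Z w)^2) = \<epsilon>"
  proof -
    have lin: "ev {..<m} d f w - Z w = ev {..<m} d (\<lambda>S. f S - f0 S) w" for w
      unfolding Z_def ev_def sum_subtractf[symmetric] by (simp add: left_diff_distrib)
    have "expectation (\<lambda>w. (F w - Z w)^2) = expectation (\<lambda>w. (ev {..<m} d (\<lambda>S. f S - f0 S) w)^2)"
    proof (rule integral_cong_AE)
      show "AE w in M. (F w - Z w)^2 = (ev {..<m} d (\<lambda>S. f S - f0 S) w)^2"
        using AE by eventually_elim (simp add: lin[symmetric])
    qed (intro all_moments_measurable all_moments_closed Fm Zm ev_moments)+
    then show ?thesis by (simp add: expectation_ev_square \<epsilon>_def)
  qed
  then have "expectation (\<lambda>w. \<bar>F w - Z w\<bar>) \<le> sqrt \<epsilon>"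
    using expectation_abs_le_sqrt[of "\<lambda>w. F w - Z w"] by (simp add: all_moments_closed Fm Zm)
  then have FZ: "expectation (\<lambda>w. \<bar>F w - Z w\<bar>) \<le> sqrt \<delta>"
    using real_sqrt_le_mono[OF \<epsilon>_le] by (rule order_trans)
  define \<eta> where "\<eta> = real (d + 1) ^ 3 * 8 ^ d * \<tau> * sqrt s + 4 * sqrt mx * sqrt (hyper ^ d) * (real d * s)"
  have infl0: "infl_le f0 mx"
    unfolding infl_le_def
  proof (intro allI)
    fix m i
    have "infl m f0 i \<le> infl m f i" unfolding infl_def by (intro sum_mono) (simp add: f0_def)
    moreover have "infl m f i \<le> mx" using infl by (simp add: infl_le_def f_def)
    ultimately show "infl m f0 i \<le> mx" by linarith
  qed
  have bl0: "bil_le f0 \<tau>" unfolding f0_def[abs_def] f_def by (rule bil_le_restrict) (rule bl)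
  have Zclt: "\<bar>expectation (\<lambda>w. cos (Z w + c)) - cos c * exp (- \<sigma> / 2)\<bar> \<le> \<eta>" for c
  proof -
    have "\<bar>expectation (\<lambda>w. cos (Z w + c)) - cos c * exp (- \<sigma> / 2)\<bar> \<le> real (d + 1) ^ 3 * 8 ^ d * \<tau> * sqrt \<sigma> + 4 * sqrt mx * sqrt (hyper ^ d) * (real d * \<sigma>)"
      unfolding Z_def \<sigma>_def by (rule ev_clt[OF D infl0 bl0 \<tau>]) (simp add: f0_def)
    also have "... \<le> \<eta>"
    proof -
      have "\<sigma> \<le> s" using \<epsilon>_eq \<epsilon>0 by simp
      then show ?thesis unfolding \<eta>_def using hyper_ge_1 \<tau> mx0
        by (intro add_mono mult_left_mono) (auto intro!: mult_nonneg_nonneg)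
    qed
    finally show ?thesis .
  qed
  have Ym: "Y \<in> borel_measurable M" by (rule sig_measurable[OF Y])
  have Zmm: "Z \<in> borel_measurable M" by (rule all_moments_measurable[OF Zm])
  have Fmm: "F \<in> borel_measurable M" by (rule all_moments_measurable[OF Fm])
  have bm: "(\<lambda>w. cos (G w)) \<in> all_moments M" "(\<lambda>w. sin (G w)) \<in> all_moments M" if "G \<in> borel_measurable M" for G
    using that by (auto intro!: all_moments_bounded[OF finite_measure_axioms, of _ 1])
  have "expectation (\<lambda>w. cos (Y w + Z w)) = expectation (\<lambda>w. cos (Y w) * cos (Z w)) - expectation (\<lambda>w. sin (Y w) * sin (Z w))"
    unfolding cos_add by (intro Bochner_Integration.integral_diff all_moments_integrable all_moments_closed bm Ym Zmm)
  also have "expectation (\<lambda>w. cos (Y w) * cos (Z w)) = expectation (\<lambda>w. cos (Y w)) * expectation (\<lambda>w. cos (Z w))"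
    by (intro expectation_mult_sig[OF dis] bm Ym Zmm measurable_compose[OF Y] measurable_compose[OF Zs]) simp_all
  also have "expectation (\<lambda>w. sin (Y w) * sin (Z w)) = expectation (\<lambda>w. sin (Y w)) * expectation (\<lambda>w. sin (Z w))"
    by (intro expectation_mult_sig[OF dis] bm Ym Zmm measurable_compose[OF Y] measurable_compose[OF Zs]) simp_all
  finally have split: "expectation (\<lambda>w. cos (Y w + Z w)) = expectation (\<lambda>w. cos (Y w)) * expectation (\<lambda>w. cos (Z w)) - expectation (\<lambda>w. sin (Y w)) * expectation (\<lambda>w. sin (Z w))" .
  have cy: "\<bar>expectation (\<lambda>w. cos (Y w))\<bar> \<le> 1" "\<bar>expectation (\<lambda>w. sin (Y w))\<bar> \<le> 1"
    using Ym by (auto intro!: expectation_bounded_le_1)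
  have cz: "\<bar>expectation (\<lambda>w. cos (Z w)) - exp (- \<sigma> / 2)\<bar> \<le> \<eta>" using Zclt[of 0] by simp
  have sz: "\<bar>expectation (\<lambda>w. sin (Z w))\<bar> \<le> \<eta>"
  proof -
    have "cos (z + pi / 2) = - sin z" for z :: real by (simp add: cos_add)
    then show ?thesis using Zclt[of "pi / 2"] by simp
  qed
  have YZ: "\<bar>expectation (\<lambda>w. cos (Y w + Z w)) - expectation (\<lambda>w. cos (Y w)) * exp (- \<sigma> / 2)\<bar> \<le> 2 * \<eta>"
  proof -
    define p where "p = expectation (\<lambda>w. cos (Y w))"
    define q where "q = expectation (\<lambda>w. sin (Y w))"
    define u where "u = expectation (\<lambda>w. cos (Z w)) - exp (- \<sigma> / 2)"
    define v where "v = expectation (\<lambda>w. sin (Z w))"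
    have "\<bar>p * u\<bar> \<le> 1 * \<eta>" unfolding abs_mult by (intro mult_mono) (use cy cz in \<open>auto simp: p_def u_def\<close>)
    moreover have "\<bar>q * v\<bar> \<le> 1 * \<eta>" unfolding abs_mult by (intro mult_mono) (use cy sz in \<open>auto simp: q_def v_def\<close>)
    moreover have "expectation (\<lambda>w. cos (Y w + Z w)) - p * exp (- \<sigma> / 2) = p * u - q * v"
      unfolding split by (simp add: p_def q_def u_def v_def algebra_simps)
    ultimately show ?thesis unfolding p_def[symmetric] by linarith
  qed
  have YF: "\<bar>expectation (\<lambda>w. cos (Y w + F w)) - expectation (\<lambda>w. cos (Y w + Z w))\<bar> \<le> sqrt \<delta>"
  proof -
    define G where "G w = cos (Y w + F w) - cos (Y w + Z w)" for w
    have Gm: "G \<in> all_moments M" unfolding G_def[abs_def] using Ym Zmm Fmm by (intro all_moments_closed bm borel_measurable_add)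
    have EG: "expectation G = expectation (\<lambda>w. cos (Y w + F w)) - expectation (\<lambda>w. cos (Y w + Z w))"
      unfolding G_def[abs_def] using Ym Zmm Fmm
      by (intro Bochner_Integration.integral_diff all_moments_integrable bm borel_measurable_add)
    have "expectation (\<lambda>w. \<bar>G w\<bar>) \<le> expectation (\<lambda>w. \<bar>F w - Z w\<bar>)"
    proof (rule integral_mono)
      show "\<bar>G w\<bar> \<le> \<bar>F w - Z w\<bar>" for w using cos_lipschitz[of "Y w + F w" "Y w + Z w"] by (simp add: G_def)
    qed (intro all_moments_integrable all_moments_abs all_moments_closed Gm Fm Zm)+
    then have "\<bar>expectation G\<bar> \<le> sqrt \<delta>" using integral_abs_bound[of M G] FZ by linarith
    then show ?thesis unfolding EG .
  qed
  have "\<bar>exp (- (\<sigma> / 2)) - exp (- (s / 2))\<bar> \<le> s / 2 - \<sigma> / 2"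
    using \<sigma>0 \<epsilon>_eq \<epsilon>0 by (intro exp_minus_diff_le) auto
  then have es: "\<bar>exp (- \<sigma> / 2) - exp (- s / 2)\<bar> \<le> \<delta> / 2" using \<epsilon>_eq \<epsilon>_le by simp
  have "\<bar>expectation (\<lambda>w. cos (Y w)) * exp (- \<sigma> / 2) - expectation (\<lambda>w. cos (Y w)) * exp (- s / 2)\<bar> \<le> 1 * (\<delta> / 2)"
    unfolding right_diff_distrib[symmetric] abs_mult by (intro mult_mono es cy) auto
  then show ?thesis using YZ YF unfolding \<eta>_def by linarith
qed

end

context iid_ultra
begin

text \<open>The sets \<open>C n\<close> may move with n; it suffices that their size stays bounded,
  because then the influences they absorb tend to zero together.\<close>

theorem Negl_joint_clt:
  fixes Y :: "nat => 'a => real" and C :: "nat => nat set"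
  assumes D: "d = Suc D" and F: "F \<in> Negl" and C: "\<And>n. finite (C n)" "\<And>n. card (C n) \<le> k"
    and Y: "\<And>n. Y n \<in> borel_measurable (sig (C n))"
  shows "((\<lambda>n. expectation (\<lambda>w. cos (Y n w + F n w)) - expectation (\<lambda>w. cos (Y n w)) * exp (- ip F F / 2)) \<longlongrightarrow> 0) U"
proof -
  note Fb = Negl_bseq[OF F]
  obtain S where S: "S \<ge> 0" "\<And>n. sq (F n) \<le> S" using bseq_bound[OF Fb] by blast
  define R where "R n = expectation (\<lambda>w. cos (Y n w + F n w)) - expectation (\<lambda>w. cos (Y n w)) * exp (- sq (F n) / 2)" for n
  define T where "T n = expectation (\<lambda>w. cos (Y n w)) * (exp (- sq (F n) / 2) - exp (- ip F F / 2))" for n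
  \<comment> \<open>With influences at most \<open>t^2\<close> and contractions at most t, every
    term of \<open>joint_clt\<close> is at most linear in t for \<open>t \<le> 1\<close>, and
    \<open>A\<close> collects the coefficients. Here \<open>1 + real k\<close> stems from the
    squared mean and the at most k influences.\<close>
  define A where "A = 2 * (real (d + 1) ^ 3 * 8 ^ d * sqrt S + 4 * sqrt (hyper ^ d) * (real d * S)) + sqrt (1 + real k) + (1 + real k) / 2"
  have A0: "A > 0" unfolding A_def using S(1) hyper_ge_1
    by (intro add_nonneg_pos mult_nonneg_nonneg add_nonneg_nonneg) auto
  have R_le: "eventually (\<lambda>n. \<bar>R n\<bar> \<le> A * t) U" if t: "0 < t" "t \<le> 1" for t
  proof -
    have "eventually (\<lambda>n. \<bar>expectation (F n)\<bar> < t) U"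
    proof -
      have "((\<lambda>n. expectation (F n)) \<longlongrightarrow> 0) U" using F by (simp add: Negl_def)
      then show ?thesis using t(1) by (auto dest!: tendstoD[of _ _ _ t] simp: dist_real_def)
    qed
    moreover have "eventually (\<lambda>n. infl_le (coef (F n)) (t^2)) U" using t by (intro Negl_infl_le[OF F]) simp
    moreover have "eventually (\<lambda>n. bil_le (coef (F n)) t) U" using t by (intro Negl_bil_le[OF F])
    ultimately show ?thesis
    proof eventually_elim
      case (elim n)
      define s where "s = sq (F n)"
      define \<delta> where "\<delta> = (expectation (F n))^2 + real (card (C n)) * t^2"
      have s: "0 \<le> s" "s \<le> S" using S by (auto simp: s_def)
      have "(expectation (F n))^2 \<le> t^2" using elim(1) by (simp add: abs_le_square_iff[symmetric])
      moreover have "real (card (C n)) * t^2 \<le> real k * t^2" using C(2)[of n] by (intro mult_right_mono) auto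
      ultimately have \<delta>: "\<delta> \<le> (1 + real k) * t^2" unfolding \<delta>_def by (simp add: algebra_simps)
      have sd: "sqrt \<delta> \<le> sqrt (1 + real k) * t"
        using real_sqrt_le_mono[OF \<delta>] t by (simp add: real_sqrt_mult)
      have "(1 + real k) * t^2 \<le> (1 + real k) * t"
        using t by (intro mult_left_mono) (auto simp: power2_eq_square mult_left_le)
      then have \<delta>2: "\<delta> \<le> (1 + real k) * t" using \<delta> by linarith
      have "\<bar>R n\<bar> \<le> 2 * (real (d + 1) ^ 3 * 8 ^ d * t * sqrt s + 4 * sqrt (t^2) * sqrt (hyper ^ d) * (real d * s)) + sqrt \<delta> + \<delta> / 2"
        unfolding R_def s_def \<delta>_def
        by (rule joint_clt[OF D bseq_poly[OF Fb] elim(2,3) _ C(1) Y]) (use t in simp)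
      moreover have "real (d + 1) ^ 3 * 8 ^ d * t * sqrt s \<le> real (d + 1) ^ 3 * 8 ^ d * t * sqrt S"
        using s t by (intro mult_left_mono) auto
      moreover have "4 * sqrt (t^2) * sqrt (hyper ^ d) * (real d * s) \<le> 4 * t * sqrt (hyper ^ d) * (real d * S)"
        using s t hyper_ge_1 by (simp add: mult_left_mono mult_nonneg_nonneg)
      ultimately have "\<bar>R n\<bar> \<le> 2 * (real (d + 1) ^ 3 * 8 ^ d * t * sqrt S + 4 * t * sqrt (hyper ^ d) * (real d * S)) + sqrt (1 + real k) * t + (1 + real k) * t / 2"
        using sd \<delta>2 by argo
      also have "... = A * t" unfolding A_def by (simp add: algebra_simps)
      finally show ?case .
    qed
  qed
  have "(R \<longlongrightarrow> 0) U"
  proof (rule tendstoI)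
    fix e :: real assume e: "e > 0"
    define t where "t = min 1 (e / (2 * A))"
    have t: "0 < t" "t \<le> 1" using e A0 by (auto simp: t_def)
    have "A * t \<le> A * (e / (2 * A))" using A0 by (intro mult_left_mono) (auto simp: t_def)
    then have "A * t < e" using A0 e by simp
    with R_le[OF t] show "eventually (\<lambda>n. dist (R n) 0 < e) U"
      by (auto elim!: eventually_mono)
  qed
  moreover have "(T \<longlongrightarrow> 0) U"
  proof (rule Lim_null_comparison)
    show "((\<lambda>n. \<bar>exp (- sq (F n) / 2) - exp (- ip F F / 2)\<bar>) \<longlongrightarrow> 0) U"
    proof -
      have "((\<lambda>n. exp (- sq (F n) / 2)) \<longlongrightarrow> exp (- ip F F / 2)) U"
        by (intro tendsto_intros sq_tendsto[OF Fb]) simp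
      then show ?thesis by (intro tendsto_rabs_zero) (simp add: LIM_zero_iff tendsto_diff LIM_zero)
    qed
    show "eventually (\<lambda>n. norm (T n) \<le> \<bar>exp (- sq (F n) / 2) - exp (- ip F F / 2)\<bar>) U"
    proof (intro always_eventually allI)
      fix n
      have "\<bar>expectation (\<lambda>w. cos (Y n w))\<bar> \<le> 1"
        using sig_measurable[OF Y[of n]] by (intro expectation_bounded_le_1) auto
      then show "norm (T n) \<le> \<bar>exp (- sq (F n) / 2) - exp (- ip F F / 2)\<bar>"
        unfolding T_def real_norm_def abs_mult by (intro mult_left_le_one_le) auto
    qed
  qed
  ultimately have "((\<lambda>n. R n + T n) \<longlongrightarrow> 0 + 0) U" by (rule tendsto_add)
  then show ?thesis by (simp add: R_def T_def algebra_simps)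
qed

end

subsection \<open>Trigonometric approximation\<close>

text \<open>The free phase c brings in the sines and makes the class closed under products, hence an
  algebra.\<close>

inductive_set trig :: "(('v => real) => real) set" where
  cos: "finite V ==> (\<lambda>y. a * cos ((\<Sum>v\<in>V. t v * y v) + c)) \<in> trig"
| add: "\<phi> \<in> trig ==> \<psi> \<in> trig ==> (\<lambda>y. \<phi> y + \<psi> y) \<in> trig"

text \<open>Polynomials are taken as functions with a degree bound, because the same polynomial is
  evaluated at the generating sequences and at their limits.\<close>

inductive_set pol :: "(nat \<times> (('v => real) => real)) set" where
  const: "(k, \<lambda>y. c) \<in> pol"
| var: "1 \<le> k ==> (k, \<lambda>y. y v) \<in> pol"
| add: "(k, p) \<in> pol ==> (k, q) \<in> pol ==> (k, \<lambda>y. p y + q y) \<in> pol"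
| mult: "(i, p) \<in> pol ==> (j, q) \<in> pol ==> i + j \<le> k ==> (k, \<lambda>y. p y * q y) \<in> pol"

lemma trig_const: "(\<lambda>y. c) \<in> trig"
  using trig.cos[of "{}" c "\<lambda>_. 0" 0] by simp

lemma trig_sin: "(\<lambda>y. sin (t * y v)) \<in> trig"
proof -
  have "(\<lambda>y. sin (t * y v)) = (\<lambda>y. 1 * cos ((\<Sum>w\<in>{v}. t * y w) + (- (pi / 2))))"
    by (simp add: fun_eq_iff cos_diff)
  also have "... \<in> trig" by (rule trig.cos) simp
  finally show ?thesis .
qed

lemma trig_cos_mult_cos:
  assumes V: "finite V" and V': "finite V'"
  shows "(\<lambda>y. (a * cos ((\<Sum>v\<in>V. t v * y v) + c)) * (a' * cos ((\<Sum>v\<in>V'. t' v * y v) + c'))) \<in> trig"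
proof -
  define s where "s v = (if v \<in> V then t v else 0)" for v
  define s' where "s' v = (if v \<in> V' then t' v else 0)" for v
  have e: "(\<Sum>v\<in>V. t v * y v) = (\<Sum>v\<in>V \<union> V'. s v * y v)" for y
    using V V' by (intro sum.mono_neutral_cong_left) (auto simp: s_def)
  have e': "(\<Sum>v\<in>V'. t' v * y v) = (\<Sum>v\<in>V \<union> V'. s' v * y v)" for y
    using V V' by (intro sum.mono_neutral_cong_left) (auto simp: s'_def)
  have "(\<lambda>y. (a * cos ((\<Sum>v\<in>V. t v * y v) + c)) * (a' * cos ((\<Sum>v\<in>V'. t' v * y v) + c'))) =
    (\<lambda>y. a * a' / 2 * cos ((\<Sum>v\<in>V \<union> V'. (s v - s' v) * y v) + (c - c')) + a * a' / 2 * cos ((\<Sum>v\<in>V \<union> V'. (s v + s' v) * y v) + (c + c')))"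
  proof
    fix y
    define A where "A = (\<Sum>v\<in>V \<union> V'. s v * y v) + c"
    define A' where "A' = (\<Sum>v\<in>V \<union> V'. s' v * y v) + c'"
    have m: "(\<Sum>v\<in>V \<union> V'. (s v - s' v) * y v) + (c - c') = A - A'"
      by (simp add: A_def A'_def sum_subtractf left_diff_distrib)
    have m': "(\<Sum>v\<in>V \<union> V'. (s v + s' v) * y v) + (c + c') = A + A'"
      by (simp add: A_def A'_def sum.distrib distrib_right)
    show "(a * cos ((\<Sum>v\<in>V. t v * y v) + c)) * (a' * cos ((\<Sum>v\<in>V'. t' v * y v) + c')) =
      a * a' / 2 * cos ((\<Sum>v\<in>V \<union> V'. (s v - s' v) * y v) + (c - c')) + a * a' / 2 * cos ((\<Sum>v\<in>V \<union> V'. (s v + s' v) * y v) + (c + c'))"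
      unfolding e e' A_def[symmetric] A'_def[symmetric] m m' by (simp add: cos_add cos_diff field_simps)
  qed
  also have "... \<in> trig" using V V' by (intro trig.intros) auto
  finally show ?thesis .
qed

lemma trig_mult:
  assumes "\<phi> \<in> trig" "\<psi> \<in> trig" shows "(\<lambda>y. \<phi> y * \<psi> y) \<in> trig"
  using assms(1)
proof induction
  case (cos V a t c)
  show ?case using assms(2)
  proof induction
    case (cos V' a' t' c')
    show ?case by (rule trig_cos_mult_cos) fact+
  next
    case (add \<phi> \<psi>)
    show ?case unfolding distrib_left by (rule trig.add) fact+
  qed
next
  case (add \<phi>' \<psi>')
  show ?case unfolding distrib_right by (rule trig.add) fact+
qed

lemma trig_polynomial_function:
  fixes q :: "real => real"
  assumes "real_polynomial_function q" "\<phi> \<in> trig" shows "(\<lambda>y. q (\<phi> y)) \<in> trig"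
  using assms(1)
proof induction
  case (linear f)
  have "f x = f 1 * x" for x
    using linear_scale[OF bounded_linear.linear[OF linear], of x 1] by simp
  then have "(\<lambda>y. f (\<phi> y)) = (\<lambda>y. f 1 * \<phi> y)" by (rule ext)
  also have "... \<in> trig" by (rule trig_mult[OF trig_const assms(2)])
  finally show ?case .
next
  case (const c) show ?case by (rule trig_const)
next
  case (add f g) show ?case by (rule trig.add) fact+
next
  case (mult f g) show ?case by (rule trig_mult) fact+
qed

lemma trig_pol:
  assumes "(k, p) \<in> pol" "\<And>v. u v \<in> trig" shows "(\<lambda>y. p (\<lambda>v. u v y)) \<in> trig"
  using assms(1)
proof induction
  case (const k c) show ?case by (rule trig_const)
next
  case (var k v) show ?case by (rule assms(2))
next
  case (add k p q) show ?case by (rule trig.add) fact+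
next
  case (mult i p j q k) show ?case by (rule trig_mult) fact+
qed

text \<open>Dependence on finitely many coordinates and the Lipschitz bound on a box are proved
  together: for a product the Lipschitz bound also supplies the bound on the size of each
  factor.\<close>

lemma pol_lipschitz:
  assumes "(k, p) \<in> pol"
  shows "\<exists>V. finite V \<and> (\<forall>R\<ge>0. \<exists>L\<ge>0. \<forall>y y'. (\<forall>v\<in>V. \<bar>y v\<bar> \<le> R \<and> \<bar>y' v\<bar> \<le> R) -->
     \<bar>p y - p y'\<bar> \<le> L * (\<Sum>v\<in>V. \<bar>y v - y' v\<bar>))"
  using assms
proof induction
  case (const k c)
  show ?case by (intro exI[of _ "{}"]) auto
next
  case (var k v)
  show ?case by (intro exI[of _ "{v}"]) (auto intro!: exI[of _ 1])
next
  case (add k p q)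
  obtain V where V: "finite V" "\<And>R. R \<ge> 0 ==> \<exists>L\<ge>0. \<forall>y y'. (\<forall>v\<in>V. \<bar>y v\<bar> \<le> R \<and> \<bar>y' v\<bar> \<le> R) --> \<bar>p y - p y'\<bar> \<le> L * (\<Sum>v\<in>V. \<bar>y v - y' v\<bar>)"
    using add.IH(1) by blast
  obtain V' where V': "finite V'" "\<And>R. R \<ge> 0 ==> \<exists>L\<ge>0. \<forall>y y'. (\<forall>v\<in>V'. \<bar>y v\<bar> \<le> R \<and> \<bar>y' v\<bar> \<le> R) --> \<bar>q y - q y'\<bar> \<le> L * (\<Sum>v\<in>V'. \<bar>y v - y' v\<bar>)"
    using add.IH(2) by blast
  show ?case
  proof (intro exI[of _ "V \<union> V'"] conjI allI impI)
    show "finite (V \<union> V')" using V V' by simp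
    fix R :: real assume R: "R \<ge> 0"
    obtain L where L: "L \<ge> 0" "\<And>y y'. \<forall>v\<in>V. \<bar>y v\<bar> \<le> R \<and> \<bar>y' v\<bar> \<le> R ==> \<bar>p y - p y'\<bar> \<le> L * (\<Sum>v\<in>V. \<bar>y v - y' v\<bar>)"
      using V(2)[OF R] by blast
    obtain L' where L': "L' \<ge> 0" "\<And>y y'. \<forall>v\<in>V'. \<bar>y v\<bar> \<le> R \<and> \<bar>y' v\<bar> \<le> R ==> \<bar>q y - q y'\<bar> \<le> L' * (\<Sum>v\<in>V'. \<bar>y v - y' v\<bar>)"
      using V'(2)[OF R] by blast
    show "\<exists>L\<ge>0. \<forall>y y'. (\<forall>v\<in>V \<union> V'. \<bar>y v\<bar> \<le> R \<and> \<bar>y' v\<bar> \<le> R) --> \<bar>p y + q y - (p y' + q y')\<bar> \<le> L * (\<Sum>v\<in>V \<union> V'. \<bar>y v - y' v\<bar>)"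
    proof (intro exI[of _ "L + L'"] conjI allI impI)
      show "L + L' \<ge> 0" using L L' by simp
      fix y y' assume b: "\<forall>v\<in>V \<union> V'. \<bar>y v\<bar> \<le> R \<and> \<bar>y' v\<bar> \<le> R"
      have "(\<Sum>v\<in>V. \<bar>y v - y' v\<bar>) \<le> (\<Sum>v\<in>V \<union> V'. \<bar>y v - y' v\<bar>)" using V V' by (intro sum_mono2) auto
      then have 1: "L * (\<Sum>v\<in>V. \<bar>y v - y' v\<bar>) \<le> L * (\<Sum>v\<in>V \<union> V'. \<bar>y v - y' v\<bar>)" using L(1) by (rule mult_left_mono)
      have "(\<Sum>v\<in>V'. \<bar>y v - y' v\<bar>) \<le> (\<Sum>v\<in>V \<union> V'. \<bar>y v - y' v\<bar>)" using V V' by (intro sum_mono2) auto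
      then have 2: "L' * (\<Sum>v\<in>V'. \<bar>y v - y' v\<bar>) \<le> L' * (\<Sum>v\<in>V \<union> V'. \<bar>y v - y' v\<bar>)" using L'(1) by (rule mult_left_mono)
      have "\<bar>p y - p y'\<bar> \<le> L * (\<Sum>v\<in>V. \<bar>y v - y' v\<bar>)" using b by (intro L(2)) simp
      moreover have "\<bar>q y - q y'\<bar> \<le> L' * (\<Sum>v\<in>V'. \<bar>y v - y' v\<bar>)" using b by (intro L'(2)) simp
      ultimately show "\<bar>p y + q y - (p y' + q y')\<bar> \<le> (L + L') * (\<Sum>v\<in>V \<union> V'. \<bar>y v - y' v\<bar>)"
        using 1 2 unfolding distrib_right by linarith
    qed
  qed
next
  case (mult i p j q k)
  obtain V where V: "finite V" "\<And>R. R \<ge> 0 ==> \<exists>L\<ge>0. \<forall>y y'. (\<forall>v\<in>V. \<bar>y v\<bar> \<le> R \<and> \<bar>y' v\<bar> \<le> R) --> \<bar>p y - p y'\<bar> \<le> L * (\<Sum>v\<in>V. \<bar>y v - y' v\<bar>)"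
    using mult.IH(1) by blast
  obtain V' where V': "finite V'" "\<And>R. R \<ge> 0 ==> \<exists>L\<ge>0. \<forall>y y'. (\<forall>v\<in>V'. \<bar>y v\<bar> \<le> R \<and> \<bar>y' v\<bar> \<le> R) --> \<bar>q y - q y'\<bar> \<le> L * (\<Sum>v\<in>V'. \<bar>y v - y' v\<bar>)"
    using mult.IH(2) by blast
  show ?case
  proof (intro exI[of _ "V \<union> V'"] conjI allI impI)
    show "finite (V \<union> V')" using V V' by simp
    fix R :: real assume R: "R \<ge> 0"
    obtain L where L: "L \<ge> 0" "\<And>y y'. \<forall>v\<in>V. \<bar>y v\<bar> \<le> R \<and> \<bar>y' v\<bar> \<le> R ==> \<bar>p y - p y'\<bar> \<le> L * (\<Sum>v\<in>V. \<bar>y v - y' v\<bar>)"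
      using V(2)[OF R] by blast
    obtain L' where L': "L' \<ge> 0" "\<And>y y'. \<forall>v\<in>V'. \<bar>y v\<bar> \<le> R \<and> \<bar>y' v\<bar> \<le> R ==> \<bar>q y - q y'\<bar> \<le> L' * (\<Sum>v\<in>V'. \<bar>y v - y' v\<bar>)"
      using V'(2)[OF R] by blast
    define E where "E = \<bar>p (\<lambda>_. 0)\<bar> + L * (real (card V) * R)"
    define E' where "E' = \<bar>q (\<lambda>_. 0)\<bar> + L' * (real (card V') * R)"
    have E: "\<bar>p y\<bar> \<le> E" if "\<forall>v\<in>V. \<bar>y v\<bar> \<le> R" for y
    proof -
      have "\<bar>p y - p (\<lambda>_. 0)\<bar> \<le> L * (\<Sum>v\<in>V. \<bar>y v - 0\<bar>)" using that R by (intro L(2)) simp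
      also have "... \<le> L * (\<Sum>v\<in>V. R)" using that L(1) by (intro mult_left_mono sum_mono) auto
      finally show ?thesis unfolding E_def by simp
    qed
    have E': "\<bar>q y\<bar> \<le> E'" if "\<forall>v\<in>V'. \<bar>y v\<bar> \<le> R" for y
    proof -
      have "\<bar>q y - q (\<lambda>_. 0)\<bar> \<le> L' * (\<Sum>v\<in>V'. \<bar>y v - 0\<bar>)" using that R by (intro L'(2)) simp
      also have "... \<le> L' * (\<Sum>v\<in>V'. R)" using that L'(1) by (intro mult_left_mono sum_mono) auto
      finally show ?thesis unfolding E'_def by simp
    qed
    have E0: "E \<ge> 0" "E' \<ge> 0" using L L' R by (auto simp: E_def E'_def)
    show "\<exists>L\<ge>0. \<forall>y y'. (\<forall>v\<in>V \<union> V'. \<bar>y v\<bar> \<le> R \<and> \<bar>y' v\<bar> \<le> R) --> \<bar>p y * q y - p y' * q y'\<bar> \<le> L * (\<Sum>v\<in>V \<union> V'. \<bar>y v - y' v\<bar>)"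
    proof (intro exI[of _ "E * L' + L * E'"] conjI allI impI)
      show "E * L' + L * E' \<ge> 0" using L L' E0 by simp
      fix y y' assume b: "\<forall>v\<in>V \<union> V'. \<bar>y v\<bar> \<le> R \<and> \<bar>y' v\<bar> \<le> R"
      define s where "s = (\<Sum>v\<in>V \<union> V'. \<bar>y v - y' v\<bar>)"
      have "(\<Sum>v\<in>V. \<bar>y v - y' v\<bar>) \<le> s" unfolding s_def using V V' by (intro sum_mono2) auto
      then have 1: "L * (\<Sum>v\<in>V. \<bar>y v - y' v\<bar>) \<le> L * s" using L(1) by (rule mult_left_mono)
      have "(\<Sum>v\<in>V'. \<bar>y v - y' v\<bar>) \<le> s" unfolding s_def using V V' by (intro sum_mono2) auto
      then have 2: "L' * (\<Sum>v\<in>V'. \<bar>y v - y' v\<bar>) \<le> L' * s" using L'(1) by (rule mult_left_mono)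
      have "\<bar>p y - p y'\<bar> \<le> L * (\<Sum>v\<in>V. \<bar>y v - y' v\<bar>)" using b by (intro L(2)) simp
      then have p1: "\<bar>p y - p y'\<bar> \<le> L * s" using 1 by linarith
      have "\<bar>q y - q y'\<bar> \<le> L' * (\<Sum>v\<in>V'. \<bar>y v - y' v\<bar>)" using b by (intro L'(2)) simp
      then have q1: "\<bar>q y - q y'\<bar> \<le> L' * s" using 2 by linarith
      have pE: "\<bar>p y\<bar> \<le> E" and qE: "\<bar>q y'\<bar> \<le> E'" using b by (auto intro!: E E')
      have "p y * q y - p y' * q y' = p y * (q y - q y') + (p y - p y') * q y'" by (simp add: algebra_simps)
      then have "\<bar>p y * q y - p y' * q y'\<bar> \<le> \<bar>p y\<bar> * \<bar>q y - q y'\<bar> + \<bar>p y - p y'\<bar> * \<bar>q y'\<bar>"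
        by (metis abs_mult abs_triangle_ineq)
      also have "... \<le> E * (L' * s) + (L * s) * E'"
        using E0 pE qE p1 q1 by (intro add_mono mult_mono) auto
      finally show "\<bar>p y * q y - p y' * q y'\<bar> \<le> (E * L' + L * E') * (\<Sum>v\<in>V \<union> V'. \<bar>y v - y' v\<bar>)"
        by (simp add: s_def algebra_simps)
    qed
  qed
qed

text \<open>A variable is recovered on \<open>[-R, R]\<close> from \<open>sin (\<pi> y / (2 R))\<close> through a polynomial
  approximation of \<open>arcsin\<close>; outside, the quadratic term absorbs the error.\<close>

lemma trig_approx:
  fixes p :: "('v => real) => real"
  assumes p: "(k, p) \<in> pol"
  shows "\<exists>V. finite V \<and> (\<forall>e R c. 0 < e --> e \<le> 1 --> 0 < R -->
    (\<exists>\<phi>\<in>trig. \<forall>y. \<bar>cos (p y + c) - \<phi> y\<bar> \<le> e + 3 * (\<Sum>v\<in>V. (y v)^2) / R^2))"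
proof -
  obtain V where V: "finite V" "\<And>R. R \<ge> 0 ==> \<exists>L\<ge>0. \<forall>y y'. (\<forall>v\<in>V. \<bar>y v\<bar> \<le> R \<and> \<bar>y' v\<bar> \<le> R) --> \<bar>p y - p y'\<bar> \<le> L * (\<Sum>v\<in>V. \<bar>y v - y' v\<bar>)"
    using pol_lipschitz[OF p] by blast
  show ?thesis
  proof (intro exI[of _ V] conjI allI impI V(1))
    fix e R c :: real assume e: "0 < e" "e \<le> 1" and R: "0 < R"
    obtain L where L: "L \<ge> 0" "\<And>y y'. \<forall>v\<in>V. \<bar>y v\<bar> \<le> R + 1 \<and> \<bar>y' v\<bar> \<le> R + 1 ==> \<bar>p y - p y'\<bar> \<le> L * (\<Sum>v\<in>V. \<bar>y v - y' v\<bar>)"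
      using V(2)[of "R + 1"] R by auto
    \<comment> \<open>The choice \<open>\<delta> = e / (2 * T)\<close> gives at once a total error
      of at most \<open>e / 2\<close> through the Lipschitz constant and
      \<open>\<delta> \<le> 1\<close>, which keeps the approximations inside the box of radius
      \<open>R + 1\<close>.\<close>
    define T where "T = L * real (card V) + 1"
    define \<delta> where "\<delta> = e / (2 * T)"
    have T1: "T \<ge> 1" using L(1) by (simp add: T_def)
    have \<delta>0: "\<delta> > 0" using e T1 by (simp add: \<delta>_def)
    have "L * (real (card V) * \<delta>) + \<delta> = T * \<delta>" by (simp add: T_def algebra_simps)
    also have "... = e / 2" using T1 by (simp add: \<delta>_def)
    finally have L\<delta>: "L * (real (card V) * \<delta>) \<le> e / 2" using \<delta>0 by linarith
    have \<delta>1: "\<delta> \<le> 1" using e T1 by (simp add: \<delta>_def)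
    define a where "a = pi / (2 * R)"
    have a0: "a > 0" using R by (simp add: a_def)
    have aR: "a * R = pi / 2" using R by (simp add: a_def)
    have "continuous_on {-1..1} (\<lambda>s. arcsin s / a)" using a0 by (intro continuous_intros) auto
    then obtain q where q: "real_polynomial_function q" "\<And>s. s \<in> {-1..1} ==> \<bar>arcsin s / a - q s\<bar> < \<delta>"
      using Stone_Weierstrass_real_polynomial_function[OF compact_Icc _ \<delta>0, of "-1" 1 "\<lambda>s. arcsin s / a"] by blast
    define u where "u v y = q (sin (a * y v))" for v and y :: "'v => real"
    have ut: "u v \<in> trig" for v unfolding u_def[abs_def] by (rule trig_polynomial_function[OF q(1) trig_sin])
    have qs: "\<bar>arcsin (sin (a * y v)) / a - u v y\<bar> < \<delta>" for v and y :: "'v => real"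
      unfolding u_def by (intro q(2)) simp
    have ub: "\<bar>u v y\<bar> \<le> R + 1" for v y
    proof -
      have "\<bar>arcsin (sin (a * y v))\<bar> \<le> pi / 2"
        using arcsin_lbound[of "sin (a * y v)"] arcsin_ubound[of "sin (a * y v)"] by (simp add: abs_le_iff)
      then have "\<bar>arcsin (sin (a * y v)) / a\<bar> \<le> R" using a0 aR by (simp add: abs_divide divide_le_eq mult.commute)
      then show ?thesis using qs[of y v] \<delta>1 by linarith
    qed
    have uy: "\<bar>y v - u v y\<bar> \<le> \<delta>" if "\<bar>y v\<bar> \<le> R" for v y
    proof -
      have "a * \<bar>y v\<bar> \<le> a * R" using that a0 by (intro mult_left_mono) auto
      then have "\<bar>a * y v\<bar> \<le> pi / 2" using a0 aR by (simp only: abs_mult abs_of_pos)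
      then have "- (pi / 2) \<le> a * y v" "a * y v \<le> pi / 2" by linarith+
      then have "arcsin (sin (a * y v)) = a * y v" by (rule arcsin_sin)
      then show ?thesis using qs[of y v] a0 by simp
    qed
    define B where "B = \<bar>p (\<lambda>_. 0)\<bar> + L * (real (card V) * (R + 1))"
    have pb: "p (\<lambda>v. u v y) \<in> {-B..B}" for y
    proof -
      have "\<bar>p (\<lambda>v. u v y) - p (\<lambda>_. 0)\<bar> \<le> L * (\<Sum>v\<in>V. \<bar>u v y - 0\<bar>)" using ub R by (intro L(2)) simp
      also have "... \<le> L * (\<Sum>v\<in>V. R + 1)" using ub L(1) by (intro mult_left_mono sum_mono) auto
      finally show ?thesis unfolding B_def by (auto simp: abs_le_iff)
    qed
    have e2: "0 < e / 2" using e by simp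
    \<comment> \<open>The outer cosine is replaced by a polynomial as well, because
      \<open>trig\<close> is closed under polynomials, not under cosine.\<close>
    have "continuous_on {-B..B} (\<lambda>x. cos (x + c))" by (intro continuous_intros)
    then obtain Q where Q: "real_polynomial_function Q" "\<And>x. x \<in> {-B..B} ==> \<bar>cos (x + c) - Q x\<bar> < e / 2"
      using Stone_Weierstrass_real_polynomial_function[OF compact_Icc _ e2, of "-B" B "\<lambda>x. cos (x + c)"] by blast
    show "\<exists>\<phi>\<in>trig. \<forall>y. \<bar>cos (p y + c) - \<phi> y\<bar> \<le> e + 3 * (\<Sum>v\<in>V. (y v)^2) / R^2"
    proof (intro bexI[of _ "\<lambda>y. Q (p (\<lambda>v. u v y))"] allI)
      show "(\<lambda>y. Q (p (\<lambda>v. u v y))) \<in> trig" by (intro trig_polynomial_function[OF Q(1)] trig_pol[OF p] ut)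
      fix y
      have Qc: "\<bar>cos (p (\<lambda>v. u v y) + c) - Q (p (\<lambda>v. u v y))\<bar> \<le> e / 2" using Q(2)[OF pb[of y]] by simp
      have s0: "0 \<le> (\<Sum>v\<in>V. (y v)^2)" by (intro sum_nonneg) simp
      show "\<bar>cos (p y + c) - Q (p (\<lambda>v. u v y))\<bar> \<le> e + 3 * (\<Sum>v\<in>V. (y v)^2) / R^2"
      proof (cases "\<forall>v\<in>V. \<bar>y v\<bar> \<le> R")
        case True
        have "\<bar>p y - p (\<lambda>v. u v y)\<bar> \<le> L * (\<Sum>v\<in>V. \<bar>y v - u v y\<bar>)" using True ub by (intro L(2)) force
        also have "... \<le> L * (\<Sum>v\<in>V. \<delta>)" using True uy L(1) by (intro mult_left_mono sum_mono) auto
        also have "... \<le> e / 2" using L\<delta> by simp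
        finally have "\<bar>cos (p y + c) - cos (p (\<lambda>v. u v y) + c)\<bar> \<le> e / 2"
          using cos_lipschitz[of "p y + c" "p (\<lambda>v. u v y) + c"] by simp
        moreover have "0 \<le> 3 * (\<Sum>v\<in>V. (y v)^2) / R^2" using s0 by simp
        ultimately show ?thesis using Qc by linarith
      next
        case False
        then obtain v where v: "v \<in> V" "R < \<bar>y v\<bar>" by auto
        have "R^2 \<le> \<bar>y v\<bar>^2" using v R by (intro power_mono) auto
        also have "... = (y v)^2" by simp
        also have "... \<le> (\<Sum>v\<in>V. (y v)^2)" using v V(1) by (intro member_le_sum) auto
        finally have "1 \<le> (\<Sum>v\<in>V. (y v)^2) / R^2" using R by simp
        \<comment> \<open>Outside the box the two cosines differ by at most 2 and the polynomial
          adds at most \<open>e / 2\<close>; as \<open>e \<le> 1\<close>, the constant 3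
          suffices.\<close>
        then have "3 \<le> 3 * (\<Sum>v\<in>V. (y v)^2) / R^2" by simp
        moreover have "\<bar>cos (p y + c)\<bar> \<le> 1" "\<bar>cos (p (\<lambda>v. u v y) + c)\<bar> \<le> 1" by simp_all
        ultimately show ?thesis using Qc e by linarith
      qed
    qed
  qed
qed

lemma trig_bounded_measurable:
  fixes w :: "'v => 'w => real"
  assumes "\<phi> \<in> trig" "\<And>v. w v \<in> borel_measurable N"
  shows "(\<lambda>u. \<phi> (\<lambda>v. w v u)) \<in> borel_measurable N \<and> (\<exists>C. \<forall>u. \<bar>\<phi> (\<lambda>v. w v u)\<bar> \<le> C)"
  using assms(1)
proof induction
  case (cos V a t c)
  have "(\<lambda>u. a * cos ((\<Sum>v\<in>V. t v * w v u) + c)) \<in> borel_measurable N" using assms(2) by measurable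
  moreover have "\<bar>a * cos ((\<Sum>v\<in>V. t v * w v u) + c)\<bar> \<le> \<bar>a\<bar>" for u
    by (simp add: abs_mult mult_left_le)
  ultimately show ?case by blast
next
  case (add \<phi> \<psi>)
  obtain C C' where C: "\<And>u. \<bar>\<phi> (\<lambda>v. w v u)\<bar> \<le> C" "\<And>u. \<bar>\<psi> (\<lambda>v. w v u)\<bar> \<le> C'" using add.IH by auto
  have "\<bar>\<phi> (\<lambda>v. w v u) + \<psi> (\<lambda>v. w v u)\<bar> \<le> C + C'" for u using C[of u] by linarith
  then show ?case using add.IH by (intro conjI exI[of _ "C + C'"] borel_measurable_add) auto
qed

lemma (in prob_space) trig_moments:
  assumes "\<phi> \<in> trig" "\<And>v. w v \<in> borel_measurable M" shows "(\<lambda>u. \<phi> (\<lambda>v. w v u)) \<in> all_moments M"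
proof -
  obtain C where "(\<lambda>u. \<phi> (\<lambda>v. w v u)) \<in> borel_measurable M" "\<And>u. \<bar>\<phi> (\<lambda>v. w v u)\<bar> \<le> C"
    using trig_bounded_measurable[of \<phi> w M, OF assms] by blast
  then show ?thesis by (rule all_moments_bounded[OF finite_measure_axioms])
qed

lemma (in prob_space) pol_moments:
  assumes "(k, p) \<in> pol" "\<And>v. w v \<in> all_moments M" shows "(\<lambda>u. p (\<lambda>v. w v u)) \<in> all_moments M"
  using assms(1)
proof induction
  case (const k c) show ?case by (rule all_moments_closed)
next
  case (var k v) show ?case by (rule assms(2))
next
  case (add k p q) show ?case by (rule all_moments_add) fact+
next
  case (mult i p j q k) show ?case by (rule all_moments_mult) fact+
qed

lemma pol_ordinary:
  assumes "(k, p) \<in> pol" "\<And>v. w v \<in> ordinary_polynomials Y 1"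
  shows "(\<lambda>u. p (\<lambda>v. w v u)) \<in> ordinary_polynomials Y k"
  using assms(1)
proof induction
  case (const k c) show ?case by (rule ordinary_polynomials_const)
next
  case (var k v) then show ?case using assms(2)[of v] ordinary_polynomials_mono[of 1 k Y] by auto
next
  case (add k p q) then show ?case by (intro ordinary_polynomials_add)
next
  case (mult i p j q k)
  have "(\<lambda>u. p (\<lambda>v. w v u) * q (\<lambda>v. w v u)) \<in> ordinary_polynomials Y (i + j)"
    using mult.IH by (intro ordinary_polynomials_mult)
  then show ?case using ordinary_polynomials_mono[OF mult.hyps(3), of Y] by blast
qed

lemma (in prob_space) cos_pol_trig_diff:
  assumes "(k, p) \<in> pol" "\<phi> \<in> trig" and w: "\<And>v. w v \<in> all_moments M"
    and C: "\<And>v. expectation (\<lambda>u. (w v u)^2) \<le> C v" and V: "finite V"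
    and le: "\<And>y. \<bar>cos (p y + c) - \<phi> y\<bar> \<le> e + 3 * (\<Sum>v\<in>V. (y v)^2) / R^2"
  shows "\<bar>expectation (\<lambda>u. cos (p (\<lambda>v. w v u) + c)) - expectation (\<lambda>u. \<phi> (\<lambda>v. w v u))\<bar> \<le> e + 3 * (\<Sum>v\<in>V. C v) / R^2"
proof -
  define G where "G u = cos (p (\<lambda>v. w v u) + c) - \<phi> (\<lambda>v. w v u)" for u
  have pm: "(\<lambda>u. p (\<lambda>v. w v u)) \<in> borel_measurable M"
    using pol_moments[OF assms(1) w] by (rule all_moments_measurable)
  have cm: "(\<lambda>u. cos (p (\<lambda>v. w v u) + c)) \<in> all_moments M"
    using pm by (intro all_moments_bounded[OF finite_measure_axioms, of _ 1]) auto
  have tm: "(\<lambda>u. \<phi> (\<lambda>v. w v u)) \<in> all_moments M"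
    by (intro trig_moments[OF assms(2)] all_moments_measurable w)
  have Gm: "G \<in> all_moments M" unfolding G_def[abs_def] by (intro all_moments_closed cm tm)
  have EG: "expectation G = expectation (\<lambda>u. cos (p (\<lambda>v. w v u) + c)) - expectation (\<lambda>u. \<phi> (\<lambda>v. w v u))"
    unfolding G_def[abs_def] by (intro Bochner_Integration.integral_diff all_moments_integrable cm tm)
  have "expectation (\<lambda>u. \<bar>G u\<bar>) \<le> expectation (\<lambda>u. e + 3 * (\<Sum>v\<in>V. (w v u)^2) / R^2)"
    by (intro integral_mono all_moments_integrable all_moments_abs Gm all_moments_closed w)
      (use le in \<open>simp add: G_def\<close>)
  also have "... = e + 3 * (\<Sum>v\<in>V. expectation (\<lambda>u. (w v u)^2)) / R^2"
  proof -
    have i: "integrable M (\<lambda>u. (w v u)^2)" for v by (intro all_moments_integrable all_moments_closed w)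
    have "expectation (\<lambda>u. e + 3 * (\<Sum>v\<in>V. (w v u)^2) / R^2) = e + expectation (\<lambda>u. 3 * (\<Sum>v\<in>V. (w v u)^2) / R^2)"
      using i by (subst Bochner_Integration.integral_add) (auto simp: prob_space)
    also have "expectation (\<lambda>u. 3 * (\<Sum>v\<in>V. (w v u)^2) / R^2) = 3 * (\<Sum>v\<in>V. expectation (\<lambda>u. (w v u)^2)) / R^2"
      using i by (simp add: Bochner_Integration.integral_sum)
    finally show ?thesis .
  qed
  also have "... \<le> e + 3 * (\<Sum>v\<in>V. C v) / R^2"
    using C by (intro add_left_mono divide_right_mono mult_left_mono sum_mono) auto
  finally have "expectation (\<lambda>u. \<bar>G u\<bar>) \<le> e + 3 * (\<Sum>v\<in>V. C v) / R^2" .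
  with integral_abs_bound[of M G] have "\<bar>expectation G\<bar> \<le> e + 3 * (\<Sum>v\<in>V. C v) / R^2" by (rule order_trans)
  then show ?thesis unfolding EG .
qed

text \<open>A continuous mapping theorem for unbounded polynomials when convergence is known only
  for cosines of linear forms. \<open>trig_approx\<close> reduces to such cosines up to an error
  governed by second moments, and these are bounded uniformly in n.\<close>

theorem pol_cos_limit:
  fixes y :: "nat => 'v => 'a => real" and z :: "'v => 'b => real"
  assumes "prob_space M" "prob_space N"
    and y: "\<And>n v. y n v \<in> all_moments M" and C: "\<And>n v. (\<integral>w. (y n v w)^2 \<partial>M) \<le> C v"
    and z: "\<And>v. z v \<in> all_moments N"
    and lim: "\<And>V t c. finite V ==> ((\<lambda>n. \<integral>w. cos ((\<Sum>v\<in>V. t v * y n v w) + c) \<partial>M) \<longlongrightarrow> (\<integral>w. cos ((\<Sum>v\<in>V. t v * z v w) + c) \<partial>N)) U"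
    and p: "(k, p) \<in> pol"
  shows "((\<lambda>n. \<integral>w. cos (p (\<lambda>v. y n v w) + c) \<partial>M) \<longlongrightarrow> (\<integral>w. cos (p (\<lambda>v. z v w) + c) \<partial>N)) U"
proof -
  interpret M: prob_space M by fact
  interpret N: prob_space N by fact
  have ym: "y n v \<in> borel_measurable M" for n v by (rule all_moments_measurable[OF y])
  have zm: "z v \<in> borel_measurable N" for v by (rule all_moments_measurable[OF z])
  have trig_lim: "((\<lambda>n. \<integral>w. \<phi> (\<lambda>v. y n v w) \<partial>M) \<longlongrightarrow> (\<integral>w. \<phi> (\<lambda>v. z v w) \<partial>N)) U" if "\<phi> \<in> trig" for \<phi>
    using that
  proof induction
    case (cos V a t c)
    show ?case using tendsto_mult_left[OF lim[OF cos], of a t c] by simp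
  next
    case (add \<phi> \<psi>)
    have "(\<integral>w. \<phi> (\<lambda>v. y n v w) + \<psi> (\<lambda>v. y n v w) \<partial>M) = (\<integral>w. \<phi> (\<lambda>v. y n v w) \<partial>M) + (\<integral>w. \<psi> (\<lambda>v. y n v w) \<partial>M)" for n
      by (intro Bochner_Integration.integral_add all_moments_integrable M.trig_moments add.hyps ym)
    moreover have "(\<integral>w. \<phi> (\<lambda>v. z v w) + \<psi> (\<lambda>v. z v w) \<partial>N) = (\<integral>w. \<phi> (\<lambda>v. z v w) \<partial>N) + (\<integral>w. \<psi> (\<lambda>v. z v w) \<partial>N)"
      by (intro Bochner_Integration.integral_add all_moments_integrable N.trig_moments add.hyps zm)
    ultimately show ?case using tendsto_add[OF add.IH] by simp
  qed
  obtain V where V: "finite V" and ap: "\<And>e R c. 0 < e ==> e \<le> 1 ==> 0 < R ==>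
    \<exists>\<phi>\<in>trig. \<forall>y. \<bar>cos (p y + c) - \<phi> y\<bar> \<le> e + 3 * (\<Sum>v\<in>V. (y v)^2) / R^2"
    using trig_approx[OF p] by blast
  define C' where "C' v = max (C v) (\<integral>w. (z v w)^2 \<partial>N)" for v
  have C1: "(\<integral>w. (y n v w)^2 \<partial>M) \<le> C' v" for n v using C[of n v] by (simp add: C'_def)
  have C2: "(\<integral>w. (z v w)^2 \<partial>N) \<le> C' v" for v by (simp add: C'_def)
  have "C' v \<ge> 0" for v using C2[of v] by (rule order_trans[rotated]) simp
  then have S0: "0 \<le> (\<Sum>v\<in>V. C' v)" by (intro sum_nonneg)
  show ?thesis
  proof (rule tendstoI)
    fix e :: real assume e: "e > 0"
    define \<eta> where "\<eta> = min 1 (e / 8)"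
    \<comment> \<open>The number 24 brings the quadratic error of \<open>trig_approx\<close> below
      \<open>e / 8\<close>.\<close>
    define R where "R = sqrt (24 * ((\<Sum>v\<in>V. C' v) + 1) / e)"
    have \<eta>: "0 < \<eta>" "\<eta> \<le> 1" "\<eta> \<le> e / 8" using e by (auto simp: \<eta>_def)
    have R: "R > 0" using e S0 by (simp add: R_def)
    have R2: "R^2 = 24 * ((\<Sum>v\<in>V. C' v) + 1) / e" using e S0 by (simp add: R_def)
    have small: "\<eta> + 3 * (\<Sum>v\<in>V. C' v) / R^2 \<le> e / 4"
    proof -
      have "3 * (\<Sum>v\<in>V. C' v) / R^2 \<le> e / 8" unfolding R2 using e S0 by (simp add: field_simps)
      then show ?thesis using \<eta>(3) by linarith
    qed
    obtain \<phi> where \<phi>: "\<phi> \<in> trig" "\<And>y. \<bar>cos (p y + c) - \<phi> y\<bar> \<le> \<eta> + 3 * (\<Sum>v\<in>V. (y v)^2) / R^2"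
      using ap[OF \<eta>(1,2) R, of c] by blast
    have a: "\<bar>(\<integral>w. cos (p (\<lambda>v. y n v w) + c) \<partial>M) - (\<integral>w. \<phi> (\<lambda>v. y n v w) \<partial>M)\<bar> \<le> e / 4" for n
      using M.cos_pol_trig_diff[OF p \<phi>(1) y C1 V \<phi>(2)] small by (rule order_trans)
    have b: "\<bar>(\<integral>w. cos (p (\<lambda>v. z v w) + c) \<partial>N) - (\<integral>w. \<phi> (\<lambda>v. z v w) \<partial>N)\<bar> \<le> e / 4"
      using N.cos_pol_trig_diff[OF p \<phi>(1) z C2 V \<phi>(2)] small by (rule order_trans)
    have "eventually (\<lambda>n. dist (\<integral>w. \<phi> (\<lambda>v. y n v w) \<partial>M) (\<integral>w. \<phi> (\<lambda>v. z v w) \<partial>N) < e / 4) U"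
      using trig_lim[OF \<phi>(1)] e by (intro tendstoD) auto
    then show "eventually (\<lambda>n. dist (\<integral>w. cos (p (\<lambda>v. y n v w) + c) \<partial>M) (\<integral>w. cos (p (\<lambda>v. z v w) + c) \<partial>N) < e) U"
    proof eventually_elim
      case (elim n)
      then show ?case using a[of n] b e unfolding dist_real_def by linarith
    qed
  qed
qed

text \<open>Consecutive differences have L1 norms at most \<open>(1 / 2) ^ l\<close>, which are
  summable, so the sequence converges almost surely; Fatou's lemma passes the bounds on to the
  limit.\<close>

lemma (in prob_space) L2_limit:
  fixes Z :: "nat => 'a => real"
  assumes Z: "\<And>l. Z l \<in> all_moments M"
    and le: "\<And>l m. l \<le> m ==> expectation (\<lambda>w. (Z m w - Z l w)^2) \<le> (1 / 4) ^ l"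
  obtains P where "P \<in> square_integrable M" "\<And>l. integrable M (\<lambda>w. (P w - Z l w)^2)"
    "\<And>l. expectation (\<lambda>w. (P w - Z l w)^2) \<le> (1 / 4) ^ l"
proof -
  have Zm[measurable]: "Z l \<in> borel_measurable M" for l by (rule all_moments_measurable[OF Z])
  have ae: "AE w in M. convergent (\<lambda>l. Z l w)"
  proof -
    have "(\<integral>\<^sup>+w. suminf (\<lambda>l. ennreal \<bar>Z (Suc l) w - Z l w\<bar>) \<partial>M) = suminf (\<lambda>l. \<integral>\<^sup>+w. ennreal \<bar>Z (Suc l) w - Z l w\<bar> \<partial>M)"
      by (rule nn_integral_suminf) measurable
    also have "... \<le> suminf (\<lambda>l. ennreal ((1 / 2) ^ l))"
    proof (intro suminf_le)
      fix l
      have dm: "(\<lambda>w. Z (Suc l) w - Z l w) \<in> all_moments M" by (intro all_moments_closed Z)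
      have "expectation (\<lambda>w. \<bar>Z (Suc l) w - Z l w\<bar>) \<le> sqrt (expectation (\<lambda>w. (Z (Suc l) w - Z l w)^2))"
        by (rule expectation_abs_le_sqrt[OF dm])
      also have "... \<le> sqrt ((1 / 4) ^ l)" by (intro real_sqrt_le_mono le) simp
      also have "... = (1 / 2) ^ l" by (simp add: real_sqrt_power real_sqrt_divide)
      finally show "(\<integral>\<^sup>+w. ennreal \<bar>Z (Suc l) w - Z l w\<bar> \<partial>M) \<le> ennreal ((1 / 2) ^ l)"
        by (subst nn_integral_eq_integral) (auto intro!: all_moments_integrable all_moments_abs dm ennreal_leI)
    qed simp_all
    also have "... = ennreal (suminf (\<lambda>l. (1 / 2) ^ l))" by (rule suminf_ennreal2) (auto intro!: summable_geometric)
    also have "... < \<infinity>" by simp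
    finally have "AE w in M. suminf (\<lambda>l. ennreal \<bar>Z (Suc l) w - Z l w\<bar>) \<noteq> \<infinity>"
      by (intro nn_integral_PInf_AE) auto
    then show ?thesis
    proof eventually_elim
      case (elim w)
      then have "summable (\<lambda>l. \<bar>Z (Suc l) w - Z l w\<bar>)" by (intro summable_suminf_not_top) auto
      then have "summable (\<lambda>l. Z (Suc l) w - Z l w)" by (rule summable_rabs_cancel)
      then have "convergent (\<lambda>n. \<Sum>l<n. Z (Suc l) w - Z l w)" by (simp add: summable_iff_convergent)
      then have "convergent (\<lambda>n. Z n w - Z 0 w)" by (simp only: sum_lessThan_telescope[of "\<lambda>l. Z l w"])
      then have "convergent (\<lambda>n. (Z n w - Z 0 w) + Z 0 w)" by (intro convergent_add convergent_const)
      then show ?case by simp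
    qed
  qed
  define P where "P w = lim (\<lambda>l. Z l w)" for w
  have Pm[measurable]: "P \<in> borel_measurable M" unfolding P_def[abs_def] by measurable
  have nn: "(\<integral>\<^sup>+w. ennreal ((P w - Z l w)^2) \<partial>M) \<le> ennreal ((1 / 4) ^ l)" for l
  proof -
    have "(\<integral>\<^sup>+w. ennreal ((P w - Z l w)^2) \<partial>M) = (\<integral>\<^sup>+w. liminf (\<lambda>m. ennreal ((Z m w - Z l w)^2)) \<partial>M)"
    proof (rule nn_integral_cong_AE)
      show "AE w in M. ennreal ((P w - Z l w)^2) = liminf (\<lambda>m. ennreal ((Z m w - Z l w)^2))"
        using ae
      proof eventually_elim
        case (elim w)
        then have "(\<lambda>m. Z m w) \<longlonglongrightarrow> P w" by (simp add: P_def convergent_LIMSEQ_iff)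
        then have "(\<lambda>m. ennreal ((Z m w - Z l w)^2)) \<longlonglongrightarrow> ennreal ((P w - Z l w)^2)"
          by (intro tendsto_ennrealI tendsto_intros)
        then show ?case using lim_imp_Liminf[of sequentially] by force
      qed
    qed
    also have "... \<le> liminf (\<lambda>m. \<integral>\<^sup>+w. ennreal ((Z m w - Z l w)^2) \<partial>M)"
      by (rule nn_integral_liminf) measurable
    also have "... \<le> liminf (\<lambda>m::nat. ennreal ((1 / 4) ^ l))"
    proof (rule Liminf_mono)
      have "(\<integral>\<^sup>+w. ennreal ((Z m w - Z l w)^2) \<partial>M) \<le> ennreal ((1 / 4) ^ l)" if "l \<le> m" for m
      proof -
        have "integrable M (\<lambda>w. (Z m w - Z l w)^2)" by (intro all_moments_integrable all_moments_closed Z)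
        then have "(\<integral>\<^sup>+w. ennreal ((Z m w - Z l w)^2) \<partial>M) = ennreal (expectation (\<lambda>w. (Z m w - Z l w)^2))"
          by (rule nn_integral_eq_integral) simp
        then show ?thesis using le[OF that] by (simp add: ennreal_leI)
      qed
      then show "eventually (\<lambda>m. (\<integral>\<^sup>+w. ennreal ((Z m w - Z l w)^2) \<partial>M) \<le> ennreal ((1 / 4) ^ l)) sequentially"
        by (auto simp: eventually_sequentially)
    qed
    also have "... = ennreal ((1 / 4) ^ l)" by (intro Liminf_const) simp
    finally show ?thesis .
  qed
  have int: "integrable M (\<lambda>w. (P w - Z l w)^2)" for l
    using le_less_trans[OF nn[of l] ennreal_less_top] by (intro integrableI_nonneg) auto
  have bd: "expectation (\<lambda>w. (P w - Z l w)^2) \<le> (1 / 4) ^ l" for l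
    using nn[of l] int[of l] by (simp add: nn_integral_eq_integral)
  have "integrable M (\<lambda>w. (P w)^2)"
  proof (rule Bochner_Integration.integrable_bound)
    show "integrable M (\<lambda>w. 2 * (P w - Z 0 w)^2 + 2 * (Z 0 w)^2)"
      by (intro Bochner_Integration.integrable_add integrable_mult_right int all_moments_integrable all_moments_closed Z)
    have "a^2 \<le> 2 * (a - b)^2 + 2 * b^2" for a b :: real
      using zero_le_power2[of "a - 2 * b"] by (simp add: power2_eq_square algebra_simps)
    then show "AE w in M. norm ((P w)^2) \<le> norm (2 * (P w - Z 0 w)^2 + 2 * (Z 0 w)^2)"
      by (intro AE_I2) (auto intro: order_trans)
  qed measurable
  then have "P \<in> square_integrable M" by (simp add: square_integrable_def)
  then show thesis using int bd that by blast
qed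

subsection \<open>The limiting probability space\<close>

text \<open>One independent variable is split off by the addition formula. Writing the sine of the
  remaining sum as a cosine with shifted phase keeps inductions within cosines of arbitrary
  phase.\<close>

lemma (in indep_reals) expectation_cos_sum_insert:
  assumes inj: "inj_on \<rho> (insert r R)" and r: "r \<notin> R"
  shows "expectation (\<lambda>w. cos ((\<Sum>i\<in>R. s i * W (\<rho> i) w) + s r * W (\<rho> r) w + c)) =
    expectation (\<lambda>w. cos ((\<Sum>i\<in>R. s i * W (\<rho> i) w) + c)) * expectation (\<lambda>w. cos (s r * W (\<rho> r) w)) -
    expectation (\<lambda>w. cos ((\<Sum>i\<in>R. s i * W (\<rho> i) w) + (c - pi / 2))) * expectation (\<lambda>w. sin (s r * W (\<rho> r) w))"
proof -
  define A where "A w = s r * W (\<rho> r) w" for w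
  define S where "S c w = (\<Sum>i\<in>R. s i * W (\<rho> i) w) + c" for c w
  have Am: "A \<in> borel_measurable (sig {\<rho> r})"
    unfolding A_def[abs_def] by (intro borel_measurable_times borel_measurable_const W_sig) simp
  have Sm: "S c \<in> borel_measurable (sig (\<rho> ` R))" for c
    unfolding S_def[abs_def]
    by (intro borel_measurable_add borel_measurable_sum borel_measurable_times borel_measurable_const W_sig) simp
  have dis: "\<rho> ` R \<inter> {\<rho> r} = {}" using inj r by (auto simp: inj_on_def)
  have bm: "(\<lambda>w. cos (G w)) \<in> all_moments N" "(\<lambda>w. sin (G w)) \<in> all_moments N" if "G \<in> borel_measurable (sig D)" for G D
    using sig_measurable[OF that] by (auto intro!: all_moments_bounded[OF finite_measure_axioms, of _ 1])
  have eq: "cos (S c w + A w) = cos (S c w) * cos (A w) - cos (S (c - pi / 2) w) * sin (A w)" for w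
  proof -
    have "S (c - pi / 2) w = S c w - pi / 2" by (simp add: S_def)
    then show ?thesis by (simp add: cos_add cos_diff)
  qed
  have "expectation (\<lambda>w. cos (S c w + A w)) = expectation (\<lambda>w. cos (S c w) * cos (A w)) - expectation (\<lambda>w. cos (S (c - pi / 2) w) * sin (A w))"
    unfolding eq by (intro Bochner_Integration.integral_diff all_moments_integrable all_moments_mult bm[OF Am] bm[OF Sm])
  also have "expectation (\<lambda>w. cos (S c w) * cos (A w)) = expectation (\<lambda>w. cos (S c w)) * expectation (\<lambda>w. cos (A w))"
    by (intro expectation_mult_sig[OF dis] bm[OF Am] bm[OF Sm] measurable_compose[OF Am] measurable_compose[OF Sm]) simp_all
  also have "expectation (\<lambda>w. cos (S (c - pi / 2) w) * sin (A w)) = expectation (\<lambda>w. cos (S (c - pi / 2) w)) * expectation (\<lambda>w. sin (A w))"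
    by (intro expectation_mult_sig[OF dis] bm[OF Am] bm[OF Sm] measurable_compose[OF Am] measurable_compose[OF Sm]) simp_all
  finally show ?thesis unfolding S_def A_def by (simp only: add_ac)
qed

lemma (in iid) expectation_cos_relabel:
  assumes "finite R" "inj_on \<rho> R"
  shows "expectation (\<lambda>w. cos ((\<Sum>i\<in>R. s i * X (\<rho> i) w) + c)) = expectation (\<lambda>w. cos ((\<Sum>i\<in>R. s i * X i w) + c))"
  using assms
proof (induction R arbitrary: c rule: finite_induct)
  case (insert r R)
  have IH: "expectation (\<lambda>w. cos ((\<Sum>i\<in>R. s i * X (\<rho> i) w) + c)) = expectation (\<lambda>w. cos ((\<Sum>i\<in>R. s i * X i w) + c))" for c
    using insert.IH insert.prems by (simp add: inj_on_insert)
  have sum: "(\<Sum>i\<in>insert r R. f i) + c = (\<Sum>i\<in>R. f i) + f r + c" for f :: "nat => real" and c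
    using insert.hyps by simp
  have c: "expectation (\<lambda>w. cos (s r * X (\<rho> r) w)) = expectation (\<lambda>w. cos (s r * X r w))"
    "expectation (\<lambda>w. sin (s r * X (\<rho> r) w)) = expectation (\<lambda>w. sin (s r * X r w))"
    using expectation_X[of "\<lambda>x. cos (s r * x)" "\<rho> r"] expectation_X[of "\<lambda>x. sin (s r * x)" "\<rho> r"]
      expectation_X[of "\<lambda>x. cos (s r * x)" r] expectation_X[of "\<lambda>x. sin (s r * x)" r] by simp_all
  show ?case
    unfolding sum expectation_cos_sum_insert[OF insert.prems insert.hyps(2)]
      expectation_cos_sum_insert[OF inj_on_id2 insert.hyps(2)] IH c ..
qed simp

section \<open>The standard Gaussian sequence\<close>

definition gauss :: "(nat => real) measure" where
  "gauss = PiM UNIV (\<lambda>_. std_normal_distribution)"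

lemma std_normal_prob_space: "prob_space std_normal_distribution"
  using real_dist_normal_dist by (simp add: real_distribution_def)

lemma gauss_indep: "indep_reals gauss (\<lambda>i x. x i)"
  unfolding gauss_def by (rule indep_reals_PiM(1)) (simp_all add: std_normal_prob_space)

lemma gauss_marginal: "distr gauss borel (\<lambda>x. x i) = std_normal_distribution"
  unfolding gauss_def by (rule indep_reals_PiM(2)) (simp_all add: std_normal_prob_space)

lemma gauss_prob_space: "prob_space gauss"
  using gauss_indep by (simp add: indep_reals_def)

lemma gauss_coordinate: "(\<lambda>x. x i) \<in> borel_measurable gauss"
  using indep_reals.W_measurable[OF gauss_indep] .

lemma sets_gauss: "sets gauss = sets (PiM UNIV (\<lambda>_. borel))"
  unfolding gauss_def by (intro sets_PiM_cong refl) simp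

lemma std_normal_cos_sin:
  "(\<integral>x. cos (t * x) \<partial>std_normal_distribution) = exp (- t\<^sup>2 / 2)"
  "(\<integral>x. sin (t * x) \<partial>std_normal_distribution) = 0"
proof -
  interpret p: prob_space std_normal_distribution by (rule std_normal_prob_space)
  have int: "integrable std_normal_distribution (\<lambda>x. iexp (t * x))" by (rule p.integrable_iexp) simp_all
  have c: "(CLINT x|std_normal_distribution. iexp (t * x)) = complex_of_real (exp (- t\<^sup>2 / 2))"
    using fun_cong[OF char_std_normal_distribution, of t] by (simp add: char_def)
  have "(\<integral>x. Re (iexp (t * x)) \<partial>std_normal_distribution) = exp (- t\<^sup>2 / 2)"
    using integral_Re[OF int] c by simp
  then show "(\<integral>x. cos (t * x) \<partial>std_normal_distribution) = exp (- t\<^sup>2 / 2)" by (simp add: Re_exp)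
  have "(\<integral>x. Im (iexp (t * x)) \<partial>std_normal_distribution) = 0"
    using integral_Im[OF int] c by simp
  then show "(\<integral>x. sin (t * x) \<partial>std_normal_distribution) = 0" by (simp add: Im_exp)
qed

lemma gauss_cos:
  assumes "finite J"
  shows "(\<integral>x. cos ((\<Sum>j\<in>J. \<tau> j * x j) + c) \<partial>gauss) = cos c * exp (- (\<Sum>j\<in>J. (\<tau> j)^2) / 2)"
  using assms
proof (induction J arbitrary: c rule: finite_induct)
  case empty
  interpret g: prob_space gauss by (rule gauss_prob_space)
  show ?case by (simp add: g.prob_space)
next
  case (insert r J)
  interpret g: indep_reals gauss "\<lambda>i x. x i" by (rule gauss_indep)
  have sum: "(\<Sum>i\<in>insert r J. f i) + c = (\<Sum>i\<in>J. f i) + f r + c" for f :: "nat => real" and c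
    using insert.hyps by simp
  have m: "(\<integral>x. f (x r) \<partial>gauss) = (\<integral>y. f y \<partial>std_normal_distribution)" if [measurable]: "f \<in> borel_measurable borel" for f :: "real => real"
    using integral_distr[OF gauss_coordinate[of r] that] by (simp add: gauss_marginal)
  have c: "(\<integral>x. cos (\<tau> r * x r) \<partial>gauss) = exp (- (\<tau> r)\<^sup>2 / 2)" "(\<integral>x. sin (\<tau> r * x r) \<partial>gauss) = 0"
    using m[of "\<lambda>y. cos (\<tau> r * y)"] m[of "\<lambda>y. sin (\<tau> r * y)"] by (simp_all add: std_normal_cos_sin)
  have "exp (- (\<Sum>j\<in>insert r J. (\<tau> j)\<^sup>2) / 2) = exp (- (\<Sum>j\<in>J. (\<tau> j)\<^sup>2) / 2) * exp (- (\<tau> r)\<^sup>2 / 2)"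
    using insert.hyps by (simp add: exp_add[symmetric] field_simps)
  then show ?case
    unfolding sum g.expectation_cos_sum_insert[OF inj_on_id2 insert.hyps(2)] insert.IH c by simp
qed

lemma all_moments_distr:
  assumes g: "g \<in> measurable N M" "distr N M g = M" and f: "f \<in> all_moments M"
  shows "(\<lambda>w. f (g w)) \<in> all_moments N"
proof -
  have fm: "f \<in> borel_measurable M" by (rule all_moments_measurable[OF f])
  have "integrable N (\<lambda>w. \<bar>f (g w)\<bar> ^ p)" for p
  proof -
    have "integrable (distr N M g) (\<lambda>x. \<bar>f x\<bar> ^ p)" using f g(2) by (simp add: all_moments_def)
    then show ?thesis by (subst (asm) integrable_distr_eq[OF g(1)]) (use fm in auto)
  qed
  then show ?thesis using measurable_compose[OF g(1) fm] by (simp add: all_moments_def)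
qed

lemma gauss_moments: "(\<lambda>x. x i) \<in> all_moments gauss"
proof -
  have "(\<lambda>y. y) \<in> all_moments std_normal_distribution"
    using integrable_abs[OF integrable_std_normal_distribution_moment]
    by (auto simp: all_moments_def power_abs[symmetric])
  moreover have "(\<lambda>x. x i) \<in> measurable gauss std_normal_distribution"
    using gauss_coordinate by simp
  moreover have "distr gauss std_normal_distribution (\<lambda>x. x i) = std_normal_distribution"
  proof -
    have "distr gauss std_normal_distribution (\<lambda>x. x i) = distr gauss borel (\<lambda>x. x i)"
      by (intro distr_cong) simp_all
    then show ?thesis by (simp add: gauss_marginal)
  qed
  ultimately show ?thesis by (intro all_moments_distr[of "\<lambda>x. x i" gauss std_normal_distribution "\<lambda>y. y"])
qed

section \<open>The product of the original space with the Gaussian one\<close>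

context iid
begin

definition MG :: "('a \<times> (nat => real)) measure" where "MG = M \<Otimes>\<^sub>M gauss"

definition GG :: "nat => 'a \<times> (nat => real) => real" where "GG i w = snd w i"

lemma pair_MG: "pair_prob_space M gauss"
proof -
  interpret g: prob_space gauss by (rule gauss_prob_space)
  show ?thesis by unfold_locales
qed

lemma prob_space_MG: "prob_space MG"
proof -
  interpret p: pair_prob_space M gauss by (rule pair_MG)
  show ?thesis unfolding MG_def by unfold_locales
qed

lemma fst_MG: "fst \<in> measurable MG M" and snd_MG: "snd \<in> measurable MG gauss"
  by (simp_all add: MG_def)

lemma distr_fst_MG: "distr MG M fst = M"
  unfolding MG_def by (rule prob_space.distr_pair_fst[OF gauss_prob_space])

lemma distr_snd_MG: "distr MG gauss snd = gauss"
proof (rule measure_eqI)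
  fix A assume "A \<in> sets (distr MG gauss snd)"
  then have A: "A \<in> sets gauss" by simp
  interpret g: prob_space gauss by (rule gauss_prob_space)
  have "emeasure (distr MG gauss snd) A = emeasure MG (snd -` A \<inter> space MG)"
    by (rule emeasure_distr[OF snd_MG A])
  also have "snd -` A \<inter> space MG = space M \<times> A"
    using sets.sets_into_space[OF A] by (auto simp: MG_def space_pair_measure)
  also have "emeasure MG (space M \<times> A) = emeasure gauss A"
    unfolding MG_def using A by (simp add: g.emeasure_pair_measure_Times emeasure_space_1)
  finally show "emeasure (distr MG gauss snd) A = emeasure gauss A" .
qed simp

lemma GG_measurable: "GG i \<in> borel_measurable MG"
  unfolding GG_def[abs_def] by (rule measurable_compose[OF snd_MG gauss_coordinate])

lemma distr_GG: "distr MG borel (GG i) = std_normal_distribution"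
proof -
  have "distr MG borel (GG i) = distr (distr MG gauss snd) borel (\<lambda>x. x i)"
    by (subst distr_distr[OF gauss_coordinate snd_MG]) (simp add: GG_def[abs_def] o_def)
  then show ?thesis by (simp add: distr_snd_MG gauss_marginal)
qed

lemma GG_distributed: "distributed MG lborel (GG i) (\<lambda>x. ennreal (std_normal_density x))"
proof -
  have "distr MG lborel (GG i) = distr MG borel (GG i)" by (intro distr_cong) simp_all
  then show ?thesis using GG_measurable by (simp add: distributed_def distr_GG)
qed

lemma GG_process: "(\<lambda>w i. GG i w) \<in> measurable MG (PiM UNIV (\<lambda>_. borel))"
    "distr MG (PiM UNIV (\<lambda>_. borel)) (\<lambda>w i. GG i w) = gauss"
proof -
  have "(\<lambda>w i. GG i w) = snd" by (simp add: fun_eq_iff GG_def)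
  moreover have "snd \<in> measurable MG (PiM UNIV (\<lambda>_. borel :: real measure))"
    using snd_MG by (simp add: measurable_cong_sets[OF refl sets_gauss])
  moreover have "distr MG (PiM UNIV (\<lambda>_. borel)) snd = distr MG gauss snd"
    by (intro distr_cong refl sets_gauss[symmetric])
  ultimately show "(\<lambda>w i. GG i w) \<in> measurable MG (PiM UNIV (\<lambda>_. borel))"
    "distr MG (PiM UNIV (\<lambda>_. borel)) (\<lambda>w i. GG i w) = gauss"
    by (simp_all add: distr_snd_MG)
qed

lemma GG_indep: "prob_space.indep_vars MG (\<lambda>_. borel) GG UNIV"
proof -
  interpret p: prob_space MG by (rule prob_space_MG)
  have "distr MG (PiM UNIV (\<lambda>_. borel)) (\<lambda>w. \<lambda>i\<in>UNIV. GG i w) = PiM UNIV (\<lambda>i. distr MG borel (GG i))"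
    by (simp add: restrict_UNIV GG_process(2) distr_GG gauss_def)
  then show ?thesis by (subst p.indep_vars_iff_distr_eq_PiM) (simp_all add: GG_measurable)
qed

lemma X_process: "(\<lambda>w i. X i w) \<in> measurable M (PiM UNIV (\<lambda>_. borel))"
  by (rule measurable_PiM_single') (auto simp: space_PiM)

lemma XG_indep: "prob_space.indep_var MG (PiM UNIV (\<lambda>_. borel)) (\<lambda>w i. X i (fst w)) (PiM UNIV (\<lambda>_. borel)) (\<lambda>w i. GG i w)"
proof -
  interpret p: prob_space MG by (rule prob_space_MG)
  let ?S = "PiM UNIV (\<lambda>_::nat. borel :: real measure)"
  have snd: "(\<lambda>x. x) \<in> measurable gauss ?S" by (simp add: measurable_cong_sets[OF sets_gauss refl])
  have g: "distr gauss ?S (\<lambda>x. x) = gauss" by (rule distr_id2) (rule sets_gauss[symmetric])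
  have Xd: "distr MG ?S (\<lambda>w i. X i (fst w)) = distr M ?S (\<lambda>w i. X i w)"
    using distr_distr[OF X_process fst_MG] by (simp add: distr_fst_MG o_def)
  have "sigma_finite_measure (distr gauss ?S (\<lambda>x. x))"
    unfolding g using gauss_prob_space prob_space_imp_sigma_finite by blast
  then have "distr M ?S (\<lambda>w i. X i w) \<Otimes>\<^sub>M distr gauss ?S (\<lambda>x. x) = distr (M \<Otimes>\<^sub>M gauss) (?S \<Otimes>\<^sub>M ?S) (\<lambda>(w, x). (\<lambda>i. X i w, x))"
    by (rule pair_measure_distr[OF X_process snd])
  then have "distr MG ?S (\<lambda>w i. X i (fst w)) \<Otimes>\<^sub>M distr MG ?S (\<lambda>w i. GG i w) = distr MG (?S \<Otimes>\<^sub>M ?S) (\<lambda>w. (\<lambda>i. X i (fst w), \<lambda>i. GG i w))"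
    unfolding GG_process(2) g Xd by (simp add: GG_def case_prod_beta' MG_def)
  moreover have "(\<lambda>w i. X i (fst w)) \<in> measurable MG ?S" by (rule measurable_compose[OF fst_MG X_process])
  ultimately show ?thesis unfolding p.indep_var_distribution_eq using GG_process(1) by simp
qed

lemma X_fst_moments: "(\<lambda>w. X i (fst w)) \<in> all_moments MG"
  by (rule all_moments_distr[OF fst_MG distr_fst_MG X_moments])

lemma GG_moments: "GG i \<in> all_moments MG"
  unfolding GG_def[abs_def] by (rule all_moments_distr[OF snd_MG distr_snd_MG gauss_moments])

text \<open>Fubini: for a fixed first component the inner integral is that of
  \<open>gauss_cos\<close> with phase \<open>Y w\<close>.\<close>

lemma MG_cos:
  assumes Y: "Y \<in> borel_measurable M" and J: "finite J"
  shows "(\<integral>w. cos (Y (fst w) + (\<Sum>j\<in>J. \<tau> j * GG j w)) \<partial>MG) = expectation (\<lambda>w. cos (Y w)) * exp (- (\<Sum>j\<in>J. (\<tau> j)^2) / 2)"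
proof -
  interpret p: pair_prob_space M gauss by (rule pair_MG)
  interpret q: prob_space MG by (rule prob_space_MG)
  define \<Phi> where "\<Phi> w = cos (Y (fst w) + (\<Sum>j\<in>J. \<tau> j * GG j w))" for w
  have "(\<lambda>w. Y (fst w)) \<in> borel_measurable MG" by (rule measurable_compose[OF fst_MG Y])
  then have "\<Phi> \<in> borel_measurable MG"
    unfolding \<Phi>_def[abs_def] using GG_measurable by measurable
  then have "\<Phi> \<in> all_moments MG"
    by (rule all_moments_bounded[OF q.finite_measure_axioms, of _ 1]) (simp add: \<Phi>_def)
  then have "integrable (M \<Otimes>\<^sub>M gauss) \<Phi>" unfolding MG_def[symmetric] by (rule all_moments_integrable)
  then have "(\<integral>w. \<integral>x. \<Phi> (w, x) \<partial>gauss \<partial>M) = (\<integral>w. \<Phi> w \<partial>MG)"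
    unfolding MG_def by (rule p.integral_fst')
  moreover have "(\<integral>x. \<Phi> (w, x) \<partial>gauss) = cos (Y w) * exp (- (\<Sum>j\<in>J. (\<tau> j)^2) / 2)" for w
    using gauss_cos[OF J, of \<tau> "Y w"] by (simp add: \<Phi>_def GG_def add.commute)
  ultimately show ?thesis by (simp add: \<Phi>_def[symmetric])
qed

end

subsection \<open>Limits of the generators\<close>

context iid_ultra
begin

lemma Negl_zero: "d \<ge> 1 ==> (\<lambda>n w. 0) \<in> Negl"
proof -
  assume d: "d \<ge> 1"
  have "ip (\<lambda>n w. 0) H = 0" for H by (rule ip_eqI) simp
  then have "(\<lambda>n w. 0) \<in> New 1" by (simp add: New_def bseq_const)
  then show ?thesis by (rule New_Negl) (use d in auto)
qed

lemma Negl_sum: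
  assumes "d \<ge> 1" "\<And>a. g a \<in> Negl" "finite A"
  shows "(\<lambda>n w. \<Sum>a\<in>A. \<tau> a * g a n w) \<in> Negl"
  using assms(3)
proof (induction A rule: finite_induct)
  case empty show ?case using Negl_zero[OF assms(1)] by simp
next
  case (insert a A)
  have "(\<lambda>n w. \<tau> a * g a n w + (\<Sum>a\<in>A. \<tau> a * g a n w)) \<in> Negl"
    by (intro Negl_add Negl_scale assms(2) insert.IH)
  then show ?case using insert.hyps by simp
qed

lemma ip_sum:
  assumes d: "d \<ge> 1" and g: "\<And>a. g a \<in> Negl" and "finite A" and H: "H \<in> bseq d"
  shows "ip (\<lambda>n w. \<Sum>a\<in>A. \<tau> a * g a n w) H = (\<Sum>a\<in>A. \<tau> a * ip (g a) H)"
  using assms(3)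
proof (induction A rule: finite_induct)
  case empty
  have "ip (\<lambda>n w. 0) H = 0" by (rule ip_eqI) simp
  then show ?case by simp
next
  case (insert a A)
  have "ip (\<lambda>n w. \<tau> a * g a n w + (\<Sum>a\<in>A. \<tau> a * g a n w)) H = \<tau> a * ip (g a) H + ip (\<lambda>n w. \<Sum>a\<in>A. \<tau> a * g a n w) H"
    using ip_add[OF bseq_scale[OF Negl_bseq[OF g]] Negl_bseq[OF Negl_sum[OF d g insert.hyps(1)]] H]
      ip_scale[OF Negl_bseq[OF g] H] by simp
  then show ?case using insert by simp
qed

text \<open>A Cholesky factorization of the possibly degenerate Gram matrix, obtained from
  Gram-Schmidt on the sequences themselves. Triangularity makes each Gaussian limit a finite linear
  form and allows any common bound m in the sums.\<close>

lemma covariance_factor: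
  assumes g: "\<And>a::nat. g a \<in> Negl"
  obtains \<kappa> :: "nat => nat => real" where "\<And>a j. a < j ==> \<kappa> a j = 0"
    "\<And>a a' m. a \<le> m ==> ip (g a) (g a') = (\<Sum>j\<le>m. \<kappa> a j * \<kappa> a' j)"
proof -
  define nb where "nb u w = ip (\<lambda>n \<omega>. u (n, \<omega>)) (\<lambda>n \<omega>. w (n, \<omega>))" for u w :: "nat \<times> 'a => real"
  define S where "S = {u :: nat \<times> 'a => real. (\<lambda>n \<omega>. u (n, \<omega>)) \<in> Negl}"
  have Sb: "(\<lambda>n \<omega>. u (n, \<omega>)) \<in> bseq d" if "u \<in> S" for u using that by (simp add: S_def Negl_bseq)
  interpret f: psd_form nb S
  proof
    fix u w :: "nat \<times> 'a => real" and x and c :: real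
    assume u: "u \<in> S"
    show "(\<lambda>z. c * u z) \<in> S" using u by (simp add: S_def Negl_scale)
    show "0 \<le> nb u u" unfolding nb_def by (rule ip_nonneg[OF Sb[OF u]])
    assume w: "w \<in> S"
    show "(\<lambda>z. u z + w z) \<in> S" using u w by (simp add: S_def Negl_add)
    show "nb u w = nb w u" unfolding nb_def by (rule ip_sym)
    show "nb (\<lambda>z. c * u z) w = c * nb u w" unfolding nb_def by (rule ip_scale[OF Sb[OF u] Sb[OF w]])
    assume x: "x \<in> S"
    show "nb (\<lambda>z. u z + w z) x = nb u x + nb w x" unfolding nb_def by (rule ip_add[OF Sb[OF u] Sb[OF w] Sb[OF x]])
  qed
  define v where "v a z = g a (fst z) (snd z)" for a and z :: "nat \<times> 'a"
  have v: "v a \<in> S" for a using g by (simp add: S_def v_def)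
  define e where "e = gram_schmidt nb v"
  have e: "e j \<in> S" for j unfolding e_def by (rule f.gram_schmidt_mem[OF v])
  have orth: "nb (e j) (e k) = 0" if "j \<noteq> k" for j k
    unfolding e_def by (rule f.gram_schmidt_orthonormal(1)[OF v that])
  define \<kappa> where "\<kappa> a j = nb (v a) (e j)" for a j
  define q where "q a z = (\<Sum>j\<le>a. \<kappa> a j * e j z)" for a z
  have q: "q a \<in> S" for a unfolding q_def[abs_def] by (intro f.S_sum[OF v] f.S_scale e)
  have res: "nb (\<lambda>z. v a z - q a z) (\<lambda>z. v a z - q a z) = 0" for a
    using f.gram_schmidt_orthonormal(3)[OF v, where k = a] by (simp add: q_def \<kappa>_def e_def)
  have expand: "nb (v a) w = (\<Sum>j\<le>a. \<kappa> a j * nb (e j) w)" if w: "w \<in> S" for a w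
  proof -
    have r: "(\<lambda>z. v a z - q a z) \<in> S" by (intro f.S_diff v q)
    have "(nb (\<lambda>z. v a z - q a z) w)^2 \<le> nb (\<lambda>z. v a z - q a z) (\<lambda>z. v a z - q a z) * nb w w"
      unfolding nb_def by (rule ip_Cauchy_Schwarz[OF Sb[OF r] Sb[OF w]])
    then have "nb (\<lambda>z. v a z - q a z) w = 0" by (simp add: res)
    then have "nb (v a) w = nb (q a) w" by (simp add: f.b_diff v q w)
    also have "... = (\<Sum>j\<le>a. nb (\<lambda>z. \<kappa> a j * e j z) w)"
      unfolding q_def[abs_def] by (intro f.b_sum w f.S_scale e)
    finally show ?thesis by (simp add: f.b_scale e w)
  qed
  have zero: "\<kappa> a j = 0" if "a < j" for a j
  proof -
    have "\<kappa> a j = (\<Sum>i\<le>a. \<kappa> a i * nb (e i) (e j))" unfolding \<kappa>_def[of a j] by (rule expand[OF e])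
    also have "... = 0" using that by (intro sum.neutral ballI) (simp add: orth)
    finally show ?thesis .
  qed
  have "ip (g a) (g a') = (\<Sum>j\<le>m. \<kappa> a j * \<kappa> a' j)" if "a \<le> m" for a a' m
  proof -
    have "ip (g a) (g a') = nb (v a) (v a')" by (simp add: nb_def v_def)
    also have "... = (\<Sum>j\<le>a. \<kappa> a j * nb (e j) (v a'))" by (rule expand[OF v])
    also have "... = (\<Sum>j\<le>a. \<kappa> a j * \<kappa> a' j)" unfolding \<kappa>_def[of a'] by (simp add: f.b_sym[OF e v])
    also have "... = (\<Sum>j\<le>m. \<kappa> a j * \<kappa> a' j)" using that by (intro sum.mono_neutral_left) (auto simp: zero)
    finally show ?thesis .
  qed
  with zero show thesis by (rule that)
qed

text \<open>The ultrafilter decides for each pair of index sequences whether they agree or differ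
  for U-many n. The least equivalent index represents a class, and these numbers serve as labels of
  the limiting variables.\<close>

lemma class_representative:
  fixes \<iota> :: "nat => nat => nat"
  defines "rep \<equiv> (\<lambda>a. LEAST b. eventually (\<lambda>n. \<iota> b n = \<iota> a n) U)"
  shows "eventually (\<lambda>n. \<forall>a\<le>m. \<forall>b\<le>m. \<iota> a n = \<iota> b n \<longleftrightarrow> rep a = rep b) U"
proof -
  have ev_rep: "eventually (\<lambda>n. \<iota> (rep a) n = \<iota> a n) U" for a
    unfolding rep_def by (rule LeastI[of _ a]) simp
  have "eventually (\<lambda>n. \<iota> a n = \<iota> b n \<longleftrightarrow> rep a = rep b) U" for a b
  proof (cases "rep a = rep b")
    case True
    have "eventually (\<lambda>n. \<iota> a n = \<iota> b n) U"
      using ev_rep[of a] ev_rep[of b] by eventually_elim (simp add: True)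
    then show ?thesis using True by simp
  next
    case False
    have "\<not> eventually (\<lambda>n. \<iota> a n = \<iota> b n) U"
    proof
      assume ab: "eventually (\<lambda>n. \<iota> a n = \<iota> b n) U"
      have "eventually (\<lambda>n. \<iota> x n = \<iota> a n) U \<longleftrightarrow> eventually (\<lambda>n. \<iota> x n = \<iota> b n) U" for x
        using eventually_elim2[OF _ ab, of "\<lambda>n. \<iota> x n = \<iota> a n" "\<lambda>n. \<iota> x n = \<iota> b n"]
          eventually_elim2[OF _ ab, of "\<lambda>n. \<iota> x n = \<iota> b n" "\<lambda>n. \<iota> x n = \<iota> a n"] by auto
      then have "rep a = rep b" by (simp add: rep_def)
      then show False using False by simp
    qed
    then have "eventually (\<lambda>n. \<iota> a n \<noteq> \<iota> b n) U" by (simp add: not_eventually_U)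
    then show ?thesis using False by simp
  qed
  then have "eventually (\<lambda>n. \<forall>b\<in>{..m}. \<iota> a n = \<iota> b n \<longleftrightarrow> rep a = rep b) U" for a
    by (intro eventually_ball_finite) auto
  then have "eventually (\<lambda>n. \<forall>a\<in>{..m}. \<forall>b\<in>{..m}. \<iota> a n = \<iota> b n \<longleftrightarrow> rep a = rep b) U"
    by (intro eventually_ball_finite) auto
  then show ?thesis by (rule eventually_mono) simp
qed

text \<open>By exchangeability only the pattern of coincidences among the indices matters.
  Coefficients at equal indices are added up first, because relabelling applies to distinct
  variables.\<close>

lemma expectation_cos_pattern:
  fixes m :: nat
  assumes pat: "\<forall>a\<le>m. \<forall>b\<le>m. j a = j b \<longleftrightarrow> rep a = rep b"
  shows "expectation (\<lambda>w. cos ((\<Sum>a\<le>m. s a * X (j a) w) + c)) = expectation (\<lambda>w. cos ((\<Sum>a\<le>m. s a * X (rep a) w) + c))"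
proof -
  define \<rho> where "\<rho> r = j (SOME a. a \<le> m \<and> rep a = r)" for r
  have \<rho>: "\<rho> (rep a) = j a" if a: "a \<le> m" for a
  proof -
    define b where "b = (SOME b. b \<le> m \<and> rep b = rep a)"
    have "b \<le> m \<and> rep b = rep a" unfolding b_def by (rule someI[of _ a]) (use a in simp)
    then have "j b = j a" using pat a by simp
    then show ?thesis by (simp add: \<rho>_def b_def)
  qed
  define R where "R = rep ` {..m}"
  have inj: "inj_on \<rho> R"
  proof (rule inj_onI)
    fix r r' assume "r \<in> R" "r' \<in> R" and e: "\<rho> r = \<rho> r'"
    then obtain a a' where a: "a \<le> m" "r = rep a" "a' \<le> m" "r' = rep a'" by (auto simp: R_def)
    then show "r = r'" using e pat by (simp add: \<rho>)
  qed
  define \<sigma> where "\<sigma> r = (\<Sum>a\<in>{a \<in> {..m}. rep a = r}. s a)" for r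
  have group: "(\<Sum>a\<le>m. s a * X (\<theta> (rep a)) w) = (\<Sum>r\<in>R. \<sigma> r * X (\<theta> r) w)" for \<theta> :: "nat => nat" and w
  proof -
    have "(\<Sum>a\<le>m. s a * X (\<theta> (rep a)) w) = (\<Sum>r\<in>R. \<Sum>a\<in>{a \<in> {..m}. rep a = r}. s a * X (\<theta> (rep a)) w)"
      unfolding R_def by (rule sum.image_gen) simp
    also have "... = (\<Sum>r\<in>R. \<sigma> r * X (\<theta> r) w)"
      unfolding \<sigma>_def sum_distrib_right by (intro sum.cong refl) auto
    finally show ?thesis .
  qed
  have "(\<Sum>a\<le>m. s a * X (j a) w) = (\<Sum>r\<in>R. \<sigma> r * X (\<rho> r) w)" for w
    using group[of \<rho> w] \<rho> by simp
  then show ?thesis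
    using expectation_cos_relabel[OF _ inj, of \<sigma> c] group[of "\<lambda>r. r"] by (simp add: R_def)
qed

text \<open>All remainders are merged into one negligible sequence and all variables into blocks of
  bounded size, so a single use of \<open>Negl_joint_clt\<close> settles every linear form. Its
  Gaussian factor is matched with \<open>MG_cos\<close> through the factorization of the Gram
  matrix.\<close>

lemma trig_limit:
  fixes \<iota> :: "nat => nat => nat" and V :: "(nat + nat) set"
  assumes D: "d = Suc D" and g: "\<And>a. g a \<in> Negl"
    and \<kappa>0: "\<And>a j. a < j ==> \<kappa> a j = 0" and \<kappa>: "\<And>a a' m. a \<le> m ==> ip (g a) (g a') = (\<Sum>j\<le>m. \<kappa> a j * \<kappa> a' j)"
    and V: "finite V"
  defines "rep \<equiv> (\<lambda>a. LEAST b. eventually (\<lambda>n. \<iota> b n = \<iota> a n) U)"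
  defines "y \<equiv> (\<lambda>n. case_sum (\<lambda>a. X (\<iota> a n)) (\<lambda>a. g a n))"
    and "z \<equiv> case_sum (\<lambda>a w. X (rep a) (fst w)) (\<lambda>a w. \<Sum>j\<le>a. \<kappa> a j * GG j w)"
  shows "((\<lambda>n. expectation (\<lambda>w. cos ((\<Sum>v\<in>V. t v * y n v w) + c))) \<longlongrightarrow> (\<integral>w. cos ((\<Sum>v\<in>V. t v * z v w) + c) \<partial>MG)) U"
proof -
  have d1: "d \<ge> 1" using D by simp
  obtain m where m: "V \<subseteq> {..m} <+> {..m}"
  proof -
    have "finite (Inl -` V)" "finite (Inr -` V)" using V by (auto intro: finite_vimageI)
    then obtain m1 m2 where mm: "Inl -` V \<subseteq> {..m1::nat}" "Inr -` V \<subseteq> {..m2::nat}"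
      by (auto simp: finite_nat_set_iff_bounded_le subset_eq)
    have "V \<subseteq> {..max m1 m2} <+> {..max m1 m2}"
    proof
      fix v assume "v \<in> V" then show "v \<in> {..max m1 m2} <+> {..max m1 m2}"
        using mm by (cases v) (auto simp: subset_eq le_max_iff_disj)
    qed
    then show thesis by (rule that)
  qed
  define s where "s a = (if Inl a \<in> V then t (Inl a) else 0)" for a
  define \<tau> where "\<tau> a = (if Inr a \<in> V then t (Inr a) else 0)" for a
  have split: "(\<Sum>v\<in>V. t v * u v) = (\<Sum>a\<le>m. s a * u (Inl a)) + (\<Sum>a\<le>m. \<tau> a * u (Inr a))" for u
  proof -
    have "(\<Sum>v\<in>V. t v * u v) = (\<Sum>v\<in>{..m} <+> {..m}. (if v \<in> V then t v else 0) * u v)"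
      using m by (intro sum.mono_neutral_cong_left) auto
    then show ?thesis by (simp add: sum.Plus s_def \<tau>_def)
  qed
  define F where "F n w = (\<Sum>a\<le>m. \<tau> a * g a n w)" for n w
  define Y where "Y n w = (\<Sum>a\<le>m. s a * X (\<iota> a n) w) + c" for n w
  define Y0 where "Y0 w = (\<Sum>a\<le>m. s a * X (rep a) w) + c" for w
  have F: "F \<in> Negl" unfolding F_def[abs_def] by (rule Negl_sum[OF d1 g]) simp
  define C where "C n = (\<lambda>a. \<iota> a n) ` {..m}" for n
  have "((\<lambda>n. expectation (\<lambda>w. cos (Y n w + F n w)) - expectation (\<lambda>w. cos (Y n w)) * exp (- ip F F / 2)) \<longlongrightarrow> 0) U"
  proof (rule Negl_joint_clt[OF D F])
    show "finite (C n)" for n by (simp add: C_def)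
    show "card (C n) \<le> Suc m" for n using card_image_le[of "{..m}" "\<lambda>a. \<iota> a n"] by (simp add: C_def)
    show "Y n \<in> borel_measurable (sig (C n))" for n
      unfolding Y_def[abs_def]
      by (intro borel_measurable_add borel_measurable_sum borel_measurable_times borel_measurable_const W_sig) (auto simp: C_def)
  qed
  moreover have "((\<lambda>n. expectation (\<lambda>w. cos (Y n w)) * exp (- ip F F / 2)) \<longlongrightarrow> expectation (\<lambda>w. cos (Y0 w)) * exp (- ip F F / 2)) U"
  proof (rule tendsto_eventually)
    show "eventually (\<lambda>n. expectation (\<lambda>w. cos (Y n w)) * exp (- ip F F / 2) = expectation (\<lambda>w. cos (Y0 w)) * exp (- ip F F / 2)) U"
      using class_representative[of m \<iota>]
    proof eventually_elim
      case (elim n)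
      show ?case unfolding Y_def Y0_def using expectation_cos_pattern[OF elim, of s c] by (simp add: rep_def)
    qed
  qed
  ultimately have "((\<lambda>n. expectation (\<lambda>w. cos (Y n w + F n w))) \<longlongrightarrow> 0 + expectation (\<lambda>w. cos (Y0 w)) * exp (- ip F F / 2)) U"
    by (drule_tac tendsto_add) (assumption, simp)
  moreover have "expectation (\<lambda>w. cos (Y0 w)) * exp (- ip F F / 2) = (\<integral>w. cos ((\<Sum>v\<in>V. t v * z v w) + c) \<partial>MG)"
  proof -
    define \<tau>' where "\<tau>' j = (\<Sum>a\<le>m. \<tau> a * \<kappa> a j)" for j
    have "ip F F = (\<Sum>j\<le>m. (\<tau>' j)^2)"
    proof -
      have "ip F F = (\<Sum>a\<le>m. \<tau> a * ip (g a) F)"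
        by (subst F_def[abs_def]) (rule ip_sum[OF d1 g _ Negl_bseq[OF F]], simp)
      also have "... = (\<Sum>a\<le>m. \<tau> a * (\<Sum>a'\<le>m. \<tau> a' * (\<Sum>j\<le>m. \<kappa> a j * \<kappa> a' j)))"
      proof (intro sum.cong refl arg_cong2[where f = "(*)"])
        fix a assume a: "a \<in> {..m}"
        have "ip (g a) F = ip F (g a)" by (rule ip_sym)
        also have "... = (\<Sum>a'\<le>m. \<tau> a' * ip (g a') (g a))"
          by (subst F_def[abs_def]) (rule ip_sum[OF d1 g _ Negl_bseq[OF g]], simp)
        also have "... = (\<Sum>a'\<le>m. \<tau> a' * (\<Sum>j\<le>m. \<kappa> a j * \<kappa> a' j))"
          using \<kappa> by (intro sum.cong refl) (simp add: mult.commute)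
        finally show "ip (g a) F = (\<Sum>a'\<le>m. \<tau> a' * (\<Sum>j\<le>m. \<kappa> a j * \<kappa> a' j))" .
      qed
      also have "... = (\<Sum>a\<le>m. \<Sum>a'\<le>m. \<Sum>j\<le>m. (\<tau> a * \<kappa> a j) * (\<tau> a' * \<kappa> a' j))"
        unfolding sum_distrib_left by (simp only: mult_ac)
      also have "... = (\<Sum>a\<le>m. \<Sum>j\<le>m. \<Sum>a'\<le>m. (\<tau> a * \<kappa> a j) * (\<tau> a' * \<kappa> a' j))"
        by (intro sum.cong refl sum.swap)
      also have "... = (\<Sum>j\<le>m. \<Sum>a\<le>m. \<Sum>a'\<le>m. (\<tau> a * \<kappa> a j) * (\<tau> a' * \<kappa> a' j))" by (rule sum.swap)
      also have "... = (\<Sum>j\<le>m. (\<tau>' j)^2)" by (simp add: \<tau>'_def power2_eq_square sum_product)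
      finally show ?thesis .
    qed
    moreover have "(\<Sum>v\<in>V. t v * z v w) + c = Y0 (fst w) + (\<Sum>j\<le>m. \<tau>' j * GG j w)" for w
    proof -
      have "(\<Sum>a\<le>m. \<tau> a * z (Inr a) w) = (\<Sum>a\<le>m. \<tau> a * (\<Sum>j\<le>m. \<kappa> a j * GG j w))"
      proof (intro sum.cong refl arg_cong2[where f = "(*)"])
        fix a assume a: "a \<in> {..m}"
        have "(\<Sum>j\<le>a. \<kappa> a j * GG j w) = (\<Sum>j\<le>m. \<kappa> a j * GG j w)"
          using a by (intro sum.mono_neutral_left) (auto simp: \<kappa>0)
        then show "z (Inr a) w = (\<Sum>j\<le>m. \<kappa> a j * GG j w)" by (simp add: z_def)
      qed
      also have "... = (\<Sum>j\<le>m. \<tau>' j * GG j w)"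
        unfolding \<tau>'_def sum_distrib_left sum_distrib_right mult.assoc by (rule sum.swap)
      finally show ?thesis by (simp add: split Y0_def z_def)
    qed
    moreover have "Y0 \<in> borel_measurable M" unfolding Y0_def[abs_def]
      by (intro borel_measurable_add borel_measurable_sum borel_measurable_times borel_measurable_const W_measurable)
    ultimately show ?thesis using MG_cos[of Y0 "{..m}" \<tau>'] by simp
  qed
  moreover have "Y n w + F n w = (\<Sum>v\<in>V. t v * y n v w) + c" for n w
    by (simp add: split Y_def F_def y_def)
  ultimately show ?thesis by simp
qed

text \<open>One polynomial works for all n, since n enters only through the generators. A remainder
  of degree j counts as a variable of degree 1, which respects the degree bound because
  \<open>1 \<le> j\<close>.\<close>

lemma alg_pol:
  assumes "(k, A) \<in> alg X GI GN" "k \<le> d" "GI \<subseteq> range \<iota>" "\<And>j f. (j, f) \<in> GN ==> 1 \<le> j ==> j \<le> d ==> f \<in> range g"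
  shows "\<exists>p. (k, p) \<in> pol \<and> (\<forall>n w. A n w = p (\<lambda>v. case_sum (\<lambda>a. X (\<iota> a n)) (\<lambda>a. g a n) v w))"
  using assms(1,2)
proof induction
  case (const k c)
  show ?case by (intro exI[of _ "\<lambda>_. c"] conjI pol.const) simp
next
  case (var i k)
  then obtain a where "i = \<iota> a" using assms(3) by auto
  then show ?case using var by (intro exI[of _ "\<lambda>y. y (Inl a)"] conjI pol.var) simp_all
next
  case (new j f k)
  then obtain a where "f = g a" using assms(4)[of j f] by auto
  then show ?case using new by (intro exI[of _ "\<lambda>y. y (Inr a)"] conjI pol.var) simp_all
next
  case (add k F G)
  obtain p where p: "(k, p) \<in> pol" "\<And>n w. F n w = p (\<lambda>v. case_sum (\<lambda>a. X (\<iota> a n)) (\<lambda>a. g a n) v w)"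
    using add.IH(1) add.prems by auto
  obtain q where q: "(k, q) \<in> pol" "\<And>n w. G n w = q (\<lambda>v. case_sum (\<lambda>a. X (\<iota> a n)) (\<lambda>a. g a n) v w)"
    using add.IH(2) add.prems by auto
  show ?case by (intro exI[of _ "\<lambda>y. p y + q y"] conjI pol.add p(1) q(1) allI) (simp only: p(2) q(2))
next
  case (mult i F j G k)
  obtain p where p: "(i, p) \<in> pol" "\<And>n w. F n w = p (\<lambda>v. case_sum (\<lambda>a. X (\<iota> a n)) (\<lambda>a. g a n) v w)"
    using mult.IH(1) mult.prems mult.hyps by auto
  obtain q where q: "(j, q) \<in> pol" "\<And>n w. G n w = q (\<lambda>v. case_sum (\<lambda>a. X (\<iota> a n)) (\<lambda>a. g a n) v w)"
    using mult.IH(2) mult.prems mult.hyps by auto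
  show ?case by (intro exI[of _ "\<lambda>y. p y * q y"] conjI pol.mult[OF p(1) q(1) mult.hyps(3)] allI) (simp only: p(2) q(2))
qed

end

lemma pol_scale: "(k, p) \<in> pol ==> (k, \<lambda>y. c * p y) \<in> pol"
  using pol.mult[OF pol.const[of 0 c], of k p k] by simp

section \<open>Comparison of laws and of second moments\<close>

lemma (in prob_space) abs_le_sqrt_L2:
  assumes [measurable]: "f \<in> borel_measurable M" and f2: "integrable M (\<lambda>w. (f w)^2)"
  shows "integrable M f" "expectation (\<lambda>w. \<bar>f w\<bar>) \<le> sqrt (expectation (\<lambda>w. (f w)^2))"
proof -
  show f: "integrable M f" by (rule square_integrable_imp_integrable) (use f2 in auto)
  have "0 \<le> variance (\<lambda>w. \<bar>f w\<bar>)" by (rule variance_positive)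
  also have "... = expectation (\<lambda>w. \<bar>f w\<bar>^2) - (expectation (\<lambda>w. \<bar>f w\<bar>))^2"
    using f f2 by (intro variance_eq) auto
  finally have "(expectation (\<lambda>w. \<bar>f w\<bar>))^2 \<le> expectation (\<lambda>w. (f w)^2)" by simp
  then show "expectation (\<lambda>w. \<bar>f w\<bar>) \<le> sqrt (expectation (\<lambda>w. (f w)^2))" by (rule real_le_rsqrt)
qed

lemma (in prob_space) expectation_lipschitz_diff:
  fixes \<psi> :: "real => real"
  assumes [measurable]: "f \<in> borel_measurable M" "g \<in> borel_measurable M" "\<psi> \<in> borel_measurable borel"
    and fg: "integrable M (\<lambda>w. (f w - g w)^2)"
    and \<psi>: "\<And>x. \<bar>\<psi> x\<bar> \<le> 1" "\<And>x y. \<bar>\<psi> x - \<psi> y\<bar> \<le> L * \<bar>x - y\<bar>" and L: "L \<ge> 0"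
  shows "\<bar>expectation (\<lambda>w. \<psi> (f w)) - expectation (\<lambda>w. \<psi> (g w))\<bar> \<le> L * sqrt (expectation (\<lambda>w. (f w - g w)^2))"
proof -
  define G where "G w = \<psi> (f w) - \<psi> (g w)" for w
  have i: "integrable M (\<lambda>w. \<psi> (f w))" "integrable M (\<lambda>w. \<psi> (g w))"
    by (auto intro!: integrable_const_bound[where B = 1] \<psi>)
  have d: "integrable M (\<lambda>w. f w - g w)" "expectation (\<lambda>w. \<bar>f w - g w\<bar>) \<le> sqrt (expectation (\<lambda>w. (f w - g w)^2))"
    using fg by (auto intro!: abs_le_sqrt_L2)
  have EG: "expectation G = expectation (\<lambda>w. \<psi> (f w)) - expectation (\<lambda>w. \<psi> (g w))"
    unfolding G_def[abs_def] by (rule Bochner_Integration.integral_diff[OF i])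
  have "expectation (\<lambda>w. \<bar>G w\<bar>) \<le> expectation (\<lambda>w. L * \<bar>f w - g w\<bar>)"
  proof (rule integral_mono)
    show "integrable M (\<lambda>w. \<bar>G w\<bar>)" unfolding G_def[abs_def] using i by auto
    show "integrable M (\<lambda>w. L * \<bar>f w - g w\<bar>)" using d(1) by auto
  qed (simp add: G_def \<psi>)
  also have "... = L * expectation (\<lambda>w. \<bar>f w - g w\<bar>)" by simp
  also have "... \<le> L * sqrt (expectation (\<lambda>w. (f w - g w)^2))" using d(2) L by (rule mult_left_mono)
  finally have "expectation (\<lambda>w. \<bar>G w\<bar>) \<le> L * sqrt (expectation (\<lambda>w. (f w - g w)^2))" .
  with integral_abs_bound[of M G] have "\<bar>expectation G\<bar> \<le> L * sqrt (expectation (\<lambda>w. (f w - g w)^2))" by (rule order_trans)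
  then show ?thesis unfolding EG .
qed

lemma (in prob_space) expectation_cos_diff:
  assumes "f \<in> borel_measurable M" "g \<in> borel_measurable M" "integrable M (\<lambda>w. (f w - g w)^2)"
  shows "\<bar>expectation (\<lambda>w. cos (t * f w + c)) - expectation (\<lambda>w. cos (t * g w + c))\<bar> \<le> \<bar>t\<bar> * sqrt (expectation (\<lambda>w. (f w - g w)^2))"
proof (rule expectation_lipschitz_diff[OF assms(1,2) _ assms(3)])
  show "\<bar>cos (t * x + c) - cos (t * y + c)\<bar> \<le> \<bar>t\<bar> * \<bar>x - y\<bar>" for x y
    using cos_lipschitz[of "t * x + c" "t * y + c"] by (simp add: abs_mult[symmetric] right_diff_distrib)
qed auto

text \<open>Second moments are recovered from cosines: \<open>2 (1 - cos (t x)) / t^2\<close> is at most \<open>x^2\<close> and tends to it.\<close>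

lemma second_moment_limit_le:
  assumes "prob_space M" "prob_space N" and U: "U \<noteq> bot"
    and Q: "Q \<in> all_moments N" and A: "\<And>n. A n \<in> all_moments M"
    and cos: "\<And>t. ((\<lambda>n::nat. \<integral>w. cos (t * A n w) \<partial>M) \<longlongrightarrow> (\<integral>w. cos (t * Q w) \<partial>N)) U"
    and sq: "((\<lambda>n. \<integral>w. (A n w)^2 \<partial>M) \<longlongrightarrow> s) U"
  shows "(\<integral>w. (Q w)^2 \<partial>N) \<le> s"
proof -
  interpret M: prob_space M by fact
  interpret N: prob_space N by fact
  have cosM: "integrable M (\<lambda>w. cos (t * A n w))" for t n
    using all_moments_measurable[OF A] by (intro M.integrable_const_bound[where B = 1]) auto
  have cosN: "integrable N (\<lambda>w. cos (t * Q w))" for t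
    using all_moments_measurable[OF Q] by (intro N.integrable_const_bound[where B = 1]) auto
  have sqM: "integrable M (\<lambda>w. (A n w)^2)" for n by (intro all_moments_integrable M.all_moments_closed A)
  have Q2: "integrable N (\<lambda>w. (Q w)^2)" by (intro all_moments_integrable N.all_moments_closed Q)
  have Q3: "integrable N (\<lambda>w. \<bar>Q w\<bar> ^ 3)" by (intro all_moments_integrable N.all_moments_closed all_moments_abs Q)
  define K where "K = (\<integral>w. \<bar>Q w\<bar> ^ 3 \<partial>N)"
  have le: "(\<integral>w. (Q w)^2 \<partial>N) \<le> s + t * K / 2" if t: "t > 0" for t
  proof -
    have "2 * (1 - (\<integral>w. cos (t * A n w) \<partial>M)) \<le> t^2 * (\<integral>w. (A n w)^2 \<partial>M)" for n
    proof -
      have "(\<integral>w. 2 * (1 - cos (t * A n w)) \<partial>M) \<le> (\<integral>w. t^2 * (A n w)^2 \<partial>M)"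
      proof (rule integral_mono)
        show "2 * (1 - cos (t * A n w)) \<le> t^2 * (A n w)^2" for w
          using cos_minus_1_le[of "t * A n w"] by (simp add: power_mult_distrib abs_le_iff)
      qed (use cosM sqM in auto)
      then show ?thesis using cosM by (simp add: M.prob_space)
    qed
    then have "2 * (1 - (\<integral>w. cos (t * Q w) \<partial>N)) \<le> t^2 * s"
    proof (intro tendsto_le[OF U])
      show "((\<lambda>n. t^2 * (\<integral>w. (A n w)^2 \<partial>M)) \<longlongrightarrow> t^2 * s) U" by (intro tendsto_intros sq)
      show "((\<lambda>n. 2 * (1 - (\<integral>w. cos (t * A n w) \<partial>M))) \<longlongrightarrow> 2 * (1 - (\<integral>w. cos (t * Q w) \<partial>N))) U"
        by (intro tendsto_intros cos)
    qed (rule always_eventually, simp)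
    moreover have "t^2 * (\<integral>w. (Q w)^2 \<partial>N) \<le> 2 * (1 - (\<integral>w. cos (t * Q w) \<partial>N)) + t ^ 3 * K / 2"
    proof -
      have "(\<integral>w. t^2 * (Q w)^2 \<partial>N) \<le> (\<integral>w. 2 * (1 - cos (t * Q w)) + t ^ 3 * \<bar>Q w\<bar> ^ 3 / 2 \<partial>N)"
      proof (rule integral_mono)
        show "t^2 * (Q w)^2 \<le> 2 * (1 - cos (t * Q w)) + t ^ 3 * \<bar>Q w\<bar> ^ 3 / 2" for w
        proof -
          have "cos (t * Q w) - 1 + (t * Q w)^2 / 2 \<le> \<bar>t * Q w\<bar> ^ 3 / 4"
            using cos_Taylor3[of "t * Q w"] by (rule abs_le_D1)
          moreover have "(t * Q w)^2 = t^2 * (Q w)^2" "\<bar>t * Q w\<bar> ^ 3 = t ^ 3 * \<bar>Q w\<bar> ^ 3"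
            using t by (simp_all add: power_mult_distrib abs_mult)
          ultimately show ?thesis by simp
        qed
      qed (use cosN Q2 Q3 in auto)
      also have "... = 2 * (1 - (\<integral>w. cos (t * Q w) \<partial>N)) + t ^ 3 * K / 2"
        using cosN[of t] Q3 by (simp add: N.prob_space K_def)
      finally show ?thesis by simp
    qed
    ultimately have "t^2 * (\<integral>w. (Q w)^2 \<partial>N) \<le> t^2 * (s + t * K / 2)"
      by (simp add: distrib_left power2_eq_square power3_eq_cube)
    then show ?thesis using t by simp
  qed
  have "((\<lambda>t. s + t * K / 2) \<longlongrightarrow> s + 0 * K / 2) (at_right 0)" by (intro tendsto_intros) simp
  moreover have "eventually (\<lambda>t. (\<integral>w. (Q w)^2 \<partial>N) \<le> s + t * K / 2) (at_right 0)"
    using eventually_at_right_less[of "0::real"] by eventually_elim (rule le)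
  ultimately show ?thesis by (intro tendsto_lowerbound[of _ _ "at_right 0"]) auto
qed

subsection \<open>Limits of bounded sequences of polynomials\<close>

context iid_ultra
begin

text \<open>The approximations \<open>A l\<close> of \<open>F\<close> are fixed polynomials in the
  generators; evaluated at the limits of the generators they give \<open>Z l\<close>. Since second
  moments do not increase in this limit, \<open>Z\<close> inherits the Cauchy rate of
  \<open>A\<close>. Laws are then compared along the chain \<open>F\<close>, \<open>A l\<close>,
  \<open>Z l\<close>, \<open>P\<close>.\<close>

theorem bseq_limit:
  assumes D: "d = Suc D" and F: "F \<in> bseq d"
  shows "\<exists>P\<in>polynomials MG (case_sum (\<lambda>i w. X i (fst w)) GG) d.
    \<forall>t c. ((\<lambda>n. expectation (\<lambda>w. cos (t * F n w + c))) \<longlongrightarrow> (\<integral>w. cos (t * P w + c) \<partial>MG)) U"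
proof -
  have d1: "1 \<le> d" using D by simp
  interpret q: prob_space MG by (rule prob_space_MG)
  \<comment> \<open>Two errors below \<open>(1 / 4) ^ Suc l\<close>, each doubled by
    \<open>ip_square_add_le\<close>, add up to at most \<open>(1 / 4) ^ l\<close>, the rate in
    \<open>L2_limit\<close>.\<close>
  define near where "near l A \<longleftrightarrow> (d, A) \<in> alg X UNIV New_all \<and> A \<in> bseq d \<and>
    ip (\<lambda>n w. F n w - A n w) (\<lambda>n w. F n w - A n w) < (1 / 4) ^ Suc l" for l A
  have "\<exists>A. near l A" for l
  proof -
    have "(0::real) < (1 / 4) ^ Suc l" by simp
    from approxE[OF bseq_approx[OF F order_refl] this order_refl] show ?thesis unfolding near_def by blast
  qed
  then obtain A where A: "\<And>l. near l (A l)" by metis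
  have Aalg: "(d, A l) \<in> alg X UNIV New_all" and Ab: "A l \<in> bseq d"
    and Aip: "ip (\<lambda>n w. F n w - A l n w) (\<lambda>n w. F n w - A l n w) < (1 / 4) ^ Suc l" for l
    using A[of l] by (simp_all add: near_def)
  define gens where "gens l S \<longleftrightarrow> finite (fst S) \<and> finite (snd S) \<and> snd S \<subseteq> New_all \<and> (d, A l) \<in> alg X (fst S) (snd S)" for l and S :: "(nat => nat) set \<times> (nat \<times> 'a rvseq) set"
  have "\<exists>S. gens l S" for l
  proof -
    obtain GI GN where "finite GI" "finite GN" "GN \<subseteq> New_all" "(d, A l) \<in> alg X GI GN"
      using alg_finite_generators[OF Aalg[of l]] by (elim exE conjE)
    then have "gens l (GI, GN)" by (simp add: gens_def)
    then show ?thesis by blast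
  qed
  then obtain S where S: "\<And>l. gens l (S l)" by metis
  \<comment> \<open>The inserted defaults make \<open>HI\<close> and \<open>HN\<close> nonempty, so
    that sequences indexed by all naturals enumerate them; the default remainder is the zero
    sequence, which is negligible. The bounds \<open>1 \<le> j\<close> and \<open>j \<le> d\<close>
    in \<open>HN\<close> are those of \<open>New_Negl\<close>.\<close>
  define HI where "HI = insert (\<lambda>_. 0) (\<Union>l. fst (S l))"
  define HN where "HN = insert (\<lambda>n w. 0) {f. \<exists>l j. (j, f) \<in> snd (S l) \<and> 1 \<le> j \<and> j \<le> d}"
  have "countable (fst (S l))" "countable (snd (S l))" for l
    using S[of l] by (auto simp: gens_def intro: countable_finite)
  then have cI: "countable HI" and c0: "countable (\<Union>l. snd (S l))" unfolding HI_def by auto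
  have cN: "countable HN"
  proof (rule countable_subset)
    show "HN \<subseteq> insert (\<lambda>n w. 0) (snd ` (\<Union>l. snd (S l)))" unfolding HN_def by force
    show "countable (insert (\<lambda>n w. 0) (snd ` (\<Union>l. snd (S l))))" using c0 by simp
  qed
  define \<iota> where "\<iota> = from_nat_into HI"
  define g where "g = from_nat_into HN"
  have r\<iota>: "range \<iota> = HI" unfolding \<iota>_def by (rule range_from_nat_into[OF _ cI]) (simp add: HI_def)
  have rg: "range g = HN" unfolding g_def by (rule range_from_nat_into[OF _ cN]) (simp add: HN_def)
  have g: "g a \<in> Negl" for a
  proof -
    have "g a \<in> HN" using rg by auto
    then consider "g a = (\<lambda>n w. 0)" | l j where "(j, g a) \<in> snd (S l)" "1 \<le> j" "j \<le> d" unfolding HN_def by auto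
    then show ?thesis
    proof cases
      case 1 then show ?thesis using Negl_zero[OF d1] by simp
    next
      case 2
      then have "g a \<in> New j" using S[of l] by (auto simp: gens_def)
      then show ?thesis using 2 by (intro New_Negl)
    qed
  qed
  define y where "y n = case_sum (\<lambda>a. X (\<iota> a n)) (\<lambda>a. g a n)" for n
  define poly_of where "poly_of l p \<longleftrightarrow> (d, p) \<in> pol \<and> (\<forall>n w. A l n w = p (\<lambda>v. y n v w))" for l p
  have "\<exists>p. poly_of l p" for l
    unfolding poly_of_def y_def
  proof (rule alg_pol[OF _ order_refl])
    show "(d, A l) \<in> alg X (fst (S l)) (snd (S l))" using S[of l] by (simp add: gens_def)
    show "fst (S l) \<subseteq> range \<iota>" unfolding r\<iota> HI_def by blast
    show "f \<in> range g" if "(j, f) \<in> snd (S l)" "1 \<le> j" "j \<le> d" for j f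
      using that unfolding rg HN_def by blast
  qed
  then obtain p where "\<And>l. poly_of l (p l)" by metis
  then have p: "(d, p l) \<in> pol" and Ap: "A l n w = p l (\<lambda>v. y n v w)" for l n w
    by (simp_all add: poly_of_def)
  define cov where "cov \<kappa> \<longleftrightarrow> (\<forall>a j. a < j --> \<kappa> a j = 0) \<and>
    (\<forall>a a' m. a \<le> m --> ip (g a) (g a') = (\<Sum>j\<le>m. \<kappa> a j * \<kappa> a' j))" for \<kappa> :: "nat => nat => real"
  have "\<exists>\<kappa>. cov \<kappa>"
    by (rule covariance_factor[of g, OF g], unfold cov_def) (intro exI conjI allI impI)
  then obtain \<kappa> where "cov \<kappa>" ..
  then have \<kappa>0: "\<And>a j. a < j ==> \<kappa> a j = 0"
    and \<kappa>: "\<And>a a' m. a \<le> m ==> ip (g a) (g a') = (\<Sum>j\<le>m. \<kappa> a j * \<kappa> a' j)"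
    unfolding cov_def by blast+
  define z where "z = case_sum (\<lambda>a w. X (LEAST b. eventually (\<lambda>n. \<iota> b n = \<iota> a n) U) (fst w)) (\<lambda>a w. \<Sum>j\<le>a. \<kappa> a j * GG j w)"
  have lim: "((\<lambda>n. expectation (\<lambda>w. cos ((\<Sum>v\<in>V. t v * y n v w) + c))) \<longlongrightarrow> (\<integral>w. cos ((\<Sum>v\<in>V. t v * z v w) + c) \<partial>MG)) U" if "finite V" for V t c
    unfolding y_def z_def by (rule trig_limit[OF D g \<kappa>0 \<kappa> that])
  have yb: "(\<lambda>n. y n v) \<in> bseq d" for v
  proof (cases v)
    case (Inl a) then show ?thesis using bseq_var[OF d1, of "\<iota> a"] by (simp add: y_def)
  next
    case (Inr a) then show ?thesis using Negl_bseq[OF g[of a]] by (simp add: y_def)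
  qed
  have ym: "y n v \<in> all_moments M" for n v using bseq_moments[OF yb[of v], of n] .
  define C where "C v = (SUP n. sq (y n v))" for v
  have C: "sq (y n v) \<le> C v" for n v
  proof -
    obtain B' where "\<forall>n. sq (y n v) \<le> B'" using yb[of v] by (auto simp: bseq_def)
    then have "bdd_above (range (\<lambda>n. sq (y n v)))" by (intro bdd_aboveI2[where M = B']) simp
    then show ?thesis unfolding C_def by (rule cSUP_upper[OF UNIV_I])
  qed
  have zm: "z v \<in> all_moments MG" for v
    unfolding z_def by (cases v) (auto intro!: X_fst_moments q.all_moments_closed GG_moments)
  define Y where "Y = case_sum (\<lambda>i w. X i (fst w)) GG"
  have zo: "z v \<in> ordinary_polynomials Y 1" for v
  proof (cases v)
    case (Inl a)
    then show ?thesis using ordinary_polynomials_var[of 1 Y "Inl (LEAST b. eventually (\<lambda>n. \<iota> b n = \<iota> a n) U)"] by (simp add: z_def Y_def)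
  next
    case (Inr a)
    have "GG j \<in> ordinary_polynomials Y 1" for j using ordinary_polynomials_var[of 1 Y "Inr j"] by (simp add: Y_def)
    then have "(\<lambda>w. \<Sum>j\<le>a. \<kappa> a j * GG j w) \<in> ordinary_polynomials Y 1"
      by (intro ordinary_polynomials_sum ordinary_polynomials_scale)
    then show ?thesis using Inr by (simp add: z_def)
  qed
  note pcl = pol_cos_limit[of M MG y C z U, OF prob_space_axioms prob_space_MG ym C zm lim]
  define Z where "Z l w = p l (\<lambda>v. z v w)" for l w
  have Zm: "Z l \<in> all_moments MG" for l unfolding Z_def[abs_def] by (rule q.pol_moments[OF p zm])
  have Zo: "Z l \<in> ordinary_polynomials Y d" for l unfolding Z_def[abs_def] by (rule pol_ordinary[OF p zo])
  have cauchy: "(\<integral>w. (Z m w - Z l w)^2 \<partial>MG) \<le> (1 / 4) ^ l" if "l \<le> m" for l m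
  proof -
    define r where "r u = p m u + (- 1) * p l u" for u
    have r: "(d, r) \<in> pol" unfolding r_def[abs_def] by (intro pol.add pol_scale p)
    have rA: "r (\<lambda>v. y n v w) = A m n w - A l n w" for n w by (simp add: r_def Ap)
    have rZ: "r (\<lambda>v. z v w) = Z m w - Z l w" for w by (simp add: r_def Z_def)
    have bd: "(\<lambda>n w. A m n w - A l n w) \<in> bseq d" by (intro bseq_diff Ab)
    \<comment> \<open>Lower semicontinuity: mass may escape in a limit in law, but a second moment
      cannot increase, and an upper bound is all that the Cauchy estimate needs.\<close>
    have "(\<integral>w. (Z m w - Z l w)^2 \<partial>MG) \<le> ip (\<lambda>n w. A m n w - A l n w) (\<lambda>n w. A m n w - A l n w)"
    proof (rule second_moment_limit_le[OF prob_space_axioms prob_space_MG U_nontrivial])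
      show "(\<lambda>w. Z m w - Z l w) \<in> all_moments MG" by (intro q.all_moments_closed Zm)
      show "(\<lambda>w. A m n w - A l n w) \<in> all_moments M" for n using bseq_moments[OF bd] .
      show "((\<lambda>n. expectation (\<lambda>w. cos (t * (A m n w - A l n w)))) \<longlongrightarrow> (\<integral>w. cos (t * (Z m w - Z l w)) \<partial>MG)) U" for t
        using pcl[OF _ pol_scale[OF r, of t], of 0] by (simp add: rA rZ)
      show "((\<lambda>n. sq (\<lambda>w. A m n w - A l n w)) \<longlongrightarrow> ip (\<lambda>n w. A m n w - A l n w) (\<lambda>n w. A m n w - A l n w)) U"
        by (rule sq_tendsto[OF bd])
    qed
    also have "... \<le> 2 * ip (\<lambda>n w. A m n w - F n w) (\<lambda>n w. A m n w - F n w) + 2 * ip (\<lambda>n w. F n w - A l n w) (\<lambda>n w. F n w - A l n w)"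
      using ip_square_add_le[OF bseq_diff[OF Ab[of m] F] bseq_diff[OF F Ab[of l]]] by simp
    also have "ip (\<lambda>n w. A m n w - F n w) (\<lambda>n w. A m n w - F n w) = ip (\<lambda>n w. F n w - A m n w) (\<lambda>n w. F n w - A m n w)"
    proof -
      have "(\<lambda>n. expectation (\<lambda>w. (A m n w - F n w) * (A m n w - F n w))) = (\<lambda>n. expectation (\<lambda>w. (F n w - A m n w) * (F n w - A m n w)))"
        by (intro ext Bochner_Integration.integral_cong refl) (simp add: algebra_simps)
      then show ?thesis by (simp only: ip_def)
    qed
    also have "2 * ip (\<lambda>n w. F n w - A m n w) (\<lambda>n w. F n w - A m n w) + 2 * ip (\<lambda>n w. F n w - A l n w) (\<lambda>n w. F n w - A l n w) \<le> 2 * (1 / 4) ^ Suc l + 2 * (1 / 4) ^ Suc l"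
    proof (intro add_mono mult_left_mono)
      have "ip (\<lambda>n w. F n w - A m n w) (\<lambda>n w. F n w - A m n w) \<le> (1 / 4) ^ Suc m" using Aip[of m] by simp
      also have "... \<le> (1 / 4) ^ Suc l" using that by (intro power_decreasing) auto
      finally show "ip (\<lambda>n w. F n w - A m n w) (\<lambda>n w. F n w - A m n w) \<le> (1 / 4) ^ Suc l" .
      show "ip (\<lambda>n w. F n w - A l n w) (\<lambda>n w. F n w - A l n w) \<le> (1 / 4) ^ Suc l" using Aip[of l] by simp
    qed simp_all
    also have "... = (1 / 4) ^ l" by simp
    finally show ?thesis .
  qed
  define L2_lim where "L2_lim P \<longleftrightarrow> P \<in> square_integrable MG \<and>
    (\<forall>l. integrable MG (\<lambda>w. (P w - Z l w)^2) \<and> (\<integral>w. (P w - Z l w)^2 \<partial>MG) \<le> (1 / 4) ^ l)" for P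
  have "\<exists>P. L2_lim P"
    by (rule q.L2_limit[of Z, OF Zm cauchy], assumption, unfold L2_lim_def) (intro exI conjI allI)
  then obtain P where "L2_lim P" ..
  then have P: "P \<in> square_integrable MG" and Pi: "\<And>l. integrable MG (\<lambda>w. (P w - Z l w)^2)"
    and Pl: "\<And>l. (\<integral>w. (P w - Z l w)^2 \<partial>MG) \<le> (1 / 4) ^ l"
    unfolding L2_lim_def by blast+
  have Pm: "P \<in> borel_measurable MG" using P by (simp add: square_integrable_def)
  have half: "sqrt ((1 / 4) ^ l) = (1 / 2) ^ l" for l by (simp add: real_sqrt_power real_sqrt_divide)
  have Psq: "sqrt (\<integral>w. (P w - Z l w)^2 \<partial>MG) \<le> (1 / 2) ^ l" for l
    using real_sqrt_le_mono[OF Pl[of l]] by (simp add: half)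
  have small: "\<exists>l. C * (1 / 2) ^ l < e" if "e > 0" for e C :: real
  proof -
    have "(\<lambda>l. C * (1 / 2) ^ l) \<longlonglongrightarrow> C * 0" by (intro tendsto_mult tendsto_const LIMSEQ_power_zero) simp
    then have "eventually (\<lambda>l. C * (1 / 2) ^ l < e) sequentially" using that by (intro order_tendstoD) auto
    then show ?thesis by (auto simp: eventually_sequentially)
  qed
  have "P \<in> polynomials MG Y d"
    unfolding polynomials_def L2_closure_def
  proof (intro CollectI conjI allI impI P)
    fix e :: real assume "e > 0"
    then obtain l where l: "1 * (1 / 2) ^ l < e" using small by blast
    have "Z l \<in> square_integrable MG"
      unfolding square_integrable_def
      by (intro CollectI conjI all_moments_measurable all_moments_integrable q.all_moments_closed Zm)
    then show "\<exists>g\<in>ordinary_polynomials Y d \<inter> square_integrable MG. sqrt (\<integral>w. (P w - g w)^2 \<partial>MG) < e"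
      using Zo[of l] Psq[of l] l by (intro bexI[of _ "Z l"]) auto
  qed
  moreover have "((\<lambda>n. expectation (\<lambda>w. cos (t * F n w + c))) \<longlongrightarrow> (\<integral>w. cos (t * P w + c) \<partial>MG)) U" for t c
  proof (rule tendstoI)
    fix e :: real assume e: "e > 0"
    obtain l where l: "\<bar>t\<bar> * (1 / 2) ^ l < e / 3" using small[of "e / 3" "\<bar>t\<bar>"] e by auto
    have FA: "(\<lambda>n w. F n w - A l n w) \<in> bseq d" by (intro bseq_diff F Ab)
    have "eventually (\<lambda>n. sq (\<lambda>w. F n w - A l n w) < (1 / 4) ^ Suc l) U"
      by (rule order_tendstoD(2)[OF sq_tendsto[OF FA] Aip])
    moreover have "((\<lambda>n. expectation (\<lambda>w. cos (t * A l n w + c))) \<longlongrightarrow> (\<integral>w. cos (t * Z l w + c) \<partial>MG)) U"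
      using pcl[OF _ pol_scale[OF p[of l], of t], of c] by (simp add: Ap Z_def)
    then have "eventually (\<lambda>n. dist (expectation (\<lambda>w. cos (t * A l n w + c))) (\<integral>w. cos (t * Z l w + c) \<partial>MG) < e / 3) U"
      using e by (intro tendstoD) auto
    ultimately show "eventually (\<lambda>n. dist (expectation (\<lambda>w. cos (t * F n w + c))) (\<integral>w. cos (t * P w + c) \<partial>MG) < e) U"
    proof eventually_elim
      case (elim n)
      have "sqrt (sq (\<lambda>w. F n w - A l n w)) \<le> sqrt ((1 / 4) ^ l)"
      proof (rule real_sqrt_le_mono)
        have "(1 / 4 :: real) ^ Suc l \<le> (1 / 4) ^ l" by (rule power_decreasing) auto
        then show "sq (\<lambda>w. F n w - A l n w) \<le> (1 / 4) ^ l" using elim(1) by linarith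
      qed
      then have "\<bar>t\<bar> * sqrt (sq (\<lambda>w. F n w - A l n w)) \<le> \<bar>t\<bar> * (1 / 2) ^ l"
        unfolding half by (intro mult_left_mono) auto
      moreover have "\<bar>expectation (\<lambda>w. cos (t * F n w + c)) - expectation (\<lambda>w. cos (t * A l n w + c))\<bar> \<le> \<bar>t\<bar> * sqrt (sq (\<lambda>w. F n w - A l n w))"
        by (intro expectation_cos_diff all_moments_measurable bseq_moments[OF F] bseq_moments[OF Ab]
            all_moments_integrable all_moments_closed)
      moreover have "\<bar>(\<integral>w. cos (t * P w + c) \<partial>MG) - (\<integral>w. cos (t * Z l w + c) \<partial>MG)\<bar> \<le> \<bar>t\<bar> * sqrt (\<integral>w. (P w - Z l w)^2 \<partial>MG)"
        by (intro q.expectation_cos_diff Pm Pi all_moments_measurable[OF Zm])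
      moreover have "\<bar>t\<bar> * sqrt (\<integral>w. (P w - Z l w)^2 \<partial>MG) \<le> \<bar>t\<bar> * (1 / 2) ^ l"
        by (intro mult_left_mono Psq) simp
      ultimately show ?case using elim(2) l unfolding dist_real_def by linarith
    qed
  qed
  ultimately show ?thesis unfolding Y_def by blast
qed

end

section \<open>Tightness and second moments through a bounded version of the square\<close>

definition sat :: "real => real" where "sat x = x^2 / (1 + x^2)"

lemma sat_pos: "1 + x^2 > (0::real)"
  by (simp add: add_pos_nonneg)

lemma sat_bounds: "0 \<le> sat x" "sat x \<le> 1"
  using sat_pos[of x] by (auto simp: sat_def divide_simps)

lemma sat_lipschitz: "\<bar>sat x - sat y\<bar> \<le> \<bar>x - y\<bar>"
proof -
  have pos: "(1 + x^2) * (1 + y^2) > 0" by (intro mult_pos_pos sat_pos)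
  have ne: "1 + x^2 \<noteq> 0" "1 + y^2 \<noteq> 0" using sat_pos[of x] sat_pos[of y] by linarith+
  have "sat x - sat y = (x - y) * (x + y) / ((1 + x^2) * (1 + y^2))"
    unfolding sat_def using ne by (simp add: field_simps power2_eq_square)
  then have "\<bar>sat x - sat y\<bar> = \<bar>x - y\<bar> * (\<bar>x + y\<bar> / ((1 + x^2) * (1 + y^2)))"
    using pos by (simp add: abs_mult)
  also have "... \<le> \<bar>x - y\<bar> * 1"
  proof (intro mult_left_mono)
    have a: "\<bar>u\<bar> \<le> (1 + u^2) / 2" for u :: real
      using zero_le_power2[of "\<bar>u\<bar> - 1"] by (simp add: power2_diff)
    have "\<bar>x + y\<bar> \<le> (1 + x^2) / 2 + (1 + y^2) / 2" using a[of x] a[of y] by linarith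
    also have "... \<le> (1 + x^2) * (1 + y^2)"
    proof -
      have eq: "(1 + x^2) * (1 + y^2) = 1 + x^2 + y^2 + x^2 * y^2" by (simp add: algebra_simps)
      have "0 \<le> x^2" "0 \<le> y^2" "0 \<le> x^2 * y^2" by simp_all
      then show ?thesis unfolding eq by argo
    qed
    finally show "\<bar>x + y\<bar> / ((1 + x^2) * (1 + y^2)) \<le> 1" using pos by simp
  qed simp
  finally show ?thesis by simp
qed

lemma sat_continuous: "isCont (\<lambda>x. sat (t * x)) x"
  unfolding sat_def using sat_pos[of "t * x"] by (intro continuous_intros) linarith

lemma sat_measurable [measurable]: "sat \<in> borel_measurable borel"
  unfolding sat_def[abs_def] by measurable

text \<open>Small saturated moments force small second moments: Cauchy-Schwarz for
  \<open>Q^2 = (Q / sqrt (1 + t^2 Q^2)) * (Q * sqrt (1 + t^2 Q^2))\<close> together with hypercontractivity.\<close>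

lemma (in iid) second_moment_le_of_sat:
  assumes Q: "Q \<in> ordinary_polynomials X d" and t: "t > 0"
    and small: "expectation (\<lambda>w. sat (t * Q w)) \<le> 1 / (2 * hyper ^ d)"
  shows "expectation (\<lambda>w. (Q w)^2) \<le> 1 / t^2"
proof -
  define s where "s = expectation (\<lambda>w. (Q w)^2)"
  define H where "H = hyper ^ d"
  define E where "E = expectation (\<lambda>w. sat (t * Q w))"
  have H: "H \<ge> 1" unfolding H_def using hyper_ge_1 by simp
  have Qm: "Q \<in> all_moments M" by (rule ordinary_moments[OF Q])
  have Qmm [measurable]: "Q \<in> borel_measurable M" by (rule all_moments_measurable[OF Qm])
  define a where "a w = t * Q w / sqrt (1 + (t * Q w)^2)" for w
  define b where "b w = sqrt (1 + (t * Q w)^2)" for w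
  have b_pos: "b w > 0" for w using sat_pos[of "t * Q w"] by (simp add: b_def)
  have b2: "(b w)^2 = 1 + (t * Q w)^2" for w using sat_pos[of "t * Q w"] by (simp add: b_def)
  have a2: "(a w)^2 = sat (t * Q w)" for w
    using sat_pos[of "t * Q w"] by (simp add: a_def sat_def power_divide)
  have am: "a \<in> all_moments M"
  proof (rule all_moments_bounded[OF finite_measure_axioms])
    show "a \<in> borel_measurable M" unfolding a_def[abs_def] by measurable
    show "\<bar>a w\<bar> \<le> 1" for w
      using a2[of w] sat_bounds(2)[of "t * Q w"] abs_square_le_1[of "a w"] by metis
  qed
  have c_m: "(\<lambda>w. Q w * b w) \<in> all_moments M"
  proof (rule all_moments_mult[OF Qm])
    have bmm: "b \<in> borel_measurable M" unfolding b_def[abs_def] by measurable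
    have sm: "(\<lambda>w. 1 + (t * Q w)^2) \<in> all_moments M" by (intro all_moments_closed Qm)
    have "integrable M (\<lambda>w. \<bar>b w\<bar> ^ p)" for p
    proof (rule Bochner_Integration.integrable_bound)
      show "integrable M (\<lambda>w. \<bar>1 + (t * Q w)^2\<bar> ^ p)" using sm by (simp add: all_moments_def)
      show "AE w in M. norm (\<bar>b w\<bar> ^ p) \<le> norm (\<bar>1 + (t * Q w)^2\<bar> ^ p)"
      proof (rule AE_I2)
        fix w
        have "1 \<le> b w" by (simp add: b_def)
        then have "b w * 1 \<le> b w * b w" by (intro mult_left_mono) auto
        then have "b w \<le> 1 + (t * Q w)^2" using b2[of w] by (simp add: power2_eq_square)
        then show "norm (\<bar>b w\<bar> ^ p) \<le> norm (\<bar>1 + (t * Q w)^2\<bar> ^ p)"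
          using b_pos[of w] by (simp add: power_mono)
      qed
    qed (use bmm in measurable)
    then show "b \<in> all_moments M" using bmm by (simp add: all_moments_def)
  qed
  have ab: "a w * (Q w * b w) = t * (Q w)^2" for w
  proof -
    have "a w = t * Q w / b w" by (simp add: a_def b_def)
    then show ?thesis using b_pos[of w] by (simp add: power2_eq_square)
  qed
  have "(expectation (\<lambda>w. a w * (Q w * b w)))^2 \<le> expectation (\<lambda>w. (a w)^2) * expectation (\<lambda>w. (Q w * b w)^2)"
    by (rule Cauchy_Schwarz_all_moments[OF am c_m])
  moreover have "expectation (\<lambda>w. a w * (Q w * b w)) = t * s"
    unfolding ab s_def by simp
  moreover have "expectation (\<lambda>w. (a w)^2) = E" unfolding a2 E_def ..
  ultimately have 1: "t^2 * s^2 \<le> E * expectation (\<lambda>w. (Q w * b w)^2)"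
    by (simp only: power_mult_distrib)
  have "expectation (\<lambda>w. (Q w * b w)^2) = expectation (\<lambda>w. (Q w)^2 + t^2 * Q w ^ 4)"
  proof (intro Bochner_Integration.integral_cong refl)
    fix w
    have "(Q w * b w)^2 = (Q w)^2 * (1 + (t * Q w)^2)" by (simp only: power_mult_distrib[of "Q w" "b w"] b2)
    also have "... = (Q w)^2 + t^2 * Q w ^ 4" by (simp add: algebra_simps power2_eq_square power4_eq_xxxx)
    finally show "(Q w * b w)^2 = (Q w)^2 + t^2 * Q w ^ 4" .
  qed
  also have "... = s + t^2 * expectation (\<lambda>w. Q w ^ 4)"
    unfolding s_def by (subst Bochner_Integration.integral_add) (auto intro!: all_moments_integrable all_moments_closed Qm)
  also have "... \<le> s + t^2 * (H * s^2)"
    unfolding H_def s_def by (intro add_left_mono mult_left_mono fourth_moment_ordinary[OF Q order_refl]) simp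
  finally have "expectation (\<lambda>w. (Q w * b w)^2) \<le> s + t^2 * (H * s^2)" .
  moreover have "E \<ge> 0" unfolding E_def by (intro Bochner_Integration.integral_nonneg sat_bounds)
  ultimately have 2: "E * expectation (\<lambda>w. (Q w * b w)^2) \<le> E * (s + t^2 * (H * s^2))" by (rule mult_left_mono)
  have s0: "s \<ge> 0" unfolding s_def by simp
  \<comment> \<open>The threshold \<open>1 / (2 * hyper ^ d)\<close> halves the fourth moment term,
    so that it can be absorbed into the left side \<open>t^2 * s^2\<close>.\<close>
  have "E * (s + t^2 * (H * s^2)) \<le> 1 / (2 * H) * (s + t^2 * (H * s^2))"
    using small s0 H unfolding E_def[symmetric] H_def[symmetric] by (intro mult_right_mono) auto
  also have "... = s / (2 * H) + t^2 * s^2 / 2" using H by (simp add: field_simps)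
  also have "s / (2 * H) \<le> s / 2" using H s0 by (intro divide_left_mono) auto
  finally have "t^2 * s^2 \<le> s / 2 + t^2 * s^2 / 2" using 1 2 by linarith
  then have 3: "(t^2 * s) * s \<le> 1 * s" by (simp add: power2_eq_square mult_ac)
  have "t^2 * s \<le> 1"
  proof (cases "s = 0")
    case False
    then have "s > 0" using s0 by simp
    then show ?thesis using 3 by (simp only: mult_le_cancel_right_pos)
  qed simp
  then show ?thesis using t by (simp add: s_def[symmetric] field_simps)
qed

text \<open>Dominated convergence: the integrand is bounded by 1 and tends to 0 at every point. This
  expresses the tightness of the single law \<mu> in terms of \<open>sat\<close>.\<close>

lemma sat_limit:
  assumes "prob_space \<mu>" "sets \<mu> = sets borel"
  shows "(\<lambda>k. \<integral>x. sat (1 / real (Suc k) * x) \<partial>\<mu>) \<longlonglongrightarrow> 0"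
proof -
  interpret prob_space \<mu> by fact
  have "(\<lambda>k. \<integral>x. sat (1 / real (Suc k) * x) \<partial>\<mu>) \<longlonglongrightarrow> (\<integral>x. 0 \<partial>\<mu>)"
  proof (rule integral_dominated_convergence[where w = "\<lambda>_. 1"])
    show "(\<lambda>x. sat (1 / real (Suc k) * x)) \<in> borel_measurable \<mu>" for k
      unfolding measurable_cong_sets[OF assms(2) refl] by measurable
    show "AE x in \<mu>. (\<lambda>k. sat (1 / real (Suc k) * x)) \<longlonglongrightarrow> 0"
    proof (rule AE_I2)
      fix x :: real
      have "(\<lambda>k. 1 / real (Suc k) * x) \<longlonglongrightarrow> 0 * x"
        by (intro tendsto_mult tendsto_const LIMSEQ_Suc[OF lim_1_over_n])
      then have "(\<lambda>k. sat (1 * (1 / real (Suc k) * x))) \<longlonglongrightarrow> sat (1 * (0 * x))"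
        by (rule isCont_tendsto_compose[OF sat_continuous])
      then show "(\<lambda>k. sat (1 / real (Suc k) * x)) \<longlonglongrightarrow> 0" by (simp add: sat_def)
    qed
    show "AE x in \<mu>. norm (sat (1 / real (Suc k) * x)) \<le> 1" for k
      using sat_bounds by (intro AE_I2) simp
  qed simp_all
  then show ?thesis by simp
qed

text \<open>Phases 0 and \<open>- (pi / 2)\<close> recover the real and the imaginary part of the
  characteristic function, and Levy's uniqueness theorem concludes.\<close>

lemma char_eq_cos:
  assumes "real_distribution N1" "real_distribution N2"
    and eq: "\<And>t c. (\<integral>x. cos (t * x + c) \<partial>N1) = (\<integral>x. cos (t * x + c) \<partial>N2)"
  shows "N1 = N2"
proof -
  have *: "Re (char N t) = (\<integral>x. cos (t * x + 0) \<partial>N)" "Im (char N t) = (\<integral>x. cos (t * x + (- (pi / 2))) \<partial>N)"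
    if "real_distribution N" for N t
  proof -
    interpret real_distribution N by fact
    have int: "integrable N (\<lambda>x. iexp (t * x))" by (rule integrable_iexp) simp_all
    show "Re (char N t) = (\<integral>x. cos (t * x + 0) \<partial>N)"
      unfolding char_def using integral_Re[OF int] by (simp add: Re_exp)
    show "Im (char N t) = (\<integral>x. cos (t * x + (- (pi / 2))) \<partial>N)"
      unfolding char_def using integral_Im[OF int] by (simp add: Im_exp cos_diff)
  qed
  have "char N1 = char N2"
    by (intro ext complex_eqI) (simp_all only: *[OF assms(1)] *[OF assms(2)] eq)
  then show ?thesis by (rule Levy_uniqueness[OF assms(1,2)])
qed

text \<open>The enlarged space projects to \<open>M\<close> by \<open>fst\<close>, so that the given
  variables themselves, not copies of them, appear next to the Gaussians. The given
  \<open>P n\<close> may already involve infinitely many variables.\<close>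

theorem theorem1p1:
  fixes M :: "'a measure"
    and X :: "nat \<Rightarrow> 'a \<Rightarrow> real"
    and P :: "nat \<Rightarrow> 'a \<Rightarrow> real"
    and \<mu> :: "real measure"
    and d :: nat
  assumes "d \<ge> 1"
    and "prob_space M"
    and "prob_space.indep_vars M (\<lambda>_. borel) X UNIV"
    and "\<And>i. distr M borel (X i) = distr M borel (X 0)"
    and "prob_space.expectation M (X 0) = 0"
    and "prob_space.expectation M (\<lambda>\<omega>. (X 0 \<omega>)\<^sup>2) = 1"
    and "\<And>p::nat. integrable M (\<lambda>\<omega>. \<bar>X 0 \<omega>\<bar> ^ p)"
    and "\<And>n. P n \<in> polynomials M X d"
    and "real_distribution \<mu>"
    and "weak_conv_m (\<lambda>n. distr M borel (P n)) \<mu>"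
  shows "\<exists>(M' :: ('a \<times> (nat \<Rightarrow> real)) measure) (G :: nat \<Rightarrow> 'a \<times> (nat \<Rightarrow> real) \<Rightarrow> real).
           prob_space M' \<and> fst \<in> measurable M' M \<and> distr M' M fst = M \<and>
           (\<forall>i. distributed M' lborel (G i) (\<lambda>x. ennreal (std_normal_density x))) \<and>
           prob_space.indep_vars M' (\<lambda>_. borel) G UNIV \<and>
           prob_space.indep_var M'
             (PiM UNIV (\<lambda>_. borel)) (\<lambda>\<omega> i. X i (fst \<omega>))
             (PiM UNIV (\<lambda>_. borel)) (\<lambda>\<omega> i. G i \<omega>) \<and>
           (\<exists>P_inf \<in> polynomials M' (case_sum (\<lambda>i \<omega>. X i (fst \<omega>)) G) d.
              distr M' borel P_inf = \<mu>)"
proof -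
  interpret prob_space M by fact
  interpret i: iid M X d
    by unfold_locales (use assms in auto)
  obtain U where "free_ultrafilter U" using free_ultrafilter_exists by blast
  then interpret u: iid_ultra M X d U
    by (intro iid_ultra.intro i.iid_axioms)
  interpret \<mu>: real_distribution \<mu> by fact
  have D: "d = Suc (d - 1)" using assms(1) by simp
  \<comment> \<open>Each \<open>P n\<close> is replaced by an ordinary polynomial within
    \<open>1 / Suc n\<close> in L2; bounded Lipschitz test functions do not see the difference in
    the limit.\<close>
  define near where "near n Q \<longleftrightarrow> Q \<in> ordinary_polynomials X d \<and> Q \<in> square_integrable M \<and>
    sqrt (\<integral>w. (P n w - Q w)^2 \<partial>M) < 1 / real (Suc n)" for n Q
  have "\<exists>Q. near n Q" for n
  proof -
    have "\<forall>e>0. \<exists>g\<in>ordinary_polynomials X d \<inter> square_integrable M. sqrt (\<integral>w. (P n w - g w)^2 \<partial>M) < e"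
      using assms(8)[of n] by (simp add: polynomials_def L2_closure_def)
    then have "\<exists>g\<in>ordinary_polynomials X d \<inter> square_integrable M. sqrt (\<integral>w. (P n w - g w)^2 \<partial>M) < 1 / real (Suc n)"
      by simp
    then show ?thesis unfolding near_def by blast
  qed
  then obtain Q where Q: "\<And>n. near n (Q n)" by metis
  have Qo: "Q n \<in> ordinary_polynomials X d" and Qs: "Q n \<in> square_integrable M"
    and PQ: "sqrt (\<integral>w. (P n w - Q n w)^2 \<partial>M) \<le> 1 / real (Suc n)" for n
    using Q[of n] by (simp_all add: near_def)
  have Ps: "P n \<in> square_integrable M" for n using assms(8)[of n] by (simp add: polynomials_def L2_closure_def)
  have Pm [measurable]: "P n \<in> borel_measurable M" and Qm [measurable]: "Q n \<in> borel_measurable M" for n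
    using Ps[of n] Qs[of n] by (simp_all add: square_integrable_def)
  have PQi: "integrable M (\<lambda>w. (P n w - Q n w)^2)" for n
  proof (rule Bochner_Integration.integrable_bound)
    show "integrable M (\<lambda>w. 2 * (P n w)^2 + 2 * (Q n w)^2)"
      using Ps[of n] Qs[of n] by (simp add: square_integrable_def)
    have "(a - b)^2 \<le> 2 * a^2 + 2 * b^2" for a b :: real
      using zero_le_power2[of "a + b"] by (simp add: power2_sum power2_diff)
    then show "AE w in M. norm ((P n w - Q n w)^2) \<le> norm (2 * (P n w)^2 + 2 * (Q n w)^2)"
      by (intro AE_I2) (simp add: abs_of_nonneg)
  qed measurable
  have null: "(\<lambda>n. L * (1 / real (Suc n))) \<longlonglongrightarrow> 0" for L
    using tendsto_mult_left[OF LIMSEQ_Suc[OF lim_1_over_n], of L] by simp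
  have weak: "(\<lambda>n. expectation (\<lambda>w. \<psi> (P n w))) \<longlonglongrightarrow> (\<integral>x. \<psi> x \<partial>\<mu>)"
    if c: "\<And>x. isCont \<psi> x" and b: "\<And>x. \<bar>\<psi> x\<bar> \<le> 1" for \<psi> :: "real => real"
  proof -
    have "(\<lambda>n. integral\<^sup>L (distr M borel (P n)) \<psi>) \<longlonglongrightarrow> integral\<^sup>L \<mu> \<psi>"
      using b by (intro weak_conv_imp_integral_bdd_continuous_conv[OF _ assms(9,10) c]) (auto intro!: real_distribution_distr)
    moreover have "\<psi> \<in> borel_measurable borel"
      using c by (intro borel_measurable_continuous_onI continuous_at_imp_continuous_on) simp
    ultimately show ?thesis by (simp add: integral_distr)
  qed
  have replace: "(\<lambda>n. expectation (\<lambda>w. \<psi> (Q n w))) \<longlonglongrightarrow> (\<integral>x. \<psi> x \<partial>\<mu>)"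
    if c: "\<And>x. isCont \<psi> x" and b: "\<And>x. \<bar>\<psi> x\<bar> \<le> 1" and L: "L \<ge> 0" "\<And>x y. \<bar>\<psi> x - \<psi> y\<bar> \<le> L * \<bar>x - y\<bar>" for \<psi> :: "real => real" and L
  proof -
    have \<psi>m: "\<psi> \<in> borel_measurable borel"
      using c by (intro borel_measurable_continuous_onI continuous_at_imp_continuous_on) simp
    have "(\<lambda>n. expectation (\<lambda>w. \<psi> (P n w)) - expectation (\<lambda>w. \<psi> (Q n w))) \<longlonglongrightarrow> 0"
    proof (rule Lim_null_comparison[OF always_eventually null[of L]], rule allI)
      fix n
      have "\<bar>expectation (\<lambda>w. \<psi> (P n w)) - expectation (\<lambda>w. \<psi> (Q n w))\<bar> \<le> L * sqrt (\<integral>w. (P n w - Q n w)^2 \<partial>M)"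
        by (rule expectation_lipschitz_diff[OF Pm Qm \<psi>m PQi b L(2,1)])
      also have "... \<le> L * (1 / real (Suc n))" by (rule mult_left_mono[OF PQ L(1)])
      finally show "norm (expectation (\<lambda>w. \<psi> (P n w)) - expectation (\<lambda>w. \<psi> (Q n w))) \<le> L * (1 / real (Suc n))"
        by simp
    qed
    from tendsto_diff[OF weak[OF c b] this] show ?thesis by simp
  qed
  obtain C where bdd: "eventually (\<lambda>n. expectation (\<lambda>w. (Q n w)^2) \<le> C) sequentially"
  proof -
    \<comment> \<open>The threshold of \<open>second_moment_le_of_sat\<close>. At some scale t the
      law \<mu> stays strictly below it by \<open>sat_limit\<close>, and convergence in law hands
      this strict inequality to \<open>Q n\<close> for large n.\<close>
    define H where "H = 1 / (2 * i.hyper ^ d)"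
    have H: "H > 0" unfolding H_def using i.hyper_ge_1 by simp
    have "eventually (\<lambda>k. (\<integral>x. sat (1 / real (Suc k) * x) \<partial>\<mu>) < H) sequentially"
      using order_tendstoD(2)[OF sat_limit[OF \<mu>.prob_space_axioms \<mu>.events_eq_borel] H] .
    then obtain k where k: "(\<integral>x. sat (1 / real (Suc k) * x) \<partial>\<mu>) < H" by (auto simp: eventually_sequentially)
    define t where "t = 1 / real (Suc k)"
    have t: "t > 0" by (simp add: t_def)
    have "(\<lambda>n. expectation (\<lambda>w. sat (t * Q n w))) \<longlonglongrightarrow> (\<integral>x. sat (t * x) \<partial>\<mu>)"
    proof (rule replace[of "\<lambda>x. sat (t * x)" t])
      show "isCont (\<lambda>x. sat (t * x)) x" for x by (rule sat_continuous)
      show "\<bar>sat (t * x)\<bar> \<le> 1" for x using sat_bounds[of "t * x"] by simp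
      show "\<bar>sat (t * x) - sat (t * y)\<bar> \<le> t * \<bar>x - y\<bar>" for x y
        using sat_lipschitz[of "t * x" "t * y"] t by (simp add: right_diff_distrib[symmetric] abs_mult)
    qed (use t in simp)
    then have "eventually (\<lambda>n. expectation (\<lambda>w. sat (t * Q n w)) < H) sequentially"
      using k unfolding t_def by (rule order_tendstoD(2))
    then have "eventually (\<lambda>n. expectation (\<lambda>w. (Q n w)^2) \<le> 1 / t^2) sequentially"
    proof eventually_elim
      case (elim n)
      show ?case by (rule i.second_moment_le_of_sat[OF Qo t]) (use elim in \<open>simp add: H_def\<close>)
    qed
    then show thesis by (rule that)
  qed
  \<comment> \<open>The second moments are bounded only from some n on; terms violating the bound
    are set to 0, which changes nothing for U-many n.\<close>
  define F where "F n = (if expectation (\<lambda>w. (Q n w)^2) \<le> C then Q n else (\<lambda>w. 0))" for n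
  have F: "F \<in> u.bseq d"
  proof (rule u.bseqI[where C = "max 0 C"])
    fix n
    show "F n \<in> ordinary_polynomials X d" by (simp add: F_def Qo ordinary_polynomials_const)
    show "expectation (\<lambda>w. (F n w)^2) \<le> max 0 C" by (simp add: F_def le_max_iff_disj)
  qed
  have FQ: "eventually (\<lambda>n. Q n = F n) U"
    using u.U_sequentially[OF bdd] by eventually_elim (simp add: F_def)
  obtain P_inf where P_inf: "P_inf \<in> polynomials i.MG (case_sum (\<lambda>i w. X i (fst w)) i.GG) d"
    and lim: "\<And>t c. ((\<lambda>n. expectation (\<lambda>w. cos (t * F n w + c))) \<longlongrightarrow> (\<integral>w. cos (t * P_inf w + c) \<partial>i.MG)) U"
    using u.bseq_limit[OF D F] by blast
  have P_inf_m: "P_inf \<in> borel_measurable i.MG"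
    using P_inf by (simp add: polynomials_def L2_closure_def square_integrable_def)
  have eq: "(\<integral>w. cos (t * P_inf w + c) \<partial>i.MG) = (\<integral>x. cos (t * x + c) \<partial>\<mu>)" for t c
  proof (rule tendsto_unique[OF u.U_nontrivial lim])
    have "(\<lambda>n. expectation (\<lambda>w. cos (t * Q n w + c))) \<longlonglongrightarrow> (\<integral>x. cos (t * x + c) \<partial>\<mu>)"
    proof (rule replace[of "\<lambda>x. cos (t * x + c)" "\<bar>t\<bar>"])
      show "isCont (\<lambda>x. cos (t * x + c)) x" for x by (intro continuous_intros)
      show "\<bar>cos (t * x + c) - cos (t * y + c)\<bar> \<le> \<bar>t\<bar> * \<bar>x - y\<bar>" for x y
        using cos_lipschitz[of "t * x + c" "t * y + c"] by (simp add: abs_mult[symmetric] right_diff_distrib)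
    qed simp_all
    from u.U_tendsto[OF this]
    show "((\<lambda>n. expectation (\<lambda>w. cos (t * F n w + c))) \<longlongrightarrow> (\<integral>x. cos (t * x + c) \<partial>\<mu>)) U"
    proof (rule Lim_transform_eventually)
      show "eventually (\<lambda>n. expectation (\<lambda>w. cos (t * Q n w + c)) = expectation (\<lambda>w. cos (t * F n w + c))) U"
        using FQ by eventually_elim simp
    qed
  qed
  have "distr i.MG borel P_inf = \<mu>"
  proof (rule char_eq_cos)
    show "real_distribution (distr i.MG borel P_inf)"
      using prob_space.real_distribution_distr[OF i.prob_space_MG P_inf_m] .
    show "real_distribution \<mu>" by fact
    show "(\<integral>x. cos (t * x + c) \<partial>distr i.MG borel P_inf) = (\<integral>x. cos (t * x + c) \<partial>\<mu>)" for t c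
      using eq[of t c] by (simp add: integral_distr[OF P_inf_m])
  qed
  then show ?thesis
    using P_inf i.prob_space_MG i.fst_MG i.distr_fst_MG i.GG_distributed i.GG_indep i.XG_indep
    by (intro exI[of _ i.MG] exI[of _ i.GG] conjI allI bexI[of _ P_inf])
qed

end
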